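(* Let $2\le p\le\infty$, let $p'$ be the conjugate exponent, and let $A=(A_1,A_2)$, $B=(B_1,B_2)$ with $A_1,A_2,B_1,B_2>0$. The inequality $$\|f\|_p\,\|\widehat f\|_{p'}\lesssim \big\||x|^{A}f\big\|_p\,\big\||\xi|^{B}\widehat f\big\|_{p'}$$ (for all $f\in L^1(\mathbb R^d)$, with a constant independent of $f$) holds if and only if $B_2\ge A_1$, $A_2\ge B_1$, $A_2>d\big(\frac12-\frac1p\big)$ and one of the following conditions holds: \begin{enumerate} \item $A_1<d\big(\frac12-\frac1p\big)$ and $B_2^2\ge d\big(\frac12-\frac1p\big)A_1$; \item $A_1>d\big(\frac12-\frac1p\big)$; \item $A_1=d\big(\frac12-\frac1p\big)<B_2$. \end{enumerate}
   Context: For integrable $f:\mathbb R^d\to\mathbb C$, $\widehat f(\xi)=\int_{\mathbb R^d}f(x)e^{-2\pi i\langle x,\xi\rangle}\,dx$. Broken power weights: for a pair $C=(C_1,C_2)$ and $x\in\mathbb R^d$, $|x|^C:=|x|^{C_1}$ if $|x|<1$ and $|x|^C:=|x|^{C_2}$ if $|x|\ge1$. $\frac1p+\frac1{p'}=1$. Norms are $L^p(\mathbb R^d)$ norms and may take the value $+\infty$. $F\lesssim G$ means $F\le C\,G$ with a constant $C$ depending only on $d,p,A,B$ and not on $f$. *)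

theory Defs
  imports "HOL-Probability.Essential_Supremum" "HOL-Analysis.Analysis"
begin

(* The characters exp (-2 pi i <x, xi>) carry the factor 2 pi, so no normalising constant
   occurs in front of the integral. *)
definition fourier :: "('a::euclidean_space \<Rightarrow> complex) \<Rightarrow> 'a \<Rightarrow> complex" where
  "fourier f \<xi> =
     (LINT x|lebesgue. f x * exp (- 2 * complex_of_real pi * \<i> * complex_of_real (x \<bullet> \<xi>)))"

definition broken_power :: "real \<times> real \<Rightarrow> 'a::euclidean_space \<Rightarrow> real" where
  "broken_power C x = (if norm x < 1 then norm x powr fst C else norm x powr snd C)"

definition ennreal_powr :: "ennreal \<Rightarrow> real \<Rightarrow> ennreal" where
  "ennreal_powr t r = (if t = \<infinity> then \<infinity> else ennreal (enn2real t powr r))"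

(* Extended-valued, since the norms are allowed to be infinite.  Meaningful for p >= 1 and
   Lebesgue measurable g; ennreal_powr is only used here with the positive exponent 1 / p. *)
definition Lp_norm :: "ennreal \<Rightarrow> ('a::euclidean_space \<Rightarrow> complex) \<Rightarrow> ennreal" where
  "Lp_norm p g =
     (if p = \<infinity> then esssup lebesgue (\<lambda>x. ennreal (norm (g x)))
      else ennreal_powr (\<integral>\<^sup>+ x. ennreal (norm (g x) powr enn2real p) \<partial>lebesgue) (1 / enn2real p))"

end

theory Submission
  imports Defs "HOL-Probability.Probability" "HOL-Complex_Analysis.Complex_Analysis"
begin

text \<open>
  With $s = 1/p$ and $\delta = d (1/2 - s)$, sufficiency comes from two estimates, both based on
  iterated differences $f(x) - f(x + h)$: on a ball of radius $R$ a function is controlled by its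
  differences with $|h| = 2R$ and by its values outside the ball, and differences in space are
  multiplications by $1 - e^{2 \pi i h \xi}$ in frequency. The first estimate, by the
  Hausdorff--Young inequality, concerns the ball of radius $R$ that carries half of the norm of $f$;
  the second, by the Hoelder and Bessel inequalities, concerns the ball of radius $S$ that carries
  half of the norm of the transform and loses a power $S^a$. Multiplying them gives a lower bound for
  $|R|^A |S|^B$, which is the claim.

  Gaussians show that $A_1 \le B_2$ and $B_1 \le A_2$ are necessary. For the other conditions the test function
  is a small Gaussian at scale $e$ plus $J$ chirps with dyadic widths whose transforms
  are disjoint bumps in a common ball of radius $S$. Spreading over $J$ scales makes the
  weighted norm of the chirps decay like $J^{s - 1/2}$, which rules out the critical cases
  $A_2 \le \delta$ and $A_1 = \delta = B_2$; a single chirp with $S \to \infty$ rules out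
  $B_2^2 < \delta A_1$ when $A_1 < \delta$.
\<close>

section \<open>Norms of $L^{1/s}$\<close>

text \<open>The two sides are not symmetric. Hausdorff-Young bounds \<open>lnorm s\<close> of f by
  \<open>lnorm (1 - s)\<close> of its transform, but for s < 1/2 no such bound exists in the
  opposite direction. On the frequency side the ball of radius S is therefore compared with L^2 by
  Hoelder, and the Bessel inequality and a second Hoelder step against the inverse weight lead back
  to f. Both Hoelder steps have reciprocal exponent 1/2 - s; this is the origin of \<delta>. If the
  lost power is a = \<delta>, the second step needs |x|^(-A1) to be integrable to the power 1/(1/2 -
  s) near 0, that is A1 < \<delta>; this separates the three cases.

  For R < 1 < S the two estimates multiply to R^(-B2) \<le> S^(a + B2) R^A1. This implies R^A1 S^B2
  \<ge> 1 exactly when A1 a \<le> B2^2, which is the quadratic condition for a = \<delta> and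
  reduces to A1 \<le> B2 for a = A1.

  Differences are iterated because 1 - e^(2 pi i h \<xi>) vanishes only to first order at 0, whereas
  the weights may have any positive exponents.\<close>

lemma ennreal_powr_ennreal [simp]: "0 \<le> a \<Longrightarrow> ennreal_powr (ennreal a) r = ennreal (a powr r)"
  by (simp add: ennreal_powr_def)

lemma ennreal_powr_top [simp]: "ennreal_powr \<top> r = \<top>"
  by (simp add: ennreal_powr_def)

lemma ennreal_powr_mono:
  assumes "a \<le> b" "0 \<le> r"
  shows "ennreal_powr a r \<le> ennreal_powr b r"
proof (cases b)
  case (real y)
  then obtain x where "a = ennreal x" "0 \<le> x"
    using assms(1) by (cases a) (auto simp: top_unique)
  with real assms show ?thesis
    by (auto intro!: ennreal_leI powr_mono2)
qed simp

text \<open>For r at most 1 the power r does not decrease numbers in [0, 1]. It is applied to the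
  shares x / (x + y) and y / (x + y), whose sum is 1.\<close>

lemma ennreal_powr_add_le:
  assumes "0 \<le> r" "r \<le> 1"
  shows "ennreal_powr (a + b) r \<le> ennreal_powr a r + ennreal_powr b r"
proof (cases a; cases b)
  fix x y assume xy: "a = ennreal x" "0 \<le> x" "b = ennreal y" "0 \<le> y"
  have "(x + y) powr r \<le> x powr r + y powr r"
  proof (cases "x + y = 0")
    case False
    then have pos: "x + y > 0" using xy by linarith
    have 1: "x / (x + y) \<le> (x / (x + y)) powr r"
      using powr_mono'[of r 1 "x / (x + y)"] assms pos xy by simp
    have 2: "y / (x + y) \<le> (y / (x + y)) powr r"
      using powr_mono'[of r 1 "y / (x + y)"] assms pos xy by simp
    have "1 = x / (x + y) + y / (x + y)" using pos by (simp flip: add_divide_distrib)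
    also have "\<dots> \<le> (x / (x + y)) powr r + (y / (x + y)) powr r" using 1 2 by simp
    also have "\<dots> = (x powr r + y powr r) / (x + y) powr r"
      using pos xy by (simp add: powr_divide add_divide_distrib)
    finally show ?thesis using pos by (simp add: pos_le_divide_eq)
  qed (use xy in auto)
  then show ?thesis
    using xy by (simp flip: ennreal_plus add: ennreal_leI)
qed (auto simp: top_add add_top)

text \<open>The norm of $L^{1/s}$, so that $s = 0$ is the essential supremum and conjugate exponents
  are $s$ and $1 - s$. It is applied to nonnegative functions only.\<close>

definition lnorm :: "real \<Rightarrow> ('a::euclidean_space \<Rightarrow> real) \<Rightarrow> ennreal" where
  "lnorm s u =
     (if s = 0 then esssup lborel (\<lambda>x. ennreal (u x))
      else ennreal_powr (\<integral>\<^sup>+ x. ennreal (u x powr (1 / s)) \<partial>lborel) s)"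

lemma lnorm_mono_AE:
  assumes "u \<in> borel_measurable borel" "0 \<le> s"
    and "AE x in lborel. 0 \<le> u x \<and> u x \<le> v x"
  shows "lnorm s u \<le> lnorm s v"
proof (cases "s = 0")
  case True
  have "AE x in lborel. ennreal (u x) \<le> ennreal (v x)"
    using assms(3) by eventually_elim (auto intro: ennreal_leI)
  with True show ?thesis
    using assms(1) by (simp add: lnorm_def esssup_AE_mono)
next
  case False
  have "AE x in lborel. ennreal (u x powr (1 / s)) \<le> ennreal (v x powr (1 / s))"
    using assms(3) by eventually_elim (use assms(2) in \<open>auto intro!: ennreal_leI powr_mono2\<close>)
  then
  have "(\<integral>\<^sup>+ x. ennreal (u x powr (1 / s)) \<partial>lborel) \<le> (\<integral>\<^sup>+ x. ennreal (v x powr (1 / s)) \<partial>lborel)"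
    by (rule nn_integral_mono_AE)
  with False assms show ?thesis
    by (auto simp: lnorm_def intro!: ennreal_powr_mono)
qed

lemma lnorm_mono:
  assumes "u \<in> borel_measurable borel" "0 \<le> s" "\<And>x. 0 \<le> u x" "\<And>x. u x \<le> v x"
  shows "lnorm s u \<le> lnorm s v"
  using assms by (intro lnorm_mono_AE) auto

lemma lnorm_cong_AE:
  assumes "u \<in> borel_measurable borel" "v \<in> borel_measurable borel" "0 \<le> s"
    and "AE x in lborel. u x = v x" "\<And>x. 0 \<le> u x" "\<And>x. 0 \<le> v x"
  shows "lnorm s u = lnorm s v"
proof -
  have "AE x in lborel. 0 \<le> u x \<and> u x \<le> v x" "AE x in lborel. 0 \<le> v x \<and> v x \<le> u x"
    using assms(4) by (eventually_elim, use assms in auto)+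
  then show ?thesis using assms by (intro antisym lnorm_mono_AE)
qed

lemma lnorm_cmult:
  assumes [measurable]: "u \<in> borel_measurable borel" and "0 \<le> s" "\<And>x. 0 \<le> u x" "0 \<le> c"
  shows "lnorm s (\<lambda>x. c * u x) = ennreal c * lnorm s u"
proof (cases "s = 0")
  case True
  show ?thesis
  proof (cases "c = 0")
    case True
    then show ?thesis using \<open>s = 0\<close>
      by (auto simp: lnorm_def esssup_const)
  next
    case False
    then have c: "c > 0" using assms by simp
    \<comment> \<open>Only this direction needs an argument: the reverse inequality is the same one
      for 1 / c, applied to \<open>c * u x\<close>.\<close>
    have le: "esssup lborel (\<lambda>x. ennreal (c * u x)) \<le> ennreal c * esssup lborel (\<lambda>x. ennreal (u x))"
      if c: "c > 0" and [measurable]: "u \<in> borel_measurable borel" and u0: "\<And>x. 0 \<le> u x" for c and u :: "'a \<Rightarrow> real"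
    proof (rule esssup_I)
      show "AE x in lborel. ennreal (c * u x) \<le> ennreal c * esssup lborel (\<lambda>x. ennreal (u x))"
        using esssup_AE[of "\<lambda>x. ennreal (u x)" lborel]
        by eventually_elim (use c u0 in \<open>auto simp: ennreal_mult intro!: mult_left_mono\<close>)
    qed measurable
    have "ennreal c * esssup lborel (\<lambda>x. ennreal (u x)) = ennreal c * esssup lborel (\<lambda>x. ennreal ((1 / c) * (c * u x)))"
      using c by simp
    also have "\<dots> \<le> ennreal c * (ennreal (1 / c) * esssup lborel (\<lambda>x. ennreal (c * u x)))"
      using c assms by (intro mult_left_mono le) auto
    also have "\<dots> = esssup lborel (\<lambda>x. ennreal (c * u x))"
      using c by (simp flip: mult.assoc ennreal_mult)
    finally show ?thesis
      using le[OF c _ assms(3)] \<open>s = 0\<close> by (simp add: lnorm_def antisym)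
  qed
next
  case False
  then have s: "s > 0" using assms by simp
  have "(\<integral>\<^sup>+ x. ennreal ((c * u x) powr (1 / s)) \<partial>lborel) = ennreal (c powr (1 / s)) * (\<integral>\<^sup>+ x. ennreal (u x powr (1 / s)) \<partial>lborel)"
    using assms by (subst nn_integral_cmult[symmetric]) (auto simp: powr_mult ennreal_mult)
  moreover have "ennreal_powr (ennreal (c powr (1 / s)) * I) s = ennreal c * ennreal_powr I s" for I
  proof (cases I)
    case (real r)
    then show ?thesis using s assms by (simp flip: ennreal_mult add: powr_mult powr_powr)
  next
    case top
    then show ?thesis using s assms by (cases "c = 0") (auto simp: ennreal_mult_top ennreal_powr_def)
  qed
  ultimately show ?thesis using False by (simp add: lnorm_def)
qed

text \<open>A quasi-triangle inequality replaces Minkowski's, since only the existence of constants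
  matters: pointwise the power 1/s of a sum costs at most 2^(1/s), and the outer power s \<le> 1 is
  subadditive.\<close>

lemma lnorm_add:
  assumes [measurable]: "u \<in> borel_measurable borel" "v \<in> borel_measurable borel"
    and s: "0 \<le> s" "s \<le> 1" and u: "\<And>x. 0 \<le> u x" and v: "\<And>x. 0 \<le> v x"
  shows "lnorm s (\<lambda>x. u x + v x) \<le> 2 * (lnorm s u + lnorm s v)"
proof (cases "s = 0")
  case True
  have "esssup lborel (\<lambda>x. ennreal (u x + v x)) \<le> esssup lborel (\<lambda>x. ennreal (u x)) + esssup lborel (\<lambda>x. ennreal (v x))"
  proof (rule esssup_I)
    show "AE x in lborel. ennreal (u x + v x) \<le> esssup lborel (\<lambda>x. ennreal (u x)) + esssup lborel (\<lambda>x. ennreal (v x))"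
      using esssup_AE[of "\<lambda>x. ennreal (u x)" lborel] esssup_AE[of "\<lambda>x. ennreal (v x)" lborel]
      by eventually_elim (use u v in \<open>auto intro!: add_mono simp: ennreal_plus\<close>)
  qed measurable
  also have "\<dots> \<le> 2 * (esssup lborel (\<lambda>x. ennreal (u x)) + esssup lborel (\<lambda>x. ennreal (v x)))"
    by (simp add: mult_2)
  finally show ?thesis using True by (simp add: lnorm_def)
next
  case False
  then have s0: "s > 0" using s by simp
  let ?I = "\<lambda>u. \<integral>\<^sup>+ x. ennreal (u x powr (1 / s)) \<partial>lborel"
  have pt: "(a + b) powr (1 / s) \<le> 2 powr (1 / s) * (a powr (1 / s) + b powr (1 / s))" if "0 \<le> a" "0 \<le> b" for a b :: real
  proof -
    have "(a + b) powr (1 / s) \<le> (2 * max a b) powr (1 / s)"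
      using that s0 by (intro powr_mono2) auto
    also have "\<dots> = 2 powr (1 / s) * (max a b) powr (1 / s)"
      using that by (subst powr_mult) auto
    also have "\<dots> \<le> 2 powr (1 / s) * (a powr (1 / s) + b powr (1 / s))"
      by (intro mult_left_mono) (auto simp: max_def)
    finally show ?thesis .
  qed
  have "?I (\<lambda>x. u x + v x) \<le> (\<integral>\<^sup>+ x. ennreal (2 powr (1 / s)) * (ennreal (u x powr (1 / s)) + ennreal (v x powr (1 / s))) \<partial>lborel)"
    using pt[OF u v] by (intro nn_integral_mono) (simp flip: ennreal_plus ennreal_mult add: ennreal_leI)
  also have "\<dots> = ennreal (2 powr (1 / s)) * (?I u + ?I v)"
    by (subst nn_integral_cmult) (auto simp: nn_integral_add)
  finally have "ennreal_powr (?I (\<lambda>x. u x + v x)) s \<le> ennreal_powr (ennreal (2 powr (1 / s)) * (?I u + ?I v)) s"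
    using s by (intro ennreal_powr_mono)
  also have "\<dots> = 2 * ennreal_powr (?I u + ?I v) s"
  proof (cases "?I u + ?I v")
    case (real r)
    moreover have "ennreal_powr (ennreal (2 powr (1 / s) * r)) s = ennreal (2 * r powr s)"
      using s0 real by (simp add: powr_mult powr_powr)
    ultimately show ?thesis using s0 by (simp add: ennreal_mult)
  qed (auto simp: ennreal_mult_top)
  also have "\<dots> \<le> 2 * (ennreal_powr (?I u) s + ennreal_powr (?I v) s)"
    using s by (intro mult_left_mono ennreal_powr_add_le) auto
  finally show ?thesis using False by (simp add: lnorm_def)
qed

lemma lnorm_affine:
  fixes u :: "'a::euclidean_space \<Rightarrow> real" and s :: real
  assumes [measurable]: "u \<in> borel_measurable borel" and "0 \<le> s" "c > 0" and u: "\<And>x. 0 \<le> u x"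
  shows "lnorm s u = ennreal (c powr (DIM('a) * s)) * lnorm s (\<lambda>x. u (t + c *\<^sub>R x))"
proof (cases "s = 0")
  case True
  \<comment> \<open>Affine bijections preserve null sets. The reverse inequality is this one for the
    inverse map, with scale 1 / c.\<close>
  have 1: "esssup lborel (\<lambda>x. ennreal (u (t + c *\<^sub>R x))) \<le> esssup lborel (\<lambda>x. ennreal (u x))"
    if c: "c > 0" and [measurable]: "u \<in> borel_measurable borel" for u :: "'a \<Rightarrow> real" and c t
  proof (rule esssup_I)
    define E where "E = esssup lborel (\<lambda>x. ennreal (u x))"
    have "AE x in lborel. ennreal (u x) \<le> E"
      unfolding E_def by (rule esssup_AE)
    then have "AE x in density (distr lborel borel (\<lambda>x. t + c *\<^sub>R x)) (\<lambda>_. \<bar>c\<bar>^DIM('a)). ennreal (u x) \<le> E"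
      using lborel_affine[of c t] c by (metis less_irrefl)
    then have "AE x in distr lborel borel (\<lambda>x. t + c *\<^sub>R x). ennreal (u x) \<le> E"
      using c by (subst (asm) AE_density) auto
    then have "AE x in lborel. ennreal (u (t + c *\<^sub>R x)) \<le> E"
      by (subst (asm) AE_distr_iff) auto
    then show "AE x in lborel. ennreal (u (t + c *\<^sub>R x)) \<le> esssup lborel (\<lambda>x. ennreal (u x))"
      unfolding E_def .
  qed measurable
  have "esssup lborel (\<lambda>x. ennreal (u x)) \<le> esssup lborel (\<lambda>x. ennreal (u (t + c *\<^sub>R x)))"
    using 1[of "1 / c" "\<lambda>x. u (t + c *\<^sub>R x)" "- (1 / c) *\<^sub>R t"] assms
    by (simp add: scaleR_add_right scaleR_diff_right)
  with 1[of c u t] assms True show ?thesis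
    by (simp add: lnorm_def antisym)
next
  case False
  have "(\<integral>\<^sup>+ x. ennreal (u x powr (1 / s)) \<partial>lborel) =
      (\<integral>\<^sup>+ x. ennreal (u x powr (1 / s)) \<partial>density (distr lborel borel (\<lambda>x. t + c *\<^sub>R x)) (\<lambda>_. \<bar>c\<bar>^DIM('a)))"
    using assms(3) lborel_affine[of c t] by (metis less_irrefl)
  also have "\<dots> = ennreal (c ^ DIM('a)) * (\<integral>\<^sup>+ x. ennreal (u (t + c *\<^sub>R x) powr (1 / s)) \<partial>lborel)"
    using assms by (simp add: nn_integral_density nn_integral_distr nn_integral_cmult)
  finally have eq: "(\<integral>\<^sup>+ x. ennreal (u x powr (1 / s)) \<partial>lborel) =
    ennreal (c ^ DIM('a)) * (\<integral>\<^sup>+ x. ennreal (u (t + c *\<^sub>R x) powr (1 / s)) \<partial>lborel)" .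
  have *: "ennreal_powr (ennreal (c ^ DIM('a)) * I) s = ennreal (c powr (DIM('a) * s)) * ennreal_powr I s" for I
  proof (cases I)
    case (real r)
    then show ?thesis using assms
      by (simp flip: ennreal_mult add: powr_mult powr_powr powr_realpow[symmetric])
  qed (use assms in \<open>auto simp: ennreal_mult_top ennreal_powr_def\<close>)
  show ?thesis
    using False unfolding lnorm_def eq * by simp
qed

lemma lnorm_shift:
  fixes u :: "'a::euclidean_space \<Rightarrow> real"
  assumes "u \<in> borel_measurable borel" "0 \<le> s" "\<And>x. 0 \<le> u x"
  shows "lnorm s (\<lambda>x. u (x + t)) = lnorm s u"
  using lnorm_affine[of u s 1 t] assms by (simp add: add.commute)

lemma lnorm_dilate:
  fixes u :: "'a::euclidean_space \<Rightarrow> real" and s :: real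
  assumes "u \<in> borel_measurable borel" "0 \<le> s" "\<And>x. 0 \<le> u x" "c > 0"
  shows "lnorm s (\<lambda>x. u (x /\<^sub>R c)) = ennreal (c powr (DIM('a) * s)) * lnorm s u"
  using lnorm_affine[of "\<lambda>x. u (x /\<^sub>R c)" s c 0] assms by simp

lemma lnorm_eq_0_AE:
  assumes [measurable]: "u \<in> borel_measurable borel" and "0 \<le> s" "\<And>x. 0 \<le> u x" "lnorm s u = 0"
  shows "AE x in lborel. u x = 0"
proof (cases "s = 0")
  case True
  with assms esssup_AE[of "\<lambda>x. ennreal (u x)" lborel] show ?thesis
    by (auto simp: lnorm_def elim!: eventually_mono intro!: antisym)
next
  case False
  with assms have "ennreal_powr (\<integral>\<^sup>+ x. ennreal (u x powr (1 / s)) \<partial>lborel) s = 0"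
    by (simp add: lnorm_def)
  then have "(\<integral>\<^sup>+ x. ennreal (u x powr (1 / s)) \<partial>lborel) = 0"
    by (cases "\<integral>\<^sup>+ x. ennreal (u x powr (1 / s)) \<partial>lborel")
       (auto simp: ennreal_eq_0_iff)
  then have "AE x in lborel. ennreal (u x powr (1 / s)) = 0"
    by (subst (asm) nn_integral_0_iff_AE) auto
  then show ?thesis using assms by (auto elim!: eventually_mono)
qed

lemma lnorm_AE_0:
  assumes "u \<in> borel_measurable borel" "0 \<le> s" "\<And>x. 0 \<le> u x" "AE x in lborel. u x = 0"
  shows "lnorm s u = 0"
proof -
  have "lnorm s u = lnorm s (\<lambda>x. 0 * u x)"
    using assms by (intro lnorm_cong_AE) auto
  also have "\<dots> = 0" using assms by (subst lnorm_cmult) auto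
  finally show ?thesis .
qed

lemma lnorm_le_iff:
  assumes "u \<in> borel_measurable borel" "0 < s" "0 \<le> c"
  shows "lnorm s u \<le> ennreal c \<longleftrightarrow> (\<integral>\<^sup>+ x. ennreal (u x powr (1 / s)) \<partial>lborel) \<le> ennreal (c powr (1 / s))"
proof (cases "\<integral>\<^sup>+ x. ennreal (u x powr (1 / s)) \<partial>lborel")
  case (real r)
  have "r powr s \<le> c \<longleftrightarrow> r \<le> c powr (1 / s)"
  proof
    assume "r powr s \<le> c"
    then have "(r powr s) powr (1 / s) \<le> c powr (1 / s)" using assms by (intro powr_mono2) auto
    then show "r \<le> c powr (1 / s)" using assms real by (simp add: powr_powr)
  next
    assume "r \<le> c powr (1 / s)"
    then have "r powr s \<le> (c powr (1 / s)) powr s" using assms real by (intro powr_mono2) auto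
    then show "r powr s \<le> c" using assms real by (simp add: powr_powr)
  qed
  then show ?thesis using real assms by (simp add: lnorm_def)
qed (use assms in \<open>auto simp: lnorm_def top_unique\<close>)

lemma lnorm_0_le_iff:
  assumes [measurable]: "u \<in> borel_measurable borel" and "0 \<le> c" "\<And>x. 0 \<le> u x"
  shows "lnorm 0 u \<le> ennreal c \<longleftrightarrow> (AE x in lborel. u x \<le> c)"
proof
  assume le: "lnorm 0 u \<le> ennreal c"
  show "AE x in lborel. u x \<le> c"
    using esssup_AE[of "\<lambda>x. ennreal (u x)" lborel]
  proof eventually_elim
    case (elim x)
    then have "ennreal (u x) \<le> ennreal c" using le by (auto simp: lnorm_def)
    then show ?case using assms by simp
  qed
next
  assume "AE x in lborel. u x \<le> c"
  then have "AE x in lborel. ennreal (u x) \<le> ennreal c"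
    by eventually_elim (auto intro: ennreal_leI)
  then show "lnorm 0 u \<le> ennreal c"
    by (simp add: lnorm_def esssup_I)
qed

section \<open>Broken power weights\<close>

lemma broken_power_measurable [measurable]: "broken_power C \<in> borel_measurable borel"
  unfolding broken_power_def[abs_def] by measurable

lemma broken_power_nonneg [simp]: "0 \<le> broken_power C x"
  by (simp add: broken_power_def)

lemma broken_power_0 [simp]: "broken_power C 0 = 0"
  by (simp add: broken_power_def)

lemma broken_power_pos: "x \<noteq> 0 \<Longrightarrow> 0 < broken_power C x"
  by (simp add: broken_power_def)

lemma broken_power_real_abs: "broken_power C (norm x) = broken_power C x"
  by (simp add: broken_power_def)

lemma broken_power_mono:
  assumes "norm x \<le> norm y" "0 \<le> fst C" "0 \<le> snd C"
  shows "broken_power C x \<le> broken_power C y"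
proof -
  consider "norm y < 1" | "norm x < 1" "1 \<le> norm y" | "1 \<le> norm x" using assms by linarith
  then show ?thesis
  proof cases
    case 2
    have "norm x powr fst C \<le> 1" using 2 assms by (intro powr_le1) auto
    also have "1 \<le> norm y powr snd C" using 2 assms by (intro ge_one_powr_ge_zero) auto
    finally show ?thesis using 2 by (simp add: broken_power_def)
  qed (use assms in \<open>auto simp: broken_power_def intro: powr_mono2\<close>)
qed

text \<open>In logarithmic coordinates the weight is continuous and piecewise linear with slopes C1
  and C2, so passing from c to \<open>c *\<^sub>R x\<close> costs at most the larger of the two pure
  powers of \<open>norm x\<close>. Their sum avoids asking which one is larger.\<close>

lemma broken_power_scaleR_le:
  assumes "0 < c" "0 < C1" "0 < C2"
  shows "broken_power (C1, C2) (c *\<^sub>R x) \<le> broken_power (C1, C2) c * (norm x powr C1 + norm x powr C2)"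
proof -
  define t where "t = norm x"
  have t: "0 \<le> t" by (simp add: t_def)
  have nrm: "norm (c *\<^sub>R x) = c * t" using assms by (simp add: t_def)
  show ?thesis
  proof (cases "t = 0")
    case False
    then have t: "0 < t" using t by simp
    have ct: "(c * t) powr e = c powr e * t powr e" for e using assms t by (simp add: powr_mult)
    have "(if c * t < 1 then (c * t) powr C1 else (c * t) powr C2) \<le>
       (if c < 1 then c powr C1 else c powr C2) * (t powr C1 + t powr C2)"
    proof (cases "c < 1")
      case c: True
      show ?thesis
      proof (cases "c * t < 1 \<or> C2 < C1")
        case True
        show ?thesis
        proof (cases "c * t < 1")
          case False
          then have "(c * t) powr C2 \<le> (c * t) powr C1" using True by (intro powr_mono) auto
          moreover have "0 \<le> c powr C1 * t powr C2" by simp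
          ultimately have "c powr C2 * t powr C2 \<le> c powr C1 * t powr C1 + c powr C1 * t powr C2"
            unfolding ct by linarith
          then show ?thesis using c False by (simp add: ct algebra_simps)
        qed (use c in \<open>simp add: ct algebra_simps\<close>)
      next
        case False
        then have "c powr C2 \<le> c powr C1" using c assms by (intro powr_mono') auto
        then have "c powr C2 * t powr C2 \<le> c powr C1 * t powr C2" by (intro mult_right_mono) auto
        then show ?thesis using c False by (simp add: ct algebra_simps add_increasing)
      qed
    next
      case c: False
      show ?thesis
      proof (cases "c * t < 1")
        case True
        show ?thesis
        proof (cases "C2 \<le> C1")
          case le: True
          have "(c * t) powr C1 \<le> (c * t) powr C2" using True le assms t by (intro powr_mono') auto
          then show ?thesis using c True by (simp add: ct algebra_simps add_increasing)
        next
          case le: False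
          then have "c powr C1 \<le> c powr C2" using c by (intro powr_mono) auto
          then have "c powr C1 * t powr C1 \<le> c powr C2 * t powr C1" by (intro mult_right_mono) auto
          then show ?thesis using c True by (simp add: ct algebra_simps add_increasing2)
        qed
      qed (use c in \<open>simp add: ct algebra_simps\<close>)
    qed
    moreover have "broken_power (C1, C2) (c *\<^sub>R x) = (if c * t < 1 then (c * t) powr C1 else (c * t) powr C2)"
      unfolding broken_power_def nrm by simp
    moreover have "broken_power (C1, C2) c = (if c < 1 then c powr C1 else c powr C2)"
      using assms by (simp add: broken_power_def)
    ultimately show ?thesis by (simp add: t_def)
  qed (use assms nrm in \<open>simp add: broken_power_def t_def\<close>)
qed

text \<open>The two points may live in different spaces, so that radii, taken as real numbers, can
  be compared with vectors.\<close>

lemma broken_power_mono_gen: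
  fixes x :: "'a::euclidean_space" and y :: "'b::euclidean_space"
  assumes "norm x \<le> norm y" "0 \<le> fst C" "0 \<le> snd C"
  shows "broken_power C x \<le> broken_power C y"
  using broken_power_mono[of "norm x" "norm y" C] assms by (simp add: broken_power_real_abs)

text \<open>Used to choose a radius by prescribing the value of the weight there.\<close>

lemma broken_power_surj:
  assumes "0 < C1" "0 < C2" "0 < y"
  obtains r :: real where "0 < r" "broken_power (C1, C2) r = y"
proof (cases "y < 1")
  case True
  have "y powr (1 / C1) < 1 powr (1 / C1)" using True assms by (intro powr_less_mono2) auto
  then show ?thesis using assms True
    by (intro that[of "y powr (1 / C1)"]) (auto simp: broken_power_def powr_powr)
next
  case False
  then have "y powr (1 / C2) \<ge> 1" using assms by (intro ge_one_powr_ge_zero) auto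
  then show ?thesis using assms False
    by (intro that[of "y powr (1 / C2)"]) (auto simp: broken_power_def powr_powr)
qed

text \<open>A dyadic decomposition replaces polar coordinates: the integrand is dominated by a sum
  over balls of radius 2^(k+1) with heights 2^(-bk) and over balls of radius 2^(-k) with heights
  2^((k+1)a). The geometric ratios 2^(d-b) and 2^(a-d) are below 1 by hypothesis.\<close>

lemma nn_integral_inverse_broken_power:
  fixes a b :: real
  assumes "0 \<le> a" "a < DIM('a)" "DIM('a) < b"
  shows "(\<integral>\<^sup>+ x. ennreal (inverse (broken_power (a, b) (x::'a::euclidean_space))) \<partial>lborel) < \<infinity>"
proof -
  let ?d = "DIM('a)"
  define V where "V = unit_ball_vol ?d"
  have V: "0 \<le> V" by (simp add: V_def)
  define c where "c k = (2 powr (- b)) ^ k" for k :: nat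
  define e where "e k = 2 powr a * (2 powr a) ^ k" for k :: nat
  define B where "B k = ball (0::'a) (2 ^ Suc k)" for k :: nat
  define D where "D k = ball (0::'a) ((1/2) ^ k)" for k :: nat
  have [measurable]: "B k \<in> sets borel" "D k \<in> sets borel" for k by (auto simp: B_def D_def)
  have c0: "0 \<le> c k" and e0: "0 \<le> e k" for k by (auto simp: c_def e_def)
  have pw: "(2 powr y) ^ k = 2 powr (real k * y)" for y :: real and k :: nat
    by (subst powr_realpow[symmetric]) (auto simp: powr_powr mult.commute)
  have single: "f k \<le> (\<Sum>k. f k)" for f :: "nat \<Rightarrow> ennreal" and k
    using sum_le_suminf[of f "{k}"] by simp
  have pt: "ennreal (inverse (broken_power (a, b) x)) \<le>
      (\<Sum>k. ennreal (c k) * indicator (B k) x) + (\<Sum>k. ennreal (e k) * indicator (D k) x)" for x :: 'a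
  proof -
    consider "x = 0" | "x \<noteq> 0" "norm x < 1" | "1 \<le> norm x" by linarith
    then show ?thesis
    proof cases
      case 2
      define k where "k = nat \<lfloor>- log 2 (norm x)\<rfloor>"
      have "log 2 (norm x) < 0" using 2 by (subst log_less_zero_cancel_iff) auto
      then have k: "real k \<le> - log 2 (norm x)" "- log 2 (norm x) < real k + 1"
        unfolding k_def by linarith+
      have n: "norm x = 2 powr (log 2 (norm x))" using 2 by simp
      have in1: "norm x \<le> 2 powr (- real k)" by (subst n) (use k in \<open>intro powr_mono; auto\<close>)
      show ?thesis
      \<comment> \<open>The balls \<open>D k\<close> are open, so a point whose norm is exactly
        2^(-k) is charged to \<open>D (k - 1)\<close>; here k > 0 because
        \<open>norm x < 1\<close>.\<close>
      proof (cases "norm x = 2 powr (- real k)")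
        case eq: True
        have k1: "k \<noteq> 0" using eq 2 by (intro notI) simp
        have nk: "norm x < (1/2) ^ (k - 1)"
        proof -
          have "norm x = (1/2) ^ k" by (simp add: eq powr_minus powr_realpow power_one_over inverse_eq_divide)
          also have "\<dots> < (1/2) ^ (k - 1)" using k1 by (intro power_strict_decreasing) auto
          finally show ?thesis .
        qed
        have "inverse (norm x powr a) = 2 powr (real k * a)"
          by (simp add: eq powr_powr powr_minus flip: powr_minus)
        also have "\<dots> = e (k - 1)"
          using k1 by (simp add: e_def pw flip: powr_add) (simp add: algebra_simps of_nat_diff)
        finally have "ennreal (inverse (broken_power (a, b) x)) \<le> ennreal (e (k - 1)) * indicator (D (k - 1)) x"
          using 2 nk by (simp add: broken_power_def D_def)
        also have "\<dots> \<le> (\<Sum>k. ennreal (e k) * indicator (D k) x)" by (rule single)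
        finally show ?thesis by (simp add: add_increasing)
      next
        case neq: False
        have nk: "norm x < (1/2) ^ k"
          using in1 neq by (simp add: powr_minus powr_realpow power_one_over inverse_eq_divide)
        have "inverse (norm x powr a) = norm x powr (- a)" by (simp add: powr_minus)
        also have "\<dots> = 2 powr (- a * log 2 (norm x))"
          by (subst (1) n) (simp add: powr_powr mult.commute)
        also have "\<dots> \<le> 2 powr ((real k + 1) * a)"
          using mult_left_mono[of "- log 2 (norm x)" "real k + 1" a] k assms
          by (intro powr_mono) (auto simp: algebra_simps)
        also have "\<dots> = e k" by (simp add: e_def pw flip: powr_add) (simp add: algebra_simps)
        finally have "ennreal (inverse (broken_power (a, b) x)) \<le> ennreal (e k) * indicator (D k) x"
          using 2 nk by (simp add: broken_power_def D_def ennreal_leI)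
        also have "\<dots> \<le> (\<Sum>k. ennreal (e k) * indicator (D k) x)" by (rule single)
        finally show ?thesis by (simp add: add_increasing)
      qed
    next
      case 3
      define k where "k = nat \<lfloor>log 2 (norm x)\<rfloor>"
      have "log 2 (norm x) \<ge> 0" using 3 by (subst zero_le_log_cancel_iff) auto
      then have k: "real k \<le> log 2 (norm x)" "log 2 (norm x) < real k + 1"
        unfolding k_def by linarith+
      have x0: "norm x > 0" using 3 by linarith
      then have n: "norm x = 2 powr (log 2 (norm x))" by simp
      have "norm x < 2 powr (real (Suc k))" by (subst n) (use k in \<open>intro powr_less_mono; auto\<close>)
      then have xB: "x \<in> B k" by (simp add: B_def powr_realpow del: of_nat_Suc power_Suc)
      have "inverse (norm x powr b) = norm x powr (- b)" by (simp add: powr_minus)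
      also have "\<dots> = 2 powr (- b * log 2 (norm x))"
        by (subst (1) n) (simp add: powr_powr mult.commute)
      also have "\<dots> \<le> 2 powr (real k * - b)"
        using mult_left_mono[of "real k" "log 2 (norm x)" b] k assms
        by (intro powr_mono) (auto simp: algebra_simps)
      also have "\<dots> = c k" by (simp add: c_def pw)
      finally have "ennreal (inverse (broken_power (a, b) x)) \<le> ennreal (c k) * indicator (B k) x"
        using 3 xB by (simp add: broken_power_def ennreal_leI)
      also have "\<dots> \<le> (\<Sum>k. ennreal (c k) * indicator (B k) x)" by (rule single)
      finally show ?thesis by (simp add: add_increasing2)
    qed simp
  qed
  have eB: "emeasure lborel (B k) = ennreal (V * (2 ^ Suc k) ^ ?d)"
    and eD: "emeasure lborel (D k) = ennreal (V * ((1/2) ^ k) ^ ?d)" for k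
    by (simp_all add: B_def D_def emeasure_ball V_def)
  have "(\<integral>\<^sup>+ x. ennreal (inverse (broken_power (a, b) (x::'a))) \<partial>lborel) \<le>
    (\<integral>\<^sup>+ x. (\<Sum>k. ennreal (c k) * indicator (B k) x) + (\<Sum>k. ennreal (e k) * indicator (D k) x) \<partial>lborel)"
    by (intro nn_integral_mono pt)
  also have "\<dots> = (\<Sum>k. ennreal (c k) * emeasure lborel (B k)) + (\<Sum>k. ennreal (e k) * emeasure lborel (D k))"
    by (simp add: nn_integral_add nn_integral_suminf nn_integral_cmult)
  also have "\<dots> = (\<Sum>k. ennreal (c k * (V * (2 ^ Suc k) ^ ?d))) + (\<Sum>k. ennreal (e k * (V * ((1/2) ^ k) ^ ?d)))"
    using c0 e0 V by (simp add: eB eD ennreal_mult)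
  also have "\<dots> < \<infinity>"
  proof -
    have "2 powr (- b) * 2 ^ ?d = 2 powr (real ?d - b)"
      by (simp add: powr_diff powr_minus powr_realpow field_simps)
    also have "\<dots> < 2 powr 0" using assms by (intro powr_less_mono) auto
    finally have r1: "2 powr (- b) * 2 ^ ?d < 1" by simp
    have s1: "c k * (V * (2 ^ Suc k) ^ ?d) = V * 2 ^ ?d * (2 powr (- b) * 2 ^ ?d) ^ k" for k
      by (simp add: c_def power_mult_distrib power_mult[symmetric] mult.commute algebra_simps)
    have "2 powr a * (1/2) ^ ?d = 2 powr (a - real ?d)"
      by (simp add: powr_diff powr_realpow power_one_over field_simps)
    also have "\<dots> < 2 powr 0" using assms by (intro powr_less_mono) auto
    finally have r2: "2 powr a * (1/2) ^ ?d < 1" by simp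
    have s2: "e k * (V * ((1/2) ^ k) ^ ?d) = V * 2 powr a * (2 powr a * (1/2) ^ ?d) ^ k" for k
      by (simp only: e_def power_mult_distrib power_mult[symmetric] mult.commute[of k]) (simp add: algebra_simps)
    have "summable (\<lambda>k. c k * (V * (2 ^ Suc k) ^ ?d))"
      unfolding s1 using r1 by (intro summable_mult summable_geometric) auto
    moreover have "summable (\<lambda>k. e k * (V * ((1/2) ^ k) ^ ?d))"
      unfolding s2 using r2 by (intro summable_mult summable_geometric) (auto simp: abs_mult)
    ultimately show ?thesis
      using c0 e0 V by (subst (1 2) suminf_ennreal2) auto
  qed
  finally show ?thesis .
qed

section \<open>Geometric sums with bounds uniform in the number of terms\<close>

lemma sum_power_inj_le:
  fixes r :: real
  assumes "finite S" "inj_on g S" "0 \<le> r" "r < 1"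
  shows "(\<Sum>j\<in>S. r ^ g j) \<le> 1 / (1 - r)"
proof -
  have "(\<Sum>j\<in>S. r ^ g j) = (\<Sum>i\<in>g ` S. r ^ i)"
    using assms by (simp add: sum.reindex)
  also have "\<dots> \<le> (\<Sum>i. r ^ i)"
    using assms by (intro sum_le_suminf summable_geometric) auto
  also have "\<dots> = 1 / (1 - r)" using assms by (simp add: suminf_geometric)
  finally show ?thesis .
qed

lemma sum_power_dist_le:
  fixes r :: real
  assumes "0 \<le> r" "r < 1" "i < J"
  shows "(\<Sum>j\<in>{..<J} - {i}. r ^ (if i < j then j - i else i - j)) \<le> 2 * r / (1 - r)"
proof -
  have "(\<Sum>j\<in>{..<J} - {i}. r ^ (if i < j then j - i else i - j)) =
     (\<Sum>j\<in>{..<i} \<union> {i<..<J}. r ^ (if i < j then j - i else i - j))"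
    using assms by (intro sum.cong) auto
  also have "\<dots> = (\<Sum>j\<in>{..<i}. r * r ^ (i - Suc j)) + (\<Sum>j\<in>{i<..<J}. r * r ^ (j - Suc i))"
    by (subst sum.union_disjoint)
       (auto intro!: arg_cong2[where f="(+)"] sum.cong simp: Suc_diff_Suc simp flip: power.simps(2))
  also have "\<dots> = r * (\<Sum>j\<in>{..<i}. r ^ (i - Suc j)) + r * (\<Sum>j\<in>{i<..<J}. r ^ (j - Suc i))"
    by (simp add: sum_distrib_left)
  also have "\<dots> \<le> r * (1 / (1 - r)) + r * (1 / (1 - r))"
    using assms by (intro add_mono mult_left_mono sum_power_inj_le) (auto simp: inj_on_def)
  finally show ?thesis by simp
qed

text \<open>Split at the floor of u: on either side the distances to u are at least distinct natural
  numbers, so two geometric series suffice. That the bound is independent of u and J keeps both the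
  frequency bumps and the dyadic scales under control.\<close>

lemma sum_exp_dist_le:
  fixes u c :: real
  assumes "0 < c"
  shows "(\<Sum>j<J. exp (- c * \<bar>u - real j\<bar>)) \<le> 2 / (1 - exp (- c))"
proof -
  define n where "n = \<lfloor>u\<rfloor>"
  have n: "real_of_int n \<le> u" "u < real_of_int n + 1" unfolding n_def by linarith+
  let ?S = "{j. j < J \<and> int j \<le> n}" and ?T = "{j. j < J \<and> n < int j}"
  have e: "exp (- c) ^ k = exp (- c * real k)" for k by (simp add: exp_of_nat_mult[symmetric] mult.commute)
  have 1: "(\<Sum>j\<in>?S. exp (- c * \<bar>u - real j\<bar>)) \<le> (\<Sum>j\<in>?S. exp (- c) ^ nat (n - int j))"
  proof (rule sum_mono)
    fix j assume "j \<in> ?S"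
    then have "real (nat (n - int j)) = real_of_int n - real j" by simp
    then show "exp (- c * \<bar>u - real j\<bar>) \<le> exp (- c) ^ nat (n - int j)"
      unfolding e using n assms by (simp del: of_nat_nat)
  qed
  have 2: "(\<Sum>j\<in>?T. exp (- c * \<bar>u - real j\<bar>)) \<le> (\<Sum>j\<in>?T. exp (- c) ^ nat (int j - n - 1))"
  proof (rule sum_mono)
    fix j assume "j \<in> ?T"
    then have *: "real (nat (int j - n - 1)) = real j - real_of_int n - 1" by simp
    have "real j - real_of_int n - 1 \<le> \<bar>u - real j\<bar>" using n by linarith
    then show "exp (- c * \<bar>u - real j\<bar>) \<le> exp (- c) ^ nat (int j - n - 1)"
      unfolding e * using assms by (simp del: of_nat_nat)
  qed
  have "(\<Sum>j<J. exp (- c * \<bar>u - real j\<bar>)) = (\<Sum>j\<in>?S \<union> ?T. exp (- c * \<bar>u - real j\<bar>))"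
    by (intro sum.cong) auto
  also have "\<dots> = (\<Sum>j\<in>?S. exp (- c * \<bar>u - real j\<bar>)) + (\<Sum>j\<in>?T. exp (- c * \<bar>u - real j\<bar>))"
    by (intro sum.union_disjoint) auto
  also have "\<dots> \<le> (\<Sum>j\<in>?S. exp (- c) ^ nat (n - int j)) + (\<Sum>j\<in>?T. exp (- c) ^ nat (int j - n - 1))"
    using 1 2 by simp
  also have "\<dots> \<le> 1 / (1 - exp (- c)) + 1 / (1 - exp (- c))"
    using assms by (intro add_mono sum_power_inj_le) (auto simp: inj_on_def)
  finally show ?thesis by simp
qed

section \<open>The Fourier transform\<close>

lemma cis_measurable [measurable (raw)]:
  "f \<in> borel_measurable M \<Longrightarrow> (\<lambda>x. cis (f x)) \<in> borel_measurable M"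
  by (rule measurable_compose[of f M borel cis borel])
     (auto intro!: borel_measurable_continuous_onI continuous_on_cis continuous_on_id)

text \<open>The definition integrates over the completed measure. For Borel functions the integral
  over \<open>lborel\<close> agrees, and there Fubini's theorem is available.\<close>

lemma fourier_lborel:
  assumes [measurable]: "f \<in> borel_measurable borel"
  shows "fourier f \<xi> = (LINT x|lborel. f x * cis (- 2 * pi * (x \<bullet> \<xi>)))"
proof -
  have "exp (- 2 * complex_of_real pi * \<i> * complex_of_real (x \<bullet> \<xi>)) = cis (- 2 * pi * (x \<bullet> \<xi>))" for x
    by (simp add: cis_conv_exp mult_ac)
  then show ?thesis
    unfolding fourier_def by (subst integral_completion) auto
qed

lemma integrable_mult_cis [intro]:
  assumes "integrable M f" "g \<in> borel_measurable M"
  shows "integrable M (\<lambda>x. f x * cis (g x))"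
  using assms by (intro Bochner_Integration.integrable_bound[OF assms(1)]) (auto simp: norm_mult)

lemma fourier_measurable [measurable]:
  fixes f :: "'a::euclidean_space \<Rightarrow> complex"
  assumes [measurable]: "f \<in> borel_measurable borel"
  shows "fourier f \<in> borel_measurable borel"
proof -
  have "(\<lambda>\<xi>. LINT x|lborel. f x * cis (- 2 * pi * (x \<bullet> \<xi>))) \<in> borel_measurable borel"
    by measurable
  also have "(\<lambda>\<xi>. LINT x|lborel. f x * cis (- 2 * pi * (x \<bullet> \<xi>))) = fourier f"
    by (intro ext) (simp add: fourier_lborel)
  finally show ?thesis .
qed

lemma norm_fourier_le:
  assumes "integrable lborel f"
  shows "norm (fourier f \<xi>) \<le> (LINT x|lborel. norm (f x))"
proof -
  have [measurable]: "f \<in> borel_measurable borel" using assms by auto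
  have "norm (fourier f \<xi>) \<le> (LINT x|lborel. norm (f x * cis (- 2 * pi * (x \<bullet> \<xi>))))"
    unfolding fourier_lborel[OF \<open>f \<in> _\<close>] by (rule integral_norm_bound)
  then show ?thesis by (simp add: norm_mult)
qed

lemma fourier_diff:
  assumes "integrable lborel f" "integrable lborel g"
  shows "fourier (\<lambda>x. f x - g x) \<xi> = fourier f \<xi> - fourier g \<xi>"
  using assms by (simp add: fourier_lborel left_diff_distrib integrable_mult_cis)

lemma fourier_add:
  assumes "integrable lborel f" "integrable lborel g"
  shows "fourier (\<lambda>x. f x + g x) \<xi> = fourier f \<xi> + fourier g \<xi>"
  using assms by (simp add: fourier_lborel distrib_right integrable_mult_cis)

lemma fourier_cmult:
  assumes "integrable lborel f"
  shows "fourier (\<lambda>x. c * f x) \<xi> = c * fourier f \<xi>"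
  using assms by (simp add: fourier_lborel mult.assoc)

lemma fourier_sum:
  assumes "\<And>i. i \<in> I \<Longrightarrow> integrable lborel (f i)"
  shows "fourier (\<lambda>x. \<Sum>i\<in>I. f i x) \<xi> = (\<Sum>i\<in>I. fourier (f i) \<xi>)"
proof -
  have "fourier (\<lambda>x. \<Sum>i\<in>I. f i x) \<xi> = (LINT x|lborel. (\<Sum>i\<in>I. f i x * cis (- 2 * pi * (x \<bullet> \<xi>))))"
    using assms by (subst fourier_lborel) (auto simp: sum_distrib_right intro!: borel_measurable_sum)
  also have "\<dots> = (\<Sum>i\<in>I. fourier (f i) \<xi>)"
    using assms by (subst Bochner_Integration.integral_sum) (auto simp: fourier_lborel intro!: sum.cong)
  finally show ?thesis .
qed

lemma integrable_translate:
  fixes f :: "'a::euclidean_space \<Rightarrow> 'b::{banach, second_countable_topology}"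
  assumes "integrable lborel f"
  shows "integrable lborel (\<lambda>x. f (x + h))"
proof -
  have "integrable (distr lborel borel ((+) h)) f" using assms by (simp add: lborel_distr_plus)
  then have "integrable lborel (\<lambda>x. f (h + x))"
    by (subst (asm) integrable_distr_eq) (use assms in auto)
  then show ?thesis by (simp add: add.commute)
qed

lemma integral_translate:
  fixes f :: "'a::euclidean_space \<Rightarrow> 'b::{banach, second_countable_topology}"
  assumes [measurable]: "f \<in> borel_measurable borel"
  shows "(LINT x|lborel. f (x + h)) = (LINT x|lborel. f x)"
proof -
  have "(LINT x|lborel. f x) = (LINT x|distr lborel borel ((+) h). f x)" by (simp add: lborel_distr_plus)
  also have "\<dots> = (LINT x|lborel. f (h + x))" by (subst integral_distr) auto
  finally show ?thesis by (simp add: add.commute)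
qed

lemma nn_integral_translate:
  fixes f :: "'a::euclidean_space \<Rightarrow> ennreal"
  assumes [measurable]: "f \<in> borel_measurable borel"
  shows "(\<integral>\<^sup>+ x. f (x + h) \<partial>lborel) = (\<integral>\<^sup>+ x. f x \<partial>lborel)"
proof -
  have "(\<integral>\<^sup>+ x. f x \<partial>lborel) = (\<integral>\<^sup>+ x. f x \<partial>distr lborel borel ((+) h))" by (simp add: lborel_distr_plus)
  also have "\<dots> = (\<integral>\<^sup>+ x. f (h + x) \<partial>lborel)" by (subst nn_integral_distr) auto
  finally show ?thesis by (simp add: add.commute)
qed

lemma nn_integral_reflect:
  fixes f :: "'a::euclidean_space \<Rightarrow> ennreal"
  assumes [measurable]: "f \<in> borel_measurable borel"
  shows "(\<integral>\<^sup>+ x. f (- x) \<partial>lborel) = (\<integral>\<^sup>+ x. f x \<partial>lborel)"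
proof -
  have "(\<integral>\<^sup>+ x. f x \<partial>lborel) = (\<integral>\<^sup>+ x. f x \<partial>density (distr lborel borel (\<lambda>x. 0 + (- 1) *\<^sub>R x)) (\<lambda>_. ennreal (\<bar>- 1\<bar> ^ DIM('a))))"
    by (rule arg_cong[where f="\<lambda>M. nn_integral M f"], rule lborel_affine) simp
  also have "\<dots> = (\<integral>\<^sup>+ x. f (- x) \<partial>lborel)"
    by (simp add: nn_integral_density nn_integral_distr)
  finally show ?thesis ..
qed

lemma fourier_translate:
  assumes f: "integrable lborel f"
  shows "fourier (\<lambda>x. f (x + h)) \<xi> = cis (2 * pi * (h \<bullet> \<xi>)) * fourier f \<xi>"
proof -
  have [measurable]: "f \<in> borel_measurable borel" using f by auto
  have "fourier (\<lambda>x. f (x + h)) \<xi> =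
    (LINT x|lborel. cis (2 * pi * (h \<bullet> \<xi>)) * (f (x + h) * cis (- 2 * pi * ((x + h) \<bullet> \<xi>))))"
    by (subst fourier_lborel) (auto intro!: Bochner_Integration.integral_cong
        simp: cis_mult inner_add_left algebra_simps)
  also have "\<dots> = cis (2 * pi * (h \<bullet> \<xi>)) * (LINT x|lborel. f (x + h) * cis (- 2 * pi * ((x + h) \<bullet> \<xi>)))"
    by simp
  also have "(LINT x|lborel. f (x + h) * cis (- 2 * pi * ((x + h) \<bullet> \<xi>))) = fourier f \<xi>"
    using integral_translate[of "\<lambda>x. f x * cis (- 2 * pi * (x \<bullet> \<xi>))" h] by (simp add: fourier_lborel)
  finally show ?thesis .
qed

lemma fourier_modulate:
  assumes [measurable]: "f \<in> borel_measurable borel"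
  shows "fourier (\<lambda>x. f x * cis (- 2 * pi * (x \<bullet> \<eta>))) \<xi> = fourier f (\<xi> + \<eta>)"
  by (simp add: fourier_lborel mult.assoc cis_mult inner_add_right algebra_simps)

text \<open>Fubini; the kernel \<open>cis (- 2 * pi * (x \<bullet> \<xi>))\<close> is symmetric in x
  and \<xi>. Inversion and the Bessel inequality are both derived from this identity.\<close>

lemma fourier_multiplication:
  fixes f g :: "'a::euclidean_space \<Rightarrow> complex"
  assumes f: "integrable lborel f" and g: "integrable lborel g"
  shows "(LINT \<xi>|lborel. fourier f \<xi> * g \<xi>) = (LINT x|lborel. f x * fourier g x)"
proof -
  have [measurable]: "f \<in> borel_measurable borel" "g \<in> borel_measurable borel" using f g by auto
  let ?F = "\<lambda>(x, \<xi>). f x * g \<xi> * cis (- 2 * pi * (x \<bullet> \<xi>))"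
  have "integrable (lborel \<Otimes>\<^sub>M lborel) ?F"
  proof (rule lborel_pair.Fubini_integrable)
    show "integrable lborel (\<lambda>x. LINT \<xi>|lborel. norm (?F (x, \<xi>)))"
      using f by (simp add: norm_mult)
    show "AE x in lborel. integrable lborel (\<lambda>\<xi>. ?F (x, \<xi>))"
      using g by (intro AE_I2) (simp add: integrable_mult_cis)
  qed measurable
  then have "(LINT \<xi>|lborel. LINT x|lborel. f x * g \<xi> * cis (- 2 * pi * (x \<bullet> \<xi>))) =
      (LINT x|lborel. LINT \<xi>|lborel. f x * g \<xi> * cis (- 2 * pi * (x \<bullet> \<xi>)))"
    by (rule lborel_pair.Fubini_integral)
  moreover have "(LINT x|lborel. f x * g \<xi> * cis (- 2 * pi * (x \<bullet> \<xi>))) = fourier f \<xi> * g \<xi>" for \<xi>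
    by (simp add: fourier_lborel mult_ac flip: integral_mult_right_zero)
  moreover have "(LINT \<xi>|lborel. f x * g \<xi> * cis (- 2 * pi * (x \<bullet> \<xi>))) = f x * fourier g x" for x
    by (simp add: fourier_lborel mult_ac inner_commute flip: integral_mult_right_zero)
  ultimately show ?thesis by simp
qed

section \<open>Transforms of Gaussians with real and complex parameters\<close>

lemma integrable_prod_lborel:
  fixes F :: "'a::euclidean_space \<Rightarrow> real \<Rightarrow> complex"
  assumes "\<And>b. b \<in> Basis \<Longrightarrow> integrable lborel (F b)"
  shows "integrable lborel (\<lambda>x::'a. \<Prod>b\<in>Basis. F b (x \<bullet> b))" (is ?A)
    and "(LINT x|lborel. (\<Prod>b\<in>Basis. F b ((x::'a) \<bullet> b))) = (\<Prod>b\<in>Basis. LINT t|lborel. F b t)" (is ?B)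
proof -
  interpret product_sigma_finite "\<lambda>_::'a. lborel :: real measure" ..
  have [measurable]: "F b \<in> borel_measurable borel" if "b \<in> Basis" for b using assms[OF that] by auto
  have eq: "(\<Prod>b\<in>Basis. F b ((\<Sum>c\<in>Basis. w c *\<^sub>R c) \<bullet> b)) = (\<Prod>b\<in>Basis. F b (w b))" for w :: "'a \<Rightarrow> real"
    by (intro prod.cong) auto
  have [measurable]: "(\<lambda>x::'a. \<Prod>b\<in>Basis. F b (x \<bullet> b)) \<in> borel_measurable borel"
    by (intro borel_measurable_prod) measurable
  define P where "P = distr (\<Pi>\<^sub>M b\<in>(Basis::'a set). (lborel :: real measure)) borel (\<lambda>f. \<Sum>b\<in>Basis. f b *\<^sub>R b)"
  have P: "lborel = P" unfolding P_def by (rule lborel_eq)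
  have "integrable P (\<lambda>x::'a. \<Prod>b\<in>Basis. F b (x \<bullet> b))"
    unfolding P_def
    by (subst integrable_distr_eq) (auto simp: eq intro!: product_integrable_prod assms)
  then show ?A by (simp only: P)
  have "(LINT x|P. (\<Prod>b\<in>Basis. F b ((x::'a) \<bullet> b))) = (\<Prod>b\<in>Basis. LINT t|lborel. F b t)"
    unfolding P_def
    by (subst integral_distr) (auto simp: eq intro!: product_integral_prod assms)
  then show ?B by (simp only: P)
qed

lemma integrable_gaussian_real:
  assumes "0 < a"
  shows "integrable lborel (\<lambda>t. exp (- pi * a * t\<^sup>2))"
proof -
  \<comment> \<open>The standard deviation for which the normal density is a multiple of
    \<open>exp (- pi * a * t\<^sup>2)\<close>.\<close>
  define \<sigma> where "\<sigma> = 1 / sqrt (2 * pi * a)"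
  have s: "0 < \<sigma>" using assms by (simp add: \<sigma>_def)
  have s2: "1 / (2 * \<sigma>\<^sup>2) = pi * a" using assms by (simp add: \<sigma>_def power_divide)
  have "integrable lborel (\<lambda>t. sqrt (2 * pi * \<sigma>\<^sup>2) * normal_density 0 \<sigma> t)"
    using s by (intro integrable_mult_right integrable_normal_density)
  also have "(\<lambda>t. sqrt (2 * pi * \<sigma>\<^sup>2) * normal_density 0 \<sigma> t) = (\<lambda>t. exp (- pi * a * t\<^sup>2))"
  proof
    fix t
    have "- t\<^sup>2 / (2 * \<sigma>\<^sup>2) = - t\<^sup>2 * (1 / (2 * \<sigma>\<^sup>2))" by simp
    then have "- t\<^sup>2 / (2 * \<sigma>\<^sup>2) = - pi * a * t\<^sup>2" unfolding s2 by simp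
    then show "sqrt (2 * pi * \<sigma>\<^sup>2) * normal_density 0 \<sigma> t = exp (- pi * a * t\<^sup>2)"
      using s by (simp add: normal_density_def)
  qed
  finally show ?thesis .
qed

text \<open>The characteristic function of the standard normal distribution after the substitution x
  = c t with c^2 = 2 pi a.\<close>

lemma fourier_gaussian_real:
  assumes "0 < a"
  shows "(LINT t|lborel. of_real (exp (- pi * a * t\<^sup>2)) * cis (- 2 * pi * (t * \<xi>))) =
    complex_of_real (exp (- pi * \<xi>\<^sup>2 / a) / sqrt a)"
proof -
  define c where "c = sqrt (2 * pi * a)"
  have c: "c > 0" "c\<^sup>2 = 2 * pi * a" using assms by (auto simp: c_def)
  define s where "s = - 2 * pi * \<xi> / c"
  have "complex_of_real (exp (- s\<^sup>2 / 2)) = char std_normal_distribution s"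
    by (simp add: char_std_normal_distribution)
  also have "\<dots> = (LINT x|lborel. std_normal_density x *\<^sub>R iexp (s * x))"
    by (simp add: char_def integral_density normal_density_nonneg)
  also have "\<dots> = c *\<^sub>R (LINT x|lborel. std_normal_density (c * x) *\<^sub>R iexp (s * (c * x)))"
    using c lborel_integral_real_affine[of c "\<lambda>x. std_normal_density x *\<^sub>R iexp (s * x)" 0] by simp
  also have "(\<lambda>x. std_normal_density (c * x) *\<^sub>R iexp (s * (c * x))) =
    (\<lambda>x. complex_of_real (1 / sqrt (2 * pi)) * (of_real (exp (- pi * a * x\<^sup>2)) * cis (- 2 * pi * (x * \<xi>))))"
  proof
    fix x
    have "(c * x)\<^sup>2 / 2 = pi * a * x\<^sup>2" using c by (simp add: power_mult_distrib)
    moreover have "s * (c * x) = - 2 * pi * (x * \<xi>)" using c by (simp add: s_def)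
    ultimately show "std_normal_density (c * x) *\<^sub>R iexp (s * (c * x)) =
      complex_of_real (1 / sqrt (2 * pi)) * (of_real (exp (- pi * a * x\<^sup>2)) * cis (- 2 * pi * (x * \<xi>)))"
      by (simp add: std_normal_density_def cis_conv_exp scaleR_conv_of_real)
  qed
  finally have "complex_of_real (exp (- s\<^sup>2 / 2)) = c *\<^sub>R (complex_of_real (1 / sqrt (2 * pi)) *
      (LINT t|lborel. of_real (exp (- pi * a * t\<^sup>2)) * cis (- 2 * pi * (t * \<xi>))))"
    by simp
  also have "\<dots> = complex_of_real (sqrt a) * (LINT t|lborel. of_real (exp (- pi * a * t\<^sup>2)) * cis (- 2 * pi * (t * \<xi>)))"
    by (simp add: c_def real_sqrt_mult scaleR_conv_of_real)
  also have "- s\<^sup>2 / 2 = - pi * \<xi>\<^sup>2 / a"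
    using assms c by (simp add: s_def power_divide power_mult_distrib) (simp add: power2_eq_square)
  finally show ?thesis using assms by (simp add: field_simps)
qed

lemma norm_exp_gaussian: "norm (exp (- of_real pi * z * of_real (t\<^sup>2))) = exp (- pi * Re z * t\<^sup>2)"
  by (simp add: norm_exp_eq_Re)

lemma integrable_gaussian_complex:
  assumes "0 < Re z"
  shows "integrable lborel (\<lambda>t. exp (- of_real pi * z * of_real (t\<^sup>2)) * cis (g * t))"
proof (rule Bochner_Integration.integrable_bound[OF integrable_gaussian_real[OF assms]])
  have "(\<lambda>t::real. exp (- of_real pi * z * of_real (t\<^sup>2)) * cis (g * t)) \<in> borel_measurable borel"
    by (intro borel_measurable_continuous_onI continuous_intros)
  then show "(\<lambda>t::real. exp (- of_real pi * z * of_real (t\<^sup>2)) * cis (g * t)) \<in> borel_measurable lborel"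
    by simp
qed (simp add: norm_mult norm_exp_gaussian)

text \<open>Both sides are holomorphic in z on the right half-plane and agree for positive real z,
  hence everywhere. The complex parameter is what produces chirps.\<close>

lemma fourier_gaussian_complex:
  assumes z: "0 < Re z"
  shows "(LINT t|lborel. exp (- of_real pi * z * of_real (t\<^sup>2)) * cis (- 2 * pi * \<xi> * t)) =
    exp (- of_real (pi * \<xi>\<^sup>2) / z) / csqrt z"
proof -
  define G where "G z t = exp (- complex_of_real pi * z * of_real (t\<^sup>2)) * cis (- 2 * pi * \<xi> * t)" for z t
  define J where "J z = (LINT t|lborel. G z t)" for z
  define Jn where "Jn n z = integral (cbox (- real n) (real n)) (G z)" for n z
  define S where "S = {z. 0 < Re z}"
  have S: "open S" "convex S" unfolding S_def by (auto intro: open_halfspace_Re_gt convex_halfspace_Re_gt)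
  have cont: "continuous_on X (G z)" for z X
    unfolding G_def by (intro continuous_intros)
  have int: "integrable lborel (G z)" if "z \<in> S" for z
    using integrable_gaussian_complex[of z "- 2 * pi * \<xi>"] that by (simp add: S_def G_def[abs_def])
  have [measurable]: "G z \<in> borel_measurable borel" for z
    by (intro borel_measurable_continuous_onI cont)
  have Jn: "Jn n z = (LINT t:{- real n..real n}|lborel. G z t)" if "z \<in> S" for n z
    unfolding Jn_def using int[OF that]
    by (subst set_borel_integral_eq_integral(2)) (auto simp: set_integrable_def intro!: integrable_mult_indicator)
  have "J holomorphic_on S"
  proof (rule holomorphic_uniform_sequence[OF S(1)])
    fix n
    show "Jn n holomorphic_on S"
      unfolding Jn_def
    proof (rule leibniz_rule_holomorphic)
      fix z t
      show "((\<lambda>z. G z t) has_field_derivative - of_real pi * of_real (t\<^sup>2) * G z t) (at z within S)"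
        unfolding G_def by (auto intro!: derivative_eq_intros)
    next
      show "continuous_on (S \<times> cbox (- real n) (real n)) (\<lambda>(z, t). - of_real pi * of_real (t\<^sup>2) * G z t)"
        unfolding G_def split_beta by (intro continuous_intros)
    qed (auto intro: integrable_continuous_real cont S)
  next
    fix x assume "x \<in> S"
    then obtain d where d: "d > 0" "cball x d \<subseteq> S"
      using S(1) open_contains_cball by blast
    \<comment> \<open>On the disc \<open>cball x d\<close> the real part is at least
      \<open>a\<close>. Hence the tails beyond [-n, n] of all the functions \<open>G w\<close> are
      bounded by the tail \<open>T n\<close> of one real Gaussian, which makes the truncated
      integrals \<open>Jn\<close> converge uniformly to \<open>J\<close>.\<close>
    define a where "a = Re x - d"
    have "x - of_real d \<in> cball x d" using d by (simp add: dist_norm)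
    then have "x - of_real d \<in> S" using d by blast
    then have a: "a > 0" using d by (auto simp: S_def a_def)
    have Re_ge: "a \<le> Re w" if "w \<in> cball x d" for w
      using that abs_Re_le_cmod[of "x - w"] by (simp add: a_def dist_norm)
    define T where "T n = (LINT t|lborel. indicator (- {- real n..real n}) t * exp (- pi * a * t\<^sup>2))" for n :: nat
    have "T \<longlonglongrightarrow> (LINT t::real|lborel. (0::real))"
      unfolding T_def
    proof (rule integral_dominated_convergence[where w="\<lambda>t. exp (- pi * a * t\<^sup>2)" and f="\<lambda>_. 0"
          and s="\<lambda>n t. indicator (- {- real n..real n}) t * exp (- pi * a * t\<^sup>2)"])
      show "AE t in lborel. (\<lambda>n. indicator (- {- real n..real n}) t * exp (- pi * a * t\<^sup>2)) \<longlonglongrightarrow> 0"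
      proof (rule AE_I2)
        fix t :: real
        obtain N where N: "\<bar>t\<bar> \<le> real N" using real_arch_simple by blast
        have "indicator (- {- real n..real n}) t * exp (- pi * a * t\<^sup>2) = 0" if "n \<ge> N" for n
          using N that by (auto simp: indicator_def abs_le_iff)
        then show "(\<lambda>n. indicator (- {- real n..real n}) t * exp (- pi * a * t\<^sup>2)) \<longlonglongrightarrow> 0"
          by (intro tendsto_eventually eventually_sequentiallyI)
      qed
    qed (use integrable_gaussian_real[OF a] in \<open>auto simp: indicator_def mult.assoc\<close>)
    then have T0: "T \<longlonglongrightarrow> 0" by simp
    have bnd: "norm (Jn n w - J w) \<le> T n" if w: "w \<in> cball x d" for n w
    proof -
      have wS: "w \<in> S" using w d by auto
      have "J w - Jn n w = (LINT t|lborel. G w t - indicator {- real n..real n} t *\<^sub>R G w t)"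
        unfolding J_def Jn[OF wS] set_lebesgue_integral_def
        using int[OF wS] by (intro Bochner_Integration.integral_diff[symmetric] integrable_mult_indicator) auto
      also have "\<dots> = (LINT t|lborel. indicator (- {- real n..real n}) t *\<^sub>R G w t)"
        by (intro Bochner_Integration.integral_cong) (auto simp: indicator_def)
      also have "norm \<dots> \<le> (LINT t|lborel. norm (indicator (- {- real n..real n}) t *\<^sub>R G w t))"
        by (rule integral_norm_bound)
      also have "\<dots> \<le> T n"
        unfolding T_def
      proof (rule integral_mono)
        show "integrable lborel (\<lambda>t. norm (indicator (- {- real n..real n}) t *\<^sub>R G w t))"
          using int[OF wS] by (intro integrable_norm integrable_mult_indicator) auto
        show "integrable lborel (\<lambda>t. indicator (- {- real n..real n}) t * exp (- pi * a * t\<^sup>2))"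
          using integrable_mult_indicator[of "- {- real n..real n}" lborel, OF _ integrable_gaussian_real[OF a]]
          by simp
        show "norm (indicator (- {- real n..real n}) t *\<^sub>R G w t) \<le> indicator (- {- real n..real n}) t * exp (- pi * a * t\<^sup>2)" for t
          using Re_ge[OF w] by (auto simp: indicator_def G_def norm_mult norm_exp_gaussian intro!: mult_right_mono)
      qed
      finally show ?thesis by (simp add: norm_minus_commute)
    qed
    have "uniform_limit (cball x d) Jn J sequentially"
    proof (rule uniform_limitI)
      fix e :: real assume "e > 0"
      with T0 have "eventually (\<lambda>n. T n < e) sequentially" by (rule order_tendstoD)
      then show "\<forall>\<^sub>F n in sequentially. \<forall>w\<in>cball x d. dist (Jn n w) (J w) < e"
        by eventually_elim (auto simp: dist_norm intro!: le_less_trans[OF bnd])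
    qed
    with d show "\<exists>d. 0 < d \<and> cball x d \<subseteq> S \<and> uniform_limit (cball x d) Jn J sequentially"
      by blast
  qed
  define K where "K z = exp (- of_real (pi * \<xi>\<^sup>2) / z) / csqrt z" for z
  have "K holomorphic_on S"
    unfolding K_def S_def by (intro holomorphic_intros) (auto simp: complex_nonpos_Reals_iff)
  have "J z - K z = 0"
  proof (rule analytic_continuation[of "\<lambda>z. J z - K z" S "of_real ` {0<..}" 1])
    show "(\<lambda>z. J z - K z) holomorphic_on S"
      using \<open>J holomorphic_on S\<close> \<open>K holomorphic_on S\<close> by (intro holomorphic_on_diff)
    show "connected S" using S by (simp add: convex_connected)
    show "(1::complex) islimpt of_real ` {0<..}"
      unfolding islimpt_approachable
    proof (intro allI impI)
      fix e :: real assume "e > 0"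
      then have "complex_of_real (1 + e / 2) \<in> complex_of_real ` {0<..}"
        by (intro imageI) simp
      moreover have "complex_of_real (1 + e / 2) \<noteq> 1 \<and> dist (complex_of_real (1 + e / 2)) 1 < e"
        using \<open>e > 0\<close> by (simp add: dist_norm)
      ultimately show "\<exists>x'\<in>complex_of_real ` {0<..}. x' \<noteq> 1 \<and> dist x' 1 < e"
        by blast
    qed
    fix w assume "w \<in> complex_of_real ` {0<..}"
    then obtain a where a: "w = of_real a" "0 < a" by auto
    have "G w = (\<lambda>t. of_real (exp (- pi * a * t\<^sup>2)) * cis (- 2 * pi * (t * \<xi>)))"
      by (simp add: G_def a fun_eq_iff exp_of_real[symmetric] mult_ac)
    then have "J w = complex_of_real (exp (- pi * \<xi>\<^sup>2 / a) / sqrt a)"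
      unfolding J_def by (simp only: fourier_gaussian_real[OF a(2)])
    also have "\<dots> = K w"
      using a by (simp add: K_def exp_of_real[symmetric] csqrt_of_real_nonneg)
    finally show "J w - K w = 0" by simp
  qed (use S z in \<open>auto simp: S_def\<close>)
  then show ?thesis by (simp add: J_def K_def G_def)
qed

section \<open>Chirps, Gaussians and the Bessel inequality\<close>

lemma norm_sq_eq_sum: "(norm (x::'a::euclidean_space))\<^sup>2 = (\<Sum>b\<in>Basis. (x \<bullet> b)\<^sup>2)"
  unfolding power2_norm_eq_inner euclidean_inner[of x x] by (simp add: power2_eq_square)

text \<open>One complex parameter per coordinate: \<open>Re (z b)\<close> is the Gaussian decay,
  \<open>Im (z b)\<close> the quadratic phase. The product form makes the transform factor over the
  coordinates.\<close>

definition chirp :: "('a::euclidean_space \<Rightarrow> complex) \<Rightarrow> 'a \<Rightarrow> complex" where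
  "chirp z x = (\<Prod>b\<in>Basis. exp (- of_real pi * z b * of_real ((x \<bullet> b)\<^sup>2)))"

lemma chirp_measurable [measurable]: "chirp z \<in> borel_measurable borel"
  unfolding chirp_def[abs_def] by (intro borel_measurable_continuous_onI continuous_intros)

lemma prod_cis: "finite I \<Longrightarrow> (\<Prod>i\<in>I. cis (g i)) = cis (\<Sum>i\<in>I. g i)"
  by (induction I rule: finite_induct) (auto simp: cis_mult)

lemma
  fixes z :: "'a::euclidean_space \<Rightarrow> complex"
  assumes z: "\<And>b. b \<in> Basis \<Longrightarrow> 0 < Re (z b)"
  shows integrable_chirp: "integrable lborel (chirp z)"
    and fourier_chirp: "fourier (chirp z) \<xi> = (\<Prod>b\<in>Basis. exp (- of_real (pi * (\<xi> \<bullet> b)\<^sup>2) / z b) / csqrt (z b))"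
proof -
  let ?F = "\<lambda>b t. exp (- of_real pi * z b * of_real (t\<^sup>2)) * cis (- 2 * pi * (\<xi> \<bullet> b) * t)"
  have "integrable lborel (\<lambda>x::'a. \<Prod>b\<in>Basis. exp (- of_real pi * z b * of_real ((x \<bullet> b)\<^sup>2)) * cis (0 * (x \<bullet> b)))"
    using z by (intro integrable_prod_lborel(1) integrable_gaussian_complex)
  then show "integrable lborel (chirp z)" by (simp add: chirp_def[abs_def])
  have eq: "chirp z x * cis (- 2 * pi * (x \<bullet> \<xi>)) = (\<Prod>b\<in>Basis. ?F b (x \<bullet> b))" for x
  proof -
    have "- 2 * pi * (x \<bullet> \<xi>) = (\<Sum>b\<in>Basis. - 2 * pi * (\<xi> \<bullet> b) * (x \<bullet> b))"
      by (simp add: euclidean_inner[of x \<xi>] sum_distrib_left mult_ac)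
    then have "cis (- 2 * pi * (x \<bullet> \<xi>)) = (\<Prod>b\<in>Basis. cis (- 2 * pi * (\<xi> \<bullet> b) * (x \<bullet> b)))"
      by (simp only: prod_cis[OF finite_Basis])
    then show ?thesis by (simp only: chirp_def prod.distrib)
  qed
  have "fourier (chirp z) \<xi> = (LINT x|lborel. (\<Prod>b\<in>Basis. ?F b (x \<bullet> b)))"
    by (subst fourier_lborel) (simp_all only: eq chirp_measurable)
  also have "\<dots> = (\<Prod>b\<in>Basis. LINT t|lborel. ?F b t)"
    using z by (intro integrable_prod_lborel(2) integrable_gaussian_complex)
  also have "\<dots> = (\<Prod>b\<in>Basis. exp (- of_real (pi * (\<xi> \<bullet> b)\<^sup>2) / z b) / csqrt (z b))"
    using z by (intro prod.cong fourier_gaussian_complex) auto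
  finally show "fourier (chirp z) \<xi> = (\<Prod>b\<in>Basis. exp (- of_real (pi * (\<xi> \<bullet> b)\<^sup>2) / z b) / csqrt (z b))" .
qed

definition gauss :: "real \<Rightarrow> 'a::euclidean_space \<Rightarrow> real" where
  "gauss a x = exp (- pi * a * (norm x)\<^sup>2)"

lemma gauss_measurable [measurable]: "gauss a \<in> borel_measurable borel"
  unfolding gauss_def[abs_def] by measurable

lemma gauss_nonneg [simp]: "0 \<le> gauss a x"
  by (simp add: gauss_def)

lemma gauss_le_1: "0 \<le> a \<Longrightarrow> gauss a x \<le> 1"
  by (simp add: gauss_def)

lemma gauss_minus [simp]: "gauss a (- x) = gauss a x" "gauss a (x - y) = gauss a (y - x)"
  by (simp_all add: gauss_def norm_minus_commute)

lemma chirp_of_real: "chirp (\<lambda>_. of_real a) = (\<lambda>x. of_real (gauss a x))"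
proof
  fix x :: 'a
  have "chirp (\<lambda>_. of_real a) x = (\<Prod>b\<in>Basis. of_real (exp (- pi * a * (x \<bullet> b)\<^sup>2)))"
    unfolding chirp_def by (intro prod.cong) (auto simp flip: exp_of_real)
  also have "\<dots> = of_real (exp (\<Sum>b\<in>Basis. - pi * a * (x \<bullet> b)\<^sup>2))"
    by (simp add: exp_sum)
  also have "(\<Sum>b\<in>Basis. - pi * a * (x \<bullet> b)\<^sup>2) = - pi * a * (norm x)\<^sup>2"
    by (simp add: norm_sq_eq_sum sum_distrib_left)
  finally show "chirp (\<lambda>_. of_real a) x = of_real (gauss a x)" by (simp add: gauss_def)
qed

lemma
  fixes \<xi> :: "'a::euclidean_space"
  assumes "0 < a"
  shows integrable_gauss: "integrable lborel (gauss a :: 'a \<Rightarrow> real)"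
    and fourier_gauss: "fourier (\<lambda>x. of_real (gauss a x)) \<xi> = of_real ((1 / sqrt a) ^ DIM('a) * gauss (1 / a) \<xi>)"
proof -
  have "integrable lborel (\<lambda>x::'a. complex_of_real (gauss a x))"
    using integrable_chirp[of "\<lambda>_. of_real a"] assms by (simp add: chirp_of_real)
  then show "integrable lborel (gauss a :: 'a \<Rightarrow> real)" by (simp add: complex_of_real_integrable_eq)
  have "fourier (\<lambda>x. of_real (gauss a x)) \<xi> =
      (\<Prod>b\<in>Basis. exp (- of_real (pi * (\<xi> \<bullet> b)\<^sup>2) / of_real a) / csqrt (of_real a))"
    using fourier_chirp[of "\<lambda>_. of_real a" \<xi>] assms by (simp add: chirp_of_real)
  also have "\<dots> = (\<Prod>b\<in>Basis. complex_of_real (exp (- pi * (1 / a) * (\<xi> \<bullet> b)\<^sup>2) * (1 / sqrt a)))"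
    using assms by (intro prod.cong) (auto simp: csqrt_of_real_nonneg simp flip: exp_of_real)
  also have "\<dots> = of_real (exp (\<Sum>b\<in>Basis. - pi * (1 / a) * (\<xi> \<bullet> b)\<^sup>2) * (1 / sqrt a) ^ DIM('a))"
    by (simp only: of_real_prod[symmetric] prod.distrib prod_constant exp_sum finite_Basis)
  also have "(\<Sum>b\<in>Basis. - pi * (1 / a) * (\<xi> \<bullet> b)\<^sup>2) = - pi * (1 / a) * (norm \<xi>)\<^sup>2"
    by (simp only: norm_sq_eq_sum sum_distrib_left)
  finally show "fourier (\<lambda>x. of_real (gauss a x)) \<xi> = of_real ((1 / sqrt a) ^ DIM('a) * gauss (1 / a) \<xi>)"
    by (simp add: gauss_def mult.commute)
qed

text \<open>The transform of \<open>gauss (e\<^sup>2)\<close>, hence of integral 1: an approximate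
  identity in which \<open>e\<close> is a width.\<close>

definition heat :: "real \<Rightarrow> 'a::euclidean_space \<Rightarrow> real" where
  "heat e x = (1 / e) ^ DIM('a) * gauss (1 / e\<^sup>2) x"

lemma heat_measurable [measurable]: "heat e \<in> borel_measurable borel"
  unfolding heat_def[abs_def] by measurable

lemma heat_nonneg: "0 < e \<Longrightarrow> 0 \<le> heat e x"
  by (simp add: heat_def)

lemma heat_le: "0 < e \<Longrightarrow> heat e (x::'a::euclidean_space) \<le> (1 / e) ^ DIM('a)"
  using gauss_le_1[of "1 / e\<^sup>2" x] by (simp add: heat_def divide_right_mono)

lemma fourier_gauss_heat:
  assumes "0 < e"
  shows "fourier (\<lambda>x. of_real (gauss (e\<^sup>2) x)) \<xi> = of_real (heat e \<xi>)"
  using fourier_gauss[of "e\<^sup>2" \<xi>] assms by (simp add: heat_def)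

lemma integrable_heat: "0 < e \<Longrightarrow> integrable lborel (heat e)"
  unfolding heat_def[abs_def] by (intro integrable_mult_right integrable_gauss) simp

lemma integral_heat:
  assumes "0 < e"
  shows "(LINT x|lborel. heat e (x::'a::euclidean_space)) = 1"
proof -
  have "complex_of_real (LINT x|lborel. gauss (1 / e\<^sup>2) (x::'a)) = fourier (\<lambda>x::'a. of_real (gauss (1 / e\<^sup>2) x)) 0"
    by (subst fourier_lborel) auto
  also have "\<dots> = of_real (e ^ DIM('a))"
    using assms by (subst fourier_gauss) (auto simp: gauss_def real_sqrt_divide)
  finally have "(LINT x|lborel. gauss (1 / e\<^sup>2) (x::'a)) = e ^ DIM('a)"
    by (simp only: of_real_eq_iff)
  then show ?thesis using assms by (simp add: heat_def[abs_def] power_divide)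
qed

lemma nn_integral_heat:
  assumes "0 < e"
  shows "(\<integral>\<^sup>+ x. ennreal (heat e (x::'a::euclidean_space)) \<partial>lborel) = 1"
  using assms by (subst nn_integral_eq_integral) (auto simp: integrable_heat integral_heat heat_nonneg)

lemma nn_integral_heat_shift:
  fixes x :: "'a::euclidean_space"
  assumes "0 < e"
  shows "(\<integral>\<^sup>+ y. ennreal (heat e (x - y)) \<partial>lborel) = 1" "(\<integral>\<^sup>+ y. ennreal (heat e (y - x)) \<partial>lborel) = 1"
proof -
  show *: "(\<integral>\<^sup>+ y. ennreal (heat e (y - x)) \<partial>lborel) = 1"
    using nn_integral_translate[of "\<lambda>y. ennreal (heat e y)" "- x"] nn_integral_heat[OF assms, where 'a='a] by simp
  have "heat e (x - y) = heat e (y - x)" for y by (simp add: heat_def)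
  with * show "(\<integral>\<^sup>+ y. ennreal (heat e (x - y)) \<partial>lborel) = 1" by simp
qed

text \<open>The transform of an integrable function is in general only bounded; Gaussian damping
  makes it integrable, so that it can be transformed again.\<close>

lemma integrable_fourier_gauss:
  assumes g: "integrable lborel g" and "0 < a"
  shows "integrable lborel (\<lambda>\<xi>. fourier g \<xi> * of_real (gauss a \<xi>))"
proof (rule Bochner_Integration.integrable_bound)
  have [measurable]: "g \<in> borel_measurable borel" using g by auto
  show "integrable lborel (\<lambda>\<xi>. (LINT x|lborel. norm (g x)) * gauss a \<xi>)"
    using assms by (intro integrable_mult_right integrable_gauss)
  show "AE \<xi> in lborel. norm (fourier g \<xi> * of_real (gauss a \<xi>)) \<le> norm ((LINT x|lborel. norm (g x)) * gauss a \<xi>)"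
    using norm_fourier_le[OF g] by (intro AE_I2) (auto simp: norm_mult abs_mult intro!: mult_right_mono order_trans[OF _ abs_ge_self])
  show "(\<lambda>\<xi>. fourier g \<xi> * of_real (gauss a \<xi>)) \<in> borel_measurable lborel"
    by measurable
qed

text \<open>The multiplication formula with a modulated Gaussian as second function: damped
  inversion is convolution with the heat kernel.\<close>

lemma fourier_inversion_gauss:
  fixes g :: "'a::euclidean_space \<Rightarrow> complex"
  assumes g: "integrable lborel g" and e: "0 < e"
  shows "fourier (\<lambda>\<xi>. fourier g \<xi> * of_real (gauss (e\<^sup>2) \<xi>)) (- x) = (LINT y|lborel. g y * of_real (heat e (x - y)))"
proof -
  have [measurable]: "g \<in> borel_measurable borel" using g by auto
  let ?h = "\<lambda>\<xi>. of_real (gauss (e\<^sup>2) \<xi>) * cis (- 2 * pi * (\<xi> \<bullet> - x))"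
  have h: "integrable lborel ?h"
    using e by (intro integrable_mult_cis) (auto intro!: integrable_of_real integrable_gauss)
  have "fourier (\<lambda>\<xi>. fourier g \<xi> * of_real (gauss (e\<^sup>2) \<xi>)) (- x) = (LINT \<xi>|lborel. fourier g \<xi> * ?h \<xi>)"
    by (subst fourier_lborel) (auto simp: mult.assoc)
  also have "\<dots> = (LINT y|lborel. g y * fourier ?h y)"
    by (rule fourier_multiplication[OF g h])
  also have "fourier ?h = (\<lambda>y. of_real (heat e (x - y)))"
    using e by (intro ext, subst fourier_modulate) (auto simp: fourier_gauss_heat heat_def)
  finally show ?thesis .
qed

lemma cnj_measurable [measurable (raw)]:
  "f \<in> borel_measurable M \<Longrightarrow> (\<lambda>x. cnj (f x)) \<in> borel_measurable M"
  by (rule borel_measurable_continuous_on[of cnj]) (auto intro: continuous_intros)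

text \<open>With Gaussian damping, the multiplication formula turns the left side into a double
  integral of g(x) and the conjugate of g(y) against the heat kernel. Bounding the product of the
  moduli by half the sum of their squares and using that the kernel has integral 1 gives the claim
  with damping; Fatou's lemma removes it. The right side may be infinite.\<close>

lemma bessel_inequality:
  fixes g :: "'a::euclidean_space \<Rightarrow> complex"
  assumes g: "integrable lborel g"
  shows "(\<integral>\<^sup>+ \<xi>. ennreal ((norm (fourier g \<xi>))\<^sup>2) \<partial>lborel) \<le> (\<integral>\<^sup>+ x. ennreal ((norm (g x))\<^sup>2) \<partial>lborel)"
proof -
  have [measurable]: "g \<in> borel_measurable borel" using g by auto
  let ?G = "\<integral>\<^sup>+ x. ennreal ((norm (g x))\<^sup>2) \<partial>lborel"
  have nsq: "fourier g \<xi> * cnj (fourier g \<xi>) = (complex_of_real (norm (fourier g \<xi>)))\<^sup>2" for \<xi>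
    by (metis complex_norm_square of_real_power)
  have main: "(\<integral>\<^sup>+ \<xi>. ennreal ((norm (fourier g \<xi>))\<^sup>2 * gauss (e\<^sup>2) \<xi>) \<partial>lborel) \<le> ?G" if e: "0 < e" for e
  proof -
    let ?h = "\<lambda>\<xi>. cnj (fourier g \<xi>) * of_real (gauss (e\<^sup>2) \<xi>)"
    let ?k = "\<lambda>\<xi>. fourier g \<xi> * complex_of_real (gauss (e\<^sup>2) \<xi>)"
    have k: "integrable lborel ?k" using integrable_fourier_gauss[OF g] e by simp
    have hk: "?h = (\<lambda>\<xi>. cnj (?k \<xi>))" by simp
    have h: "integrable lborel ?h" unfolding hk complex_integrable_cnj by (rule k)
    \<comment> \<open>\<open>?h\<close> is the conjugate of the damped transform, so its transform
      at x is the conjugate of the damped inversion integral, a convolution of g with the heat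
      kernel.\<close>
    have fh: "fourier ?h x = cnj (LINT y|lborel. g y * of_real (heat e (x - y)))" for x
    proof -
      have "fourier ?h x = (LINT \<xi>|lborel. ?h \<xi> * cis (- 2 * pi * (\<xi> \<bullet> x)))"
        by (rule fourier_lborel) measurable
      also have "\<dots> = (LINT \<xi>|lborel. cnj (?k \<xi> * cis (- 2 * pi * (\<xi> \<bullet> - x))))"
        by (simp add: cis_cnj)
      also have "\<dots> = cnj (LINT \<xi>|lborel. ?k \<xi> * cis (- 2 * pi * (\<xi> \<bullet> - x)))"
        by (rule Bochner_Integration.integral_cnj)
      also have "(LINT \<xi>|lborel. ?k \<xi> * cis (- 2 * pi * (\<xi> \<bullet> - x))) = fourier ?k (- x)"
        by (rule fourier_lborel[symmetric]) measurable
      finally show ?thesis using fourier_inversion_gauss[OF g e, of x] by simp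
    qed
    have int: "integrable lborel (\<lambda>\<xi>. (norm (fourier g \<xi>))\<^sup>2 * gauss (e\<^sup>2) \<xi>)"
    proof -
      have "integrable lborel (\<lambda>\<xi>. fourier g \<xi> * ?h \<xi>)"
      proof (rule Bochner_Integration.integrable_bound[OF integrable_mult_right[OF h, of "of_real (LINT x|lborel. norm (g x))"]])
        show "AE \<xi> in lborel. norm (fourier g \<xi> * ?h \<xi>) \<le> norm (complex_of_real (LINT x|lborel. norm (g x)) * ?h \<xi>)"
          using norm_fourier_le[OF g] by (intro AE_I2) (auto simp: norm_mult intro!: mult_right_mono order_trans[OF _ abs_ge_self])
      qed measurable
      moreover have "fourier g \<xi> * ?h \<xi> = of_real ((norm (fourier g \<xi>))\<^sup>2 * gauss (e\<^sup>2) \<xi>)" for \<xi>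
        by (simp add: mult.assoc[symmetric] nsq)
      ultimately show ?thesis
        by (simp add: complex_of_real_integrable_eq del: of_real_mult of_real_power)
    qed
    have "(\<integral>\<^sup>+ \<xi>. ennreal ((norm (fourier g \<xi>))\<^sup>2 * gauss (e\<^sup>2) \<xi>) \<partial>lborel) =
        ennreal (LINT \<xi>|lborel. (norm (fourier g \<xi>))\<^sup>2 * gauss (e\<^sup>2) \<xi>)"
      by (rule nn_integral_eq_integral[OF int]) auto
    also have "(LINT \<xi>|lborel. (norm (fourier g \<xi>))\<^sup>2 * gauss (e\<^sup>2) \<xi>) =
       norm (LINT \<xi>|lborel. complex_of_real ((norm (fourier g \<xi>))\<^sup>2 * gauss (e\<^sup>2) \<xi>))"
      by (subst Bochner_Integration.integral_of_real[OF int]) (auto intro!: abs_of_nonneg[symmetric] integral_nonneg_AE)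
    also have "(\<lambda>\<xi>. complex_of_real ((norm (fourier g \<xi>))\<^sup>2 * gauss (e\<^sup>2) \<xi>)) = (\<lambda>\<xi>. fourier g \<xi> * ?h \<xi>)"
      by (simp add: mult.assoc[symmetric] nsq)
    also have "(LINT \<xi>|lborel. fourier g \<xi> * ?h \<xi>) = (LINT x|lborel. g x * fourier ?h x)"
      by (rule fourier_multiplication[OF g h])
    also have "ennreal (norm (LINT x|lborel. g x * fourier ?h x)) \<le> (\<integral>\<^sup>+ x. ennreal (norm (g x * fourier ?h x)) \<partial>lborel)"
      by (cases "integrable lborel (\<lambda>x. g x * fourier ?h x)")
         (auto intro!: integral_norm_bound_ennreal simp: not_integrable_integral_eq)
    also have "\<dots> \<le> (\<integral>\<^sup>+ x. (\<integral>\<^sup>+ y. (ennreal ((norm (g x))\<^sup>2 / 2) * ennreal (heat e (x - y)) + ennreal ((norm (g y))\<^sup>2 / 2) * ennreal (heat e (x - y))) \<partial>lborel) \<partial>lborel)"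
    proof (rule nn_integral_mono)
      fix x :: 'a
      have "ennreal (norm (g x * fourier ?h x)) = ennreal (norm (g x)) * ennreal (norm (LINT y|lborel. g y * of_real (heat e (x - y))))"
        by (simp add: norm_mult fh ennreal_mult)
      also have "\<dots> \<le> ennreal (norm (g x)) * (\<integral>\<^sup>+ y. ennreal (norm (g y * of_real (heat e (x - y)))) \<partial>lborel)"
        by (intro mult_left_mono, cases "integrable lborel (\<lambda>y. g y * complex_of_real (heat e (x - y)))")
           (auto intro!: integral_norm_bound_ennreal simp: not_integrable_integral_eq)
      also have "\<dots> = (\<integral>\<^sup>+ y. ennreal (norm (g x)) * ennreal (norm (g y * of_real (heat e (x - y)))) \<partial>lborel)"
        by (subst nn_integral_cmult) auto
      also have "\<dots> \<le> (\<integral>\<^sup>+ y. (ennreal ((norm (g x))\<^sup>2 / 2) * ennreal (heat e (x - y)) + ennreal ((norm (g y))\<^sup>2 / 2) * ennreal (heat e (x - y))) \<partial>lborel)"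
      proof (rule nn_integral_mono)
        fix y :: 'a
        have "norm (g x) * norm (g y) \<le> (norm (g x))\<^sup>2 / 2 + (norm (g y))\<^sup>2 / 2"
          using sum_squares_bound[of "norm (g x)" "norm (g y)"] by simp
        then have "norm (g x) * norm (g y) * heat e (x - y) \<le> ((norm (g x))\<^sup>2 / 2 + (norm (g y))\<^sup>2 / 2) * heat e (x - y)"
          using e by (intro mult_right_mono heat_nonneg)
        then show "ennreal (norm (g x)) * ennreal (norm (g y * of_real (heat e (x - y)))) \<le>
            ennreal ((norm (g x))\<^sup>2 / 2) * ennreal (heat e (x - y)) + ennreal ((norm (g y))\<^sup>2 / 2) * ennreal (heat e (x - y))"
          using heat_nonneg[OF e, of "x - y"]
          by (simp flip: ennreal_mult ennreal_plus add: norm_mult ennreal_leI distrib_right mult.assoc)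
      qed
      finally show "ennreal (norm (g x * fourier ?h x)) \<le> (\<integral>\<^sup>+ y. (ennreal ((norm (g x))\<^sup>2 / 2) * ennreal (heat e (x - y)) + ennreal ((norm (g y))\<^sup>2 / 2) * ennreal (heat e (x - y))) \<partial>lborel)" .
    qed
    also have "\<dots> = (\<integral>\<^sup>+ x. (ennreal ((norm (g x))\<^sup>2 / 2) + (\<integral>\<^sup>+ y. ennreal ((norm (g y))\<^sup>2 / 2) * ennreal (heat e (x - y)) \<partial>lborel)) \<partial>lborel)"
      using e by (intro nn_integral_cong) (subst nn_integral_add, auto simp: nn_integral_cmult nn_integral_heat_shift)
    also have "\<dots> = (\<integral>\<^sup>+ x. ennreal ((norm (g x))\<^sup>2 / 2) \<partial>lborel) +
        (\<integral>\<^sup>+ x. \<integral>\<^sup>+ y. ennreal ((norm (g y))\<^sup>2 / 2) * ennreal (heat e (x - y)) \<partial>lborel \<partial>lborel)"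
      by (subst nn_integral_add) auto
    also have "(\<integral>\<^sup>+ x. \<integral>\<^sup>+ y. ennreal ((norm (g y))\<^sup>2 / 2) * ennreal (heat e (x - y)) \<partial>lborel \<partial>lborel) =
        (\<integral>\<^sup>+ y. \<integral>\<^sup>+ x. ennreal ((norm (g y))\<^sup>2 / 2) * ennreal (heat e (x - y)) \<partial>lborel \<partial>lborel)"
      by (rule lborel_pair.Fubini'[symmetric]) measurable
    also have "\<dots> = (\<integral>\<^sup>+ y. ennreal ((norm (g y))\<^sup>2 / 2) \<partial>lborel)"
      using e by (intro nn_integral_cong) (auto simp: nn_integral_cmult nn_integral_heat_shift)
    also have "(\<integral>\<^sup>+ x. ennreal ((norm (g x))\<^sup>2 / 2) \<partial>lborel) + (\<integral>\<^sup>+ y. ennreal ((norm (g y))\<^sup>2 / 2) \<partial>lborel) =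
      (\<integral>\<^sup>+ x. (ennreal ((norm (g x))\<^sup>2 / 2) + ennreal ((norm (g x))\<^sup>2 / 2)) \<partial>lborel)"
      by (subst nn_integral_add) auto
    also have "\<dots> = ?G" by (simp flip: ennreal_plus)
    finally show ?thesis .
  qed
  have lim: "(\<lambda>n. ennreal ((norm (fourier g \<xi>))\<^sup>2 * gauss ((1 / real (Suc n))\<^sup>2) \<xi>)) \<longlonglongrightarrow> ennreal ((norm (fourier g \<xi>))\<^sup>2)" for \<xi>
  proof -
    have "(\<lambda>n. gauss ((1 / real (Suc n))\<^sup>2) \<xi>) \<longlonglongrightarrow> exp (- pi * 0\<^sup>2 * (norm \<xi>)\<^sup>2)"
      unfolding gauss_def using LIMSEQ_Suc[OF lim_1_over_n] by (intro tendsto_intros)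
    then have "(\<lambda>n. (norm (fourier g \<xi>))\<^sup>2 * gauss ((1 / real (Suc n))\<^sup>2) \<xi>) \<longlonglongrightarrow> (norm (fourier g \<xi>))\<^sup>2 * 1"
      by (intro tendsto_mult tendsto_const) simp
    then show ?thesis by (intro tendsto_ennrealI) simp
  qed
  have "(\<integral>\<^sup>+ \<xi>. ennreal ((norm (fourier g \<xi>))\<^sup>2) \<partial>lborel) =
     (\<integral>\<^sup>+ \<xi>. liminf (\<lambda>n. ennreal ((norm (fourier g \<xi>))\<^sup>2 * gauss ((1 / real (Suc n))\<^sup>2) \<xi>)) \<partial>lborel)"
    using lim_imp_Liminf[OF _ lim] by (intro nn_integral_cong) (metis trivial_limit_sequentially)
  also have "\<dots> \<le> liminf (\<lambda>n. \<integral>\<^sup>+ \<xi>. ennreal ((norm (fourier g \<xi>))\<^sup>2 * gauss ((1 / real (Suc n))\<^sup>2) \<xi>) \<partial>lborel)"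
    by (intro nn_integral_liminf) auto
  also have "\<dots> \<le> liminf (\<lambda>n::nat. ?G)"
    by (intro Liminf_mono always_eventually allI main) auto
  also have "\<dots> = ?G" by (simp add: Liminf_const)
  finally show ?thesis .
qed

section \<open>Level sets of the transform\<close>

lemma nn_integral_powr_Ioc:
  assumes "-1 < a" "0 \<le> c"
  shows "(\<integral>\<^sup>+ l. ennreal (l powr a) * indicator {0..c} l \<partial>lborel) = ennreal (c powr (a + 1) / (a + 1))"
proof -
  have "((\<lambda>l. if l \<in> {0..c} then l powr a else 0) has_integral c powr (a + 1) / (a + 1)) UNIV"
    using has_integral_powr_from_0[OF assms] by (subst has_integral_restrict_UNIV)
  then have "(\<integral>\<^sup>+ l. ennreal (if l \<in> {0..c} then l powr a else 0) \<partial>lborel) = ennreal (c powr (a + 1) / (a + 1))"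
    by (intro nn_integral_has_integral_lborel) auto
  moreover have "ennreal (if l \<in> {0..c} then l powr a else 0) = ennreal (l powr a) * indicator {0..c} l" for l
    by (auto simp: indicator_def)
  ultimately show ?thesis by simp
qed

text \<open>Distributional estimate of the Marcinkiewicz argument: the part of g above height t has a
  transform bounded by l / 2, the part below it is controlled by the Bessel inequality.\<close>

lemma fourier_distribution_le:
  fixes g :: "'a::euclidean_space \<Rightarrow> complex"
  assumes g: "integrable lborel g" and q: "1 \<le> q" and t: "0 < t" and l: "0 < l"
    and m: "(\<integral>\<^sup>+ x. ennreal (norm (g x) powr q) \<partial>lborel) = ennreal m" "0 \<le> m" "t powr (1 - q) * m \<le> l / 2"
  shows "emeasure lborel {x. l \<le> norm (fourier g x)}
    \<le> ennreal (4 / l\<^sup>2) * (\<integral>\<^sup>+ x. ennreal ((norm (g x))\<^sup>2) * indicator {x. norm (g x) \<le> t} x \<partial>lborel)"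
proof -
  have [measurable]: "g \<in> borel_measurable borel" using g by auto
  define S where "S = {x. norm (g x) \<le> t}"
  have [measurable]: "S \<in> sets borel" unfolding S_def by measurable
  define g1 where "g1 x = indicator S x *\<^sub>R g x" for x
  define g2 where "g2 x = indicator (- S) x *\<^sub>R g x" for x
  have g1: "integrable lborel g1" unfolding g1_def using g by (intro integrable_mult_indicator) auto
  have g2: "integrable lborel g2" unfolding g2_def using g by (intro integrable_mult_indicator) auto
  have "fourier g x = fourier g1 x + fourier g2 x" for x
  proof -
    have "g = (\<lambda>x. g1 x + g2 x)" by (auto simp: g1_def g2_def indicator_def fun_eq_iff)
    then show ?thesis using fourier_add[OF g1 g2] by simp
  qed
  note fg = this
  have f2: "norm (fourier g2 x) \<le> l / 2" for x
  proof -
    have "ennreal (LINT x|lborel. norm (g2 x)) = (\<integral>\<^sup>+ x. ennreal (norm (g2 x)) \<partial>lborel)"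
      using g2 by (subst nn_integral_eq_integral) auto
    also have "\<dots> \<le> (\<integral>\<^sup>+ x. ennreal (t powr (1 - q)) * ennreal (norm (g x) powr q) \<partial>lborel)"
    proof (rule nn_integral_mono)
      fix x
      \<comment> \<open>Since 1 - q \<le> 0, the power 1 - q of a value above t is at most
        \<open>t powr (1 - q)\<close>. This bounds the L^1 norm of the high part by
        \<open>t powr (1 - q) * m\<close>.\<close>
      have "norm (g x) \<le> t powr (1 - q) * norm (g x) powr q" if "t < norm (g x)"
      proof -
        have pos: "0 < norm (g x)" using that t by linarith
        have "norm (g x) = norm (g x) powr (1 - q) * norm (g x) powr q"
          using pos by (simp flip: powr_add)
        also have "\<dots> \<le> t powr (1 - q) * norm (g x) powr q"
          using that t q by (intro mult_right_mono powr_mono2') auto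
        finally show ?thesis .
      qed
      then show "ennreal (norm (g2 x)) \<le> ennreal (t powr (1 - q)) * ennreal (norm (g x) powr q)"
        by (auto simp: g2_def S_def indicator_def simp flip: ennreal_mult intro!: ennreal_leI)
    qed
    also have "\<dots> = ennreal (t powr (1 - q) * m)"
      using m by (subst nn_integral_cmult) (auto simp: ennreal_mult)
    finally have "(LINT x|lborel. norm (g2 x)) \<le> t powr (1 - q) * m"
      using m by (subst (asm) ennreal_le_iff) auto
    then show ?thesis using norm_fourier_le[OF g2, of x] m by linarith
  qed
  have big: "l / 2 \<le> norm (fourier g1 x)" if "l \<le> norm (fourier g x)" for x
    using that norm_triangle_ineq[of "fourier g1 x" "fourier g2 x"] f2[of x] unfolding fg[of x] by linarith
  have "emeasure lborel {x. l \<le> norm (fourier g x)} = (\<integral>\<^sup>+ x. indicator {x. l \<le> norm (fourier g x)} x \<partial>lborel)"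
    by (subst nn_integral_indicator) auto
  also have "\<dots> \<le> (\<integral>\<^sup>+ x. ennreal (4 / l\<^sup>2) * ennreal ((norm (fourier g1 x))\<^sup>2) \<partial>lborel)"
  proof (rule nn_integral_mono)
    fix x
    have "1 \<le> 4 / l\<^sup>2 * (norm (fourier g1 x))\<^sup>2" if "l \<le> norm (fourier g x)"
    proof -
      have "(l / 2)\<^sup>2 \<le> (norm (fourier g1 x))\<^sup>2" using big[OF that] l by (intro power_mono) auto
      then show ?thesis using l by (simp add: field_simps power_divide)
    qed
    then show "indicator {x. l \<le> norm (fourier g x)} x \<le> ennreal (4 / l\<^sup>2) * ennreal ((norm (fourier g1 x))\<^sup>2)"
      by (auto simp: indicator_def simp flip: ennreal_mult ennreal_1 intro!: ennreal_leI)
  qed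
  also have "\<dots> = ennreal (4 / l\<^sup>2) * (\<integral>\<^sup>+ x. ennreal ((norm (fourier g1 x))\<^sup>2) \<partial>lborel)"
  proof -
    have [measurable]: "g1 \<in> borel_measurable borel" using g1 by auto
    show ?thesis by (subst nn_integral_cmult) auto
  qed
  also have "\<dots> \<le> ennreal (4 / l\<^sup>2) * (\<integral>\<^sup>+ x. ennreal ((norm (g1 x))\<^sup>2) \<partial>lborel)"
    by (intro mult_left_mono bessel_inequality g1) auto
  also have "(\<lambda>x. ennreal ((norm (g1 x))\<^sup>2)) = (\<lambda>x. ennreal ((norm (g x))\<^sup>2) * indicator {x. norm (g x) \<le> t} x)"
    by (auto simp: g1_def S_def indicator_def fun_eq_iff)
  finally show ?thesis .
qed

section \<open>The Hausdorff--Young inequality\<close>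

text \<open>The layer-cake formula in the level l, with the distributional estimate at every level.
  Exchanging the integrals once more leaves, for fixed x, the integral of l^(r-3) over 0 < l \<le>
  c, which converges because r > 2.\<close>

lemma nn_integral_fourier_powr_le:
  fixes g :: "'a::euclidean_space \<Rightarrow> complex"
  assumes g: "integrable lborel g" and r: "2 < r"
    and m: "(\<integral>\<^sup>+ x. ennreal (norm (g x) powr (r / (r - 1))) \<partial>lborel) = ennreal m" "0 < m"
  shows "(\<integral>\<^sup>+ x. ennreal (norm (fourier g x) powr r) \<partial>lborel)
    \<le> ennreal (4 * r * 2 powr (r - 2) / (r - 2) * m powr (r - 1))"
proof -
  have [measurable]: "g \<in> borel_measurable borel" using g by auto
  define u where "u x = norm (fourier g x)" for x
  define v where "v x = norm (g x)" for x
  have u0: "0 \<le> u x" and v0: "0 \<le> v x" for x by (simp_all add: u_def v_def)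
  have [measurable]: "u \<in> borel_measurable borel" "v \<in> borel_measurable borel"
    unfolding u_def[abs_def] v_def[abs_def] by measurable
  define t where "t l = (l / (2 * m)) powr (- (r - 1))" for l
  have [measurable]: "t \<in> borel_measurable borel" unfolding t_def[abs_def] by measurable
  have q: "1 \<le> r / (r - 1)" using r by simp
  define H where "H = 4 * r * (2 * m) powr (r - 2) / (r - 2)"
  have H: "0 \<le> H" using r m by (simp add: H_def)
  have "(\<integral>\<^sup>+ x. ennreal (u x powr r) \<partial>lborel) =
      (\<integral>\<^sup>+ x. (\<integral>\<^sup>+ l. (if 0 \<le> l \<and> l \<le> u x then ennreal (r * l powr (r - 1)) else 0) \<partial>lborel) \<partial>lborel)"
  proof (rule nn_integral_cong)
    fix x
    have "(\<integral>\<^sup>+ l. (if 0 \<le> l \<and> l \<le> u x then ennreal (r * l powr (r - 1)) else 0) \<partial>lborel) =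
        (\<integral>\<^sup>+ l. ennreal r * (ennreal (l powr (r - 1)) * indicator {0..u x} l) \<partial>lborel)"
      using r by (intro nn_integral_cong) (auto simp: indicator_def ennreal_mult)
    also have "\<dots> = ennreal r * ennreal (u x powr (r - 1 + 1) / (r - 1 + 1))"
      using r u0 by (subst nn_integral_cmult) (auto simp: nn_integral_powr_Ioc)
    also have "\<dots> = ennreal (u x powr r)" using r by (simp flip: ennreal_mult)
    finally show "ennreal (u x powr r) = (\<integral>\<^sup>+ l. (if 0 \<le> l \<and> l \<le> u x then ennreal (r * l powr (r - 1)) else 0) \<partial>lborel)" ..
  qed
  also have "\<dots> = (\<integral>\<^sup>+ l. (\<integral>\<^sup>+ x. (if 0 \<le> l \<and> l \<le> u x then ennreal (r * l powr (r - 1)) else 0) \<partial>lborel) \<partial>lborel)"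
    by (rule lborel_pair.Fubini'[symmetric]) measurable
  also have "\<dots> \<le> (\<integral>\<^sup>+ l. (\<integral>\<^sup>+ x. (if 0 < l \<and> v x \<le> t l then ennreal (4 * r * l powr (r - 3) * (v x)\<^sup>2) else 0) \<partial>lborel) \<partial>lborel)"
  proof (rule nn_integral_mono)
    fix l :: real
    show "(\<integral>\<^sup>+ x. (if 0 \<le> l \<and> l \<le> u x then ennreal (r * l powr (r - 1)) else 0) \<partial>lborel) \<le>
       (\<integral>\<^sup>+ x. (if 0 < l \<and> v x \<le> t l then ennreal (4 * r * l powr (r - 3) * (v x)\<^sup>2) else 0) \<partial>lborel)"
    proof (cases "0 < l")
      case l: True
      have "(\<integral>\<^sup>+ x. (if 0 \<le> l \<and> l \<le> u x then ennreal (r * l powr (r - 1)) else 0) \<partial>lborel) =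
        (\<integral>\<^sup>+ x. ennreal (r * l powr (r - 1)) * indicator {x. l \<le> u x} x \<partial>lborel)"
        using l by (intro nn_integral_cong) (auto simp: indicator_def)
      also have "\<dots> = ennreal (r * l powr (r - 1)) * emeasure lborel {x. l \<le> u x}"
        by (subst nn_integral_cmult_indicator) auto
      also have "\<dots> \<le> ennreal (r * l powr (r - 1)) *
          (ennreal (4 / l\<^sup>2) * (\<integral>\<^sup>+ x. ennreal ((v x)\<^sup>2) * indicator {x. v x \<le> t l} x \<partial>lborel))"
        unfolding u_def v_def
      proof (intro mult_left_mono fourier_distribution_le[OF g q _ l m(1)])
        show "0 < t l" using l m by (simp add: t_def)
        have "(1 - r / (r - 1)) * - (r - 1) = 1" using r by (simp add: field_simps)
        then have "t l powr (1 - r / (r - 1)) = l / (2 * m)"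
          using l m unfolding t_def powr_powr by (simp add: mult.commute)
        then show "t l powr (1 - r / (r - 1)) * m \<le> l / 2" using m by simp
      qed (use m in auto)
      also have "\<dots> = (\<integral>\<^sup>+ x. ennreal (r * l powr (r - 1)) * (ennreal (4 / l\<^sup>2) * (ennreal ((v x)\<^sup>2) * indicator {x. v x \<le> t l} x)) \<partial>lborel)"
        by (simp add: nn_integral_cmult)
      also have "\<dots> = (\<integral>\<^sup>+ x. (if 0 < l \<and> v x \<le> t l then ennreal (4 * r * l powr (r - 3) * (v x)\<^sup>2) else 0) \<partial>lborel)"
      proof (rule nn_integral_cong)
        fix x
        have "l powr (r - 1) / l\<^sup>2 = l powr (r - 1) / l powr 2" using l by (simp add: powr_realpow)
        also have "\<dots> = l powr (r - 3)" by (simp flip: powr_diff)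
        finally have eq: "l powr (r - 1) / l\<^sup>2 = l powr (r - 3)" .
        have "r * l powr (r - 1) * (4 / l\<^sup>2 * (v x)\<^sup>2) = 4 * r * (l powr (r - 1) / l\<^sup>2) * (v x)\<^sup>2"
          by simp
        then have "r * l powr (r - 1) * (4 / l\<^sup>2 * (v x)\<^sup>2) = 4 * r * l powr (r - 3) * (v x)\<^sup>2"
          unfolding eq .
        then show "ennreal (r * l powr (r - 1)) * (ennreal (4 / l\<^sup>2) * (ennreal ((v x)\<^sup>2) * indicator {x. v x \<le> t l} x)) =
          (if 0 < l \<and> v x \<le> t l then ennreal (4 * r * l powr (r - 3) * (v x)\<^sup>2) else 0)"
          using l r by (simp add: indicator_def flip: ennreal_mult)
      qed
      finally show ?thesis .
    next
      \<comment> \<open>At l = 0 the integrand is 0 because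
        \<open>0 powr (r - 1) = 0\<close>.\<close>
      case False
      then have "(\<integral>\<^sup>+ x. (if 0 \<le> l \<and> l \<le> u x then ennreal (r * l powr (r - 1)) else 0) \<partial>lborel) = (\<integral>\<^sup>+ x. 0 \<partial>(lborel :: 'a measure))"
        by (intro nn_integral_cong) auto
      then show ?thesis by simp
    qed
  qed
  also have "\<dots> = (\<integral>\<^sup>+ x. (\<integral>\<^sup>+ l. (if 0 < l \<and> v x \<le> t l then ennreal (4 * r * l powr (r - 3) * (v x)\<^sup>2) else 0) \<partial>lborel) \<partial>lborel)"
    by (rule lborel_pair.Fubini') measurable
  also have "\<dots> \<le> (\<integral>\<^sup>+ x. ennreal H * ennreal (v x powr (r / (r - 1))) \<partial>lborel)"
  proof (rule nn_integral_mono)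
    fix x
    show "(\<integral>\<^sup>+ l. (if 0 < l \<and> v x \<le> t l then ennreal (4 * r * l powr (r - 3) * (v x)\<^sup>2) else 0) \<partial>lborel) \<le> ennreal H * ennreal (v x powr (r / (r - 1)))"
    proof (cases "v x = 0")
      case False
      then have v: "0 < v x" using v0[of x] by simp
      \<comment> \<open>Solving \<open>v x \<le> t l\<close> for l gives l \<le> c, so the integral
        over l ends at c.\<close>
      define c where "c = 2 * m * v x powr (- (1 / (r - 1)))"
      have c: "0 < c" using m v by (simp add: c_def)
      have lc: "l \<le> c" if "0 < l" "v x \<le> t l" for l
      proof -
        have "t l powr (- (1 / (r - 1))) \<le> v x powr (- (1 / (r - 1)))"
          using that v r by (intro powr_mono2') auto
        moreover have "- (r - 1) * - (1 / (r - 1)) = 1" using r by (simp only: minus_mult_minus) simp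
        then have "t l powr (- (1 / (r - 1))) = l / (2 * m)"
          using that m unfolding t_def powr_powr by simp
        ultimately show ?thesis using m by (simp add: c_def field_simps)
      qed
      have "(\<integral>\<^sup>+ l. (if 0 < l \<and> v x \<le> t l then ennreal (4 * r * l powr (r - 3) * (v x)\<^sup>2) else 0) \<partial>lborel) \<le>
        (\<integral>\<^sup>+ l. ennreal (4 * r * (v x)\<^sup>2) * (ennreal (l powr (r - 3)) * indicator {0..c} l) \<partial>lborel)"
        using lc r by (intro nn_integral_mono) (auto simp: indicator_def mult_ac simp flip: ennreal_mult)
      also have "\<dots> = ennreal (4 * r * (v x)\<^sup>2) * ennreal (c powr (r - 2) / (r - 2))"
        using r c by (subst nn_integral_cmult) (auto simp: nn_integral_powr_Ioc)
      also have "\<dots> = ennreal (4 * r * (v x)\<^sup>2 * (c powr (r - 2) / (r - 2)))"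
        using r by (simp flip: ennreal_mult)
      also have "4 * r * (v x)\<^sup>2 * (c powr (r - 2) / (r - 2)) = H * (v x powr 2 * v x powr (- (1 / (r - 1)) * (r - 2)))"
        using m v by (simp add: H_def c_def powr_mult powr_powr powr_realpow)
      also have "v x powr 2 * v x powr (- (1 / (r - 1)) * (r - 2)) = v x powr (r / (r - 1))"
      proof -
        have "2 + - (1 / (r - 1)) * (r - 2) = r / (r - 1)" using r by (simp add: field_simps)
        then show ?thesis by (simp only: powr_add[symmetric])
      qed
      finally show ?thesis using H by (simp add: ennreal_mult)
    qed (simp cong: if_cong)
  qed
  also have "\<dots> = ennreal H * ennreal m"
    using m unfolding v_def by (subst nn_integral_cmult) auto
  also have "\<dots> = ennreal (H * m)" using H m by (simp add: ennreal_mult)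
  also have "H * m = 4 * r * 2 powr (r - 2) / (r - 2) * m powr (r - 1)"
  proof -
    have "m powr (r - 2) * m = m powr (r - 1)"
      using m powr_add[of m "r - 2" 1] by simp
    then show ?thesis using m by (simp add: H_def powr_mult field_simps)
  qed
  finally show ?thesis by (simp add: u_def)
qed

lemma lnorm_one: "lnorm 1 u = (\<integral>\<^sup>+ x. ennreal \<bar>u x\<bar> \<partial>lborel)"
proof -
  have "ennreal_powr I 1 = I" for I by (cases I) auto
  then show ?thesis by (simp add: lnorm_def)
qed

text \<open>Only the existence of a constant matters, so interpolation in the style of Marcinkiewicz
  replaces the Riesz--Thorin theorem.\<close>

lemma hausdorff_young_fourier:
  assumes s: "0 \<le> s" "s \<le> 1 / 2"
  obtains C where "0 < C" "\<And>g::'a::euclidean_space \<Rightarrow> complex. integrable lborel g \<Longrightarrow>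
    lnorm s (\<lambda>x. norm (fourier g x)) \<le> ennreal C * lnorm (1 - s) (\<lambda>x. norm (g x))"
proof -
  consider "s = 0" | "0 < s" "s < 1 / 2" | "s = 1 / 2" using s by linarith
  then show ?thesis
  proof cases
    case 1
    show ?thesis
    proof (rule that[of 1])
      fix g :: "'a \<Rightarrow> complex" assume g: "integrable lborel g"
      then have [measurable]: "g \<in> borel_measurable borel" by auto
      have "lnorm (1 - s) (\<lambda>x. norm (g x)) = ennreal (LINT x|lborel. norm (g x))"
        using g 1 by (simp add: lnorm_one nn_integral_eq_integral)
      moreover have "lnorm s (\<lambda>x. norm (fourier g x)) \<le> ennreal (LINT x|lborel. norm (g x))"
        using norm_fourier_le[OF g] 1 by (simp add: lnorm_0_le_iff)
      ultimately show "lnorm s (\<lambda>x. norm (fourier g x)) \<le> ennreal 1 * lnorm (1 - s) (\<lambda>x. norm (g x))" by simp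
    qed simp
  next
    case 3
    show ?thesis
    proof (rule that[of 1])
      fix g :: "'a \<Rightarrow> complex" assume g: "integrable lborel g"
      have "ennreal_powr (\<integral>\<^sup>+ x. ennreal ((norm (fourier g x))\<^sup>2) \<partial>lborel) (1 / 2) \<le> ennreal_powr (\<integral>\<^sup>+ x. ennreal ((norm (g x))\<^sup>2) \<partial>lborel) (1 / 2)"
        by (intro ennreal_powr_mono bessel_inequality g) auto
      then show "lnorm s (\<lambda>x. norm (fourier g x)) \<le> ennreal 1 * lnorm (1 - s) (\<lambda>x. norm (g x))"
        unfolding \<open>s = 1 / 2\<close> lnorm_def by simp
    qed simp
  next
    case 2
    define r where "r = 1 / s"
    have r: "2 < r" using 2 by (simp add: r_def field_simps)
    have q: "1 / (1 - s) = r / (r - 1)" using 2 by (simp add: r_def field_simps)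
    define H where "H = 4 * r * 2 powr (r - 2) / (r - 2)"
    have H: "0 < H" using r by (simp add: H_def)
    show ?thesis
    proof (rule that[of "H powr s"])
      show "0 < H powr s" using H by simp
      fix g :: "'a \<Rightarrow> complex" assume g: "integrable lborel g"
      then have [measurable]: "g \<in> borel_measurable borel" by auto
      define I where "I = (\<integral>\<^sup>+ x. ennreal (norm (g x) powr (r / (r - 1))) \<partial>lborel)"
      have ln: "lnorm (1 - s) (\<lambda>x. norm (g x)) = ennreal_powr I (1 - s)"
        using 2 by (simp add: lnorm_def I_def q)
      consider "I = \<top>" | "I = 0" | m where "I = ennreal m" "0 < m"
        by (cases I) (auto simp: le_less)
      then show "lnorm s (\<lambda>x. norm (fourier g x)) \<le> ennreal (H powr s) * lnorm (1 - s) (\<lambda>x. norm (g x))"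
      proof cases
        case 1
        then show ?thesis using ln H by (simp add: ennreal_mult_top)
      next
        \<comment> \<open>The level function of \<open>nn_integral_fourier_powr_le\<close> divides
          by m, so the case of vanishing g is treated apart; the transform is then identically
          0.\<close>
        case 2
        then have "AE x in lborel. ennreal (norm (g x) powr (r / (r - 1))) = 0"
          unfolding I_def by (subst (asm) nn_integral_0_iff_AE) auto
        then have ae: "AE x in lborel. g x = 0" by (auto elim!: eventually_mono)
        have "fourier g \<xi> = 0" for \<xi>
          using ae by (subst fourier_lborel) (auto intro!: integral_eq_zero_AE elim!: eventually_mono)
        then have "lnorm s (\<lambda>x. norm (fourier g x)) = 0"
          using \<open>0 < s\<close> by (intro lnorm_AE_0) auto
        then show ?thesis by simp
      next
        case (3 m)
        have "lnorm s (\<lambda>x. norm (fourier g x)) = ennreal_powr (\<integral>\<^sup>+ x. ennreal (norm (fourier g x) powr r) \<partial>lborel) s"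
          using \<open>0 < s\<close> by (simp add: lnorm_def r_def)
        also have "\<dots> \<le> ennreal_powr (ennreal (H * m powr (r - 1))) s"
          unfolding H_def using nn_integral_fourier_powr_le[OF g r _ 3(2)] 3(1) s
          by (intro ennreal_powr_mono) (auto simp: I_def)
        also have "\<dots> = ennreal (H powr s * m powr ((r - 1) * s))"
          using H by (simp add: powr_mult powr_powr)
        also have "(r - 1) * s = 1 - s" using \<open>0 < s\<close> by (simp add: r_def field_simps)
        also have "ennreal (H powr s * m powr (1 - s)) = ennreal (H powr s) * lnorm (1 - s) (\<lambda>x. norm (g x))"
          using ln 3 by (simp add: ennreal_mult)
        finally show ?thesis .
      qed
    qed
  qed
qed

section \<open>Recovering a function from its damped transform\<close>

lemma lborel_distr_uminus_euclidean: "distr lborel borel uminus = (lborel :: 'a::euclidean_space measure)"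
proof -
  have "(lborel :: 'a measure) = density (distr lborel borel (\<lambda>x. 0 + (- 1) *\<^sub>R x)) (\<lambda>_. ennreal (\<bar>- 1\<bar> ^ DIM('a)))"
    by (rule lborel_affine) simp
  also have "\<dots> = density (distr lborel borel uminus) (\<lambda>_. 1)" by simp
  also have "\<dots> = distr lborel borel uminus" by (rule density_1)
  finally show ?thesis ..
qed

lemma lnorm_reflect:
  fixes u :: "'a::euclidean_space \<Rightarrow> real"
  assumes [measurable]: "u \<in> borel_measurable borel"
  shows "lnorm s (\<lambda>x. u (- x)) = lnorm s u"
proof (cases "s = 0")
  case True
  have le: "esssup lborel (\<lambda>x. ennreal (u (- x))) \<le> esssup lborel (\<lambda>x. ennreal (u x))"
    if [measurable]: "u \<in> borel_measurable borel" for u :: "'a \<Rightarrow> real"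
  proof (rule esssup_I)
    have "AE x in distr lborel borel uminus. ennreal (u x) \<le> esssup lborel (\<lambda>x. ennreal (u x))"
      unfolding lborel_distr_uminus_euclidean by (rule esssup_AE)
    then show "AE x in lborel. ennreal (u (- x)) \<le> esssup lborel (\<lambda>x. ennreal (u x))"
      by (subst (asm) AE_distr_iff) auto
  qed measurable
  show ?thesis using True le[of u] le[of "\<lambda>x. u (- x)"] by (simp add: lnorm_def antisym)
next
  case False
  then show ?thesis
    using nn_integral_reflect[of "\<lambda>x. ennreal (u x powr (1 / s))"] by (simp add: lnorm_def)
qed

text \<open>The modulus of continuity in L^1, extended-valued so that it can be estimated before
  finiteness is known.\<close>

definition shift_osc :: "('a::euclidean_space \<Rightarrow> complex) \<Rightarrow> 'a \<Rightarrow> ennreal" where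
  "shift_osc f w = (\<integral>\<^sup>+ x. ennreal (norm (f (x + w) - f x)) \<partial>lborel)"

lemma shift_osc_triangle:
  assumes [measurable]: "f \<in> borel_measurable borel" "g \<in> borel_measurable borel"
  shows "shift_osc f w \<le> 2 * (\<integral>\<^sup>+ x. ennreal (norm (f x - g x)) \<partial>lborel) + shift_osc g w"
proof -
  have "shift_osc f w \<le> (\<integral>\<^sup>+ x. (ennreal (norm (f (x + w) - g (x + w))) + ennreal (norm (f x - g x)) + ennreal (norm (g (x + w) - g x))) \<partial>lborel)"
    unfolding shift_osc_def
  proof (rule nn_integral_mono)
    fix x
    have "f (x + w) - f x = (f (x + w) - g (x + w)) - (f x - g x) + (g (x + w) - g x)" by simp
    then have "norm (f (x + w) - f x) \<le> norm (f (x + w) - g (x + w)) + norm (f x - g x) + norm (g (x + w) - g x)"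
      by (metis norm_triangle_le norm_triangle_ineq4 add_right_mono)
    then show "ennreal (norm (f (x + w) - f x)) \<le> ennreal (norm (f (x + w) - g (x + w))) + ennreal (norm (f x - g x)) + ennreal (norm (g (x + w) - g x))"
      by (simp flip: ennreal_plus)
  qed
  also have "\<dots> = (\<integral>\<^sup>+ x. ennreal (norm (f (x + w) - g (x + w))) \<partial>lborel) + (\<integral>\<^sup>+ x. ennreal (norm (f x - g x)) \<partial>lborel) + shift_osc g w"
    unfolding shift_osc_def by (simp add: nn_integral_add)
  also have "(\<integral>\<^sup>+ x. ennreal (norm (f (x + w) - g (x + w))) \<partial>lborel) = (\<integral>\<^sup>+ x. ennreal (norm (f x - g x)) \<partial>lborel)"
    by (rule nn_integral_translate[where f="\<lambda>x. ennreal (norm (f x - g x))"]) measurable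
  finally show ?thesis by (simp add: mult_2)
qed

text \<open>Replacing f by g costs at most twice their L^1 distance, uniformly in the shift, so the
  convergence passes to L^1 limits.\<close>

lemma shift_osc_approx:
  assumes f: "f \<in> borel_measurable borel"
    and approx: "\<And>e::real. 0 < e \<Longrightarrow> \<exists>g \<in> borel_measurable borel.
      (\<integral>\<^sup>+ x. ennreal (norm (f x - g x)) \<partial>lborel) \<le> ennreal e \<and> (\<lambda>n. shift_osc g (w n)) \<longlonglongrightarrow> 0"
  shows "(\<lambda>n. shift_osc f (w n)) \<longlonglongrightarrow> 0"
proof (rule order_tendstoI)
  fix a :: ennreal assume "0 < a"
  then obtain e :: real where e: "0 < e" "ennreal e \<le> a"
    by (cases a) (auto intro: that[of 1])
  then obtain g where g: "g \<in> borel_measurable borel"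
      "(\<integral>\<^sup>+ x. ennreal (norm (f x - g x)) \<partial>lborel) \<le> ennreal (e / 4)" "(\<lambda>n. shift_osc g (w n)) \<longlonglongrightarrow> 0"
    using approx[of "e / 4"] by auto
  have "eventually (\<lambda>n. shift_osc g (w n) < ennreal (e / 4)) sequentially"
    using g(3) e by (intro order_tendstoD(2)) auto
  then show "eventually (\<lambda>n. shift_osc f (w n) < a) sequentially"
  proof eventually_elim
    case (elim n)
    have "shift_osc f (w n) \<le> 2 * ennreal (e / 4) + ennreal (e / 4)"
      using shift_osc_triangle[OF f g(1), of "w n"] g(2) elim
      by (elim order_trans) (intro add_mono mult_left_mono, auto)
    also have "\<dots> = ennreal (3 * e / 4)"
      using e by (simp add: ennreal_mult[symmetric] ennreal_plus[symmetric] flip: ennreal_numeral)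
    also have "\<dots> < ennreal e" using e by (intro ennreal_lessI) auto
    finally show ?case using e by simp
  qed
qed simp

text \<open>Openness gives pointwise convergence: a point of U stays in U under small shifts, so
  dominated convergence applies to the points that leave U. The points that enter U are, after a
  translation, those that leave it under the opposite shift.\<close>

lemma shift_osc_open:
  assumes U: "open U" "emeasure lborel U < \<infinity>" and w: "w \<longlonglongrightarrow> 0"
  shows "(\<lambda>n. shift_osc (\<lambda>x. indicator U x *\<^sub>R c) (w n)) \<longlonglongrightarrow> 0"
proof -
  have [measurable]: "U \<in> sets borel" using U by simp
  define T where "T v = (\<integral>\<^sup>+ x. ennreal (indicator U x * (1 - indicator U (x + v))) \<partial>lborel)" for v
  have T: "(\<lambda>n. T (v n)) \<longlonglongrightarrow> 0" if v: "v \<longlonglongrightarrow> 0" for v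
  proof -
    have "(\<lambda>n. T (v n)) \<longlonglongrightarrow> (\<integral>\<^sup>+ x. 0 \<partial>(lborel :: 'a measure))"
      unfolding T_def
    proof (rule nn_integral_dominated_convergence[where w="indicator U"])
      show "AE x in lborel. (\<lambda>n. ennreal (indicator U x * (1 - indicator U (x + v n)))) \<longlonglongrightarrow> 0"
      proof (rule AE_I2)
        fix x
        show "(\<lambda>n. ennreal (indicator U x * (1 - indicator U (x + v n)))) \<longlonglongrightarrow> 0"
        proof (cases "x \<in> U")
          case True
          have "(\<lambda>n. x + v n) \<longlonglongrightarrow> x + 0" using v by (intro tendsto_intros)
          then have "eventually (\<lambda>n. x + v n \<in> U) sequentially"
            using U True by (intro topological_tendstoD) auto
          then have "eventually (\<lambda>n. ennreal (indicator U x * (1 - indicator U (x + v n))) = 0) sequentially"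
            by eventually_elim simp
          then show ?thesis by (rule tendsto_eventually)
        qed simp
      qed
      show "(\<integral>\<^sup>+ x. indicator U x \<partial>lborel) < \<infinity>" using U(2) by simp
    qed (auto simp: indicator_def)
    then show ?thesis by simp
  qed
  have "shift_osc (\<lambda>x. indicator U x *\<^sub>R c) v = ennreal (norm c) * (T v + T (- v))" for v
  proof -
    have "shift_osc (\<lambda>x. indicator U x *\<^sub>R c) v =
        (\<integral>\<^sup>+ x. ennreal (norm c) * (ennreal (indicator U x * (1 - indicator U (x + v))) + ennreal (indicator U (x + v) * (1 - indicator U x))) \<partial>lborel)"
      unfolding shift_osc_def by (intro nn_integral_cong) (auto simp: indicator_def)
    also have "\<dots> = ennreal (norm c) * (T v + (\<integral>\<^sup>+ x. ennreal (indicator U (x + v) * (1 - indicator U x)) \<partial>lborel))"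
      unfolding T_def by (subst nn_integral_cmult) (auto simp: nn_integral_add)
    also have "(\<integral>\<^sup>+ x. ennreal (indicator U (x + v) * (1 - indicator U x)) \<partial>lborel) = T (- v)"
      unfolding T_def using nn_integral_translate[of "\<lambda>x. ennreal (indicator U x * (1 - indicator U (x + - v)))" v] by simp
    finally show ?thesis .
  qed
  moreover have "(\<lambda>n. ennreal (norm c) * (T (w n) + T (- w n))) \<longlonglongrightarrow> ennreal (norm c) * (0 + 0)"
    using T[OF w] T[of "\<lambda>n. - w n"] tendsto_minus[OF w]
    by (intro ennreal_tendsto_cmult tendsto_add) auto
  ultimately show ?thesis by simp
qed

text \<open>Continuity of translations in L^1, by induction over integrable functions; measurable
  sets are approximated from outside by open ones.\<close>

lemma shift_osc_tendsto_0:
  fixes f :: "'a::euclidean_space \<Rightarrow> complex"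
  assumes f: "integrable lborel f" and w: "w \<longlonglongrightarrow> 0"
  shows "(\<lambda>n. shift_osc f (w n)) \<longlonglongrightarrow> 0"
  using f
proof (induction rule: integrable_induct)
  case (base A c)
  then have [measurable]: "A \<in> sets borel" by simp
  show ?case
  proof (rule shift_osc_approx)
    fix e :: real assume e: "0 < e"
    \<comment> \<open>The 1 in the denominator covers c = 0.\<close>
    define e' where "e' = e / (1 + norm c)"
    have e': "0 < e'" "e' * norm c \<le> e" using e
      by (auto simp: e'_def field_simps add_pos_nonneg intro!: divide_pos_pos)
    obtain U where U: "open U" "A \<subseteq> U" "emeasure lborel (U - A) < ennreal e'"
      using outer_regular_lborel[OF \<open>A \<in> sets borel\<close> e'(1)] by blast
    have [measurable]: "U \<in> sets borel" using U by simp
    have fin: "emeasure lborel U < \<infinity>"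
    proof -
      have "emeasure lborel U \<le> emeasure lborel A + emeasure lborel (U - A)"
        using emeasure_subadditive[of A lborel "U - A"] U by (simp add: Un_absorb1)
      also have "\<dots> < \<infinity>" using base(2) U(3) by (auto simp: less_top intro: order_less_trans)
      finally show ?thesis .
    qed
    show "\<exists>g\<in>borel_measurable borel. (\<integral>\<^sup>+ x. ennreal (norm (indicat_real A x *\<^sub>R c - g x)) \<partial>lborel) \<le> ennreal e \<and> (\<lambda>n. shift_osc g (w n)) \<longlonglongrightarrow> 0"
    proof (intro bexI[of _ "\<lambda>x. indicat_real U x *\<^sub>R c"] conjI)
      have "(\<integral>\<^sup>+ x. ennreal (norm (indicat_real A x *\<^sub>R c - indicat_real U x *\<^sub>R c)) \<partial>lborel) =
          (\<integral>\<^sup>+ x. ennreal (norm c) * indicator (U - A) x \<partial>lborel)"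
        using U(2) by (intro nn_integral_cong) (auto simp: indicator_def)
      also have "\<dots> = ennreal (norm c) * emeasure lborel (U - A)"
        by (subst nn_integral_cmult_indicator) auto
      also have "\<dots> \<le> ennreal (norm c) * ennreal e'"
        using U(3) by (intro mult_left_mono) auto
      also have "\<dots> \<le> ennreal e" using e' by (simp flip: ennreal_mult add: ennreal_leI mult.commute)
      finally show "(\<integral>\<^sup>+ x. ennreal (norm (indicat_real A x *\<^sub>R c - indicat_real U x *\<^sub>R c)) \<partial>lborel) \<le> ennreal e" .
      show "(\<lambda>n. shift_osc (\<lambda>x. indicat_real U x *\<^sub>R c) (w n)) \<longlonglongrightarrow> 0"
        by (rule shift_osc_open[OF U(1) fin w])
    qed measurable
  qed measurable
next
  case (add f g)
  then have [measurable]: "f \<in> borel_measurable borel" "g \<in> borel_measurable borel" by auto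
  have le: "shift_osc (\<lambda>x. f x + g x) v \<le> shift_osc f v + shift_osc g v" for v
  proof -
    have "shift_osc (\<lambda>x. f x + g x) v \<le> (\<integral>\<^sup>+ x. (ennreal (norm (f (x + v) - f x)) + ennreal (norm (g (x + v) - g x))) \<partial>lborel)"
      unfolding shift_osc_def
    proof (rule nn_integral_mono)
      fix x
      have "norm (f (x + v) + g (x + v) - (f x + g x)) \<le> norm (f (x + v) - f x) + norm (g (x + v) - g x)"
        using norm_triangle_ineq[of "f (x + v) - f x" "g (x + v) - g x"] by (simp add: algebra_simps)
      then show "ennreal (norm (f (x + v) + g (x + v) - (f x + g x))) \<le> ennreal (norm (f (x + v) - f x)) + ennreal (norm (g (x + v) - g x))"
        by (simp flip: ennreal_plus)
    qed
    also have "\<dots> = shift_osc f v + shift_osc g v"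
      unfolding shift_osc_def by (rule nn_integral_add) measurable
    finally show ?thesis .
  qed
  have "(\<lambda>n. shift_osc f (w n) + shift_osc g (w n)) \<longlonglongrightarrow> 0 + 0"
    using add by (intro tendsto_add) auto
  then have lim: "(\<lambda>n. shift_osc f (w n) + shift_osc g (w n)) \<longlonglongrightarrow> 0" by simp
  show ?case
    by (rule tendsto_sandwich[OF _ _ tendsto_const lim]) (auto simp: le)
next
  case (lim f s)
  then have [measurable]: "f \<in> borel_measurable borel" "\<And>i. s i \<in> borel_measurable borel" by auto
  show ?case
  proof (rule shift_osc_approx)
    fix e :: real assume e: "0 < e"
    have "(\<lambda>i. \<integral>\<^sup>+ x. ennreal (norm (f x - s i x)) \<partial>lborel) \<longlonglongrightarrow> 0"
    proof (rule nn_integral_dominated_convergence_norm[where w="\<lambda>x. 2 * norm (f x)"])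
      have "integrable lborel (\<lambda>x. 2 * norm (f x))" using lim by auto
      then show "(\<integral>\<^sup>+ x. ennreal (2 * norm (f x)) \<partial>lborel) < \<infinity>"
        by (subst nn_integral_eq_integral) auto
    qed (use lim in auto)
    then have "eventually (\<lambda>i. (\<integral>\<^sup>+ x. ennreal (norm (f x - s i x)) \<partial>lborel) < ennreal e) sequentially"
      using e by (intro order_tendstoD(2)) auto
    then obtain i where "(\<integral>\<^sup>+ x. ennreal (norm (f x - s i x)) \<partial>lborel) < ennreal e"
      by (auto simp: eventually_sequentially)
    then show "\<exists>g\<in>borel_measurable borel. (\<integral>\<^sup>+ x. ennreal (norm (f x - g x)) \<partial>lborel) \<le> ennreal e \<and> (\<lambda>n. shift_osc g (w n)) \<longlonglongrightarrow> 0"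
      using lim by (intro bexI[of _ "s i"]) auto
  qed measurable
qed

lemma lnorm_fatou:
  assumes [measurable]: "\<And>n. u n \<in> borel_measurable borel" "v \<in> borel_measurable borel"
    and u: "\<And>n x. 0 \<le> u n x" and v: "\<And>x. 0 \<le> v x" and s: "0 \<le> s" and c: "0 \<le> c"
    and le: "\<And>n. lnorm s (u n) \<le> ennreal c" and lim: "AE x in lborel. (\<lambda>n. u n x) \<longlonglongrightarrow> v x"
  shows "lnorm s v \<le> ennreal c"
proof (cases "s = 0")
  case True
  have "AE x in lborel. u n x \<le> c" for n
    using le[of n] True u c by (simp add: lnorm_0_le_iff)
  then have "AE x in lborel. \<forall>n. u n x \<le> c" by (simp add: AE_all_countable)
  with lim have "AE x in lborel. v x \<le> c"
    by eventually_elim (auto intro: LIMSEQ_le_const2)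
  then show ?thesis using True v c by (simp add: lnorm_0_le_iff)
next
  case False
  then have s: "0 < s" using s by simp
  have lim': "AE x in lborel. (\<lambda>n. ennreal (u n x powr (1 / s))) \<longlonglongrightarrow> ennreal (v x powr (1 / s))"
    using lim
  proof eventually_elim
    case (elim x)
    then show ?case using s u by (intro tendsto_ennrealI tendsto_powr') auto
  qed
  have "(\<integral>\<^sup>+ x. ennreal (v x powr (1 / s)) \<partial>lborel) = (\<integral>\<^sup>+ x. liminf (\<lambda>n. ennreal (u n x powr (1 / s))) \<partial>lborel)"
  proof (rule nn_integral_cong_AE)
    show "AE x in lborel. ennreal (v x powr (1 / s)) = liminf (\<lambda>n. ennreal (u n x powr (1 / s)))"
      using lim' by eventually_elim (rule lim_imp_Liminf[OF trivial_limit_sequentially, symmetric])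
  qed
  also have "\<dots> \<le> liminf (\<lambda>n. \<integral>\<^sup>+ x. ennreal (u n x powr (1 / s)) \<partial>lborel)"
    by (intro nn_integral_liminf) auto
  also have "\<dots> \<le> liminf (\<lambda>n::nat. ennreal (c powr (1 / s)))"
    using le s c by (intro Liminf_mono always_eventually allI) (simp add: lnorm_le_iff)
  also have "\<dots> = ennreal (c powr (1 / s))" by (simp add: Liminf_const)
  finally show ?thesis using s c by (simp add: lnorm_le_iff)
qed

lemma nn_integral_scaleR:
  fixes F :: "'a::euclidean_space \<Rightarrow> ennreal"
  assumes [measurable]: "F \<in> borel_measurable borel" and c: "0 < c"
  shows "(\<integral>\<^sup>+ x. F x \<partial>lborel) = ennreal (c ^ DIM('a)) * (\<integral>\<^sup>+ x. F (c *\<^sub>R x) \<partial>lborel)"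
proof -
  have "(\<integral>\<^sup>+ x. F x \<partial>lborel) = (\<integral>\<^sup>+ x. F x \<partial>density (distr lborel borel (\<lambda>x. 0 + c *\<^sub>R x)) (\<lambda>_. ennreal (\<bar>c\<bar> ^ DIM('a))))"
    using c by (intro arg_cong[where f="\<lambda>M. nn_integral M F"] lborel_affine) simp
  also have "\<dots> = ennreal (c ^ DIM('a)) * (\<integral>\<^sup>+ x. F (c *\<^sub>R x) \<partial>lborel)"
    using c by (simp add: nn_integral_density nn_integral_distr nn_integral_cmult)
  finally show ?thesis .
qed

text \<open>The kernel is even and has integral 1, so the difference at x is the average of f(x + w)
  - f(x) over w. The integrals are then exchanged and w = e u is substituted.\<close>

lemma heat_approximation_le:
  fixes f :: "'a::euclidean_space \<Rightarrow> complex"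
  assumes f: "integrable lborel f" and e: "0 < e"
  shows "(\<integral>\<^sup>+ x. ennreal (norm ((LINT y|lborel. f y * of_real (heat e (x - y))) - f x)) \<partial>lborel)
    \<le> (\<integral>\<^sup>+ u. ennreal (heat 1 u) * shift_osc f (e *\<^sub>R u) \<partial>lborel)"
proof -
  have [measurable]: "f \<in> borel_measurable borel" using f by auto
  have [measurable]: "shift_osc f \<in> borel_measurable borel" unfolding shift_osc_def[abs_def] by measurable
  have heat_int: "integrable lborel (\<lambda>y. complex_of_real (heat e (x - y)))" for x :: 'a
  proof -
    have "integrable lborel (\<lambda>y. heat e (y - x))"
      using integrable_translate[OF integrable_heat[OF e], of "- x"] by simp
    moreover have "heat e (x - y) = heat e (y - x)" for y by (simp add: heat_def)
    ultimately show ?thesis by (simp only: complex_of_real_integrable_eq)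
  qed
  have hb: "\<bar>heat e y\<bar> \<le> (1 / e) ^ DIM('a)" for y :: 'a
    using heat_le[OF e, of y] heat_nonneg[OF e, of y] by simp
  have "(\<integral>\<^sup>+ x. ennreal (norm ((LINT y|lborel. f y * of_real (heat e (x - y))) - f x)) \<partial>lborel)
    \<le> (\<integral>\<^sup>+ x. \<integral>\<^sup>+ w. ennreal (heat e w) * ennreal (norm (f (x + w) - f x)) \<partial>lborel \<partial>lborel)"
  proof (rule nn_integral_mono)
    fix x :: 'a
    have i1: "integrable lborel (\<lambda>y. f y * of_real (heat e (x - y)))"
    proof (rule Bochner_Integration.integrable_bound[OF integrable_mult_right[OF f, of "of_real ((1 / e) ^ DIM('a))"]])
      show "AE y in lborel. norm (f y * complex_of_real (heat e (x - y))) \<le> norm (complex_of_real ((1 / e) ^ DIM('a)) * f y)"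
        using hb e
        by (intro AE_I2) (simp add: norm_mult norm_divide norm_power mult.commute mult_left_mono del: power_one_over)
    qed measurable
    have "(LINT y|lborel. f x * complex_of_real (heat e (x - y))) = f x * of_real (LINT y|lborel. heat e (y - x))"
      by (simp add: heat_def)
    also have "(LINT y|lborel. heat e (y - x)) = 1"
      using integral_translate[of "heat e" "- x"] integral_heat[OF e, where 'a='a] by simp
    finally have "(LINT y|lborel. f y * of_real (heat e (x - y))) - f x =
        (LINT y|lborel. f y * of_real (heat e (x - y))) - (LINT y|lborel. f x * complex_of_real (heat e (x - y)))" by simp
    also have "\<dots> = (LINT y|lborel. f y * of_real (heat e (x - y)) - f x * of_real (heat e (x - y)))"
      using i1 heat_int by (intro Bochner_Integration.integral_diff[symmetric]) auto
    finally have eq: "(LINT y|lborel. f y * of_real (heat e (x - y))) - f x =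
        (LINT y|lborel. f y * of_real (heat e (x - y)) - f x * of_real (heat e (x - y)))" .
    have "ennreal (norm ((LINT y|lborel. f y * of_real (heat e (x - y))) - f x)) \<le>
        (\<integral>\<^sup>+ y. ennreal (norm (f y * of_real (heat e (x - y)) - f x * of_real (heat e (x - y)))) \<partial>lborel)"
      unfolding eq
      by (intro integral_norm_bound_ennreal Bochner_Integration.integrable_diff i1 integrable_mult_right heat_int)
    also have "\<dots> = (\<integral>\<^sup>+ y. ennreal (heat e (x - y)) * ennreal (norm (f y - f x)) \<partial>lborel)"
    proof (rule nn_integral_cong)
      fix y
      have "f y * of_real (heat e (x - y)) - f x * of_real (heat e (x - y)) = of_real (heat e (x - y)) * (f y - f x)"
        by (simp add: algebra_simps)
      then show "ennreal (norm (f y * of_real (heat e (x - y)) - f x * of_real (heat e (x - y)))) = ennreal (heat e (x - y)) * ennreal (norm (f y - f x))"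
        using heat_nonneg[OF e, of "x - y"] by (simp only: norm_mult norm_of_real abs_of_nonneg ennreal_mult norm_ge_zero)
    qed
    also have "\<dots> = (\<integral>\<^sup>+ w. ennreal (heat e (x - (w + x))) * ennreal (norm (f (w + x) - f x)) \<partial>lborel)"
      by (rule nn_integral_translate[symmetric, where f="\<lambda>y. ennreal (heat e (x - y)) * ennreal (norm (f y - f x))"]) measurable
    also have "\<dots> = (\<integral>\<^sup>+ w. ennreal (heat e w) * ennreal (norm (f (x + w) - f x)) \<partial>lborel)"
      by (simp add: heat_def add.commute)
    finally show "ennreal (norm ((LINT y|lborel. f y * of_real (heat e (x - y))) - f x)) \<le>
      (\<integral>\<^sup>+ w. ennreal (heat e w) * ennreal (norm (f (x + w) - f x)) \<partial>lborel)" .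
  qed
  also have "\<dots> = (\<integral>\<^sup>+ w. \<integral>\<^sup>+ x. ennreal (heat e w) * ennreal (norm (f (x + w) - f x)) \<partial>lborel \<partial>lborel)"
    by (rule lborel_pair.Fubini'[symmetric]) measurable
  also have "\<dots> = (\<integral>\<^sup>+ w. ennreal (heat e w) * shift_osc f w \<partial>lborel)"
    unfolding shift_osc_def by (intro nn_integral_cong nn_integral_cmult) measurable
  also have "\<dots> = ennreal (e ^ DIM('a)) * (\<integral>\<^sup>+ u. ennreal (heat e (e *\<^sub>R u)) * shift_osc f (e *\<^sub>R u) \<partial>lborel)"
    using e by (intro nn_integral_scaleR) auto
  also have "\<dots> = (\<integral>\<^sup>+ u. ennreal (e ^ DIM('a)) * (ennreal (heat e (e *\<^sub>R u)) * shift_osc f (e *\<^sub>R u)) \<partial>lborel)"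
    by (subst nn_integral_cmult) auto
  also have "\<dots> = (\<integral>\<^sup>+ u. ennreal (heat 1 u) * shift_osc f (e *\<^sub>R u) \<partial>lborel)"
  proof (rule nn_integral_cong)
    fix u :: 'a
    have "e ^ DIM('a) * heat e (e *\<^sub>R u) = heat 1 u"
      using e by (simp add: heat_def gauss_def power_mult_distrib power_divide)
    then have "ennreal (e ^ DIM('a)) * ennreal (heat e (e *\<^sub>R u)) = ennreal (heat 1 u)"
      using e heat_nonneg[OF e, of "e *\<^sub>R u"] by (simp flip: ennreal_mult)
    then show "ennreal (e ^ DIM('a)) * (ennreal (heat e (e *\<^sub>R u)) * shift_osc f (e *\<^sub>R u)) = ennreal (heat 1 u) * shift_osc f (e *\<^sub>R u)"
      by (simp add: mult.assoc[symmetric])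
  qed
  finally show ?thesis .
qed

text \<open>Dominated convergence: each oscillation tends to 0, and all of them are at most twice
  the L^1 norm of f.\<close>

lemma heat_approximation:
  fixes f :: "'a::euclidean_space \<Rightarrow> complex"
  assumes f: "integrable lborel f"
  shows "(\<lambda>n. \<integral>\<^sup>+ x. ennreal (norm ((LINT y|lborel. f y * of_real (heat (1 / real (Suc n)) (x - y))) - f x)) \<partial>lborel) \<longlonglongrightarrow> 0"
proof -
  have [measurable]: "f \<in> borel_measurable borel" using f by auto
  have [measurable]: "shift_osc f \<in> borel_measurable borel" unfolding shift_osc_def[abs_def] by measurable
  define I where "I = (\<integral>\<^sup>+ x. ennreal (norm (f x)) \<partial>lborel)"
  have I: "I < \<infinity>" using f by (simp add: I_def integrable_iff_bounded)
  have osc_le: "shift_osc f w \<le> 2 * I" for w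
    using shift_osc_triangle[of f "\<lambda>_. 0" w] by (simp add: I_def shift_osc_def[of "\<lambda>_. 0"])
  have "(\<lambda>n. \<integral>\<^sup>+ u. ennreal (heat 1 u) * shift_osc f ((1 / real (Suc n)) *\<^sub>R u) \<partial>lborel) \<longlonglongrightarrow> (\<integral>\<^sup>+ u. 0 \<partial>(lborel::'a measure))"
  proof (rule nn_integral_dominated_convergence[where w="\<lambda>u. ennreal (heat 1 u) * (2 * I)"])
    show "AE u in lborel. (\<lambda>n. ennreal (heat 1 u) * shift_osc f ((1 / real (Suc n)) *\<^sub>R u)) \<longlonglongrightarrow> 0"
    proof (rule AE_I2)
      fix u :: 'a
      have "(\<lambda>n. (1 / real (Suc n)) *\<^sub>R u) \<longlonglongrightarrow> 0 *\<^sub>R u"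
        using LIMSEQ_Suc[OF lim_1_over_n] by (intro tendsto_intros)
      then have "(\<lambda>n. shift_osc f ((1 / real (Suc n)) *\<^sub>R u)) \<longlonglongrightarrow> 0"
        by (intro shift_osc_tendsto_0 f) simp
      then have "(\<lambda>n. ennreal (heat 1 u) * shift_osc f ((1 / real (Suc n)) *\<^sub>R u)) \<longlonglongrightarrow> ennreal (heat 1 u) * 0"
        by (intro ennreal_tendsto_cmult) auto
      then show "(\<lambda>n. ennreal (heat 1 u) * shift_osc f ((1 / real (Suc n)) *\<^sub>R u)) \<longlonglongrightarrow> 0" by simp
    qed
    show "(\<integral>\<^sup>+ u. ennreal (heat 1 (u::'a)) * (2 * I) \<partial>lborel) < \<infinity>"
      using I by (simp add: nn_integral_multc nn_integral_heat ennreal_mult_less_top)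
  qed (auto intro!: mult_left_mono osc_le)
  then have lim: "(\<lambda>n. \<integral>\<^sup>+ u. ennreal (heat 1 (u::'a)) * shift_osc f ((1 / real (Suc n)) *\<^sub>R u) \<partial>lborel) \<longlonglongrightarrow> 0"
    by simp
  show ?thesis
    by (rule tendsto_sandwich[OF _ _ tendsto_const lim]) (auto intro!: always_eventually heat_approximation_le[OF f])
qed

text \<open>The transform need not be integrable, so \<open>hausdorff_young_fourier\<close> is
  applied to the damped transforms \<open>G n\<close>, whose reflected transforms \<open>F n\<close>
  are heat averages of f. These tend to f in L^1, hence almost everywhere along a subsequence, and
  Fatou's lemma transfers the bound.\<close>

lemma hausdorff_young:
  assumes s: "0 \<le> s" "s \<le> 1 / 2"
  obtains C where "0 < C" "\<And>f::'a::euclidean_space \<Rightarrow> complex. integrable lborel f \<Longrightarrow>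
    lnorm s (\<lambda>x. norm (f x)) \<le> ennreal C * lnorm (1 - s) (\<lambda>x. norm (fourier f x))"
proof -
  obtain C where C: "0 < C" "\<And>g::'a \<Rightarrow> complex. integrable lborel g \<Longrightarrow>
      lnorm s (\<lambda>x. norm (fourier g x)) \<le> ennreal C * lnorm (1 - s) (\<lambda>x. norm (g x))"
    using hausdorff_young_fourier[OF s] by blast
  show ?thesis
  proof (rule that[OF C(1)])
    fix f :: "'a \<Rightarrow> complex" assume f: "integrable lborel f"
    then have [measurable]: "f \<in> borel_measurable borel" by auto
    define e where "e n = 1 / real (Suc n)" for n
    have e: "0 < e n" for n by (simp add: e_def)
    define G where "G n \<xi> = fourier f \<xi> * of_real (gauss ((e n)\<^sup>2) \<xi>)" for n \<xi>
    have G: "integrable lborel (G n)" for n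
      unfolding G_def[abs_def] using e[of n] by (intro integrable_fourier_gauss f) auto
    have [measurable]: "G n \<in> borel_measurable borel" for n using G[of n] by auto
    define F where "F n x = fourier (G n) (- x)" for n x
    have [measurable]: "F n \<in> borel_measurable borel" for n unfolding F_def[abs_def] by measurable
    have F: "F n x = (LINT y|lborel. f y * of_real (heat (e n) (x - y)))" for n x
      unfolding F_def G_def[abs_def] by (rule fourier_inversion_gauss[OF f e])
    have lim: "(\<lambda>n. \<integral>\<^sup>+ x. ennreal (norm (F n x - f x)) \<partial>lborel) \<longlonglongrightarrow> 0"
      using heat_approximation[OF f] by (simp add: F e_def)
    then have "eventually (\<lambda>n. (\<integral>\<^sup>+ x. ennreal (norm (F n x - f x)) \<partial>lborel) < 1) sequentially"
      by (rule order_tendstoD) simp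
    then obtain N where N: "\<And>n. n \<ge> N \<Longrightarrow> (\<integral>\<^sup>+ x. ennreal (norm (F n x - f x)) \<partial>lborel) < 1"
      by (auto simp: eventually_sequentially)
    \<comment> \<open>Convergence of the extended integrals makes the differences integrable from
      the index N on, which the extraction of an almost everywhere convergent subsequence
      requires.\<close>
    have int: "integrable lborel (\<lambda>x. F (n + N) x - f x)" for n
      using N[of "n + N"] by (intro integrableI_bounded) (auto intro: order_less_trans)
    have lim': "(\<lambda>n. \<integral>\<^sup>+ x. ennreal (norm (F (n + N) x - f x)) \<partial>lborel) \<longlonglongrightarrow> 0"
      using LIMSEQ_ignore_initial_segment[OF lim, of N] .
    have "(\<lambda>n. LINT x|lborel. norm (F (n + N) x - f x)) \<longlonglongrightarrow> 0"
    proof (rule ennreal_tendsto_0_iff[THEN iffD1])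
      have "ennreal (LINT x|lborel. norm (F (n + N) x - f x)) = (\<integral>\<^sup>+ x. ennreal (norm (F (n + N) x - f x)) \<partial>lborel)" for n
        using int[of n] by (subst nn_integral_eq_integral) auto
      with lim' show "(\<lambda>n. ennreal (LINT x|lborel. norm (F (n + N) x - f x))) \<longlonglongrightarrow> 0" by simp
    qed auto
    then obtain r where "AE x in lborel. (\<lambda>n. F (r n + N) x - f x) \<longlonglongrightarrow> 0"
      using tendsto_L1_AE_subseq[of lborel "\<lambda>n x. F (n + N) x - f x", OF int] by blast
    then have ae: "AE x in lborel. (\<lambda>n. norm (F (r n + N) x)) \<longlonglongrightarrow> norm (f x)"
      by eventually_elim (auto intro!: tendsto_norm simp: LIM_zero_iff)
    have bound: "lnorm s (\<lambda>x. norm (F n x)) \<le> ennreal C * lnorm (1 - s) (\<lambda>x. norm (fourier f x))" for n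
    proof -
      have "lnorm s (\<lambda>x. norm (F n x)) = lnorm s (\<lambda>x. norm (fourier (G n) x))"
        unfolding F_def by (rule lnorm_reflect[of "\<lambda>x. norm (fourier (G n) x)"]) measurable
      also have "\<dots> \<le> ennreal C * lnorm (1 - s) (\<lambda>x. norm (G n x))" by (rule C(2)[OF G])
      also have "\<dots> \<le> ennreal C * lnorm (1 - s) (\<lambda>x. norm (fourier f x))"
        using s by (intro mult_left_mono lnorm_mono) (auto simp: G_def norm_mult gauss_le_1 mult_left_le)
      finally show ?thesis .
    qed
    show "lnorm s (\<lambda>x. norm (f x)) \<le> ennreal C * lnorm (1 - s) (\<lambda>x. norm (fourier f x))"
    proof (cases "lnorm (1 - s) (\<lambda>x. norm (fourier f x))")
      case (real c)
      show ?thesis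
        using bound real C(1) s ae
        by (simp flip: ennreal_mult) (rule lnorm_fatou[where u="\<lambda>n x. norm (F (r n + N) x)"], auto)
    next
      case top
      then show ?thesis using C by (simp add: ennreal_mult_top)
    qed
  qed
qed

text \<open>With norms indexed by reciprocal exponents the indices add. The factor 2 pays for a
  crude form of Young's inequality.\<close>

lemma lnorm_holder:
  fixes u v :: "'a::euclidean_space \<Rightarrow> real"
  assumes [measurable]: "u \<in> borel_measurable borel" "v \<in> borel_measurable borel"
    and u: "\<And>x. 0 \<le> u x" and v: "\<And>x. 0 \<le> v x" and s: "0 \<le> s" and t: "0 \<le> t" "s + t \<le> 1"
  shows "lnorm (s + t) (\<lambda>x. u x * v x) \<le> 2 * (lnorm s u * lnorm t v)"
proof -
  have zero: "lnorm (s + t) (\<lambda>x. u x * v x) = 0" if "lnorm s u = 0 \<or> lnorm t v = 0"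
  proof (rule lnorm_AE_0)
    show "AE x in lborel. u x * v x = 0"
      using that lnorm_eq_0_AE[OF assms(1) s u] lnorm_eq_0_AE[OF assms(2) t(1) v] by (auto elim!: eventually_mono)
  qed (use u v s t in auto)
  \<comment> \<open>\<open>nz\<close> keeps the right side infinite whenever
    \<open>lnorm 0 u\<close> is, since \<open>\<top> * 0 = 0\<close>; vanishing norms are covered by
    \<open>zero\<close>.\<close>
  have sup: "lnorm t (\<lambda>x. u x * v x) \<le> lnorm 0 u * lnorm t v"
    if [measurable]: "u \<in> borel_measurable borel" "v \<in> borel_measurable borel"
      and u: "\<And>x. 0 \<le> u x" and v: "\<And>x. 0 \<le> v x" and t: "0 \<le> t" and nz: "lnorm t v \<noteq> 0" for t and u v :: "'a \<Rightarrow> real"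
  proof (cases "lnorm 0 u")
    case (real c)
    then have "AE x in lborel. u x \<le> c" using u by (subst lnorm_0_le_iff[symmetric]) auto
    then have "AE x in lborel. 0 \<le> u x * v x \<and> u x * v x \<le> c * v x"
      by eventually_elim (use u v in \<open>auto intro: mult_right_mono\<close>)
    then have "lnorm t (\<lambda>x. u x * v x) \<le> lnorm t (\<lambda>x. c * v x)"
      using t by (intro lnorm_mono_AE) auto
    then show ?thesis using real v t by (simp add: lnorm_cmult)
  next
    case top
    then show ?thesis using nz by (simp add: ennreal_top_mult)
  qed
  have two: "a \<le> b \<Longrightarrow> a \<le> 2 * b" for a b :: ennreal
    by (simp add: mult_2 add_increasing2)
  show ?thesis
  proof (cases "lnorm s u = 0 \<or> lnorm t v = 0")
    case nz: False
    consider "s = 0" | "t = 0" | "lnorm s u = \<top> \<or> lnorm t v = \<top>" | U V where "0 < s" "0 < t" "0 < U" "0 < V" "lnorm s u = ennreal U" "lnorm t v = ennreal V"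
      using s t nz by (cases "lnorm s u"; cases "lnorm t v") (auto simp: less_le)
    then show ?thesis
    proof cases
      case 1
      then show ?thesis using sup[OF assms(1,2) u v t(1)] nz by (auto intro: two)
    next
      case 2
      then show ?thesis using sup[OF assms(2,1) v u s] nz by (auto intro: two simp: mult.commute)
    next
      case 3
      then show ?thesis using nz by (auto simp: ennreal_mult_top ennreal_top_mult)
    next
      case (4 U V)
      define q where "q = 1 / (s + t)"
      have q: "1 \<le> q" "0 < q" using 4 t by (auto simp: q_def)
      have Iu: "(\<integral>\<^sup>+ x. ennreal (u x powr (1 / s)) \<partial>lborel) \<le> ennreal (U powr (1 / s))"
        using lnorm_le_iff[OF assms(1) 4(1), of U] 4 by simp
      have Iv: "(\<integral>\<^sup>+ x. ennreal (v x powr (1 / t)) \<partial>lborel) \<le> ennreal (V powr (1 / t))"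
        using lnorm_le_iff[OF assms(2) 4(2), of V] 4 by simp
      \<comment> \<open>With M the larger of the two terms on the right, a \<le> M^s and b \<le>
        M^t, so ab \<le> M^(s+t), and the power q = 1 / (s + t) returns M.\<close>
      have young: "(a * b) powr q \<le> a powr (1 / s) + b powr (1 / t)" if ab: "0 \<le> a" "0 \<le> b" for a b :: real
      proof -
        define M where "M = max (a powr (1 / s)) (b powr (1 / t))"
        have "a = (a powr (1 / s)) powr s" "b = (b powr (1 / t)) powr t"
          using ab 4 by (simp_all add: powr_powr)
        then have "a \<le> M powr s" "b \<le> M powr t"
          using 4 by (metis M_def max.cobounded1 max.cobounded2 powr_mono2 powr_ge_zero less_imp_le)+
        then have "(a * b) powr q \<le> (M powr s * M powr t) powr q"
          using ab q by (intro powr_mono2 mult_mono) auto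
        also have "\<dots> = M"
        proof -
          have "0 \<le> M" by (simp add: M_def le_max_iff_disj)
          then show ?thesis using 4 by (simp add: q_def powr_powr flip: powr_add)
        qed
        also have "\<dots> \<le> a powr (1 / s) + b powr (1 / t)" by (simp add: M_def)
        finally show ?thesis .
      qed
      have "(\<integral>\<^sup>+ x. ennreal ((u x * v x) powr q) \<partial>lborel) \<le>
        (\<integral>\<^sup>+ x. ennreal ((U * V) powr q) * (ennreal (1 / U powr (1 / s)) * ennreal (u x powr (1 / s)) + ennreal (1 / V powr (1 / t)) * ennreal (v x powr (1 / t))) \<partial>lborel)"
      proof (rule nn_integral_mono)
        fix x
        have "(u x * v x) powr q = (U * V) powr q * ((u x / U) * (v x / V)) powr q"
          using 4 u v by (simp flip: powr_mult)
        also have "\<dots> \<le> (U * V) powr q * ((u x / U) powr (1 / s) + (v x / V) powr (1 / t))"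
          using 4 u v by (intro mult_left_mono young) auto
        also have "\<dots> = (U * V) powr q * (1 / U powr (1 / s) * u x powr (1 / s) + 1 / V powr (1 / t) * v x powr (1 / t))"
          using 4 u v by (simp add: powr_divide)
        finally show "ennreal ((u x * v x) powr q) \<le> ennreal ((U * V) powr q) * (ennreal (1 / U powr (1 / s)) * ennreal (u x powr (1 / s)) + ennreal (1 / V powr (1 / t)) * ennreal (v x powr (1 / t)))"
          by (simp flip: ennreal_mult ennreal_plus add: ennreal_leI)
      qed
      also have "\<dots> = ennreal ((U * V) powr q) * (ennreal (1 / U powr (1 / s)) * (\<integral>\<^sup>+ x. ennreal (u x powr (1 / s)) \<partial>lborel) + ennreal (1 / V powr (1 / t)) * (\<integral>\<^sup>+ x. ennreal (v x powr (1 / t)) \<partial>lborel))"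
        by (simp add: nn_integral_cmult nn_integral_add)
      also have "\<dots> \<le> ennreal ((U * V) powr q) * (ennreal (1 / U powr (1 / s)) * ennreal (U powr (1 / s)) + ennreal (1 / V powr (1 / t)) * ennreal (V powr (1 / t)))"
        by (intro mult_left_mono add_mono Iu Iv) auto
      also have "ennreal (1 / U powr (1 / s)) * ennreal (U powr (1 / s)) = 1"
        using 4 by (simp flip: ennreal_mult)
      also have "ennreal (1 / V powr (1 / t)) * ennreal (V powr (1 / t)) = 1"
        using 4 by (simp flip: ennreal_mult)
      also have "ennreal ((U * V) powr q) * (1 + 1) = ennreal ((U * V) powr q * 2)"
        by (simp add: ennreal_mult one_add_one)
      \<comment> \<open>The two normalised integrals contribute 2, which is at most 2^q because q
        \<ge> 1; after the root this is the factor 2 of the statement.\<close>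
      also have "ennreal ((U * V) powr q * 2) \<le> ennreal ((2 * (U * V)) powr q)"
      proof -
        have "(U * V) powr q * 2 \<le> (U * V) powr q * 2 powr q"
          using q powr_mono[of 1 q 2] by (intro mult_left_mono) auto
        also have "\<dots> = (2 * (U * V)) powr q" using 4 by (simp add: powr_mult)
        finally show ?thesis by (rule ennreal_leI)
      qed
      finally have "lnorm (s + t) (\<lambda>x. u x * v x) \<le> ennreal (2 * (U * V))"
        using 4 by (subst lnorm_le_iff) (auto simp: q_def)
      then show ?thesis using 4 by (simp add: ennreal_mult)
    qed
  qed (simp add: zero)
qed

section \<open>Iterated differences and sufficiency\<close>

definition shift_diff :: "'a::euclidean_space \<Rightarrow> ('a \<Rightarrow> complex) \<Rightarrow> 'a \<Rightarrow> complex" where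
  "shift_diff h g = (\<lambda>x. g x - g (x + h))"

lemma shift_diff_Suc:
  "(shift_diff h ^^ Suc m) g = (\<lambda>x. (shift_diff h ^^ m) g x - (shift_diff h ^^ m) g (x + h))"
  by (simp add: shift_diff_def[of h "(shift_diff h ^^ m) g"])

lemma shift_diff_measurable:
  "g \<in> borel_measurable borel \<Longrightarrow> (shift_diff h ^^ m) g \<in> borel_measurable borel"
proof (induction m)
  case (Suc m)
  then have [measurable]: "(shift_diff h ^^ m) g \<in> borel_measurable borel" by simp
  show ?case unfolding shift_diff_Suc by measurable
qed simp

lemma shift_diff_integrable:
  "integrable lborel g \<Longrightarrow> integrable lborel ((shift_diff h ^^ m) g)"
proof (induction m)
  case (Suc m)
  then have "integrable lborel ((shift_diff h ^^ m) g)" by simp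
  then show ?case
    unfolding shift_diff_Suc by (intro Bochner_Integration.integrable_diff integrable_translate)
qed simp

text \<open>Up to sign the coefficients of an m-fold difference are binomial coefficients, hence at
  most 2^m, and the term at x itself cancels against \<open>g x\<close>.\<close>

lemma norm_shift_diff_le:
  "norm ((shift_diff h ^^ m) g x - g x) \<le> 2 ^ m * (\<Sum>j=1..m. norm (g (x + real j *\<^sub>R h)))"
proof (induction m arbitrary: x)
  case (Suc m)
  let ?D = "(shift_diff h ^^ m) g"
  let ?a = "\<lambda>j. norm (g (x + real j *\<^sub>R h))"
  have p2: "1 \<le> (2::real) ^ m" by simp
  have shift: "(\<Sum>j=1..m. norm (g (x + h + real j *\<^sub>R h))) = (\<Sum>j=2..Suc m. ?a j)"
  proof -
    have "x + h + real j *\<^sub>R h = x + real (Suc j) *\<^sub>R h" for j by (simp add: algebra_simps)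
    then have "(\<Sum>j=1..m. norm (g (x + h + real j *\<^sub>R h))) = (\<Sum>j=1..m. ?a (Suc j))" by (simp only:)
    also have "\<dots> = (\<Sum>j=Suc 1..Suc m. ?a j)" by (rule sum.shift_bounds_cl_Suc_ivl[symmetric])
    finally show ?thesis by (simp add: numeral_2_eq_2)
  qed
  have le1: "(\<Sum>j=1..m. ?a j) \<le> (\<Sum>j=1..Suc m. ?a j)" by simp
  have split: "(\<Sum>j=1..Suc m. ?a j) = ?a 1 + (\<Sum>j=2..Suc m. ?a j)"
    by (subst sum.atLeast_Suc_atMost) (auto simp: numeral_2_eq_2)
  have "norm ((shift_diff h ^^ Suc m) g x - g x) = norm ((?D x - g x) - (?D (x + h) - g (x + h)) - g (x + h))"
    unfolding shift_diff_Suc by (simp add: algebra_simps)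
  also have "\<dots> \<le> norm (?D x - g x) + norm (?D (x + h) - g (x + h)) + norm (g (x + h))"
    by (meson norm_triangle_le_diff norm_triangle_ineq4 add_right_mono order_trans)
  also have "\<dots> \<le> 2 ^ m * (\<Sum>j=1..m. ?a j) + 2 ^ m * (\<Sum>j=2..Suc m. ?a j) + ?a 1"
    using Suc.IH[of x] Suc.IH[of "x + h"] unfolding shift by simp
  also have "\<dots> \<le> 2 ^ m * (\<Sum>j=1..m. ?a j) + 2 ^ m * (\<Sum>j=2..Suc m. ?a j) + 2 ^ m * ?a 1"
    using p2 mult_right_mono[of 1 "2 ^ m" "?a 1"] by simp
  also have "2 ^ m * (\<Sum>j=1..m. ?a j) + 2 ^ m * (\<Sum>j=2..Suc m. ?a j) + 2 ^ m * ?a 1 =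
      2 ^ m * (\<Sum>j=1..m. ?a j) + 2 ^ m * (\<Sum>j=1..Suc m. ?a j)"
    unfolding split by (simp add: algebra_simps)
  also have "\<dots> \<le> 2 ^ m * (\<Sum>j=1..Suc m. ?a j) + 2 ^ m * (\<Sum>j=1..Suc m. ?a j)"
    using le1 by (intro add_right_mono mult_left_mono) auto
  finally show ?case by simp
qed simp

text \<open>The quasi-triangle constant doubles with each summand. This is harmless because the
  number of summands will be the order of a difference, which depends on the weights only.\<close>

lemma lnorm_sum:
  assumes "finite J" and u: "\<And>j. j \<in> J \<Longrightarrow> u j \<in> borel_measurable borel" "\<And>j x. j \<in> J \<Longrightarrow> 0 \<le> u j x"
    and s: "0 \<le> s" "s \<le> 1"
  shows "lnorm s (\<lambda>x. \<Sum>j\<in>J. u j x) \<le> 2 ^ card J * (\<Sum>j\<in>J. lnorm s (u j))"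
  using \<open>finite J\<close> u
proof (induction J rule: finite_induct)
  case empty
  show ?case using s by (auto intro: lnorm_AE_0)
next
  case (insert i J)
  have one: "(1::ennreal) \<le> 2 ^ card J" by (rule one_le_power) simp
  have "lnorm s (\<lambda>x. \<Sum>j\<in>insert i J. u j x) = lnorm s (\<lambda>x. u i x + (\<Sum>j\<in>J. u j x))"
    using insert by simp
  also have "\<dots> \<le> 2 * (lnorm s (u i) + lnorm s (\<lambda>x. \<Sum>j\<in>J. u j x))"
    using insert s by (intro lnorm_add borel_measurable_sum) (auto intro: sum_nonneg)
  also have "\<dots> \<le> 2 * (2 ^ card J * lnorm s (u i) + 2 ^ card J * (\<Sum>j\<in>J. lnorm s (u j)))"
    using insert mult_right_mono[OF one, of "lnorm s (u i)"] by (intro mult_left_mono add_mono) auto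
  also have "\<dots> = 2 ^ card (insert i J) * (\<Sum>j\<in>insert i J. lnorm s (u j))"
    using insert by (simp add: distrib_left mult.assoc)
  finally show ?case .
qed

text \<open>Since the shifts of the ball by h, 2h, ... leave the ball, on the ball the iterated difference
  differs from g only by values of g outside it.\<close>

lemma lnorm_local_shift_diff:
  fixes g :: "'a::euclidean_space \<Rightarrow> complex"
  assumes [measurable]: "g \<in> borel_measurable borel" and s: "0 \<le> s" "s \<le> 1" and R: "0 < R" "norm h = 2 * R"
  shows "lnorm s (\<lambda>x. norm (g x)) \<le>
    ennreal (4 * (1 + 4 ^ m * real m)) * (lnorm s (\<lambda>x. indicator (ball 0 R) x * norm ((shift_diff h ^^ m) g x))
      + lnorm s (\<lambda>x. indicator (- ball 0 R) x * norm (g x)))"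
proof -
  let ?D = "(shift_diff h ^^ m) g"
  have [measurable]: "?D \<in> borel_measurable borel" by (rule shift_diff_measurable) measurable
  have [measurable]: "ball (0::'a) R \<in> sets borel" by simp
  define a where "a x = indicator (ball 0 R) x * norm (?D x)" for x
  define b where "b x = indicator (- ball 0 R) x * norm (g x)" for x
  define c where "c j x = indicator (ball 0 R) x * norm (g (x + real j *\<^sub>R h))" for j x
  have [measurable]: "a \<in> borel_measurable borel" "b \<in> borel_measurable borel" "c j \<in> borel_measurable borel" for j
    unfolding a_def[abs_def] b_def[abs_def] c_def[abs_def] by measurable
  have pos: "0 \<le> a x" "0 \<le> b x" "0 \<le> c j x" for x j by (auto simp: a_def b_def c_def)
  \<comment> \<open>For \<open>norm x < R\<close> and j \<ge> 1 the point x + j h has norm more than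
    2 j R - R \<ge> R, so the shifted values are values of \<open>b\<close>.\<close>
  have cb: "lnorm s (c j) \<le> lnorm s b" if "j \<in> {1..m}" for j
  proof -
    have "lnorm s (c j) \<le> lnorm s (\<lambda>x. b (x + real j *\<^sub>R h))"
    proof (rule lnorm_mono)
      fix x
      have "x + real j *\<^sub>R h \<notin> ball 0 R" if x: "x \<in> ball 0 R"
      proof -
        have "2 * R \<le> real j * (2 * R)" using \<open>j \<in> {1..m}\<close> R by simp
        also have "\<dots> = norm (real j *\<^sub>R h)" using R by simp
        also have "\<dots> \<le> norm (x + real j *\<^sub>R h) + norm x"
          using norm_triangle_ineq4[of "x + real j *\<^sub>R h" x] by simp
        finally show ?thesis using x by simp
      qed
      then show "c j x \<le> b (x + real j *\<^sub>R h)" by (auto simp: c_def b_def indicator_def)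
    qed (use s pos in auto)
    also have "\<dots> = lnorm s b" using s pos by (intro lnorm_shift) auto
    finally show ?thesis .
  qed
  have "lnorm s (\<lambda>x. norm (g x)) \<le> lnorm s (\<lambda>x. (a x + b x) + 2 ^ m * (\<Sum>j\<in>{1..m}. c j x))"
  proof (rule lnorm_mono)
    fix x
    have "norm (g x) \<le> norm (?D x) + norm (?D x - g x)"
      using norm_triangle_ineq4[of "?D x" "?D x - g x"] by simp
    then have "norm (g x) \<le> norm (?D x) + 2 ^ m * (\<Sum>j=1..m. norm (g (x + real j *\<^sub>R h)))"
      using norm_shift_diff_le[where h=h and m=m and g=g and x=x] by linarith
    then show "norm (g x) \<le> (a x + b x) + 2 ^ m * (\<Sum>j\<in>{1..m}. c j x)"
      by (cases "x \<in> ball 0 R") (auto simp: a_def b_def c_def sum_distrib_left)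
  qed (use s in auto)
  also have "\<dots> \<le> 2 * (lnorm s (\<lambda>x. a x + b x) + lnorm s (\<lambda>x. 2 ^ m * (\<Sum>j\<in>{1..m}. c j x)))"
    using s pos by (intro lnorm_add) (auto intro!: sum_nonneg mult_nonneg_nonneg)
  also have "\<dots> \<le> 2 * (2 * (lnorm s a + lnorm s b) + ennreal (4 ^ m * real m) * lnorm s b)"
  proof (intro mult_left_mono add_mono)
    show "lnorm s (\<lambda>x. a x + b x) \<le> 2 * (lnorm s a + lnorm s b)"
      using s pos by (intro lnorm_add) auto
    have "lnorm s (\<lambda>x. 2 ^ m * (\<Sum>j\<in>{1..m}. c j x)) = ennreal (2 ^ m) * lnorm s (\<lambda>x. \<Sum>j\<in>{1..m}. c j x)"
      using s pos by (intro lnorm_cmult) (auto intro!: sum_nonneg)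
    also have "\<dots> \<le> ennreal (2 ^ m) * (2 ^ card {1..m} * (\<Sum>j\<in>{1..m}. lnorm s (c j)))"
      using s pos by (intro mult_left_mono lnorm_sum) auto
    also have "\<dots> \<le> ennreal (2 ^ m) * (2 ^ card {1..m} * (\<Sum>j\<in>{1..m}. lnorm s b))"
      by (intro mult_left_mono sum_mono cb) auto
    \<comment> \<open>One factor 2^m comes from \<open>norm_shift_diff_le\<close>, the other from
      the quasi-triangle inequality for m summands.\<close>
    also have "\<dots> = ennreal (4 ^ m * real m) * lnorm s b"
    proof -
      have "ennreal (4 ^ m * real m) = ennreal (2 ^ m) * (2 ^ m * of_nat m)"
      proof -
        have "(4::real) ^ m = 2 ^ m * 2 ^ m" by (simp flip: power_mult_distrib)
        then show ?thesis by (simp add: ennreal_mult ennreal_power[symmetric] ennreal_of_nat_eq_real_of_nat mult.assoc)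
      qed
      then show ?thesis by (simp add: mult.assoc)
    qed
    finally show "lnorm s (\<lambda>x. 2 ^ m * (\<Sum>j\<in>{1..m}. c j x)) \<le> ennreal (4 ^ m * real m) * lnorm s b" .
  qed auto
  also have "\<dots> \<le> 2 * (2 * (lnorm s a + lnorm s b) + ennreal (4 ^ m * real m) * (2 * (lnorm s a + lnorm s b)))"
  proof -
    have "lnorm s b \<le> lnorm s a + lnorm s b" by (simp add: add_increasing)
    also have "\<dots> \<le> 2 * (lnorm s a + lnorm s b)" by (simp add: mult_2 add_increasing)
    finally show ?thesis by (intro mult_left_mono add_mono order_refl) auto
  qed
  also have "\<dots> = ennreal (4 * (1 + 4 ^ m * real m)) * (lnorm s a + lnorm s b)"
  proof -
    have "ennreal (4 * (1 + 4 ^ m * real m)) = 4 * (1 + ennreal (4 ^ m * real m))"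
      by (simp add: ennreal_mult)
    moreover have "2 * (2 * Z + E * (2 * Z)) = 4 * (1 + E) * Z" for Z E :: ennreal
    proof -
      have "2 * (2 * Z + E * (2 * Z)) = (2 * 2) * (Z + E * Z)" by (simp add: distrib_left mult_ac)
      then show ?thesis by (simp add: distrib_right mult.assoc)
    qed
    ultimately show ?thesis by (simp only:)
  qed
  finally show ?thesis by (simp add: a_def[abs_def] b_def[abs_def])
qed

lemma fourier_shift_diff:
  assumes "integrable lborel f"
  shows "fourier ((shift_diff h ^^ m) f) \<xi> = (1 - cis (2 * pi * (h \<bullet> \<xi>))) ^ m * fourier f \<xi>"
proof (induction m)
  case (Suc m)
  let ?D = "(shift_diff h ^^ m) f"
  have D: "integrable lborel ?D" by (rule shift_diff_integrable[OF assms])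
  have "fourier ((shift_diff h ^^ Suc m) f) \<xi> = fourier ?D \<xi> - fourier (\<lambda>x. ?D (x + h)) \<xi>"
    using D integrable_translate[OF D, of h] unfolding shift_diff_Suc by (rule fourier_diff)
  then show ?case using Suc by (simp add: fourier_translate[OF D] algebra_simps)
qed simp

lemma shift_diff_fourier:
  assumes f: "integrable lborel f"
  shows "(shift_diff \<eta> ^^ m) (fourier f) = fourier (\<lambda>x. f x * (1 - cis (- 2 * pi * (x \<bullet> \<eta>))) ^ m)"
    and "integrable lborel (\<lambda>x. f x * (1 - cis (- 2 * pi * (x \<bullet> \<eta>))) ^ m)"
proof -
  have both: "integrable lborel (\<lambda>x. f x * (1 - cis (- 2 * pi * (x \<bullet> \<eta>))) ^ m) \<and>
     (shift_diff \<eta> ^^ m) (fourier f) = fourier (\<lambda>x. f x * (1 - cis (- 2 * pi * (x \<bullet> \<eta>))) ^ m)"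
  proof (induction m)
    case (Suc m)
    let ?g = "\<lambda>x. f x * (1 - cis (- 2 * pi * (x \<bullet> \<eta>))) ^ m"
    have g: "integrable lborel ?g" using Suc by simp
    then have gm[measurable]: "?g \<in> borel_measurable borel" by auto
    have g': "integrable lborel (\<lambda>x. ?g x * cis (- 2 * pi * (x \<bullet> \<eta>)))"
      by (intro integrable_mult_cis g) measurable
    have eq: "(\<lambda>x. f x * (1 - cis (- 2 * pi * (x \<bullet> \<eta>))) ^ Suc m) = (\<lambda>x. ?g x - ?g x * cis (- 2 * pi * (x \<bullet> \<eta>)))"
      by (simp add: fun_eq_iff algebra_simps)
    have "(shift_diff \<eta> ^^ Suc m) (fourier f) = fourier (\<lambda>x. ?g x - ?g x * cis (- 2 * pi * (x \<bullet> \<eta>)))"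
    proof
      fix \<xi>
      have "(shift_diff \<eta> ^^ Suc m) (fourier f) \<xi> = fourier ?g \<xi> - fourier ?g (\<xi> + \<eta>)"
        unfolding shift_diff_Suc using Suc by simp
      also have "fourier ?g (\<xi> + \<eta>) = fourier (\<lambda>x. ?g x * cis (- 2 * pi * (x \<bullet> \<eta>))) \<xi>"
        by (rule fourier_modulate[OF gm, symmetric])
      finally show "(shift_diff \<eta> ^^ Suc m) (fourier f) \<xi> = fourier (\<lambda>x. ?g x - ?g x * cis (- 2 * pi * (x \<bullet> \<eta>))) \<xi>"
        using fourier_diff[OF g g'] by simp
    qed
    then show ?case unfolding eq using g g' by auto
  qed (use f in simp)
  show "integrable lborel (\<lambda>x. f x * (1 - cis (- 2 * pi * (x \<bullet> \<eta>))) ^ m)"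
    "(shift_diff \<eta> ^^ m) (fourier f) = fourier (\<lambda>x. f x * (1 - cis (- 2 * pi * (x \<bullet> \<eta>))) ^ m)"
    using both by auto
qed

lemma norm_one_minus_cis_le: "norm (1 - cis t) \<le> \<bar>t\<bar>" "norm (1 - cis t) \<le> 2"
proof -
  show "norm (1 - cis t) \<le> \<bar>t\<bar>"
    using iexp_approx1[of t 0] by (simp add: cis_conv_exp norm_minus_commute)
  show "norm (1 - cis t) \<le> 2"
    using norm_triangle_ineq4[of 1 "cis t"] by simp
qed

text \<open>The bounds \<open>\<bar>t\<bar>\<close> and 2 of the preceding lemma combined; 4 pi
  dominates both constants.\<close>

lemma norm_one_minus_cis_inner_le:
  fixes h x :: "'a::euclidean_space"
  assumes "norm h = 2 * R" "\<bar>t\<bar> = 2 * pi * \<bar>h \<bullet> x\<bar>"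
  shows "norm (1 - cis t) \<le> 4 * pi * min 1 (R * norm x)"
proof -
  have "\<bar>h \<bullet> x\<bar> \<le> 2 * R * norm x" using Cauchy_Schwarz_ineq2[of h x] assms by simp
  then have "\<bar>t\<bar> \<le> 4 * pi * (R * norm x)"
    using assms mult_left_mono[of "\<bar>h \<bullet> x\<bar>" "2 * R * norm x" "2 * pi"] by (simp add: mult_ac)
  moreover have "2 \<le> 4 * pi" using pi_gt3 by simp
  ultimately show ?thesis using norm_one_minus_cis_le[of t] by (auto simp: min_def)
qed

text \<open>This fixes the order of the differences: m at least as large as both exponents makes the
  multiplier vanish at the origin at least as fast as the weight. Beyond 1 / R monotonicity of the
  weight suffices; below, passing from \<xi> to radius 1 / R is a dilation by 1 / \<tau> and costs
  at most 2 (1 / \<tau>)^m.\<close>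

lemma min_power_broken_power_le:
  fixes \<xi> :: "'a::euclidean_space" and B1 B2 R :: real and m :: nat
  assumes B: "0 < B1" "0 < B2" "B1 \<le> m" "B2 \<le> m" and R: "0 < R"
  shows "(min 1 (R * norm \<xi>)) ^ m * broken_power (B1, B2) (1 / R) \<le> 2 * broken_power (B1, B2) \<xi>"
proof -
  consider "\<xi> = 0" | "\<xi> \<noteq> 0" "R * norm \<xi> < 1" | "1 \<le> R * norm \<xi>" by linarith
  then show ?thesis
  proof cases
    case 1
    \<comment> \<open>m is positive because 0 < B1 \<le> m, so both sides are 0.\<close>
    then show ?thesis using B by (cases m) auto
  next
    case 3
    then have "broken_power (B1, B2) (1 / R) \<le> broken_power (B1, B2) \<xi>"
      using R B by (intro broken_power_mono_gen) (auto simp: field_simps)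
    also have "\<dots> \<le> 2 * broken_power (B1, B2) \<xi>" by simp
    finally show ?thesis using 3 by simp
  next
    case 2
    define \<tau> where "\<tau> = R * norm \<xi>"
    have \<tau>: "0 < \<tau>" "\<tau> < 1" using 2 R by (auto simp: \<tau>_def)
    have "broken_power (B1, B2) (1 / R) = broken_power (B1, B2) (norm \<xi> *\<^sub>R (1 / \<tau>))"
      using 2 R by (simp add: \<tau>_def)
    also have "\<dots> \<le> broken_power (B1, B2) (norm \<xi>) * (norm (1 / \<tau>) powr B1 + norm (1 / \<tau>) powr B2)"
      using 2 B by (intro broken_power_scaleR_le) auto
    also have "\<dots> \<le> broken_power (B1, B2) (norm \<xi>) * ((1 / \<tau>) powr m + (1 / \<tau>) powr m)"
      using \<tau> B by (intro mult_left_mono add_mono) (auto intro!: powr_mono)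
    also have "\<dots> = broken_power (B1, B2) (norm \<xi>) * (2 * (1 / \<tau>) ^ m)"
      using \<tau> by (simp add: powr_realpow)
    finally have "\<tau> ^ m * broken_power (B1, B2) (1 / R) \<le> \<tau> ^ m * (broken_power (B1, B2) (norm \<xi>) * (2 * (1 / \<tau>) ^ m))"
      using \<tau> by (intro mult_left_mono) auto
    also have "\<dots> = 2 * broken_power (B1, B2) \<xi>"
      using \<tau> by (simp add: power_divide broken_power_real_abs)
    finally show ?thesis using \<tau> by (simp add: \<tau>_def min_def)
  qed
qed

lemma lnorm_outside_ball_le:
  fixes g :: "'a::euclidean_space \<Rightarrow> real"
  assumes [measurable]: "g \<in> borel_measurable borel" and g: "\<And>x. 0 \<le> g x" and s: "0 \<le> s" and A: "0 < A1" "0 < A2" and R: "0 < R"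
  shows "lnorm s (\<lambda>x. indicator (- ball 0 R) x * g x) \<le>
    ennreal (1 / broken_power (A1, A2) R) * lnorm s (\<lambda>x. broken_power (A1, A2) x * g x)"
proof -
  have wR: "0 < broken_power (A1, A2) R" using R by (intro broken_power_pos) simp
  have [measurable]: "ball (0::'a) R \<in> sets borel" by simp
  have "lnorm s (\<lambda>x. indicator (- ball 0 R) x * g x) \<le> lnorm s (\<lambda>x. 1 / broken_power (A1, A2) R * (broken_power (A1, A2) x * g x))"
  proof (rule lnorm_mono)
    fix x :: 'a
    have "broken_power (A1, A2) R \<le> broken_power (A1, A2) x" if "x \<notin> ball 0 R"
      using that R A by (intro broken_power_mono_gen) auto
    then have "1 * g x \<le> broken_power (A1, A2) x / broken_power (A1, A2) R * g x" if "x \<notin> ball 0 R"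
      using that wR g[of x] by (intro mult_right_mono) auto
    then show "indicator (- ball 0 R) x * g x \<le> 1 / broken_power (A1, A2) R * (broken_power (A1, A2) x * g x)"
      using wR g[of x] by (auto simp: indicator_def)
  qed (use s g in auto)
  also have "\<dots> = ennreal (1 / broken_power (A1, A2) R) * lnorm s (\<lambda>x. broken_power (A1, A2) x * g x)"
    using s g wR by (intro lnorm_cmult) auto
  finally show ?thesis .
qed

text \<open>On the ball the m-fold difference with \<open>norm h = 2 * R\<close> is estimated by
  Hausdorff-Young, and its multiplier by the ratio of the weight at \<xi> to the weight at 1 / R.
  The radius R stays free; it is chosen only when both estimates are combined.\<close>

lemma space_side_estimate:
  assumes s: "0 \<le> s" "s \<le> 1 / 2" and A: "0 < A1" "0 < A2" and B: "0 < B1" "0 < B2"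
  obtains C where "0 < C" "\<And>(f::'a::euclidean_space \<Rightarrow> complex) (R::real). integrable lborel f \<Longrightarrow> 0 < R \<Longrightarrow>
    lnorm s (\<lambda>x. norm (f x)) \<le> ennreal C *
      (ennreal (1 / broken_power (B1, B2) (1 / R)) * lnorm (1 - s) (\<lambda>\<xi>. broken_power (B1, B2) \<xi> * norm (fourier f \<xi>))
       + ennreal (1 / broken_power (A1, A2) R) * lnorm s (\<lambda>x. broken_power (A1, A2) x * norm (f x)))"
proof -
  obtain H where H: "0 < H" "\<And>f::'a \<Rightarrow> complex. integrable lborel f \<Longrightarrow>
      lnorm s (\<lambda>x. norm (f x)) \<le> ennreal H * lnorm (1 - s) (\<lambda>x. norm (fourier f x))"
    using hausdorff_young[OF s] by blast
  define m where "m = nat \<lceil>max B1 B2\<rceil>"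
  have m: "B1 \<le> m" "B2 \<le> m" using B by (auto simp: m_def) linarith+
  define M where "M = 4 * (1 + 4 ^ m * real m)"
  define L where "L = H * ((4 * pi) ^ m * 2)"
  have pc: "0 < M" "0 < L" using H by (auto simp: M_def L_def add_pos_nonneg)
  show ?thesis
  proof (rule that[of "M * (L + 1)"])
    show "0 < M * (L + 1)" using pc by simp
    fix f :: "'a \<Rightarrow> complex" and R :: real assume f: "integrable lborel f" and R: "0 < R"
    have [measurable]: "f \<in> borel_measurable borel" using f by auto
    obtain h :: 'a where h: "norm h = 2 * R" using vector_choose_size[of "2 * R"] R by auto
    let ?D = "(shift_diff h ^^ m) f"
    have [measurable]: "?D \<in> borel_measurable borel" by (rule shift_diff_measurable) measurable
    have [measurable]: "ball (0::'a) R \<in> sets borel" by simp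
    let ?w = "broken_power (B1, B2) (1 / R)"
    have w: "0 < ?w" using R by (intro broken_power_pos) simp
    let ?Y = "lnorm (1 - s) (\<lambda>\<xi>. broken_power (B1, B2) \<xi> * norm (fourier f \<xi>))"
    let ?X = "lnorm s (\<lambda>x. broken_power (A1, A2) x * norm (f x))"
    have "lnorm (1 - s) (\<lambda>x. norm (fourier ?D x)) \<le> lnorm (1 - s) (\<lambda>\<xi>. ((4 * pi) ^ m * 2 / ?w) * (broken_power (B1, B2) \<xi> * norm (fourier f \<xi>)))"
    proof (rule lnorm_mono)
      fix \<xi>
      have "norm (1 - cis (2 * pi * (h \<bullet> \<xi>))) \<le> 4 * pi * min 1 (R * norm \<xi>)"
        by (rule norm_one_minus_cis_inner_le[OF h]) (simp add: abs_mult)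
      then have "norm (1 - cis (2 * pi * (h \<bullet> \<xi>))) ^ m \<le> (4 * pi * min 1 (R * norm \<xi>)) ^ m"
        by (intro power_mono) auto
      also have "\<dots> = (4 * pi) ^ m * (min 1 (R * norm \<xi>)) ^ m" by (rule power_mult_distrib)
      also have "\<dots> \<le> (4 * pi) ^ m * (2 * broken_power (B1, B2) \<xi> / ?w)"
        using min_power_broken_power_le[OF B m R, of \<xi>] w
        by (intro mult_left_mono) (auto simp: field_simps)
      finally have "norm (1 - cis (2 * pi * (h \<bullet> \<xi>))) ^ m * norm (fourier f \<xi>) \<le> (4 * pi) ^ m * (2 * broken_power (B1, B2) \<xi> / ?w) * norm (fourier f \<xi>)"
        by (intro mult_right_mono) auto
      then show "norm (fourier ?D \<xi>) \<le> ((4 * pi) ^ m * 2 / ?w) * (broken_power (B1, B2) \<xi> * norm (fourier f \<xi>))"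
        by (simp add: fourier_shift_diff[OF f] norm_mult norm_power mult_ac)
    qed (use s in auto)
    also have "\<dots> = ennreal ((4 * pi) ^ m * 2 / ?w) * ?Y"
      using s w by (intro lnorm_cmult) auto
    finally have D: "lnorm (1 - s) (\<lambda>x. norm (fourier ?D x)) \<le> ennreal ((4 * pi) ^ m * 2 / ?w) * ?Y" .
    have "lnorm s (\<lambda>x. indicator (ball 0 R) x * norm (?D x)) \<le> lnorm s (\<lambda>x. norm (?D x))"
      using s by (intro lnorm_mono) (auto simp: indicator_def)
    also have "\<dots> \<le> ennreal H * lnorm (1 - s) (\<lambda>x. norm (fourier ?D x))"
      by (rule H(2)[OF shift_diff_integrable[OF f]])
    also have "\<dots> \<le> ennreal H * (ennreal ((4 * pi) ^ m * 2 / ?w) * ?Y)"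
      by (intro mult_left_mono D) simp
    also have "\<dots> = ennreal L * (ennreal (1 / ?w) * ?Y)"
      using H w by (simp add: L_def mult.assoc[symmetric] flip: ennreal_mult)
    finally have 1: "lnorm s (\<lambda>x. indicator (ball 0 R) x * norm (?D x)) \<le> ennreal L * (ennreal (1 / ?w) * ?Y)" .
    have 2: "lnorm s (\<lambda>x. indicator (- ball 0 R) x * norm (f x)) \<le> ennreal (1 / broken_power (A1, A2) R) * ?X"
      using s A R by (intro lnorm_outside_ball_le) auto
    have "lnorm s (\<lambda>x. norm (f x)) \<le> ennreal M * (lnorm s (\<lambda>x. indicator (ball 0 R) x * norm (?D x)) + lnorm s (\<lambda>x. indicator (- ball 0 R) x * norm (f x)))"
      unfolding M_def using s R h by (intro lnorm_local_shift_diff) auto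
    also have "\<dots> \<le> ennreal M * (ennreal L * (ennreal (1 / ?w) * ?Y) + ennreal (1 / broken_power (A1, A2) R) * ?X)"
      by (intro mult_left_mono add_mono 1 2) auto
    also have "\<dots> \<le> ennreal M * (ennreal (L + 1) * (ennreal (1 / ?w) * ?Y) + ennreal (L + 1) * (ennreal (1 / broken_power (A1, A2) R) * ?X))"
    proof -
      have "ennreal L \<le> ennreal (L + 1)" "1 \<le> ennreal (L + 1)" using pc by (auto intro!: ennreal_leI)
      then show ?thesis
        using mult_right_mono[of 1 "ennreal (L + 1)" "ennreal (1 / broken_power (A1, A2) R) * ?X"]
        by (intro mult_left_mono add_mono mult_right_mono) auto
    qed
    also have "\<dots> = ennreal (M * (L + 1)) * (ennreal (1 / ?w) * ?Y + ennreal (1 / broken_power (A1, A2) R) * ?X)"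
    proof -
      have "ennreal (M * (L + 1)) = ennreal M * ennreal (L + 1)" using pc by (intro ennreal_mult) auto
      then show ?thesis by (simp only: distrib_left mult.assoc)
    qed
    finally show "lnorm s (\<lambda>x. norm (f x)) \<le> ennreal (M * (L + 1)) * (ennreal (1 / ?w) * ?Y + ennreal (1 / broken_power (A1, A2) R) * ?X)" .
  qed
qed

section \<open>The estimate on the frequency side\<close>

lemma broken_power_eq_0_iff [simp]: "broken_power C x = 0 \<longleftrightarrow> x = 0"
  using broken_power_pos[of x C] by (cases "x = 0") auto

text \<open>The power 1 / t turns the exponents into a / t and b / t, which must enclose the
  dimension. For t = 0 the norm is a supremum; it is finite because the weight is 1 near the origin
  (a = 0) and at least 1 outside the unit ball.\<close>

lemma lnorm_inverse_broken_power:
  fixes a b t :: real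
  assumes t: "0 \<le> t" and a: "0 \<le> a" "a < DIM('a) * t \<or> a = 0 \<and> t = 0" and b: "DIM('a) * t < b"
  shows "lnorm t (\<lambda>x::'a::euclidean_space. inverse (broken_power (a, b) x)) < \<infinity>"
proof (cases "t = 0")
  case True
  have "inverse (broken_power (a, b) x) \<le> 1" for x :: 'a
    using ge_one_powr_ge_zero[of "norm x" b] a b True by (auto simp: broken_power_def inverse_le_1_iff)
  then have "lnorm t (\<lambda>x::'a. inverse (broken_power (a, b) x)) \<le> ennreal 1"
    unfolding True by (subst lnorm_0_le_iff) auto
  also have "\<dots> < \<infinity>" by simp
  finally show ?thesis .
next
  case False
  then have t: "0 < t" using t by simp
  have "(inverse (broken_power (a, b) x)) powr (1 / t) = inverse (broken_power (a / t, b / t) x)" for x :: 'a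
    by (simp add: broken_power_def inverse_powr powr_powr)
  then have "lnorm t (\<lambda>x::'a. inverse (broken_power (a, b) x)) =
      ennreal_powr (\<integral>\<^sup>+ x. ennreal (inverse (broken_power (a / t, b / t) (x::'a))) \<partial>lborel) t"
    using False by (simp add: lnorm_def)
  moreover have "(\<integral>\<^sup>+ x. ennreal (inverse (broken_power (a / t, b / t) (x::'a))) \<partial>lborel) < \<infinity>"
    using t a b by (intro nn_integral_inverse_broken_power) (auto simp: field_simps)
  ultimately show ?thesis
    by (cases "(\<integral>\<^sup>+ x. ennreal (inverse (broken_power (a / t, b / t) (x::'a))) \<partial>lborel)") auto
qed

text \<open>The logarithmic form of the next lemma, with r = ln (norm y) and q = ln S.\<close>

lemma min_power_exponent_le:
  fixes A1 A2 a m r q :: real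
  assumes A: "0 < A1" "0 < A2" "A1 \<le> a" "A1 \<le> m" "A2 \<le> m"
  shows "m * min 0 r \<le> (if q < 0 then A2 * q else a * q) + (if r < 0 then 0 else - min a A2 * r)
    + (if r - q < 0 then A1 else A2) * (r - q)"
proof -
  define k where "k = min a A2"
  have k: "k \<le> a" "k \<le> A2" "0 < k" using A by (auto simp: k_def)
  note mnn = mult_nonneg_nonneg
  consider "r < 0" "q < 0" "r - q < 0" | "r < 0" "q < 0" "0 \<le> r - q" | "r < 0" "0 \<le> q"
    | "0 \<le> r" "q < 0" | "0 \<le> r" "0 \<le> q" "r - q < 0" | "0 \<le> r" "0 \<le> q" "0 \<le> r - q" by linarith
  then have "m * min 0 r \<le> (if q < 0 then A2 * q else a * q) + (if r < 0 then 0 else - k * r)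
    + (if r - q < 0 then A1 else A2) * (r - q)"
  proof cases
    case 1
    have "A2 * q + A1 * (r - q) - m * r = (m - A2) * (- q) + (m - A1) * (q - r)" by (simp add: algebra_simps)
    moreover have "0 \<le> (m - A2) * (- q)" "0 \<le> (m - A1) * (q - r)" by (rule mnn; use 1 A in linarith)+
    ultimately show ?thesis using 1 by simp
  next
    case 2
    have "A2 * q + A2 * (r - q) - m * r = (m - A2) * (- r)" by (simp add: algebra_simps)
    moreover have "0 \<le> (m - A2) * (- r)" by (rule mnn; use 2 A in linarith)
    ultimately show ?thesis using 2 by simp
  next
    case 3
    have "a * q + A1 * (r - q) - m * r = (a - A1) * q + (m - A1) * (- r)" by (simp add: algebra_simps)
    moreover have "0 \<le> (a - A1) * q" "0 \<le> (m - A1) * (- r)" by (rule mnn; use 3 A in linarith)+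
    ultimately show ?thesis using 3 by simp
  next
    case 4
    have "A2 * q - k * r + A2 * (r - q) = (A2 - k) * r" by (simp add: algebra_simps)
    moreover have "0 \<le> (A2 - k) * r" by (rule mnn; use 4 k in linarith)
    ultimately show ?thesis using 4 by simp
  next
    case 5
    \<comment> \<open>On the wedge 0 \<le> r < q the order of A1 and k decides which decomposition
      has nonnegative coefficients.\<close>
    have "0 \<le> a * q - k * r + A1 * (r - q)"
    proof (cases "A1 \<ge> k")
      case True
      have "a * q - k * r + A1 * (r - q) = (a - A1) * q + (A1 - k) * r" by (simp add: algebra_simps)
      moreover have "0 \<le> (a - A1) * q" "0 \<le> (A1 - k) * r" by (rule mnn; use 5 A True in linarith)+
      ultimately show ?thesis by linarith
    next
      case False
      have "a * q - k * r + A1 * (r - q) = (a - k) * q + (k - A1) * (q - r)" by (simp add: algebra_simps)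
      moreover have "0 \<le> (a - k) * q" "0 \<le> (k - A1) * (q - r)" by (rule mnn; use 5 k False in linarith)+
      ultimately show ?thesis by linarith
    qed
    then show ?thesis using 5 by simp
  next
    case 6
    have "a * q - k * r + A2 * (r - q) = (a - k) * q + (A2 - k) * (r - q)" by (simp add: algebra_simps)
    moreover have "0 \<le> (a - k) * q" "0 \<le> (A2 - k) * (r - q)" by (rule mnn; use 6 k in linarith)+
    ultimately show ?thesis using 6 by simp
  qed
  then show ?thesis unfolding k_def .
qed

text \<open>Separation of variables after the rescaling y = S x: a power of S factors out and leaves
  a profile independent of S, equal to 1 on the punctured unit ball. The exponent
  \<open>min a A2\<close> at infinity serves S on both sides of 1.\<close>

lemma min_power_over_broken_power_le:
  fixes y :: "'a::euclidean_space" and A1 A2 a S :: real and m :: nat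
  assumes A: "0 < A1" "0 < A2" "A1 \<le> a" "A1 \<le> m" "A2 \<le> m" and S: "0 < S"
  shows "(min 1 (norm y)) ^ m / broken_power (A1, A2) (y /\<^sub>R S) \<le>
    (if S < 1 then S powr A2 else S powr a) * inverse (broken_power (0, min a A2) y)"
proof (cases "y = 0")
  case False
  define r where "r = ln (norm y)"
  define q where "q = ln S"
  have Y: "norm y = exp r" using False by (simp add: r_def)
  have Sq: "S = exp q" using S by (simp add: q_def)
  have nS: "norm (y /\<^sub>R S) = exp (r - q)" using S by (simp add: Y Sq exp_diff exp_minus divide_inverse mult.commute)
  have w: "broken_power (A1, A2) (y /\<^sub>R S) = exp ((if r - q < 0 then A1 else A2) * (r - q))"
    unfolding broken_power_def nS by (simp add: powr_def)
  have g: "inverse (broken_power (0, min a A2) y) = exp (if r < 0 then 0 else - min a A2 * r)"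
    unfolding broken_power_def Y by (simp add: powr_def exp_minus)
  have P: "(if S < 1 then S powr A2 else S powr a) = exp (if q < 0 then A2 * q else a * q)"
    by (simp add: Sq powr_def)
  have mi: "(min 1 (norm y)) ^ m = exp (m * min 0 r)"
    by (simp add: Y min_def exp_of_nat_mult)
  have "exp (m * min 0 r) \<le> exp ((if q < 0 then A2 * q else a * q) + (if r < 0 then 0 else - min a A2 * r)
      + (if r - q < 0 then A1 else A2) * (r - q))"
    using min_power_exponent_le[OF A, of r q] by (simp only: exp_le_cancel_iff)
  then show ?thesis
    unfolding w g P mi by (subst pos_divide_le_eq) (simp_all only: exp_gt_zero exp_add)
qed (use A in simp)

text \<open>Dilation to the unit ball, whose indicator is dominated by an inverse weight of finite
  norm; this treats t = 0 and t > 0 alike.\<close>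

lemma lnorm_indicator_ball:
  fixes t :: real
  assumes t: "0 \<le> t"
  obtains N where "0 < N" "\<And>S. 0 < S \<Longrightarrow>
    lnorm t (indicator (ball (0::'a::euclidean_space) S)) \<le> ennreal (N * S powr (DIM('a) * t))"
proof -
  let ?I = "\<lambda>x::'a. inverse (broken_power (0, DIM('a) * t + 1) x)"
  have "lnorm t ?I < \<infinity>" using t by (intro lnorm_inverse_broken_power) (auto simp: less_le)
  then obtain c where c: "0 \<le> c" "lnorm t ?I = ennreal c" by (cases "lnorm t ?I") auto
  have [measurable]: "ball (0::'a) R \<in> sets borel" for R by simp
  have one: "lnorm t (indicator (ball (0::'a) 1)) \<le> ennreal c"
    unfolding c(2)[symmetric]
  proof (rule lnorm_mono_AE)
    show "AE x in lborel. 0 \<le> indicat_real (ball (0::'a) 1) x \<and> indicator (ball (0::'a) 1) x \<le> ?I x"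
      using AE_lborel_singleton[of "0::'a"]
      by eventually_elim (auto simp: indicator_def broken_power_def)
  qed (use t in auto)
  show ?thesis
  \<comment> \<open>c is only known to be nonnegative; c + 1 is a positive constant.\<close>
  proof (rule that[of "c + 1"])
    fix S :: real assume S: "0 < S"
    have "indicator (ball (0::'a) S) = (\<lambda>x. indicat_real (ball (0::'a) 1) (x /\<^sub>R S))"
      using S by (auto simp: indicator_def fun_eq_iff field_simps)
    then have "lnorm t (indicator (ball (0::'a) S)) = ennreal (S powr (DIM('a) * t)) * lnorm t (indicator (ball (0::'a) 1))"
      using t S lnorm_dilate[of "indicat_real (ball (0::'a) 1)" t S] by simp
    also have "\<dots> \<le> ennreal (S powr (DIM('a) * t)) * ennreal (c + 1)"
      using one c by (intro mult_left_mono order_trans[OF one] ennreal_leI) auto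
    also have "\<dots> = ennreal ((c + 1) * S powr (DIM('a) * t))"
      by (subst ennreal_mult[symmetric]) (use c in \<open>auto simp: mult.commute\<close>)
    finally show "lnorm t (indicator (ball (0::'a) S)) \<le> ennreal ((c + 1) * S powr (DIM('a) * t))" .
  qed (use c in auto)
qed

text \<open>The factor S^(d t) comes from the indicator of the ball in the first Hoelder inequality,
  and it is exactly the Jacobian factor of the rescaling y = S x. If d t < a, the separated bound
  has finite norm. If a = d t, it fails to be integrable at infinity; for S \<ge> 1 the multiplier
  is then dropped, and the bare inverse weight has finite norm because A1 < d t < A2.\<close>

lemma lnorm_min_power_over_broken_power:
  fixes A1 A2 a t :: real and m :: nat
  assumes t: "0 \<le> t" and A: "0 < A1" "0 < A2" "A1 \<le> a" "A1 \<le> m" "A2 \<le> m"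
    and A2: "DIM('a) * t < A2" and a: "DIM('a) * t < a \<or> DIM('a) * t = a \<and> A1 < a"
  obtains N where "0 < N" "\<And>S. 0 < S \<Longrightarrow>
    ennreal (S powr (DIM('a) * t)) * lnorm t (\<lambda>x::'a::euclidean_space. (min 1 (S * norm x)) ^ m / broken_power (A1, A2) x)
      \<le> ennreal (N * (if S < 1 then S powr A2 else S powr a))"
proof -
  let ?v = "\<lambda>S (x::'a). (min 1 (S * norm x)) ^ m / broken_power (A1, A2) x"
  have scaled: "\<exists>c\<ge>0. \<forall>S>0. ennreal (S powr (DIM('a) * t)) * lnorm t (?v S) \<le> ennreal (c * (if S < 1 then S powr A2 else S powr b))"
    if b: "A1 \<le> b" "DIM('a) * t < b" for b
  proof -
    let ?I = "\<lambda>x::'a. inverse (broken_power (0, min b A2) x)"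
    have "lnorm t ?I < \<infinity>" using t b A2 by (intro lnorm_inverse_broken_power) (auto simp: less_le)
    then obtain c where c: "0 \<le> c" "lnorm t ?I = ennreal c" by (cases "lnorm t ?I") auto
    show ?thesis
    proof (intro exI[of _ c] conjI allI impI c(1))
      fix S :: real assume S: "0 < S"
      let ?P = "if S < 1 then S powr A2 else S powr b"
      have "ennreal (S powr (DIM('a) * t)) * lnorm t (?v S) = lnorm t (\<lambda>y. ?v S (y /\<^sub>R S))"
        using t S by (intro lnorm_dilate[symmetric]) auto
      also have "\<dots> \<le> lnorm t (\<lambda>y. ?P * ?I y)"
      proof (rule lnorm_mono)
        fix y :: 'a
        have eq: "S * norm (y /\<^sub>R S) = norm y" using S by simp
        show "?v S (y /\<^sub>R S) \<le> ?P * ?I y"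
          unfolding eq by (rule min_power_over_broken_power_le[OF A(1,2) b(1) A(4,5) S])
      qed (use t S in auto)
      also have "\<dots> = ennreal ?P * ennreal c"
        unfolding c(2)[symmetric] using t by (intro lnorm_cmult) auto
      also have "\<dots> = ennreal (c * ?P)"
        using c by (simp add: ennreal_mult[symmetric] mult.commute)
      finally show "ennreal (S powr (DIM('a) * t)) * lnorm t (?v S) \<le> ennreal (c * ?P)" .
    qed
  qed
  show ?thesis
  proof (cases "DIM('a) * t < a")
    case True
    then obtain c where c: "0 \<le> c" "\<forall>S>0. ennreal (S powr (DIM('a) * t)) * lnorm t (?v S) \<le> ennreal (c * (if S < 1 then S powr A2 else S powr a))"
      using scaled[OF A(3)] by blast
    show ?thesis
    proof (rule that[of "c + 1"])
      fix S :: real assume "0 < S"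
      with c(2) have "ennreal (S powr (DIM('a) * t)) * lnorm t (?v S) \<le> ennreal (c * (if S < 1 then S powr A2 else S powr a))" by blast
      also have "\<dots> \<le> ennreal ((c + 1) * (if S < 1 then S powr A2 else S powr a))"
        by (intro ennreal_leI mult_right_mono) auto
      finally show "ennreal (S powr (DIM('a) * t)) * lnorm t (?v S) \<le> ennreal ((c + 1) * (if S < 1 then S powr A2 else S powr a))" .
    qed (use c in auto)
  next
    case False
    then have eq: "DIM('a) * t = a" "A1 < DIM('a) * t" using a by auto
    \<comment> \<open>For S < 1 the bound S^A2 does not involve the exponent a, so the noncritical
      estimate applies with any exponent that is at least A1 and exceeds d t;
      \<open>max A1 A2\<close> is one.\<close>
    obtain c where c: "0 \<le> c" "\<forall>S>0. ennreal (S powr (DIM('a) * t)) * lnorm t (?v S) \<le> ennreal (c * (if S < 1 then S powr A2 else S powr (max A1 A2)))"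
      using scaled[of "max A1 A2"] A2 by (auto simp: less_max_iff_disj)
    let ?I = "\<lambda>x::'a. inverse (broken_power (A1, A2) x)"
    have "lnorm t ?I < \<infinity>" using t A2 eq A by (intro lnorm_inverse_broken_power) auto
    then obtain c' where c': "0 \<le> c'" "lnorm t ?I = ennreal c'" by (cases "lnorm t ?I") auto
    show ?thesis
    proof (rule that[of "c + c' + 1"])
      fix S :: real assume S: "0 < S"
      let ?P = "if S < 1 then S powr A2 else S powr a"
      have "\<exists>c''\<le>c + c' + 1. ennreal (S powr (DIM('a) * t)) * lnorm t (?v S) \<le> ennreal (c'' * ?P)"
      proof (cases "S < 1")
        case True
        then show ?thesis using c c' S by (intro exI[of _ c]) auto
      next
        case False
        have "lnorm t (?v S) \<le> lnorm t ?I"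
        proof (rule lnorm_mono)
          fix x :: 'a
          have "(min 1 (S * norm x)) ^ m \<le> 1" using S by (intro power_le_one) auto
          then have "?v S x \<le> 1 / broken_power (A1, A2) x" by (intro divide_right_mono) auto
          then show "?v S x \<le> ?I x" by (simp add: divide_inverse)
        qed (use t S in auto)
        then have "ennreal (S powr (DIM('a) * t)) * lnorm t (?v S) \<le> ennreal (S powr a) * ennreal c'"
          unfolding c'(2)[symmetric] eq(1) by (intro mult_left_mono) auto
        also have "\<dots> = ennreal (c' * ?P)"
          using c' False by (simp add: ennreal_mult[symmetric] mult.commute)
        finally show ?thesis using c by (intro exI[of _ c']) auto
      qed
      then obtain c'' where c'': "c'' \<le> c + c' + 1" "ennreal (S powr (DIM('a) * t)) * lnorm t (?v S) \<le> ennreal (c'' * ?P)" by blast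
      note c''(2)
      also have "ennreal (c'' * ?P) \<le> ennreal ((c + c' + 1) * ?P)"
        using c''(1) by (intro ennreal_leI mult_right_mono) auto
      finally show "ennreal (S powr (DIM('a) * t)) * lnorm t (?v S) \<le> ennreal ((c + c' + 1) * ?P)" .
    qed (use c c' in auto)
  qed
qed

text \<open>Hoelder on the ball (1 - s = t + 1/2), the Bessel inequality for \<open>k\<close>, whose
  transform is the m-fold difference of the transform of f, and Hoelder against the inverse weight
  (1/2 = s + t). The two norms of index t combine to the power of S.\<close>

lemma frequency_side_estimate:
  fixes s A1 A2 B1 B2 a :: real
  defines "\<delta> \<equiv> DIM('a) * (1 / 2 - s)"
  assumes s: "0 \<le> s" "s \<le> 1 / 2" and A: "0 < A1" "0 < A2" and B: "0 < B1" "0 < B2"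
    and A2: "\<delta> < A2" and a: "A1 \<le> a" "\<delta> < a \<or> \<delta> = a \<and> A1 < a"
  obtains C where "0 < C" "\<And>(f::'a::euclidean_space \<Rightarrow> complex) (S::real). integrable lborel f \<Longrightarrow> 0 < S \<Longrightarrow>
    lnorm (1 - s) (\<lambda>\<xi>. norm (fourier f \<xi>)) \<le> ennreal C *
      (ennreal (if S < 1 then S powr A2 else S powr a) * lnorm s (\<lambda>x. broken_power (A1, A2) x * norm (f x))
       + ennreal (1 / broken_power (B1, B2) S) * lnorm (1 - s) (\<lambda>\<xi>. broken_power (B1, B2) \<xi> * norm (fourier f \<xi>)))"
proof -
  define t where "t = 1 / 2 - s"
  have t: "0 \<le> t" "t \<le> 1 / 2" using s by (auto simp: t_def)
  have dt: "\<delta> = DIM('a) * t" by (simp add: \<delta>_def t_def)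
  define m where "m = nat \<lceil>max A1 A2\<rceil>"
  have m: "A1 \<le> m" "A2 \<le> m" "0 < m" using A by (auto simp: m_def) linarith+
  obtain H where H: "0 < H" "\<And>g::'a \<Rightarrow> complex. integrable lborel g \<Longrightarrow>
      lnorm (1 / 2) (\<lambda>x. norm (fourier g x)) \<le> ennreal H * lnorm (1 - 1 / 2) (\<lambda>x. norm (g x))"
    using hausdorff_young_fourier[of "1 / 2"] by auto
  obtain N1 where N1: "0 < N1" "\<And>S. 0 < S \<Longrightarrow> lnorm t (indicator (ball (0::'a) S)) \<le> ennreal (N1 * S powr (DIM('a) * t))"
    using lnorm_indicator_ball[OF t(1)] by blast
  obtain N2 where N2: "0 < N2" "\<And>S. 0 < S \<Longrightarrow>
      ennreal (S powr (DIM('a) * t)) * lnorm t (\<lambda>x::'a. (min 1 (S * norm x)) ^ m / broken_power (A1, A2) x)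
      \<le> ennreal (N2 * (if S < 1 then S powr A2 else S powr a))"
    using lnorm_min_power_over_broken_power[where 'a='a, OF t(1) A a(1) m(1,2)] A2 a(2) unfolding dt by blast
  define M where "M = 4 * (1 + 4 ^ m * real m)"
  define L where "L = 2 * H * (4 * pi) ^ m * 2 * N1 * N2"
  have pc: "0 < M" "0 < L" using H N1 N2 by (auto simp: M_def L_def add_pos_nonneg)
  show ?thesis
  proof (rule that[of "M * (L + 1)"])
    show "0 < M * (L + 1)" using pc by simp
    fix f :: "'a \<Rightarrow> complex" and S :: real assume f: "integrable lborel f" and S: "0 < S"
    have [measurable]: "f \<in> borel_measurable borel" using f by auto
    have [measurable]: "ball (0::'a) S \<in> sets borel" by simp
    obtain h :: 'a where h: "norm h = 2 * S" using vector_choose_size[of "2 * S"] S by auto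
    define k where "k x = f x * (1 - cis (- 2 * pi * (x \<bullet> h))) ^ m" for x
    have k: "integrable lborel k" and Dk: "(shift_diff h ^^ m) (fourier f) = fourier k"
      unfolding k_def[abs_def] using shift_diff_fourier[OF f] by auto
    have [measurable]: "k \<in> borel_measurable borel" using k by auto
    let ?v = "\<lambda>x::'a. (min 1 (S * norm x)) ^ m / broken_power (A1, A2) x"
    let ?P = "if S < 1 then S powr A2 else S powr a"
    let ?Y = "lnorm (1 - s) (\<lambda>\<xi>. broken_power (B1, B2) \<xi> * norm (fourier f \<xi>))"
    let ?X = "lnorm s (\<lambda>x. broken_power (A1, A2) x * norm (f x))"
    have v0: "0 \<le> ?v x" for x using S by simp
    have kle: "lnorm (1 / 2) (\<lambda>x. norm (k x)) \<le> ennreal ((4 * pi) ^ m) * (2 * (?X * lnorm t ?v))"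
    proof -
      have "lnorm (1 / 2) (\<lambda>x. norm (k x)) \<le> lnorm (1 / 2) (\<lambda>x. (4 * pi) ^ m * ((broken_power (A1, A2) x * norm (f x)) * ?v x))"
      proof (rule lnorm_mono)
        fix x
        define V where "V = ?v x"
        have "norm (1 - cis (- 2 * pi * (x \<bullet> h))) \<le> 4 * pi * min 1 (S * norm x)"
          by (rule norm_one_minus_cis_inner_le[OF h]) (simp add: abs_mult inner_commute)
        then have "norm (1 - cis (- 2 * pi * (x \<bullet> h))) ^ m \<le> (4 * pi * min 1 (S * norm x)) ^ m"
          by (intro power_mono) auto
        also have "\<dots> = (4 * pi) ^ m * (min 1 (S * norm x)) ^ m" by (rule power_mult_distrib)
        also have "(min 1 (S * norm x)) ^ m = broken_power (A1, A2) x * V"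
        proof (cases "x = 0")
          case False
          then show ?thesis unfolding V_def using broken_power_pos[OF False, of "(A1, A2)"] by simp
        qed (use m in simp)
        finally have "norm (f x) * norm (1 - cis (- 2 * pi * (x \<bullet> h))) ^ m \<le> norm (f x) * ((4 * pi) ^ m * (broken_power (A1, A2) x * V))"
          by (intro mult_left_mono) auto
        then show "norm (k x) \<le> (4 * pi) ^ m * ((broken_power (A1, A2) x * norm (f x)) * ?v x)"
          unfolding V_def[symmetric] by (simp add: k_def norm_mult norm_power mult_ac)
      qed auto
      also have "\<dots> = ennreal ((4 * pi) ^ m) * lnorm (1 / 2) (\<lambda>x. (broken_power (A1, A2) x * norm (f x)) * ?v x)"
      proof (rule lnorm_cmult)
        show "0 \<le> (broken_power (A1, A2) x * norm (f x)) * ?v x" for x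
          by (intro mult_nonneg_nonneg v0) auto
      qed auto
      also have "\<dots> \<le> ennreal ((4 * pi) ^ m) * (2 * (?X * lnorm t ?v))"
      proof (rule mult_left_mono)
        have st: "s + t = 1 / 2" by (simp add: t_def)
        show "lnorm (1 / 2) (\<lambda>x. (broken_power (A1, A2) x * norm (f x)) * ?v x) \<le> 2 * (?X * lnorm t ?v)"
          unfolding st[symmetric] by (rule lnorm_holder) (use s t v0 in auto)
      qed simp
      finally show ?thesis .
    qed
    have 1: "lnorm (1 - s) (\<lambda>\<xi>. indicator (ball 0 S) \<xi> * norm (fourier k \<xi>)) \<le> ennreal L * (ennreal ?P * ?X)"
    proof -
      have "lnorm (1 - s) (\<lambda>\<xi>. indicator (ball 0 S) \<xi> * norm (fourier k \<xi>)) \<le>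
          2 * (lnorm t (indicator (ball (0::'a) S)) * lnorm (1 / 2) (\<lambda>\<xi>. norm (fourier k \<xi>)))"
        using lnorm_holder[of "indicat_real (ball (0::'a) S)" "\<lambda>\<xi>. norm (fourier k \<xi>)" t "1 / 2"] t by (simp add: t_def)
      also have "\<dots> \<le> 2 * (ennreal (N1 * S powr (DIM('a) * t)) * (ennreal H * (ennreal ((4 * pi) ^ m) * (2 * (?X * lnorm t ?v)))))"
      proof (intro mult_left_mono mult_mono)
        show "lnorm t (indicator (ball (0::'a) S)) \<le> ennreal (N1 * S powr (DIM('a) * t))" by (rule N1(2)[OF S])
        have "lnorm (1 / 2) (\<lambda>x. norm (fourier k x)) \<le> ennreal H * lnorm (1 / 2) (\<lambda>x. norm (k x))"
          using H(2)[OF k] by simp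
        also have "\<dots> \<le> ennreal H * (ennreal ((4 * pi) ^ m) * (2 * (?X * lnorm t ?v)))"
          by (intro mult_left_mono kle) auto
        finally show "lnorm (1 / 2) (\<lambda>x. norm (fourier k x)) \<le> ennreal H * (ennreal ((4 * pi) ^ m) * (2 * (?X * lnorm t ?v)))" .
      qed auto
      also have "\<dots> = ennreal (2 * H * (4 * pi) ^ m * 2 * N1) * (ennreal (S powr (DIM('a) * t)) * lnorm t ?v * ?X)"
        using H N1 by (simp add: ennreal_mult mult_ac)
      also have "\<dots> \<le> ennreal (2 * H * (4 * pi) ^ m * 2 * N1) * (ennreal (N2 * ?P) * ?X)"
        by (intro mult_left_mono mult_right_mono N2(2)[OF S]) auto
      also have "\<dots> = ennreal L * (ennreal ?P * ?X)"
        using H N1 N2 by (simp add: L_def ennreal_mult mult_ac)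
      finally show ?thesis .
    qed
    have 2: "lnorm (1 - s) (\<lambda>\<xi>. indicator (- ball 0 S) \<xi> * norm (fourier f \<xi>)) \<le> ennreal (1 / broken_power (B1, B2) S) * ?Y"
      using s B S by (intro lnorm_outside_ball_le) auto
    have "lnorm (1 - s) (\<lambda>\<xi>. norm (fourier f \<xi>)) \<le> ennreal M *
        (lnorm (1 - s) (\<lambda>\<xi>. indicator (ball 0 S) \<xi> * norm (fourier k \<xi>)) + lnorm (1 - s) (\<lambda>\<xi>. indicator (- ball 0 S) \<xi> * norm (fourier f \<xi>)))"
      unfolding M_def Dk[symmetric] using s S h by (intro lnorm_local_shift_diff) auto
    also have "\<dots> \<le> ennreal M * (ennreal L * (ennreal ?P * ?X) + ennreal (1 / broken_power (B1, B2) S) * ?Y)"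
      by (intro mult_left_mono add_mono 1 2) auto
    also have "\<dots> \<le> ennreal M * (ennreal (L + 1) * (ennreal ?P * ?X) + ennreal (L + 1) * (ennreal (1 / broken_power (B1, B2) S) * ?Y))"
    proof -
      have "ennreal L \<le> ennreal (L + 1)" "1 \<le> ennreal (L + 1)" using pc by (auto intro!: ennreal_leI)
      then show ?thesis
        using mult_right_mono[of 1 "ennreal (L + 1)" "ennreal (1 / broken_power (B1, B2) S) * ?Y"]
        by (intro mult_left_mono add_mono mult_right_mono) auto
    qed
    also have "\<dots> = ennreal (M * (L + 1)) * (ennreal ?P * ?X + ennreal (1 / broken_power (B1, B2) S) * ?Y)"
    proof -
      have "ennreal (M * (L + 1)) = ennreal M * ennreal (L + 1)" using pc by (intro ennreal_mult) auto
      then show ?thesis by (simp only: distrib_left mult.assoc)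
    qed
    finally show "lnorm (1 - s) (\<lambda>\<xi>. norm (fourier f \<xi>)) \<le> ennreal (M * (L + 1)) * (ennreal ?P * ?X + ennreal (1 / broken_power (B1, B2) S) * ?Y)" .
  qed
qed

text \<open>R and S are the scales at which half of the norm of f and of its transform is concentrated;
  both estimates together exclude that they are small simultaneously.\<close>

lemma broken_power_scales:
  fixes A1 A2 B1 B2 a R S :: real
  assumes A: "0 < A1" "0 < A2" and B: "0 < B1" "0 < B2" and AB: "B1 \<le> A2" "A1 * a \<le> B2\<^sup>2"
    and R: "0 < R" and S: "0 < S"
    and le: "broken_power (B1, B2) (1 / R) \<le>
      (if S < 1 then S powr A2 else S powr a) * broken_power (B1, B2) S * broken_power (A1, A2) R"
  shows "1 \<le> broken_power (A1, A2) R * broken_power (B1, B2) S"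
proof -
  define r where "r = ln R"
  define q where "q = ln S"
  have Re: "R = exp r" and Se: "S = exp q" using R S by (simp_all add: r_def q_def)
  have wA: "broken_power (A1, A2) R = exp ((if r < 0 then A1 else A2) * r)"
    by (simp add: broken_power_def Re powr_def)
  have wB: "broken_power (B1, B2) S = exp ((if q < 0 then B1 else B2) * q)"
    by (simp add: broken_power_def Se powr_def)
  have "1 / R = exp (- r)" by (simp add: Re exp_minus divide_inverse)
  then have wR: "broken_power (B1, B2) (1 / R) = exp ((if - r < 0 then B1 else B2) * - r)"
    by (simp add: broken_power_def powr_def)
  have P: "(if S < 1 then S powr A2 else S powr a) = exp (if q < 0 then A2 * q else a * q)"
    by (simp add: Se powr_def)
  have le': "(if - r < 0 then B1 else B2) * - r \<le> (if q < 0 then A2 * q else a * q) + (if q < 0 then B1 else B2) * q + (if r < 0 then A1 else A2) * r"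
    using le unfolding wA wB wR P by (simp only: exp_add[symmetric] exp_le_cancel_iff)
  note mnn = mult_nonneg_nonneg
  have "0 \<le> (if r < 0 then A1 else A2) * r + (if q < 0 then B1 else B2) * q"
  proof -
    consider "r \<le> 0" "q < 0" | "0 < r" "0 \<le> q" | "r \<le> 0" "0 \<le> q" | "0 < r" "q < 0" by linarith
    then show ?thesis
    proof cases
      case 1
      \<comment> \<open>The hypothesis bounds A1 r + B1 q from below by - B2 r - A2 q \<ge> 0, so
        the scales cannot both be small.\<close>
      then show ?thesis using le' mnn[of B2 "- r"] mnn[of A2 "- q"] A B by (cases "r = 0") auto
    next
      case 2
      then show ?thesis using mnn[of A2 r] mnn[of B2 q] A B by simp
    next
      case 3
      then have l: "- B2 * r \<le> (a + B2) * q + A1 * r" using le' by (cases "r = 0") (auto simp: algebra_simps)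
      then have "0 \<le> (a + B2) * q + (A1 + B2) * r" by (simp add: algebra_simps)
      \<comment> \<open>The hypothesis says R^(-(A1 + B2)) \<le> S^(a + B2). Multiplied by A1 and
        corrected by (B2^2 - A1 a) q \<ge> 0 it becomes A1 + B2 times the claim; this is where A1 a
        \<le> B2^2 enters.\<close>
      then have "0 \<le> A1 * ((a + B2) * q + (A1 + B2) * r)" using A by (intro mnn) auto
      moreover have "0 \<le> (B2\<^sup>2 - A1 * a) * q" using 3 AB by (intro mnn) auto
      moreover have "A1 * ((a + B2) * q + (A1 + B2) * r) + (B2\<^sup>2 - A1 * a) * q = (A1 + B2) * (A1 * r + B2 * q)"
        by (simp add: algebra_simps power2_eq_square)
      ultimately have "0 \<le> (A1 + B2) * (A1 * r + B2 * q)" by linarith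
      then have "0 \<le> A1 * r + B2 * q" using A B by (simp add: zero_le_mult_iff)
      then show ?thesis using 3 by (cases "r = 0") auto
    next
      case 4
      then have "0 \<le> (A2 + B1) * (r + q)" using le' by (simp add: algebra_simps)
      then have "0 \<le> r + q" using A B by (simp add: zero_le_mult_iff)
      \<comment> \<open>The claim A2 r + B1 q \<ge> 0 differs from B1 (r + q) \<ge> 0 by the surplus
        (A2 - B1) r, nonnegative because B1 \<le> A2.\<close>
      then have "0 \<le> B1 * (r + q)" by (rule mnn[rotated]) (use B in simp)
      moreover have "0 \<le> (A2 - B1) * r" by (rule mnn; use 4 AB in linarith)
      ultimately have "0 \<le> B1 * (r + q) + (A2 - B1) * r" by (rule add_nonneg_nonneg)
      then show ?thesis using 4 by (simp add: algebra_simps)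
    qed
  qed
  then show ?thesis unfolding wA wB by (simp flip: exp_add)
qed

lemma ennreal_mult_add_mult:
  assumes "0 \<le> c" "0 \<le> p" "0 \<le> q" "0 \<le> x" "0 \<le> y"
  shows "ennreal c * (ennreal p * ennreal x + ennreal q * ennreal y) = ennreal (c * (p * x + q * y))"
  using assms by (simp add: ennreal_mult ennreal_plus)

text \<open>\<open>a\<close> is the power of S lost on the frequency side. It is kept as a parameter
  because the three regimes of the theorem differ only in its value: \<open>\<delta>\<close>,
  \<open>A1\<close> or \<open>B2\<^sup>2 / A1\<close>.\<close>

theorem uncertainty_sufficient:
  fixes s A1 A2 B1 B2 a :: real
  defines "\<delta> \<equiv> DIM('a) * (1 / 2 - s)"
  assumes s: "0 \<le> s" "s \<le> 1 / 2" and A: "0 < A1" "0 < A2" and B: "0 < B1" "0 < B2"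
    and A2: "\<delta> < A2" and AB: "B1 \<le> A2"
    and a: "A1 \<le> a" "\<delta> < a \<or> \<delta> = a \<and> A1 < a" "A1 * a \<le> B2\<^sup>2"
  obtains K where "0 < K" "\<And>f::'a::euclidean_space \<Rightarrow> complex. integrable lborel f \<Longrightarrow>
    lnorm s (\<lambda>x. norm (f x)) * lnorm (1 - s) (\<lambda>\<xi>. norm (fourier f \<xi>)) \<le>
    ennreal K * (lnorm s (\<lambda>x. broken_power (A1, A2) x * norm (f x))
      * lnorm (1 - s) (\<lambda>\<xi>. broken_power (B1, B2) \<xi> * norm (fourier f \<xi>)))"
proof -
  obtain C1 where C1: "0 < C1" "\<And>(f::'a \<Rightarrow> complex) (R::real). integrable lborel f \<Longrightarrow> 0 < R \<Longrightarrow>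
    lnorm s (\<lambda>x. norm (f x)) \<le> ennreal C1 *
      (ennreal (1 / broken_power (B1, B2) (1 / R)) * lnorm (1 - s) (\<lambda>\<xi>. broken_power (B1, B2) \<xi> * norm (fourier f \<xi>))
       + ennreal (1 / broken_power (A1, A2) R) * lnorm s (\<lambda>x. broken_power (A1, A2) x * norm (f x)))"
    using space_side_estimate[OF s A B] by blast
  obtain C2 where C2: "0 < C2" "\<And>(f::'a \<Rightarrow> complex) (S::real). integrable lborel f \<Longrightarrow> 0 < S \<Longrightarrow>
    lnorm (1 - s) (\<lambda>\<xi>. norm (fourier f \<xi>)) \<le> ennreal C2 *
      (ennreal (if S < 1 then S powr A2 else S powr a) * lnorm s (\<lambda>x. broken_power (A1, A2) x * norm (f x))
       + ennreal (1 / broken_power (B1, B2) S) * lnorm (1 - s) (\<lambda>\<xi>. broken_power (B1, B2) \<xi> * norm (fourier f \<xi>)))"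
    using frequency_side_estimate[where 'a='a, OF s A B A2[unfolded \<delta>_def] a(1) a(2)[unfolded \<delta>_def]] by blast
  show ?thesis
  proof (rule that[of "4 * C1 * C2"])
    show "0 < 4 * C1 * C2" using C1 C2 by simp
    fix f :: "'a \<Rightarrow> complex" assume f: "integrable lborel f"
    have [measurable]: "f \<in> borel_measurable borel" using f by auto
    define F where "F = lnorm s (\<lambda>x. norm (f x))"
    define G where "G = lnorm (1 - s) (\<lambda>\<xi>. norm (fourier f \<xi>))"
    define X where "X = lnorm s (\<lambda>x. broken_power (A1, A2) x * norm (f x))"
    define Y where "Y = lnorm (1 - s) (\<lambda>\<xi>. broken_power (B1, B2) \<xi> * norm (fourier f \<xi>))"
    \<comment> \<open>The weight vanishes only at the origin, which is a null set.\<close>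
    have X0: "F = 0" if "X = 0"
      unfolding F_def
    proof (rule lnorm_AE_0)
      have "AE x in lborel. broken_power (A1, A2) x * norm (f x) = 0"
        using that s unfolding X_def by (intro lnorm_eq_0_AE) auto
      then show "AE x in lborel. norm (f x) = 0"
        using AE_lborel_singleton[of "0::'a"]
        by eventually_elim simp
    qed (use s in auto)
    have Y0: "G = 0" if "Y = 0"
      unfolding G_def
    proof (rule lnorm_AE_0)
      have "AE x in lborel. broken_power (B1, B2) x * norm (fourier f x) = 0"
        using that s unfolding Y_def by (intro lnorm_eq_0_AE) auto
      then show "AE x in lborel. norm (fourier f x) = 0"
        using AE_lborel_singleton[of "0::'a"]
        by eventually_elim simp
    qed (use s in auto)
    have "F * G \<le> ennreal (4 * C1 * C2) * (X * Y)"
    proof (cases "F = 0 \<or> G = 0")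
      case True
      then show ?thesis by auto
    next
      case False
      then have nz: "F \<noteq> 0" "G \<noteq> 0" "X \<noteq> 0" "Y \<noteq> 0" using X0 Y0 by auto
      show ?thesis
      proof (cases "X = \<top> \<or> Y = \<top>")
        case True
        then have "X * Y = \<top>" using nz by (auto simp: ennreal_mult_top ennreal_top_mult)
        then show ?thesis using C1 C2 by (simp add: ennreal_mult_top)
      next
        case False
        obtain x where x: "X = ennreal x" "0 < x" using False nz by (cases X) (auto simp: less_le)
        obtain y where y: "Y = ennreal y" "0 < y" using False nz by (cases Y) (auto simp: less_le)
        have Fle: "F \<le> ennreal (C1 * (y / broken_power (B1, B2) (1 / R) + x / broken_power (A1, A2) R))" if "0 < R" for R :: real
        proof -
          have "F \<le> ennreal C1 * (ennreal (1 / broken_power (B1, B2) (1 / R)) * ennreal y + ennreal (1 / broken_power (A1, A2) R) * ennreal x)"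
            using C1(2)[OF f that] unfolding F_def[symmetric] X_def[symmetric] Y_def[symmetric] x(1) y(1) .
          also have "\<dots> = ennreal (C1 * (1 / broken_power (B1, B2) (1 / R) * y + 1 / broken_power (A1, A2) R * x))"
            using C1(1) x(2) y(2) by (intro ennreal_mult_add_mult) auto
          finally show ?thesis by simp
        qed
        have Gle: "G \<le> ennreal (C2 * ((if S < 1 then S powr A2 else S powr a) * x + y / broken_power (B1, B2) S))" if "0 < S" for S :: real
        proof -
          have "G \<le> ennreal C2 * (ennreal (if S < 1 then S powr A2 else S powr a) * ennreal x + ennreal (1 / broken_power (B1, B2) S) * ennreal y)"
            using C2(2)[OF f that] unfolding G_def[symmetric] X_def[symmetric] Y_def[symmetric] x(1) y(1) .
          also have "\<dots> = ennreal (C2 * ((if S < 1 then S powr A2 else S powr a) * x + 1 / broken_power (B1, B2) S * y))"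
            using C2(1) x(2) y(2) by (intro ennreal_mult_add_mult) auto
          finally show ?thesis by simp
        qed
        obtain \<phi> where \<phi>: "F = ennreal \<phi>" "0 < \<phi>" using nz Fle[of 1] by (cases F) (auto simp: less_le top_unique)
        obtain \<gamma> where \<gamma>: "G = ennreal \<gamma>" "0 < \<gamma>" using nz Gle[of 1] by (cases G) (auto simp: less_le top_unique)
        \<comment> \<open>R and S are chosen so that in each estimate the term from outside the ball
          is exactly half of the left side. That half is absorbed, and the term from inside the ball
          has to carry the other half.\<close>
        obtain R :: real where R: "0 < R" "broken_power (A1, A2) R = 2 * C1 * x / \<phi>"
          using broken_power_surj[OF A, of "2 * C1 * x / \<phi>"] C1 x \<phi> by auto
        obtain S :: real where S: "0 < S" "broken_power (B1, B2) S = 2 * C2 * y / \<gamma>"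
          using broken_power_surj[OF B, of "2 * C2 * y / \<gamma>"] C2 y \<gamma> by auto
        let ?wR = "broken_power (B1, B2) (1 / R)"
        let ?P = "if S < 1 then S powr A2 else S powr a"
        have wR: "0 < ?wR" using R by (intro broken_power_pos) simp
        have P: "0 \<le> ?P" by simp
        have nn: "0 \<le> C1 * (y / ?wR + x / broken_power (A1, A2) R)"
          using C1 x y by (intro mult_nonneg_nonneg add_nonneg_nonneg divide_nonneg_nonneg) auto
        have "\<phi> \<le> C1 * (y / ?wR + x / broken_power (A1, A2) R)"
          using Fle[OF R(1)] unfolding \<phi>(1) ennreal_le_iff[OF nn] .
        also have "\<dots> = C1 * y / ?wR + \<phi> / 2"
          using C1 x \<phi> by (simp add: R(2) field_simps)
        finally have "\<phi> / 2 \<le> C1 * y / ?wR" by linarith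
        then have e1: "\<phi> * ?wR \<le> 2 * C1 * y" using wR by (simp add: field_simps)
        have nn: "0 \<le> C2 * (?P * x + y / broken_power (B1, B2) S)"
          using C2 x y P by (intro mult_nonneg_nonneg add_nonneg_nonneg divide_nonneg_nonneg) auto
        have "\<gamma> \<le> C2 * (?P * x + y / broken_power (B1, B2) S)"
          using Gle[OF S(1)] unfolding \<gamma>(1) ennreal_le_iff[OF nn] .
        also have "\<dots> = C2 * (?P * x) + \<gamma> / 2"
          using C2 y \<gamma> by (simp add: S(2) field_simps split del: if_split)
        finally have e2: "\<gamma> \<le> 2 * C2 * (?P * x)" by linarith
        \<comment> \<open>The product of the two remaining inequalities is rewritten by expressing x
          and y through the weights at R and S; then \<phi> and \<gamma> cancel, and a relation
          between R and S alone is left.\<close>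
        have "\<phi> * \<gamma> * ?wR = (\<phi> * ?wR) * \<gamma>" by simp
        also have "\<dots> \<le> (2 * C1 * y) * (2 * C2 * (?P * x))"
          using C1 y \<gamma> by (intro mult_mono[OF e1 e2]) auto
        also have "\<dots> = \<phi> * \<gamma> * (?P * broken_power (B1, B2) S * broken_power (A1, A2) R)"
          using \<phi> \<gamma> by (simp add: R(2) S(2) mult_ac split del: if_split)
        finally have "?wR \<le> ?P * broken_power (B1, B2) S * broken_power (A1, A2) R"
          using \<phi> \<gamma> by (subst (asm) mult_le_cancel_left_pos) auto
        then have "1 \<le> broken_power (A1, A2) R * broken_power (B1, B2) S"
          by (intro broken_power_scales[OF A B AB a(3) R(1) S(1)])
        \<comment> \<open>By the choice of R and S the product of the two weights is 4 C1 C2 x y /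
          (\<phi> \<gamma>), so the lower bound 1 is the claim.\<close>
        then have "\<phi> * \<gamma> \<le> 4 * C1 * C2 * (x * y)"
          using \<phi> \<gamma> unfolding R(2) S(2) by (simp add: field_simps)
        then show ?thesis
          using x y \<phi> \<gamma> C1 C2 by (simp flip: ennreal_mult add: ennreal_leI)
      qed
    qed
    then show "lnorm s (\<lambda>x. norm (f x)) * lnorm (1 - s) (\<lambda>\<xi>. norm (fourier f \<xi>)) \<le>
      ennreal (4 * C1 * C2) * (lnorm s (\<lambda>x. broken_power (A1, A2) x * norm (f x))
      * lnorm (1 - s) (\<lambda>\<xi>. broken_power (B1, B2) \<xi> * norm (fourier f \<xi>)))"
      by (simp add: F_def G_def X_def Y_def)
  qed
qed

section \<open>Test functions\<close>

text \<open>ln t \<le> t, and k t - c t^2 is at most k^2 / (4 c) by completing the square.\<close>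

lemma powr_mult_exp_le:
  fixes c k t :: real
  assumes "0 \<le> k" "0 < c" "0 \<le> t"
  shows "t powr k * exp (- c * t\<^sup>2) \<le> exp (k\<^sup>2 / (4 * c))"
proof (cases "t = 0")
  case False
  then have t: "0 < t" using assms by simp
  have "k * ln t \<le> k * t" using ln_bound[of t] t assms by (intro mult_left_mono) auto
  also have "k * t = c * t\<^sup>2 + k\<^sup>2 / (4 * c) - c * (t - k / (2 * c))\<^sup>2"
    using assms by (simp add: power2_eq_square field_simps)
  also have "\<dots> \<le> c * t\<^sup>2 + k\<^sup>2 / (4 * c)" using assms by simp
  finally have "k * ln t + - c * t\<^sup>2 \<le> k\<^sup>2 / (4 * c)" by simp
  moreover have "t powr k * exp (- c * t\<^sup>2) = exp (k * ln t + - c * t\<^sup>2)"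
    using t by (simp add: powr_def exp_add[symmetric])
  ultimately show ?thesis by simp
qed simp

lemma powr_gauss_le_inverse_broken_power:
  fixes b c \<beta> :: real
  assumes b: "0 \<le> b" and c: "0 < c" and \<beta>: "0 \<le> \<beta>"
  obtains C where "0 < C" "\<And>x::'a::euclidean_space. norm x powr b * gauss c x \<le> C * inverse (broken_power (0, \<beta>) x)"
proof -
  define C where "C = max 1 (exp ((b + \<beta>)\<^sup>2 / (4 * (pi * c))))"
  show ?thesis
  proof (rule that[of C])
    show "0 < C" by (simp add: C_def)
    fix x :: 'a
    consider "x = 0" | "x \<noteq> 0" "norm x < 1" | "1 \<le> norm x" by linarith
    then show "norm x powr b * gauss c x \<le> C * inverse (broken_power (0, \<beta>) x)"
    proof cases
      case 2
      have "norm x powr b * gauss c x \<le> 1 * 1"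
        using 2 b c by (intro mult_mono powr_le1 gauss_le_1) auto
      also have "1 * 1 \<le> C" by (simp add: C_def)
      finally show ?thesis using 2 by (simp add: broken_power_def)
    next
      case 3
      have "norm x powr (b + \<beta>) * exp (- (pi * c) * (norm x)\<^sup>2) \<le> exp ((b + \<beta>)\<^sup>2 / (4 * (pi * c)))"
        using b c \<beta> by (intro powr_mult_exp_le) auto
      also have "\<dots> \<le> C" by (simp add: C_def)
      finally have "norm x powr b * gauss c x * norm x powr \<beta> \<le> C"
        by (simp add: gauss_def powr_add mult_ac)
      moreover have "0 < norm x" using 3 by linarith
      ultimately show ?thesis using 3 by (simp add: broken_power_def divide_inverse[symmetric] pos_le_divide_eq)
    qed simp
  qed
qed

lemma lnorm_powr_gauss_finite:
  fixes b c s :: real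
  assumes b: "0 \<le> b" and c: "0 < c" and s: "0 \<le> s"
  shows "lnorm s (\<lambda>x::'a::euclidean_space. norm x powr b * gauss c x) < \<infinity>"
proof -
  obtain C where C: "0 < C" "\<And>x::'a. norm x powr b * gauss c x \<le> C * inverse (broken_power (0, DIM('a) * s + 1) x)"
    using powr_gauss_le_inverse_broken_power[where 'a='a, OF b c, of "DIM('a) * s + 1"] s by auto
  have "lnorm s (\<lambda>x::'a. norm x powr b * gauss c x) \<le> lnorm s (\<lambda>x::'a. C * inverse (broken_power (0, DIM('a) * s + 1) x))"
    using C s by (intro lnorm_mono) auto
  also have "\<dots> = ennreal C * lnorm s (\<lambda>x::'a. inverse (broken_power (0, DIM('a) * s + 1) x))"
    using C s by (intro lnorm_cmult) auto
  also have "\<dots> < \<infinity>"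
  proof -
    have "lnorm s (\<lambda>x::'a. inverse (broken_power (0, DIM('a) * s + 1) x)) < \<infinity>"
      using s by (intro lnorm_inverse_broken_power) (auto simp: less_le)
    then show ?thesis by (simp add: ennreal_mult_less_top)
  qed
  finally show ?thesis .
qed

lemma lnorm_broken_power_gauss:
  fixes A1 A2 c s :: real
  assumes A: "0 < A1" "0 < A2" and c: "0 < c" and s: "0 \<le> s" "s \<le> 1"
  obtains N where "0 < N" "\<And>R::real. 0 < R \<Longrightarrow>
    lnorm s (\<lambda>x::'a::euclidean_space. broken_power (A1, A2) x * gauss c (x /\<^sub>R R))
    \<le> ennreal (N * R powr (DIM('a) * s) * broken_power (A1, A2) R)"
proof -
  let ?u = "\<lambda>x::'a. norm x powr A1 * gauss c x + norm x powr A2 * gauss c x"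
  have "lnorm s ?u \<le> 2 * (lnorm s (\<lambda>x::'a. norm x powr A1 * gauss c x) + lnorm s (\<lambda>x::'a. norm x powr A2 * gauss c x))"
    using s by (intro lnorm_add) auto
  also have "\<dots> < \<infinity>"
    using lnorm_powr_gauss_finite[where 'a='a, of A1 c s] lnorm_powr_gauss_finite[where 'a='a, of A2 c s] A c s
    by (auto simp: ennreal_mult_less_top)
  finally obtain N where N: "0 \<le> N" "lnorm s ?u = ennreal N" by (cases "lnorm s ?u") auto
  show ?thesis
  proof (rule that[of "N + 1"])
    fix R :: real assume R: "0 < R"
    let ?w = "broken_power (A1, A2) R"
    let ?v = "\<lambda>y::'a. broken_power (A1, A2) (R *\<^sub>R y) * gauss c y"
    have "lnorm s (\<lambda>x::'a. broken_power (A1, A2) x * gauss c (x /\<^sub>R R)) = lnorm s (\<lambda>x. ?v (x /\<^sub>R R))"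
      using R by simp
    also have "\<dots> = ennreal (R powr (DIM('a) * s)) * lnorm s ?v"
      using s R by (intro lnorm_dilate) auto
    also have "\<dots> \<le> ennreal (R powr (DIM('a) * s)) * lnorm s (\<lambda>x. ?w * ?u x)"
    proof (intro mult_left_mono lnorm_mono)
      fix y :: 'a
      have "broken_power (A1, A2) (R *\<^sub>R y) * gauss c y \<le> (?w * (norm y powr A1 + norm y powr A2)) * gauss c y"
        using R A by (intro mult_right_mono broken_power_scaleR_le) auto
      then show "?v y \<le> ?w * ?u y" by (simp add: algebra_simps)
    qed (use s in auto)
    also have "lnorm s (\<lambda>x. ?w * ?u x) = ennreal ?w * ennreal N"
      unfolding N(2)[symmetric] using s by (intro lnorm_cmult) auto
    also have "ennreal (R powr (DIM('a) * s)) * (ennreal ?w * ennreal N) = ennreal (N * R powr (DIM('a) * s) * ?w)"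
      using N by (simp add: ennreal_mult mult_ac)
    also have "\<dots> \<le> ennreal ((N + 1) * R powr (DIM('a) * s) * ?w)"
      by (intro ennreal_leI mult_right_mono) auto
    finally show "lnorm s (\<lambda>x::'a. broken_power (A1, A2) x * gauss c (x /\<^sub>R R)) \<le> ennreal ((N + 1) * R powr (DIM('a) * s) * ?w)" .
  qed (use N in simp)
qed

lemma lnorm_gauss:
  fixes s c :: real
  assumes s: "0 \<le> s" and c: "0 < c"
  obtains n where "0 < n" "\<And>R::real. 0 < R \<Longrightarrow>
    lnorm s (\<lambda>x::'a::euclidean_space. gauss c (x /\<^sub>R R)) = ennreal (n * R powr (DIM('a) * s))"
proof -
  have "lnorm s (gauss c :: 'a \<Rightarrow> real) \<le> lnorm s (\<lambda>x::'a. norm x powr 0 * gauss c x)"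
  proof (rule lnorm_mono_AE)
    \<comment> \<open>\<open>0 powr 0 = 0\<close>, so the two functions differ at the
      origin.\<close>
    show "AE x in lborel. 0 \<le> gauss c x \<and> gauss c x \<le> norm (x::'a) powr 0 * gauss c x"
      using AE_lborel_singleton[of "0::'a"] by eventually_elim auto
  qed (use s in auto)
  also have "\<dots> < \<infinity>" using s c by (intro lnorm_powr_gauss_finite) auto
  finally obtain n where n: "0 \<le> n" "lnorm s (gauss c :: 'a \<Rightarrow> real) = ennreal n"
    by (cases "lnorm s (gauss c :: 'a \<Rightarrow> real)") auto
  have "n \<noteq> 0"
  proof
    assume "n = 0"
    then have "AE x in lborel. gauss c (x::'a) = 0"
      using n s by (intro lnorm_eq_0_AE[of _ s]) auto
    then have "AE x in (lborel :: 'a measure). False" by (simp add: gauss_def)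
    then show False by (simp add: eventually_False ae_filter_eq_bot_iff)
  qed
  show ?thesis
  proof (rule that[of n])
    show "0 < n" using n \<open>n \<noteq> 0\<close> by simp
    fix R :: real assume R: "0 < R"
    have "lnorm s (\<lambda>x::'a. gauss c (x /\<^sub>R R)) = ennreal (R powr (DIM('a) * s)) * lnorm s (gauss c :: 'a \<Rightarrow> real)"
      using s R by (intro lnorm_dilate) auto
    then show "lnorm s (\<lambda>x::'a. gauss c (x /\<^sub>R R)) = ennreal (n * R powr (DIM('a) * s))"
      using n by (simp add: ennreal_mult mult.commute)
  qed
qed

lemma gauss_scaleR: "0 < R \<Longrightarrow> gauss c (x /\<^sub>R R) = gauss (c / R\<^sup>2) x"
  by (simp add: gauss_def power_mult_distrib power_inverse divide_inverse mult_ac)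

lemma fourier_gauss_dilate:
  fixes \<xi> :: "'a::euclidean_space"
  assumes e: "0 < e"
  shows "integrable lborel (\<lambda>x::'a. complex_of_real (gauss 1 (x /\<^sub>R e)))"
    and "fourier (\<lambda>x. complex_of_real (gauss 1 (x /\<^sub>R e))) \<xi> = of_real (e ^ DIM('a) * gauss 1 (\<xi> /\<^sub>R (1 / e)))"
proof -
  show "integrable lborel (\<lambda>x::'a. complex_of_real (gauss 1 (x /\<^sub>R e)))"
    unfolding gauss_scaleR[OF e] using e by (intro integrable_of_real integrable_gauss) simp
  have "fourier (\<lambda>x. complex_of_real (gauss (1 / e\<^sup>2) x)) \<xi> = of_real ((1 / sqrt (1 / e\<^sup>2)) ^ DIM('a) * gauss (1 / (1 / e\<^sup>2)) \<xi>)"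
    using e by (intro fourier_gauss) simp
  also have "1 / sqrt (1 / e\<^sup>2) = e" using e by (simp add: real_sqrt_divide)
  also have "gauss (1 / (1 / e\<^sup>2)) \<xi> = gauss 1 (\<xi> /\<^sub>R (1 / e))"
    using gauss_scaleR[of "1 / e" 1 \<xi>] e by (simp add: power_divide)
  finally show "fourier (\<lambda>x. complex_of_real (gauss 1 (x /\<^sub>R e))) \<xi> = of_real (e ^ DIM('a) * gauss 1 (\<xi> /\<^sub>R (1 / e)))"
    unfolding gauss_scaleR[OF e] by simp
qed

definition uncertainty :: "real \<Rightarrow> real \<times> real \<Rightarrow> real \<times> real \<Rightarrow> real \<Rightarrow> ('a::euclidean_space \<Rightarrow> complex) \<Rightarrow> bool" where
  "uncertainty s A B K f \<longleftrightarrow>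
    lnorm s (\<lambda>x. norm (f x)) * lnorm (1 - s) (\<lambda>\<xi>. norm (fourier f \<xi>)) \<le>
    ennreal K * (lnorm s (\<lambda>x. broken_power A x * norm (f x))
      * lnorm (1 - s) (\<lambda>\<xi>. broken_power B \<xi> * norm (fourier f \<xi>)))"

text \<open>The Gaussian of width e is multiplied by k = e^(-d s). Its transform then carries k e^d
  = e^(d (1 - s)), so the same factor makes the norm of the transform independent of e as well; only
  the weighted norms feel the scale.\<close>

lemma normalised_gauss:
  fixes s A1 A2 B1 B2 :: real
  assumes s: "0 \<le> s" "s \<le> 1" and A: "0 < A1" "0 < A2" and B: "0 < B1" "0 < B2"
  obtains n n' N N' :: real where "0 < n" "0 < n'" "0 < N" "0 < N'"
    "\<And>e::real. 0 < e \<Longrightarrow> \<exists>g::'a::euclidean_space \<Rightarrow> complex. integrable lborel g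
      \<and> lnorm s (\<lambda>x. norm (g x)) = ennreal n
      \<and> lnorm (1 - s) (\<lambda>\<xi>. norm (fourier g \<xi>)) = ennreal n'
      \<and> lnorm s (\<lambda>x. broken_power (A1, A2) x * norm (g x)) \<le> ennreal (N * broken_power (A1, A2) e)
      \<and> lnorm (1 - s) (\<lambda>\<xi>. broken_power (B1, B2) \<xi> * norm (fourier g \<xi>)) \<le> ennreal (N' * broken_power (B1, B2) (1 / e))"
proof -
  have s': "0 \<le> 1 - s" "1 - s \<le> 1" using s by auto
  obtain n where n: "0 < n" "\<And>R::real. 0 < R \<Longrightarrow> lnorm s (\<lambda>x::'a. gauss 1 (x /\<^sub>R R)) = ennreal (n * R powr (DIM('a) * s))"
    using lnorm_gauss[OF s(1), of 1] by auto
  obtain n' where n': "0 < n'" "\<And>R::real. 0 < R \<Longrightarrow> lnorm (1 - s) (\<lambda>x::'a. gauss 1 (x /\<^sub>R R)) = ennreal (n' * R powr (DIM('a) * (1 - s)))"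
    using lnorm_gauss[OF s'(1), of 1] by auto
  obtain N where N: "0 < N" "\<And>R::real. 0 < R \<Longrightarrow> lnorm s (\<lambda>x::'a. broken_power (A1, A2) x * gauss 1 (x /\<^sub>R R))
      \<le> ennreal (N * R powr (DIM('a) * s) * broken_power (A1, A2) R)"
    using lnorm_broken_power_gauss[OF A _ s, of 1] by auto
  obtain N' where N': "0 < N'" "\<And>R::real. 0 < R \<Longrightarrow> lnorm (1 - s) (\<lambda>x::'a. broken_power (B1, B2) x * gauss 1 (x /\<^sub>R R))
      \<le> ennreal (N' * R powr (DIM('a) * (1 - s)) * broken_power (B1, B2) R)"
    using lnorm_broken_power_gauss[OF B _ s', of 1] by auto
  show ?thesis
  proof (rule that[OF n(1) n'(1) N(1) N'(1)])
    fix e :: real assume e: "0 < e"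
    define k where "k = e powr - (DIM('a) * s)"
    define k' where "k' = k * e ^ DIM('a)"
    have k: "0 < k" "0 < k'" using e by (auto simp: k_def k'_def)
    have ke: "k * e powr (DIM('a) * s) = 1" using e by (simp add: k_def flip: powr_add)
    have ke': "k' * (1 / e) powr (DIM('a) * (1 - s)) = 1"
    proof -
      have "(1 / e) powr (DIM('a) * (1 - s)) = e powr - (DIM('a) * (1 - s))"
        using e by (simp add: powr_divide powr_minus_divide)
      moreover have "e ^ DIM('a) = e powr DIM('a)" using e by (simp add: powr_realpow)
      ultimately have "k' * (1 / e) powr (DIM('a) * (1 - s)) = e powr (- (DIM('a) * s) + DIM('a) + - (DIM('a) * (1 - s)))"
        by (simp only: k_def k'_def powr_add)
      also have "- (DIM('a) * s) + DIM('a) + - (DIM('a) * (1 - s)) = 0" by (simp add: algebra_simps)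
      finally show ?thesis using e by simp
    qed
    define g where "g x = complex_of_real k * complex_of_real (gauss 1 (x /\<^sub>R e))" for x :: 'a
    have gi: "integrable lborel g" unfolding g_def[abs_def] by (intro integrable_mult_right fourier_gauss_dilate e)
    have ng: "norm (g x) = k * gauss 1 (x /\<^sub>R e)" for x using k by (simp add: g_def norm_mult)
    have fg: "fourier g \<xi> = of_real (k' * gauss 1 (\<xi> /\<^sub>R (1 / e)))" for \<xi>
      unfolding g_def[abs_def] by (subst fourier_cmult[OF fourier_gauss_dilate(1)[OF e]]) (simp add: fourier_gauss_dilate(2)[OF e] k'_def)
    have nfg: "norm (fourier g \<xi>) = k' * gauss 1 (\<xi> /\<^sub>R (1 / e))" for \<xi>
      using k unfolding fg norm_of_real by simp
    have 1: "lnorm s (\<lambda>x. norm (g x)) = ennreal n"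
    proof -
      have "lnorm s (\<lambda>x. norm (g x)) = ennreal k * ennreal (n * e powr (DIM('a) * s))"
        unfolding ng n(2)[OF e, symmetric] using s k by (intro lnorm_cmult) auto
      also have "\<dots> = ennreal (k * e powr (DIM('a) * s) * n)"
        using k n by (subst ennreal_mult[symmetric]) (auto simp: mult_ac)
      finally show ?thesis unfolding ke by simp
    qed
    have 2: "lnorm (1 - s) (\<lambda>\<xi>. norm (fourier g \<xi>)) = ennreal n'"
    proof -
      have "lnorm (1 - s) (\<lambda>\<xi>. norm (fourier g \<xi>)) = ennreal k' * ennreal (n' * (1 / e) powr (DIM('a) * (1 - s)))"
        unfolding nfg using s' k e by (subst n'(2)[symmetric], simp) (intro lnorm_cmult; auto)
      also have "\<dots> = ennreal (k' * (1 / e) powr (DIM('a) * (1 - s)) * n')"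
        using k n' by (subst ennreal_mult[symmetric]) (auto simp: mult_ac)
      finally show ?thesis unfolding ke' by simp
    qed
    have 3: "lnorm s (\<lambda>x. broken_power (A1, A2) x * norm (g x)) \<le> ennreal (N * broken_power (A1, A2) e)"
    proof -
      have "lnorm s (\<lambda>x. broken_power (A1, A2) x * norm (g x)) = lnorm s (\<lambda>x::'a. k * (broken_power (A1, A2) x * gauss 1 (x /\<^sub>R e)))"
        by (simp add: ng mult_ac)
      also have "\<dots> = ennreal k * lnorm s (\<lambda>x::'a. broken_power (A1, A2) x * gauss 1 (x /\<^sub>R e))"
        using s k by (intro lnorm_cmult) auto
      also have "\<dots> \<le> ennreal k * ennreal (N * e powr (DIM('a) * s) * broken_power (A1, A2) e)"
        by (intro mult_left_mono N(2)[OF e]) simp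
      also have "\<dots> = ennreal (k * e powr (DIM('a) * s) * (N * broken_power (A1, A2) e))"
        using k N by (subst ennreal_mult[symmetric]) (auto simp: mult_ac)
      finally show ?thesis unfolding ke by simp
    qed
    have 4: "lnorm (1 - s) (\<lambda>\<xi>. broken_power (B1, B2) \<xi> * norm (fourier g \<xi>)) \<le> ennreal (N' * broken_power (B1, B2) (1 / e))"
    proof -
      have "lnorm (1 - s) (\<lambda>x. broken_power (B1, B2) x * norm (fourier g x)) = lnorm (1 - s) (\<lambda>x::'a. k' * (broken_power (B1, B2) x * gauss 1 (x /\<^sub>R (1 / e))))"
        unfolding nfg by (simp only: mult_ac)
      also have "\<dots> = ennreal k' * lnorm (1 - s) (\<lambda>x::'a. broken_power (B1, B2) x * gauss 1 (x /\<^sub>R (1 / e)))"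
        using s' k by (intro lnorm_cmult) auto
      also have "\<dots> \<le> ennreal k' * ennreal (N' * (1 / e) powr (DIM('a) * (1 - s)) * broken_power (B1, B2) (1 / e))"
        using e by (intro mult_left_mono N'(2)) auto
      also have "\<dots> = ennreal (k' * (1 / e) powr (DIM('a) * (1 - s)) * (N' * broken_power (B1, B2) (1 / e)))"
        using k N' by (subst ennreal_mult[symmetric]) (auto simp: mult_ac)
      finally show ?thesis unfolding ke' by simp
    qed
    show "\<exists>g::'a \<Rightarrow> complex. integrable lborel g
      \<and> lnorm s (\<lambda>x. norm (g x)) = ennreal n
      \<and> lnorm (1 - s) (\<lambda>\<xi>. norm (fourier g \<xi>)) = ennreal n'
      \<and> lnorm s (\<lambda>x. broken_power (A1, A2) x * norm (g x)) \<le> ennreal (N * broken_power (A1, A2) e)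
      \<and> lnorm (1 - s) (\<lambda>\<xi>. broken_power (B1, B2) \<xi> * norm (fourier g \<xi>)) \<le> ennreal (N' * broken_power (B1, B2) (1 / e))"
      using gi 1 2 3 4 by blast
  qed
qed

lemma uncertainty_gauss:
  fixes s A1 A2 B1 B2 K :: real
  assumes s: "0 \<le> s" "s \<le> 1" and A: "0 < A1" "0 < A2" and B: "0 < B1" "0 < B2" and K: "0 < K"
    and unc: "\<And>f::'a::euclidean_space \<Rightarrow> complex. integrable lborel f \<Longrightarrow> uncertainty s (A1, A2) (B1, B2) K f"
  obtains c where "0 < c" "\<And>e::real. 0 < e \<Longrightarrow> c \<le> broken_power (A1, A2) e * broken_power (B1, B2) (1 / e)"
proof -
  obtain n n' N N' :: real where c: "0 < n" "0 < n'" "0 < N" "0 < N'"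
    and g: "\<And>e::real. 0 < e \<Longrightarrow> \<exists>g::'a \<Rightarrow> complex. integrable lborel g
      \<and> lnorm s (\<lambda>x. norm (g x)) = ennreal n
      \<and> lnorm (1 - s) (\<lambda>\<xi>. norm (fourier g \<xi>)) = ennreal n'
      \<and> lnorm s (\<lambda>x. broken_power (A1, A2) x * norm (g x)) \<le> ennreal (N * broken_power (A1, A2) e)
      \<and> lnorm (1 - s) (\<lambda>\<xi>. broken_power (B1, B2) \<xi> * norm (fourier g \<xi>)) \<le> ennreal (N' * broken_power (B1, B2) (1 / e))"
    using normalised_gauss[OF s A B] by blast
  show ?thesis
  proof (rule that[of "n * n' / (K * N * N')"])
    show "0 < n * n' / (K * N * N')" using c K by simp
    fix e :: real assume e: "0 < e"
    let ?a = "broken_power (A1, A2) e" and ?b = "broken_power (B1, B2) (1 / e)"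
    obtain g :: "'a \<Rightarrow> complex" where g: "integrable lborel g" "lnorm s (\<lambda>x. norm (g x)) = ennreal n"
       "lnorm (1 - s) (\<lambda>\<xi>. norm (fourier g \<xi>)) = ennreal n'"
       "lnorm s (\<lambda>x. broken_power (A1, A2) x * norm (g x)) \<le> ennreal (N * ?a)"
       "lnorm (1 - s) (\<lambda>\<xi>. broken_power (B1, B2) \<xi> * norm (fourier g \<xi>)) \<le> ennreal (N' * ?b)"
      using g[OF e] by blast
    have "ennreal n * ennreal n' \<le> ennreal K * (lnorm s (\<lambda>x. broken_power (A1, A2) x * norm (g x))
       * lnorm (1 - s) (\<lambda>\<xi>. broken_power (B1, B2) \<xi> * norm (fourier g \<xi>)))"
      using unc[OF g(1)] unfolding uncertainty_def g(2,3) .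
    also have "\<dots> \<le> ennreal K * (ennreal (N * ?a) * ennreal (N' * ?b))"
      by (intro mult_left_mono mult_mono g) auto
    also have "\<dots> = ennreal (K * ((N * ?a) * (N' * ?b)))"
      using K c by (simp add: ennreal_mult)
    finally have "ennreal (n * n') \<le> ennreal (K * ((N * ?a) * (N' * ?b)))"
      using c by (simp add: ennreal_mult)
    then have "n * n' \<le> K * ((N * ?a) * (N' * ?b))"
      using c K by (subst (asm) ennreal_le_iff) auto
    then show "n * n' / (K * N * N') \<le> ?a * ?b" using c K by (simp add: field_simps)
  qed
qed

lemma ennreal_mult_mult:
  "0 \<le> a \<Longrightarrow> 0 \<le> b \<Longrightarrow> 0 \<le> c \<Longrightarrow> ennreal a * (ennreal b * ennreal c) = ennreal (a * (b * c))"
  by (simp add: ennreal_mult)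

text \<open>A reverse triangle inequality extracted from the quasi-triangle inequality: a
  perturbation of at most a / 4 leaves at least a / 4.\<close>

lemma ennreal_le_double_add:
  assumes "ennreal a \<le> 2 * (F + ennreal b)" "0 \<le> b" "b \<le> a / 4"
  shows "ennreal (a / 4) \<le> F"
proof (cases F)
  case (real f)
  then have "2 * (F + ennreal b) = ennreal (2 * (f + b))" using assms by (simp add: ennreal_mult ennreal_plus)
  then have "ennreal a \<le> ennreal (2 * (f + b))" using assms(1) by simp
  then have "a \<le> 2 * (f + b)" using real assms by (subst (asm) ennreal_le_iff) auto
  then show ?thesis using real assms by (auto intro!: ennreal_leI)
qed simp

text \<open>Testing the inequality on the sum of a Gaussian at scale e, of size l, and of a function g whose
  transform lives at scale S.\<close>

lemma uncertainty_two_scales: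
  fixes s A1 A2 B1 B2 K c0 c1 :: real
  assumes s: "0 \<le> s" "s \<le> 1" and A: "0 < A1" "0 < A2" and B: "0 < B1" "0 < B2" and K: "0 < K"
    and c01: "0 < c0" "0 < c1"
    and unc: "\<And>f::'a::euclidean_space \<Rightarrow> complex. integrable lborel f \<Longrightarrow> uncertainty s (A1, A2) (B1, B2) K f"
  obtains M where "1 \<le> M" "\<And>(g::'a \<Rightarrow> complex) (l::real) (e::real) (S::real) (b0::real) (b1::real). integrable lborel g \<Longrightarrow>
      0 < l \<Longrightarrow> 0 < e \<Longrightarrow> 0 \<le> b0 \<Longrightarrow> 0 \<le> b1 \<Longrightarrow> l \<le> 1 / M \<Longrightarrow> b0 \<le> l / M \<Longrightarrow>
      lnorm s (\<lambda>x. norm (g x)) \<le> ennreal b0 \<Longrightarrow>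
      lnorm s (\<lambda>x. broken_power (A1, A2) x * norm (g x)) \<le> ennreal b1 \<Longrightarrow>
      ennreal c0 \<le> lnorm (1 - s) (\<lambda>\<xi>. norm (fourier g \<xi>)) \<Longrightarrow>
      lnorm (1 - s) (\<lambda>\<xi>. broken_power (B1, B2) \<xi> * norm (fourier g \<xi>)) \<le> ennreal (c1 * broken_power (B1, B2) S) \<Longrightarrow>
      l \<le> M * ((l * broken_power (A1, A2) e + b1) * (l * broken_power (B1, B2) (1 / e) + broken_power (B1, B2) S))"
proof -
  have s': "0 \<le> 1 - s" "1 - s \<le> 1" using s by auto
  obtain n n' N N' :: real where c: "0 < n" "0 < n'" "0 < N" "0 < N'"
    and g0: "\<And>e::real. 0 < e \<Longrightarrow> \<exists>g::'a \<Rightarrow> complex. integrable lborel g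
      \<and> lnorm s (\<lambda>x. norm (g x)) = ennreal n
      \<and> lnorm (1 - s) (\<lambda>\<xi>. norm (fourier g \<xi>)) = ennreal n'
      \<and> lnorm s (\<lambda>x. broken_power (A1, A2) x * norm (g x)) \<le> ennreal (N * broken_power (A1, A2) e)
      \<and> lnorm (1 - s) (\<lambda>\<xi>. broken_power (B1, B2) \<xi> * norm (fourier g \<xi>)) \<le> ennreal (N' * broken_power (B1, B2) (1 / e))"
    using normalised_gauss[OF s A B] by blast
  define m1 where "m1 = max 1 (max N (max N' c1))"
  \<comment> \<open>The summands ensure, in turn, that M \<ge> 1, that g is negligible next to the
    Gaussian in space, that the Gaussian is negligible next to g in frequency, and the final
    constant: 16 from the two quarters, 4 from the two quasi-triangle inequalities.\<close>
  define M where "M = 1 + 4 / n + 4 * n' / c0 + 64 * K * m1 * m1 / (n * c0)"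
  have m1: "1 \<le> m1" "N \<le> m1" "N' \<le> m1" "c1 \<le> m1" "0 < m1" by (auto simp: m1_def)
  have M: "1 \<le> M" "4 / n \<le> M" "4 * n' / c0 \<le> M" "64 * K * m1 * m1 / (n * c0) \<le> M"
    using c c01 K m1 by (auto simp: M_def intro!: add_increasing add_increasing2)
  show ?thesis
  proof (rule that[OF M(1)])
    fix g :: "'a \<Rightarrow> complex" and l e S b0 b1 :: real
    assume g: "integrable lborel g" and l: "0 < l" and e: "0 < e" and b: "0 \<le> b0" "0 \<le> b1"
      and lM: "l \<le> 1 / M" and b0M: "b0 \<le> l / M"
      and g1: "lnorm s (\<lambda>x. norm (g x)) \<le> ennreal b0"
      and g2: "lnorm s (\<lambda>x. broken_power (A1, A2) x * norm (g x)) \<le> ennreal b1"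
      and g3: "ennreal c0 \<le> lnorm (1 - s) (\<lambda>\<xi>. norm (fourier g \<xi>))"
      and g4: "lnorm (1 - s) (\<lambda>\<xi>. broken_power (B1, B2) \<xi> * norm (fourier g \<xi>)) \<le> ennreal (c1 * broken_power (B1, B2) S)"
    let ?a = "broken_power (A1, A2) e" and ?b = "broken_power (B1, B2) (1 / e)" and ?S = "broken_power (B1, B2) S"
    obtain h0 :: "'a \<Rightarrow> complex" where h0: "integrable lborel h0" "lnorm s (\<lambda>x. norm (h0 x)) = ennreal n"
       "lnorm (1 - s) (\<lambda>\<xi>. norm (fourier h0 \<xi>)) = ennreal n'"
       "lnorm s (\<lambda>x. broken_power (A1, A2) x * norm (h0 x)) \<le> ennreal (N * ?a)"
       "lnorm (1 - s) (\<lambda>\<xi>. broken_power (B1, B2) \<xi> * norm (fourier h0 \<xi>)) \<le> ennreal (N' * ?b)"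
      using g0[OF e] by blast
    define h where "h x = of_real l * h0 x" for x
    have h: "integrable lborel h" unfolding h_def[abs_def] by (intro integrable_mult_right h0)
    have [measurable]: "h0 \<in> borel_measurable borel" "h \<in> borel_measurable borel" "g \<in> borel_measurable borel" using h0 h g by auto
    have nh: "norm (h x) = l * norm (h0 x)" for x using l by (simp add: h_def norm_mult)
    have nfh: "norm (fourier h x) = l * norm (fourier h0 x)" for x
      using l unfolding h_def[abs_def] by (simp add: fourier_cmult[OF h0(1)] norm_mult)
    have h1: "lnorm s (\<lambda>x. norm (h x)) = ennreal (l * n)"
      unfolding nh using s l h0(2) c by (subst lnorm_cmult) (auto simp: ennreal_mult)
    have h2: "lnorm (1 - s) (\<lambda>x. norm (fourier h x)) = ennreal (l * n')"
      unfolding nfh using s' l h0(3) c by (subst lnorm_cmult) (auto simp: ennreal_mult)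
    have h3: "lnorm s (\<lambda>x. broken_power (A1, A2) x * norm (h x)) \<le> ennreal (l * (N * ?a))"
    proof -
      have "lnorm s (\<lambda>x. broken_power (A1, A2) x * norm (h x)) = lnorm s (\<lambda>x. l * (broken_power (A1, A2) x * norm (h0 x)))"
        by (simp add: nh mult_ac)
      also have "\<dots> = ennreal l * lnorm s (\<lambda>x. broken_power (A1, A2) x * norm (h0 x))"
        using s l by (intro lnorm_cmult) auto
      also have "\<dots> \<le> ennreal l * ennreal (N * ?a)" by (intro mult_left_mono h0) simp
      also have "\<dots> = ennreal (l * (N * ?a))" using l c by (simp add: ennreal_mult)
      finally show ?thesis .
    qed
    have h4: "lnorm (1 - s) (\<lambda>x. broken_power (B1, B2) x * norm (fourier h x)) \<le> ennreal (l * (N' * ?b))"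
    proof -
      have "lnorm (1 - s) (\<lambda>x. broken_power (B1, B2) x * norm (fourier h x)) = lnorm (1 - s) (\<lambda>x. l * (broken_power (B1, B2) x * norm (fourier h0 x)))"
        by (simp add: nfh mult_ac)
      also have "\<dots> = ennreal l * lnorm (1 - s) (\<lambda>x. broken_power (B1, B2) x * norm (fourier h0 x))"
        using s' l by (intro lnorm_cmult) auto
      also have "\<dots> \<le> ennreal l * ennreal (N' * ?b)" by (intro mult_left_mono h0) simp
      also have "\<dots> = ennreal (l * (N' * ?b))" using l c by (simp add: ennreal_mult)
      finally show ?thesis .
    qed
    define f where "f x = h x + g x" for x
    have f: "integrable lborel f" unfolding f_def[abs_def] by (intro Bochner_Integration.integrable_add h g)
    have [measurable]: "f \<in> borel_measurable borel" using f by auto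
    have ff: "fourier f \<xi> = fourier h \<xi> + fourier g \<xi>" for \<xi>
      unfolding f_def[abs_def] by (rule fourier_add[OF h g])
    \<comment> \<open>The unweighted norm in space is carried by the Gaussian, of size l n, and the
      unweighted norm in frequency by g, of size at least c0. The product is therefore of order l,
      while the Gaussian alone yields only l^2.\<close>
    have F: "ennreal (l * n / 4) \<le> lnorm s (\<lambda>x. norm (f x))"
    proof (rule ennreal_le_double_add[OF _ b(1)])
      have "lnorm s (\<lambda>x. norm (h x)) \<le> lnorm s (\<lambda>x. norm (f x) + norm (g x))"
      proof (rule lnorm_mono)
        show "norm (h x) \<le> norm (f x) + norm (g x)" for x
          using norm_triangle_ineq4[of "f x" "g x"] by (simp add: f_def)
      qed (use s in auto)
      also have "\<dots> \<le> 2 * (lnorm s (\<lambda>x. norm (f x)) + lnorm s (\<lambda>x. norm (g x)))"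
        using s by (intro lnorm_add) auto
      also have "\<dots> \<le> 2 * (lnorm s (\<lambda>x. norm (f x)) + ennreal b0)"
        by (intro mult_left_mono add_mono g1) auto
      finally show "ennreal (l * n) \<le> 2 * (lnorm s (\<lambda>x. norm (f x)) + ennreal b0)" unfolding h1 .
      have "1 / M \<le> n / 4" using M c by (simp add: field_simps)
      then have "l * (1 / M) \<le> l * (n / 4)" using l by (intro mult_left_mono) auto
      moreover have "b0 \<le> l * (1 / M)" using b0M by simp
      ultimately have "b0 \<le> l * (n / 4)" by (rule order_trans[rotated])
      then show "b0 \<le> l * n / 4" by simp
    qed
    have ln': "0 \<le> l * n'" using l c by simp
    have G: "ennreal (c0 / 4) \<le> lnorm (1 - s) (\<lambda>x. norm (fourier f x))"
    proof (rule ennreal_le_double_add[OF _ ln'])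
      have "lnorm (1 - s) (\<lambda>x. norm (fourier g x)) \<le> lnorm (1 - s) (\<lambda>x. norm (fourier f x) + norm (fourier h x))"
      proof (rule lnorm_mono)
        show "norm (fourier g x) \<le> norm (fourier f x) + norm (fourier h x)" for x
          using norm_triangle_ineq4[of "fourier f x" "fourier h x"] by (simp add: ff)
      qed (use s in auto)
      also have "\<dots> \<le> 2 * (lnorm (1 - s) (\<lambda>x. norm (fourier f x)) + lnorm (1 - s) (\<lambda>x. norm (fourier h x)))"
        using s' by (intro lnorm_add) auto
      finally show "ennreal c0 \<le> 2 * (lnorm (1 - s) (\<lambda>x. norm (fourier f x)) + ennreal (l * n'))"
        unfolding h2 by (rule order_trans[OF g3])
      have "l * n' \<le> 1 / M * n'" using lM c by (intro mult_right_mono) auto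
      also have "\<dots> \<le> c0 / 4" using M c c01 by (simp add: field_simps)
      finally show "l * n' \<le> c0 / 4" .
    qed
    have X: "lnorm s (\<lambda>x. broken_power (A1, A2) x * norm (f x)) \<le> ennreal (2 * m1 * (l * ?a + b1))"
    proof -
      have "lnorm s (\<lambda>x. broken_power (A1, A2) x * norm (f x)) \<le>
          lnorm s (\<lambda>x. broken_power (A1, A2) x * norm (h x) + broken_power (A1, A2) x * norm (g x))"
        using s by (intro lnorm_mono) (auto simp: f_def norm_triangle_ineq intro!: mult_left_mono simp flip: distrib_left)
      also have "\<dots> \<le> 2 * (lnorm s (\<lambda>x. broken_power (A1, A2) x * norm (h x)) + lnorm s (\<lambda>x. broken_power (A1, A2) x * norm (g x)))"
        using s by (intro lnorm_add) auto
      also have "\<dots> \<le> 2 * (ennreal (l * (N * ?a)) + ennreal b1)"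
        by (intro mult_left_mono add_mono h3 g2) auto
      also have "\<dots> = ennreal (2 * (l * (N * ?a) + b1))"
        using l c b by (simp add: ennreal_mult ennreal_plus)
      also have "\<dots> \<le> ennreal (2 * m1 * (l * ?a + b1))"
      proof (rule ennreal_leI)
        have "N * (l * ?a) \<le> m1 * (l * ?a)" "1 * b1 \<le> m1 * b1" using m1 l b by (intro mult_right_mono; simp)+
        then show "2 * (l * (N * ?a) + b1) \<le> 2 * m1 * (l * ?a + b1)" by (simp add: algebra_simps)
      qed
      finally show ?thesis .
    qed
    have Y: "lnorm (1 - s) (\<lambda>x. broken_power (B1, B2) x * norm (fourier f x)) \<le> ennreal (2 * m1 * (l * ?b + ?S))"
    proof -
      have "lnorm (1 - s) (\<lambda>x. broken_power (B1, B2) x * norm (fourier f x)) \<le>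
          lnorm (1 - s) (\<lambda>x. broken_power (B1, B2) x * norm (fourier h x) + broken_power (B1, B2) x * norm (fourier g x))"
        using s by (intro lnorm_mono) (auto simp: ff norm_triangle_ineq intro!: mult_left_mono simp flip: distrib_left)
      also have "\<dots> \<le> 2 * (lnorm (1 - s) (\<lambda>x. broken_power (B1, B2) x * norm (fourier h x)) + lnorm (1 - s) (\<lambda>x. broken_power (B1, B2) x * norm (fourier g x)))"
        using s' by (intro lnorm_add) auto
      also have "\<dots> \<le> 2 * (ennreal (l * (N' * ?b)) + ennreal (c1 * ?S))"
        by (intro mult_left_mono add_mono h4 g4) auto
      also have "\<dots> = ennreal (2 * (l * (N' * ?b) + c1 * ?S))"
        using l c c01 by (simp add: ennreal_mult ennreal_plus)
      also have "\<dots> \<le> ennreal (2 * m1 * (l * ?b + ?S))"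
      proof (rule ennreal_leI)
        have "N' * (l * ?b) \<le> m1 * (l * ?b)" "c1 * ?S \<le> m1 * ?S" using m1 l by (intro mult_right_mono; simp)+
        then show "2 * (l * (N' * ?b) + c1 * ?S) \<le> 2 * m1 * (l * ?b + ?S)" by (simp add: algebra_simps)
      qed
      finally show ?thesis .
    qed
    have pX: "0 \<le> l * ?a + b1" and pY: "0 \<le> l * ?b + ?S" using l b by auto
    have "ennreal (l * n / 4 * (c0 / 4)) = ennreal (l * n / 4) * ennreal (c0 / 4)"
      using l c c01 by (intro ennreal_mult) auto
    also have "\<dots> \<le> lnorm s (\<lambda>x. norm (f x)) * lnorm (1 - s) (\<lambda>x. norm (fourier f x))"
      by (intro mult_mono F G) auto
    also have "\<dots> \<le> ennreal K * (lnorm s (\<lambda>x. broken_power (A1, A2) x * norm (f x)) * lnorm (1 - s) (\<lambda>x. broken_power (B1, B2) x * norm (fourier f x)))"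
      using unc[OF f] unfolding uncertainty_def .
    also have "\<dots> \<le> ennreal K * (ennreal (2 * m1 * (l * ?a + b1)) * ennreal (2 * m1 * (l * ?b + ?S)))"
      by (intro mult_left_mono mult_mono X Y) auto
    also have "\<dots> = ennreal (K * ((2 * m1 * (l * ?a + b1)) * (2 * m1 * (l * ?b + ?S))))"
      using K m1 pX pY by (intro ennreal_mult_mult mult_nonneg_nonneg) auto
    finally have "l * n / 4 * (c0 / 4) \<le> K * ((2 * m1 * (l * ?a + b1)) * (2 * m1 * (l * ?b + ?S)))"
      using K m1 pX pY by (subst (asm) ennreal_le_iff) (auto intro!: mult_nonneg_nonneg)
    moreover have "l * n / 4 * (c0 / 4) \<le> K * ((2 * m1 * x) * (2 * m1 * y)) \<Longrightarrow> l \<le> 64 * K * m1 * m1 / (n * c0) * (x * y)" for x y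
      using c c01 by (simp add: field_simps)
    ultimately have "l \<le> 64 * K * m1 * m1 / (n * c0) * ((l * ?a + b1) * (l * ?b + ?S))" by blast
    also have "\<dots> \<le> M * ((l * ?a + b1) * (l * ?b + ?S))"
      using M pX pY by (intro mult_right_mono) auto
    finally show "l \<le> M * ((l * ?a + b1) * (l * ?b + ?S))" .
  qed
qed

section \<open>Equally spaced Gaussian bumps along one coordinate\<close>

lemma sum_gaussian_bumps_le:
  obtains C where "0 < C" "\<And>(u::real) J::nat. 0 < J \<Longrightarrow>
    (\<Sum>j<J. exp (- pi * (real J * u - 2 * real j)\<^sup>2)) \<le> C * exp (- pi * u\<^sup>2 / 4)"
proof -
  \<comment> \<open>The centres v = 2 j / J lie in [0, 2], so the sum decays in u uniformly in J.
    Half of the exponent provides this decay; the other half provides decay in j, which is summed by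
    \<open>sum_exp_dist_le\<close> with c = 2.\<close>
  define D where "D = 2 / (1 - exp (- 2 :: real))"
  have D: "0 < D" by (simp add: D_def)
  show ?thesis
  proof (rule that[of "exp (2 * pi + 1) * D"])
    show "0 < exp (2 * pi + 1) * D" using D by simp
    fix u :: real and J :: nat assume J: "0 < J"
    have "exp (- pi * (real J * u - 2 * real j)\<^sup>2) \<le> exp (2 * pi + 1) * exp (- pi * u\<^sup>2 / 4) * exp (- 2 * \<bar>real J * u / 2 - real j\<bar>)"
      if j: "j < J" for j
    proof -
      define T where "T = real J * u - 2 * real j"
      define v where "v = 2 * real j / real J"
      have v: "0 \<le> v" "v \<le> 2" using j by (auto simp: v_def field_simps)
      have T: "T = real J * (u - v)" using J by (simp add: T_def v_def field_simps)
      have "1 * \<bar>u - v\<bar> \<le> \<bar>T\<bar>" unfolding T abs_mult using J by (intro mult_right_mono) auto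
      then have uv: "(u - v)\<^sup>2 \<le> T\<^sup>2" by (simp add: abs_le_square_iff)
      have "u\<^sup>2 \<le> 2 * (u - v)\<^sup>2 + 2 * v\<^sup>2"
        using zero_le_power2[of "u - 2 * v"] by (simp add: power2_eq_square algebra_simps)
      moreover have "v\<^sup>2 \<le> 2\<^sup>2" using v by (intro power_mono) auto
      ultimately have "u\<^sup>2 / 4 - 2 \<le> T\<^sup>2 / 2" using uv by simp
      then have 1: "pi * (u\<^sup>2 / 4 - 2) \<le> pi * (T\<^sup>2 / 2)" by (intro mult_left_mono) auto
      have "\<bar>T\<bar> - 1 \<le> T\<^sup>2"
      proof -
        have "0 \<le> (\<bar>T\<bar> - 1 / 2)\<^sup>2 + 3 / 4" by (intro add_nonneg_nonneg) auto
        also have "\<dots> = T\<^sup>2 - \<bar>T\<bar> + 1" by (simp add: power2_eq_square algebra_simps)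
        finally show ?thesis by simp
      qed
      also have "1 * T\<^sup>2 \<le> pi / 2 * T\<^sup>2" using pi_gt3 by (intro mult_right_mono) auto
      finally have 2: "\<bar>T\<bar> - 1 \<le> pi * (T\<^sup>2 / 2)" by simp
      have "- pi * T\<^sup>2 \<le> (2 * pi + 1) + - pi * u\<^sup>2 / 4 + - \<bar>T\<bar>"
        using 1 2 by (simp add: algebra_simps)
      also have "- \<bar>T\<bar> = - 2 * \<bar>real J * u / 2 - real j\<bar>" by (simp add: T_def abs_if)
      finally have "exp (- pi * T\<^sup>2) \<le> exp ((2 * pi + 1) + - pi * u\<^sup>2 / 4 + - 2 * \<bar>real J * u / 2 - real j\<bar>)" by simp
      then show ?thesis by (simp only: exp_add T_def)
    qed
    then have "(\<Sum>j<J. exp (- pi * (real J * u - 2 * real j)\<^sup>2)) \<le>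
        (\<Sum>j<J. exp (2 * pi + 1) * exp (- pi * u\<^sup>2 / 4) * exp (- 2 * \<bar>real J * u / 2 - real j\<bar>))"
      by (intro sum_mono) auto
    also have "\<dots> = exp (2 * pi + 1) * exp (- pi * u\<^sup>2 / 4) * (\<Sum>j<J. exp (- 2 * \<bar>real J * u / 2 - real j\<bar>))"
      by (simp add: sum_distrib_left)
    also have "\<dots> \<le> exp (2 * pi + 1) * exp (- pi * u\<^sup>2 / 4) * D"
      unfolding D_def by (intro mult_left_mono sum_exp_dist_le) auto
    finally show "(\<Sum>j<J. exp (- pi * (real J * u - 2 * real j)\<^sup>2)) \<le> exp (2 * pi + 1) * D * exp (- pi * u\<^sup>2 / 4)"
      by (simp add: mult_ac)
  qed
qed

text \<open>In the variable J u the centres are 2 apart. Within 1/2 of the j-th centre its own bump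
  is at least q, a bump n places away is at most r^n with r = q exp (-2 pi) \<le> q / 7, and the
  geometric tails sum to at most q / 2.\<close>

lemma gaussian_bump_separated:
  fixes u :: real and J j :: nat
  assumes j: "j < J" and u: "\<bar>real J * u - 2 * real j\<bar> \<le> 1 / 2"
  shows "exp (- pi / 4) / 2 \<le> exp (- pi * (real J * u - 2 * real j)\<^sup>2) - (\<Sum>k\<in>{..<J} - {j}. exp (- pi * (real J * u - 2 * real k)\<^sup>2))"
proof -
  define q where "q = exp (- pi / 4)"
  \<comment> \<open>9 / 4 is the square of 3 / 2: a bump n places away is evaluated at distance at
    least 2 n - 1/2 \<ge> 3 n / 2 from its centre, and n^2 \<ge> n.\<close>
  define r where "r = exp (- pi * (9 / 4))"
  have q: "0 < q" "q < 1" by (simp_all add: q_def)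
  have main: "q \<le> exp (- pi * (real J * u - 2 * real j)\<^sup>2)"
  proof -
    have "(real J * u - 2 * real j)\<^sup>2 \<le> (1 / 2)\<^sup>2" using u by (simp add: abs_le_square_iff[symmetric])
    then have "pi * (real J * u - 2 * real j)\<^sup>2 \<le> pi * (1 / 4)" by (intro mult_left_mono) (auto simp: power2_eq_square)
    then show ?thesis by (simp add: q_def)
  qed
  have r: "0 \<le> r" "r \<le> q / 7"
  proof -
    have "7 \<le> 1 + 2 * pi" using pi_gt3 by simp
    also have "\<dots> \<le> exp (2 * pi)" by (rule exp_ge_add_one_self)
    finally have "7 * r \<le> exp (2 * pi) * r" by (intro mult_right_mono) (auto simp: r_def)
    also have "\<dots> = q" by (simp add: r_def q_def flip: exp_add)
    finally show "r \<le> q / 7" by simp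
  qed (simp add: r_def)
  have "(\<Sum>k\<in>{..<J} - {j}. exp (- pi * (real J * u - 2 * real k)\<^sup>2)) \<le> (\<Sum>k\<in>{..<J} - {j}. r ^ (if j < k then k - j else j - k))"
  proof (rule sum_mono)
    fix k assume k: "k \<in> {..<J} - {j}"
    define n where "n = (if j < k then k - j else j - k)"
    have n: "1 \<le> n" "\<bar>real j - real k\<bar> = real n" using k by (auto simp: n_def)
    have "real J * u - 2 * real k = (real J * u - 2 * real j) + 2 * (real j - real k)" by simp
    then have "2 * real n - 1 / 2 \<le> \<bar>real J * u - 2 * real k\<bar>" using u n(2) by linarith
    moreover have "3 / 2 * real n \<le> 2 * real n - 1 / 2" using n(1) by simp
    ultimately have "3 / 2 * real n \<le> \<bar>real J * u - 2 * real k\<bar>" by linarith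
    then have "(3 / 2 * real n)\<^sup>2 \<le> (real J * u - 2 * real k)\<^sup>2"
      using power_mono[of "3 / 2 * real n" "\<bar>real J * u - 2 * real k\<bar>" 2] by simp
    moreover have "9 / 4 * real n \<le> (3 / 2 * real n)\<^sup>2"
      using n(1) by (simp add: power2_eq_square)
    ultimately have "9 / 4 * real n \<le> (real J * u - 2 * real k)\<^sup>2" by linarith
    then have "pi * (9 / 4 * real n) \<le> pi * (real J * u - 2 * real k)\<^sup>2" by (intro mult_left_mono) auto
    then have "exp (- pi * (real J * u - 2 * real k)\<^sup>2) \<le> exp (real n * (- pi * (9 / 4)))"
      by (simp add: mult_ac)
    also have "\<dots> = r ^ n" by (simp only: r_def exp_of_nat_mult)
    finally show "exp (- pi * (real J * u - 2 * real k)\<^sup>2) \<le> r ^ (if j < k then k - j else j - k)"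
      unfolding n_def .
  qed
  also have "\<dots> \<le> 2 * r / (1 - r)"
    using r q j by (intro sum_power_dist_le) auto
  also have "\<dots> \<le> q / 2"
  proof -
    have "2 * r \<le> 2 * (q / 7)" using r by simp
    also have "\<dots> \<le> q / 2 * (1 - r)"
    proof -
      have "q / 2 * (6 / 7) \<le> q / 2 * (1 - r)" using r q by (intro mult_left_mono) auto
      then show ?thesis using q by simp
    qed
    finally show ?thesis using r q by (simp add: pos_divide_le_eq)
  qed
  finally show ?thesis using main unfolding q_def by linarith
qed

lemma norm_chirp:
  fixes x :: "'a::euclidean_space"
  assumes "\<And>b. b \<in> Basis \<Longrightarrow> Re (z b) = a"
  shows "norm (chirp z x) = gauss a x"
proof -
  have "norm (chirp z x) = (\<Prod>b\<in>Basis. exp (- pi * a * (x \<bullet> b)\<^sup>2))"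
    unfolding chirp_def prod_norm[symmetric] using assms by (intro prod.cong) (auto simp only: norm_exp_gaussian)
  also have "\<dots> = exp (\<Sum>b\<in>Basis. - pi * a * (x \<bullet> b)\<^sup>2)" by (simp add: exp_sum)
  also have "(\<Sum>b\<in>Basis. - pi * a * (x \<bullet> b)\<^sup>2) = - pi * a * (norm x)\<^sup>2"
    by (simp only: norm_sq_eq_sum sum_distrib_left)
  finally show ?thesis by (simp add: gauss_def)
qed

lemma norm_csqrt: "norm (csqrt z) = sqrt (norm z)"
proof -
  have "(norm (csqrt z))\<^sup>2 = norm z" by (simp flip: norm_power)
  then show ?thesis by (metis norm_ge_zero real_sqrt_unique)
qed

text \<open>A chirp of width R in space whose transform has width w b in the direction b; any widths
  with R w b at least 1 can occur.\<close>

lemma chirp_with_widths: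
  fixes w :: "'a::euclidean_space \<Rightarrow> real"
  assumes R: "0 < R" and w: "\<And>b. b \<in> Basis \<Longrightarrow> 0 < w b" "\<And>b. b \<in> Basis \<Longrightarrow> 1 \<le> R * w b"
  obtains f :: "'a \<Rightarrow> complex" where "integrable lborel f" "\<And>x. norm (f x) = gauss 1 (x /\<^sub>R R)"
    "\<And>\<xi>. norm (fourier f \<xi>) = (\<Prod>b\<in>Basis. exp (- pi * (\<xi> \<bullet> b / w b)\<^sup>2) * sqrt (R / w b))"
proof -
  \<comment> \<open>The real part 1 / R^2 fixes the width in space. The modulus w b / R gives 1 / z
    b the real part (1 / R^2) / (w b / R)^2 = 1 / (w b)^2, which fixes the width in frequency. The
    imaginary part is a real square root because R w b \<ge> 1.\<close>
  define z where "z b = Complex (1 / R\<^sup>2) (sqrt ((w b)\<^sup>2 / R\<^sup>2 - (1 / R\<^sup>2)\<^sup>2))" for b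
  have nn: "0 \<le> (w b)\<^sup>2 / R\<^sup>2 - (1 / R\<^sup>2)\<^sup>2" if b: "b \<in> Basis" for b
  proof -
    have "1\<^sup>2 \<le> (R * w b)\<^sup>2" using w(2)[OF b] by (intro power_mono) auto
    then have "1 / (R\<^sup>2 * R\<^sup>2) \<le> (R * w b)\<^sup>2 / (R\<^sup>2 * R\<^sup>2)" using R by (intro divide_right_mono) auto
    also have "\<dots> = (w b)\<^sup>2 / R\<^sup>2"
      unfolding power_mult_distrib using R by (subst nonzero_mult_divide_mult_cancel_left) auto
    finally show ?thesis by (simp add: power2_eq_square)
  qed
  have cm2: "(Re (z b))\<^sup>2 + (Im (z b))\<^sup>2 = (w b / R)\<^sup>2" if b: "b \<in> Basis" for b
    using nn[OF b] by (simp add: z_def power_divide)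
  have cm: "norm (z b) = w b / R" if b: "b \<in> Basis" for b
    unfolding cmod_def cm2[OF b] using w(1)[OF b] R by (simp add: real_sqrt_abs)
  have Re: "0 < Re (z b)" for b using R by (simp add: z_def)
  show ?thesis
  proof (rule that[of "chirp z"])
    show "integrable lborel (chirp z)" using Re by (intro integrable_chirp)
    fix x
    have "norm (chirp z x) = gauss (1 / R\<^sup>2) x" by (rule norm_chirp) (simp add: z_def)
    then show "norm (chirp z x) = gauss 1 (x /\<^sub>R R)" using gauss_scaleR[OF R, of 1 x] by simp
    show "norm (fourier (chirp z) \<xi>) = (\<Prod>b\<in>Basis. exp (- pi * (\<xi> \<bullet> b / w b)\<^sup>2) * sqrt (R / w b))" for \<xi>
    proof -
      have "norm (fourier (chirp z) \<xi>) = (\<Prod>b\<in>Basis. norm (exp (- of_real (pi * (\<xi> \<bullet> b)\<^sup>2) / z b) / csqrt (z b)))"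
        using fourier_chirp[of z \<xi>] Re by (simp add: prod_norm)
      also have "\<dots> = (\<Prod>b\<in>Basis. exp (- pi * (\<xi> \<bullet> b / w b)\<^sup>2) * sqrt (R / w b))"
      proof (rule prod.cong[OF refl])
        fix b :: 'a assume b: "b \<in> Basis"
        have "Re (inverse (z b)) = (1 / R\<^sup>2) / (w b / R)\<^sup>2"
          by (simp only: inverse_complex.sel cm2[OF b]) (simp add: z_def)
        also have "\<dots> = 1 / (w b)\<^sup>2" using R by (simp add: power_divide)
        finally have Rei: "Re (inverse (z b)) = 1 / (w b)\<^sup>2" .
        have "Re (- of_real (pi * (\<xi> \<bullet> b)\<^sup>2) / z b) = - (pi * (\<xi> \<bullet> b)\<^sup>2) * Re (inverse (z b))"
        proof -
          have "- of_real (pi * (\<xi> \<bullet> b)\<^sup>2) / z b = of_real (- (pi * (\<xi> \<bullet> b)\<^sup>2)) * inverse (z b)"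
            by (simp add: divide_inverse)
          then show ?thesis by (simp only: times_complex.sel Re_complex_of_real Im_complex_of_real mult_zero_left diff_0_right)
        qed
        also have "\<dots> = - pi * (\<xi> \<bullet> b / w b)\<^sup>2" unfolding Rei by (simp add: power_divide)
        finally have "norm (exp (- of_real (pi * (\<xi> \<bullet> b)\<^sup>2) / z b)) = exp (- pi * (\<xi> \<bullet> b / w b)\<^sup>2)"
          by (simp only: norm_exp_eq_Re)
        moreover have "norm (csqrt (z b)) = sqrt (w b / R)" unfolding norm_csqrt cm[OF b] ..
        ultimately show "norm (exp (- of_real (pi * (\<xi> \<bullet> b)\<^sup>2) / z b) / csqrt (z b)) = exp (- pi * (\<xi> \<bullet> b / w b)\<^sup>2) * sqrt (R / w b)"
          using w(1)[OF b] R by (simp add: norm_divide real_sqrt_divide)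
      qed
      finally show ?thesis .
    qed
  qed
qed

text \<open>A majorant of the superposition by the triangle inequality. The amplitudes are S^(-d (1
  - s)) divided by the peak (R j / S)^(d/2) J^(1/2) of the transform of the j-th chirp; this gives
  all bumps the same height and the whole transform a norm of order 1.\<close>

definition chirp_envelope :: "real \<Rightarrow> nat \<Rightarrow> real \<Rightarrow> (nat \<Rightarrow> real) \<Rightarrow> 'a::euclidean_space \<Rightarrow> real" where
  "chirp_envelope s J S R x = S powr - (DIM('a) * (1 / 2 - s)) * real J powr - (1 / 2)
     * (\<Sum>j<J. R j powr - (DIM('a) / 2) * gauss 1 (x /\<^sub>R R j))"

text \<open>The J chirps have widths R j in space; their transforms are bumps with centres
  spaced along one coordinate direction which share the ball of radius S.\<close>

lemma chirp_superposition:
  fixes s :: real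
  assumes s: "0 \<le> s" "s \<le> 1 / 2"
  obtains c0 c1 where "0 < c0" "0 < c1" "\<And>(J::nat) (S::real) R. 0 < J \<Longrightarrow> 0 < S \<Longrightarrow> (\<And>j. j < J \<Longrightarrow> 0 < R j \<and> J \<le> R j * S) \<Longrightarrow>
    \<exists>g::'a::euclidean_space \<Rightarrow> complex. integrable lborel g
      \<and> (\<forall>x. norm (g x) \<le> chirp_envelope s J S R x)
      \<and> ennreal c0 \<le> lnorm (1 - s) (\<lambda>\<xi>. norm (fourier g \<xi>))
      \<and> (\<forall>\<xi>. norm (fourier g \<xi>) \<le> c1 * S powr - (DIM('a) * (1 - s)) * gauss (1 / 4) (\<xi> /\<^sub>R S))"
proof -
  let ?d = "DIM('a)"
  obtain C where C: "0 < C" "\<And>(u::real) J::nat. 0 < J \<Longrightarrow>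
    (\<Sum>j<J. exp (- pi * (real J * u - 2 * real j)\<^sup>2)) \<le> C * exp (- pi * u\<^sup>2 / 4)"
    using sum_gaussian_bumps_le by blast
  obtain e :: 'a where e: "e \<in> Basis" using nonempty_Basis by blast
  define q where "q = exp (- pi / 4)"
  have q: "0 < q" "q < 1" by (simp_all add: q_def)
  define \<kappa> where "\<kappa> = q ^ ?d * (q / 2)"
  have \<kappa>: "0 < \<kappa>" using q by (simp add: \<kappa>_def)
  show ?thesis
  proof (rule that[OF \<kappa> C(1)])
    fix J :: nat and S :: real and R :: "nat \<Rightarrow> real"
    assume J: "0 < J" and S: "0 < S" and R: "\<And>j. j < J \<Longrightarrow> 0 < R j \<and> J \<le> R j * S"
    \<comment> \<open>Width S / J along e leaves room for J separated bumps at scale S. The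
      hypothesis J \<le> R j S is then the condition R j w b \<ge> 1 of
      \<open>chirp_with_widths\<close> for b = e.\<close>
    define w where "w b = (if b = e then S / J else S)" for b
    define \<sigma> where "\<sigma> = S powr - (?d * (1 - s))"
    have \<sigma>: "0 < \<sigma>" using S by (simp add: \<sigma>_def)
    define D where "D j = sqrt (R j / S) ^ ?d * sqrt J" for j
    have "\<exists>f. \<forall>j<J. integrable lborel (f j) \<and> (\<forall>x. norm (f j x) = gauss 1 (x /\<^sub>R R j))
      \<and> (\<forall>\<xi>. norm (fourier (f j) \<xi>) = (\<Prod>b\<in>Basis. exp (- pi * (\<xi> \<bullet> b / w b)\<^sup>2)) * D j)"
    proof (rule choice_iff'[THEN iffD1, rule_format])
      fix j assume j: "j < J"
      have "0 < w b" for b using S J by (simp add: w_def)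
      moreover have "1 \<le> R j * w b" for b
      proof (cases "b = e")
        case True
        then show ?thesis using R[OF j] J by (simp add: w_def field_simps)
      next
        case False
        have "1 \<le> real J" using J by simp
        also have "\<dots> \<le> R j * S" using R[OF j] by simp
        finally show ?thesis using False by (simp add: w_def)
      qed
      ultimately obtain h :: "'a \<Rightarrow> complex" where h: "integrable lborel h" "\<And>x. norm (h x) = gauss 1 (x /\<^sub>R R j)"
        "\<And>\<xi>. norm (fourier h \<xi>) = (\<Prod>b\<in>Basis. exp (- pi * (\<xi> \<bullet> b / w b)\<^sup>2) * sqrt (R j / w b))"
        using chirp_with_widths[of "R j" w] R[OF j] by blast
      have "(\<Prod>b\<in>(Basis::'a set). sqrt (R j / w b)) = (\<Prod>b\<in>(Basis::'a set). sqrt (R j / S) * (if b = e then sqrt J else 1))"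
        using R[OF j] S J by (intro prod.cong) (auto simp: w_def real_sqrt_divide real_sqrt_mult)
      also have "\<dots> = D j" using e by (simp add: prod.distrib D_def)
      finally have "norm (fourier h \<xi>) = (\<Prod>b\<in>Basis. exp (- pi * (\<xi> \<bullet> b / w b)\<^sup>2)) * D j" for \<xi>
        unfolding h(3) prod.distrib by simp
      then show "\<exists>h::'a \<Rightarrow> complex. integrable lborel h \<and> (\<forall>x. norm (h x) = gauss 1 (x /\<^sub>R R j))
        \<and> (\<forall>\<xi>. norm (fourier h \<xi>) = (\<Prod>b\<in>Basis. exp (- pi * (\<xi> \<bullet> b / w b)\<^sup>2)) * D j)"
        using h by blast
    qed
    then obtain f :: "nat \<Rightarrow> 'a \<Rightarrow> complex" where f: "\<And>j. j < J \<Longrightarrow> integrable lborel (f j)"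
      "\<And>j x. j < J \<Longrightarrow> norm (f j x) = gauss 1 (x /\<^sub>R R j)"
      "\<And>j \<xi>. j < J \<Longrightarrow> norm (fourier (f j) \<xi>) = (\<Prod>b\<in>Basis. exp (- pi * (\<xi> \<bullet> b / w b)\<^sup>2)) * D j"
      by blast
    have D: "0 < D j" if "j < J" for j using R[OF that] S J by (simp add: D_def)
    \<comment> \<open>Modulation moves the j-th bump to the centre 2 j S / J along e; division by
      the peak \<open>D j\<close> equalises the heights to \<sigma>.\<close>
    define \<eta> where "\<eta> j = (- (2 * real j * S / J)) *\<^sub>R e" for j
    define c where "c j = \<sigma> / D j" for j
    have c: "0 < c j" if "j < J" for j using D[OF that] \<sigma> by (simp add: c_def)
    define F where "F j x = of_real (c j) * (f j x * cis (- 2 * pi * (x \<bullet> \<eta> j)))" for j x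
    have F: "integrable lborel (F j)" if "j < J" for j
      unfolding F_def[abs_def] using f(1)[OF that] by (intro integrable_mult_right integrable_mult_cis) auto
    define g where "g x = (\<Sum>j<J. F j x)" for x
    have g: "integrable lborel g" unfolding g_def[abs_def] using F by (intro Bochner_Integration.integrable_sum) auto
    have [measurable]: "g \<in> borel_measurable borel" using g by auto
    define P where "P y = (\<Prod>b\<in>Basis - {e}. exp (- pi * (y \<bullet> b)\<^sup>2))" for y :: 'a
    have P: "0 \<le> P y" for y by (auto simp: P_def intro!: prod_nonneg)
    have nF: "norm (fourier (F j) \<xi>) = \<sigma> * P (\<xi> /\<^sub>R S) * exp (- pi * (real J * ((\<xi> /\<^sub>R S) \<bullet> e) - 2 * real j)\<^sup>2)"
      if j: "j < J" for j \<xi>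
    proof -
      have fm: "f j \<in> borel_measurable borel" using f(1)[OF j] by auto
      have "fourier (F j) \<xi> = of_real (c j) * fourier (\<lambda>x. f j x * cis (- 2 * pi * (x \<bullet> \<eta> j))) \<xi>"
        unfolding F_def[abs_def] using f(1)[OF j] by (intro fourier_cmult integrable_mult_cis) auto
      also have "fourier (\<lambda>x. f j x * cis (- 2 * pi * (x \<bullet> \<eta> j))) \<xi> = fourier (f j) (\<xi> + \<eta> j)"
        by (rule fourier_modulate[OF fm])
      finally have "norm (fourier (F j) \<xi>) = c j * norm (fourier (f j) (\<xi> + \<eta> j))"
        using c[OF j] by (simp add: norm_mult)
      also have "\<dots> = \<sigma> * (\<Prod>b\<in>Basis. exp (- pi * ((\<xi> + \<eta> j) \<bullet> b / w b)\<^sup>2))"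
        using D[OF j] unfolding f(3)[OF j] by (simp add: c_def)
      also have "(\<Prod>b\<in>Basis. exp (- pi * ((\<xi> + \<eta> j) \<bullet> b / w b)\<^sup>2)) =
          exp (- pi * ((\<xi> + \<eta> j) \<bullet> e / w e)\<^sup>2) * (\<Prod>b\<in>Basis - {e}. exp (- pi * ((\<xi> + \<eta> j) \<bullet> b / w b)\<^sup>2))"
        by (rule prod.remove) (use e in auto)
      also have "(\<Prod>b\<in>Basis - {e}. exp (- pi * ((\<xi> + \<eta> j) \<bullet> b / w b)\<^sup>2)) = P (\<xi> /\<^sub>R S)"
        unfolding P_def
      proof (rule prod.cong[OF refl])
        fix b assume b: "b \<in> Basis - {e}"
        then have "e \<bullet> b = 0" using e by (auto simp: inner_not_same_Basis)
        then have "\<eta> j \<bullet> b = 0" by (simp add: \<eta>_def)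
        then have "(\<xi> + \<eta> j) \<bullet> b / w b = (\<xi> /\<^sub>R S) \<bullet> b"
          using b by (simp add: w_def inner_add_left divide_inverse mult.commute)
        then show "exp (- pi * ((\<xi> + \<eta> j) \<bullet> b / w b)\<^sup>2) = exp (- pi * ((\<xi> /\<^sub>R S) \<bullet> b)\<^sup>2)" by simp
      qed
      also have "(\<xi> + \<eta> j) \<bullet> e / w e = real J * ((\<xi> /\<^sub>R S) \<bullet> e) - 2 * real j"
      proof -
        have "\<eta> j \<bullet> e = - (2 * real j * S / J)" using e by (simp add: \<eta>_def)
        then show ?thesis using S J by (simp add: w_def inner_add_left field_simps)
      qed
      finally show ?thesis by (simp add: mult_ac)
    qed
    have fg: "fourier g \<xi> = (\<Sum>j<J. fourier (F j) \<xi>)" for \<xi>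
      unfolding g_def[abs_def] by (rule fourier_sum) (use F in auto)
    have env: "norm (g x) \<le> chirp_envelope s J S R x" for x
    proof -
      have "norm (g x) \<le> (\<Sum>j<J. norm (F j x))" unfolding g_def by (rule norm_sum)
      also have "\<dots> = (\<Sum>j<J. c j * gauss 1 (x /\<^sub>R R j))"
        using c f(2) by (intro sum.cong) (auto simp: F_def norm_mult less_imp_le)
      also have "\<dots> = (\<Sum>j<J. S powr - (?d * (1 / 2 - s)) * real J powr - (1 / 2) * (R j powr - (?d / 2) * gauss 1 (x /\<^sub>R R j)))"
      proof (rule sum.cong[OF refl])
        fix j assume "j \<in> {..<J}"
        then have j: "j < J" and Rj: "0 < R j" using R by auto
        have "sqrt (R j / S) ^ ?d = (R j / S) powr (?d / 2)"
          using Rj S by (simp add: powr_half_sqrt[symmetric] powr_powr flip: powr_realpow)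
        also have "\<dots> = R j powr (?d / 2) * S powr - (?d / 2)"
          using Rj S by (simp add: powr_divide powr_minus_divide)
        finally have "D j = R j powr (?d / 2) * S powr - (?d / 2) * J powr (1 / 2)"
          by (simp add: D_def powr_half_sqrt)
        then have "c j = \<sigma> * S powr (?d / 2) * J powr - (1 / 2) * R j powr - (?d / 2)"
          by (simp add: c_def powr_minus_divide)
        also have "\<sigma> * S powr (?d / 2) = S powr - (?d * (1 / 2 - s))"
        proof -
          have "- (?d * (1 - s)) + ?d / 2 = - (?d * (1 / 2 - s))" by (simp add: algebra_simps)
          then show ?thesis by (simp only: \<sigma>_def powr_add[symmetric])
        qed
        finally show "c j * gauss 1 (x /\<^sub>R R j) = S powr - (?d * (1 / 2 - s)) * real J powr - (1 / 2) * (R j powr - (?d / 2) * gauss 1 (x /\<^sub>R R j))"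
          by (simp add: mult_ac)
      qed
      also have "\<dots> = chirp_envelope s J S R x"
        by (simp add: chirp_envelope_def sum_distrib_left)
      finally show ?thesis .
    qed
    have upper: "norm (fourier g \<xi>) \<le> C * S powr - (?d * (1 - s)) * gauss (1 / 4) (\<xi> /\<^sub>R S)" for \<xi>
    proof -
      define y where "y = \<xi> /\<^sub>R S"
      have "norm (fourier g \<xi>) \<le> (\<Sum>j<J. norm (fourier (F j) \<xi>))" unfolding fg by (rule norm_sum)
      also have "\<dots> = \<sigma> * P y * (\<Sum>j<J. exp (- pi * (real J * (y \<bullet> e) - 2 * real j)\<^sup>2))"
        unfolding sum_distrib_left y_def using nF by (intro sum.cong) auto
      also have "\<dots> \<le> \<sigma> * P y * (C * exp (- pi * (y \<bullet> e)\<^sup>2 / 4))"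
        using \<sigma> P by (intro mult_left_mono C(2) J) auto
      \<comment> \<open>The transverse factors are weakened to the decay rate that remains along e,
        so that the bound is a single radial Gaussian.\<close>
      also have "\<dots> \<le> \<sigma> * (\<Prod>b\<in>Basis - {e}. exp (- pi * (y \<bullet> b)\<^sup>2 / 4)) * (C * exp (- pi * (y \<bullet> e)\<^sup>2 / 4))"
        unfolding P_def using \<sigma> C by (intro mult_right_mono mult_left_mono prod_mono) auto
      also have "\<dots> = C * \<sigma> * (exp (- pi * (y \<bullet> e)\<^sup>2 / 4) * (\<Prod>b\<in>Basis - {e}. exp (- pi * (y \<bullet> b)\<^sup>2 / 4)))"
        by (simp add: mult_ac)
      also have "exp (- pi * (y \<bullet> e)\<^sup>2 / 4) * (\<Prod>b\<in>Basis - {e}. exp (- pi * (y \<bullet> b)\<^sup>2 / 4)) = (\<Prod>b\<in>Basis. exp (- pi * (y \<bullet> b)\<^sup>2 / 4))"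
        by (rule prod.remove[symmetric]) (use e in auto)
      also have "\<dots> = exp (\<Sum>b\<in>Basis. - pi * (y \<bullet> b)\<^sup>2 / 4)" by (simp add: exp_sum)
      also have "(\<Sum>b\<in>Basis. - pi * (y \<bullet> b)\<^sup>2 / 4) = - pi * (1 / 4) * (norm y)\<^sup>2"
        by (simp add: norm_sq_eq_sum sum_distrib_left sum_divide_distrib sum_negf)
      finally show ?thesis by (simp add: \<sigma>_def y_def gauss_def)
    qed
    have lower: "ennreal \<kappa> \<le> lnorm (1 - s) (\<lambda>\<xi>. norm (fourier g \<xi>))"
    proof -
      \<comment> \<open>The boxes \<open>Q j\<close> have side 1 / J along e and 1 in the other
        directions. They are disjoint, with union of measure 1 for every J, and on
        \<open>Q j\<close> the j-th bump dominates the sum of the others.\<close>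
      define v where "v = (\<Sum>b\<in>Basis. (if b = e then 1 / (2 * real J) else 1 / 2) *\<^sub>R b)"
      define m where "m j = (2 * real j / J) *\<^sub>R e" for j
      define Q where "Q j = cbox (m j - v) (m j + v)" for j
      have vb: "v \<bullet> b = (if b = e then 1 / (2 * real J) else 1 / 2)" if "b \<in> Basis" for b
        using that by (simp add: v_def inner_sum_left_Basis)
      have me: "m j \<bullet> b = (if b = e then 2 * real j / J else 0)" if "b \<in> Basis" for j b
        using that e by (auto simp: m_def inner_not_same_Basis)
      have Qe: "\<bar>real J * (y \<bullet> e) - 2 * real j\<bar> \<le> 1 / 2" if y: "y \<in> Q j" for y j
      proof -
        have "2 * real j / J - 1 / (2 * real J) \<le> y \<bullet> e \<and> y \<bullet> e \<le> 2 * real j / J + 1 / (2 * real J)"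
          using y e by (auto simp: Q_def mem_box inner_diff_left inner_add_left vb me)
        then have "real J * (2 * real j / J - 1 / (2 * real J)) \<le> real J * (y \<bullet> e)"
            "real J * (y \<bullet> e) \<le> real J * (2 * real j / J + 1 / (2 * real J))"
          by (auto intro!: mult_left_mono)
        moreover have "real J * (2 * real j / J - 1 / (2 * real J)) = 2 * real j - 1 / 2"
            "real J * (2 * real j / J + 1 / (2 * real J)) = 2 * real j + 1 / 2"
          using J by (auto simp: field_simps)
        ultimately show ?thesis unfolding abs_le_iff by linarith
      qed
      have Qb: "\<bar>y \<bullet> b\<bar> \<le> 1 / 2" if "y \<in> Q j" "b \<in> Basis - {e}" for y j b
        using that e by (auto simp: Q_def mem_box inner_diff_left inner_add_left vb me abs_le_iff)
      have eQ: "emeasure lborel (Q j) = ennreal (1 / J)" for j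
      proof -
        have "emeasure lborel (Q j) = ennreal (\<Prod>b\<in>Basis. (m j + v - (m j - v)) \<bullet> b)"
          unfolding Q_def by (rule emeasure_lborel_cbox) (auto simp: inner_diff_left inner_add_left vb)
        also have "(\<Prod>b\<in>Basis. (m j + v - (m j - v)) \<bullet> b) = (\<Prod>b\<in>(Basis::'a set). if b = e then 1 / real J else 1)"
          by (intro prod.cong) (auto simp: inner_diff_left inner_add_left vb)
        also have "\<dots> = 1 / J" using e by simp
        finally show ?thesis .
      qed
      define U where "U = (\<Union>j<J. Q j)"
      have [measurable]: "Q j \<in> sets borel" for j by (simp add: Q_def)
      have [measurable]: "U \<in> sets borel" unfolding U_def by measurable
      have "disjoint_family_on Q {..<J}"
      proof (unfold disjoint_family_on_def, intro ballI impI)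
        fix i j :: nat assume ij: "i \<noteq> j"
        show "Q i \<inter> Q j = {}"
        proof (rule ccontr)
          assume "Q i \<inter> Q j \<noteq> {}"
          then obtain y where "y \<in> Q i" "y \<in> Q j" by blast
          from Qe[OF this(1)] Qe[OF this(2)] have "\<bar>2 * real i - 2 * real j\<bar> \<le> 1" by linarith
          then have "\<bar>2 * int i - 2 * int j\<bar> \<le> 1" by linarith
          with ij show False by presburger
        qed
      qed
      then have "emeasure lborel U = (\<Sum>j<J. emeasure lborel (Q j))"
        unfolding U_def by (intro sum_emeasure[symmetric]) auto
      also have "\<dots> = of_nat J * ennreal (1 / real J)" by (simp add: eQ)
      also have "\<dots> = 1" using J by (simp add: ennreal_of_nat_eq_real_of_nat flip: ennreal_mult)
      finally have eU: "emeasure lborel U = 1" .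
      have low: "\<sigma> * \<kappa> * indicator U (\<xi> /\<^sub>R S) \<le> norm (fourier g \<xi>)" for \<xi>
      proof (cases "\<xi> /\<^sub>R S \<in> U")
        case True
        define y where "y = \<xi> /\<^sub>R S"
        obtain j where j: "j < J" "y \<in> Q j" using True by (auto simp: U_def y_def)
        define a where "a k = exp (- pi * (real J * (y \<bullet> e) - 2 * real k)\<^sup>2)" for k
        have "q / 2 \<le> a j - (\<Sum>k\<in>{..<J} - {j}. a k)"
          unfolding a_def q_def by (rule gaussian_bump_separated[OF j(1) Qe[OF j(2)]])
        moreover have "q ^ ?d \<le> P y"
        proof -
          have "q ^ ?d \<le> q ^ card (Basis - {e})"
            using q e by (intro power_decreasing) (auto simp: card_Diff_singleton)
          also have "\<dots> = (\<Prod>b\<in>Basis - {e}. q)" by simp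
          also have "\<dots> \<le> P y"
            unfolding P_def
          proof (rule prod_mono)
            fix b assume b: "b \<in> Basis - {e}"
            have "\<bar>y \<bullet> b\<bar>\<^sup>2 \<le> (1 / 2)\<^sup>2" using Qb[OF j(2) b] by (intro power_mono) auto
            then have "pi * (y \<bullet> b)\<^sup>2 \<le> pi * (1 / 4)" by (intro mult_left_mono) (auto simp: power2_eq_square)
            then show "0 \<le> q \<and> q \<le> exp (- pi * (y \<bullet> b)\<^sup>2)" using q by (simp add: q_def)
          qed
          finally show ?thesis .
        qed
        ultimately have "\<kappa> \<le> P y * (a j - (\<Sum>k\<in>{..<J} - {j}. a k))"
          unfolding \<kappa>_def using q P by (intro mult_mono) auto
        then have "\<sigma> * \<kappa> \<le> \<sigma> * (P y * (a j - (\<Sum>k\<in>{..<J} - {j}. a k)))" using \<sigma> by (intro mult_left_mono) auto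
        also have "\<dots> = \<sigma> * P y * a j - (\<Sum>k\<in>{..<J} - {j}. \<sigma> * P y * a k)"
          by (simp add: algebra_simps sum_distrib_left)
        also have "\<dots> = norm (fourier (F j) \<xi>) - (\<Sum>k\<in>{..<J} - {j}. norm (fourier (F k) \<xi>))"
          using nF[of _ \<xi>] j by (auto simp: a_def y_def intro!: arg_cong2[where f="(-)"] sum.cong)
        also have "\<dots> \<le> norm (fourier (F j) \<xi>) - norm (\<Sum>k\<in>{..<J} - {j}. fourier (F k) \<xi>)"
          by (intro diff_left_mono norm_sum)
        also have "\<dots> \<le> norm (fourier (F j) \<xi> + (\<Sum>k\<in>{..<J} - {j}. fourier (F k) \<xi>))"
          by (rule norm_diff_ineq)
        also have "fourier (F j) \<xi> + (\<Sum>k\<in>{..<J} - {j}. fourier (F k) \<xi>) = fourier g \<xi>"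
          unfolding fg using j by (intro sum.remove[symmetric]) auto
        finally show ?thesis using True by simp
      qed simp
      have "ennreal \<kappa> = ennreal (\<sigma> * \<kappa>) * (ennreal (S powr (?d * (1 - s))) * 1)"
        using \<sigma> \<kappa> S by (simp add: \<sigma>_def flip: ennreal_mult powr_add)
      also have "1 \<le> lnorm (1 - s) (indicat_real U)"
      proof -
        have "(indicat_real U x) powr (1 / (1 - s)) = indicator U x" for x by (simp add: indicator_def)
        then have "lnorm (1 - s) (indicat_real U) = ennreal_powr (\<integral>\<^sup>+ x. ennreal (indicat_real U x) \<partial>lborel) (1 - s)"
          using s by (simp add: lnorm_def)
        also have "(\<integral>\<^sup>+ x. ennreal (indicat_real U x) \<partial>lborel) = emeasure lborel U"
          by (simp add: nn_integral_indicator[symmetric] del: nn_integral_indicator) (auto intro!: nn_integral_cong simp: indicator_def)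
        also have "ennreal_powr (emeasure lborel U) (1 - s) = 1" unfolding eU by (simp add: ennreal_powr_def)
        finally show ?thesis by simp
      qed
      then have "ennreal (\<sigma> * \<kappa>) * (ennreal (S powr (?d * (1 - s))) * 1) \<le>
          ennreal (\<sigma> * \<kappa>) * (ennreal (S powr (?d * (1 - s))) * lnorm (1 - s) (indicat_real U))"
        by (intro mult_left_mono) auto
      also have "ennreal (S powr (?d * (1 - s))) * lnorm (1 - s) (indicat_real U) = lnorm (1 - s) (\<lambda>\<xi>. indicat_real U (\<xi> /\<^sub>R S))"
        using s S by (intro lnorm_dilate[symmetric]) auto
      also have "ennreal (\<sigma> * \<kappa>) * \<dots> = lnorm (1 - s) (\<lambda>\<xi>. \<sigma> * \<kappa> * indicat_real U (\<xi> /\<^sub>R S))"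
        using s \<sigma> \<kappa> by (intro lnorm_cmult[symmetric]) auto
      also have "\<dots> \<le> lnorm (1 - s) (\<lambda>\<xi>. norm (fourier g \<xi>))"
        using s \<sigma> \<kappa> low by (intro lnorm_mono) auto
      finally show ?thesis .
    qed
    show "\<exists>g::'a \<Rightarrow> complex. integrable lborel g
      \<and> (\<forall>x. norm (g x) \<le> chirp_envelope s J S R x)
      \<and> ennreal \<kappa> \<le> lnorm (1 - s) (\<lambda>\<xi>. norm (fourier g \<xi>))
      \<and> (\<forall>\<xi>. norm (fourier g \<xi>) \<le> C * S powr - (?d * (1 - s)) * gauss (1 / 4) (\<xi> /\<^sub>R S))"
      using g env lower upper by blast
  qed
qed

text \<open>At most boundedly many of the dyadic scales contribute at any point, which is why the power of
  J is s instead of 1.\<close>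

lemma lnorm_dyadic_sum:
  fixes s b :: real
  assumes s: "0 \<le> s" "s \<le> 1" and b: "0 \<le> b"
  obtains C where "0 < C" "\<And>(r::real) J::nat. 0 < r \<Longrightarrow> 0 < J \<Longrightarrow>
    lnorm s (\<lambda>x::'a::euclidean_space. norm x powr (DIM('a) * (1 / 2 - s)) *
      (\<Sum>j<J. (r * 2 ^ j) powr - (DIM('a) / 2) * ((norm x / (r * 2 ^ j)) powr b * gauss 1 (x /\<^sub>R (r * 2 ^ j)))))
    \<le> ennreal (C * J powr s)"
proof -
  define d where "d = real DIM('a)"
  have d: "0 < d" by (simp add: d_def)
  define C0 where "C0 = max 1 (exp ((d + b)\<^sup>2 / (4 * pi)))"
  have C0: "1 \<le> C0" by (simp add: C0_def)
  \<comment> \<open>\<open>mm t\<close> is the smaller of t and 1 / t to the power d / 2: the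
    profile with which the scale R contributes at t = |x| / R. Its branch t \<ge> 1 uses the
    Gaussian decay.\<close>
  define mm where "mm t = exp (- (d / 2) * \<bar>ln t\<bar>)" for t :: real
  have mm0: "0 \<le> mm t" for t by (simp add: mm_def)
  have mlt: "mm t = t powr (d / 2)" if "0 < t" "t < 1" for t
    using that by (simp add: mm_def powr_def ln_less_zero_iff abs_of_neg)
  have mge: "mm t = t powr - (d / 2)" if "1 \<le> t" for t
    using that by (simp add: mm_def powr_def)
  have kb: "t powr (d / 2) * (t powr b * exp (- pi * t\<^sup>2)) \<le> C0 * mm t" if t: "0 < t" for t
  proof (cases "t < 1")
    case True
    have "t powr b * exp (- pi * t\<^sup>2) \<le> 1 * 1" using t True b by (intro mult_mono powr_le1) auto
    then have "t powr b * exp (- pi * t\<^sup>2) \<le> C0" using C0 by simp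
    then have "t powr (d / 2) * (t powr b * exp (- pi * t\<^sup>2)) \<le> t powr (d / 2) * C0" by (intro mult_left_mono) auto
    then show ?thesis using mlt[OF t True] by (simp add: mult.commute)
  next
    case False
    have "t powr (d + b) * exp (- pi * t\<^sup>2) \<le> C0"
      using powr_mult_exp_le[of "d + b" pi t] d b t by (simp add: C0_def le_max_iff_disj)
    then have "t powr - (d / 2) * (t powr (d + b) * exp (- pi * t\<^sup>2)) \<le> t powr - (d / 2) * C0" by (intro mult_left_mono) auto
    also have "t powr - (d / 2) * (t powr (d + b) * exp (- pi * t\<^sup>2)) = t powr (- (d / 2) + d + b) * exp (- pi * t\<^sup>2)"
      using t by (simp only: powr_add mult_ac)
    also have "- (d / 2) + d + b = d / 2 + b" by simp
    finally show ?thesis using mge[of t] False by (simp add: powr_add mult_ac)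
  qed
  define C1 where "C1 = 2 / (1 - exp (- (d / 2 * ln 2)))"
  have C1: "0 < C1" using d by (simp add: C1_def)
  \<comment> \<open>The scales 2^j are equally spaced in ln t, so their contributions add up to a
    constant independent of J.\<close>
  have Hle: "(\<Sum>j<J. mm (t / 2 ^ j)) \<le> C1" if t: "0 < t" for t :: real and J :: nat
  proof -
    have "mm (t / 2 ^ j) = exp (- (d / 2 * ln 2) * \<bar>ln t / ln 2 - real j\<bar>)" for j
    proof -
      have "ln (t / 2 ^ j) = ln t - real j * ln 2" using t by (simp add: ln_div ln_realpow)
      also have "\<dots> = ln 2 * (ln t / ln 2 - real j)" by (simp add: field_simps)
      finally have "\<bar>ln (t / 2 ^ j)\<bar> = ln 2 * \<bar>ln t / ln 2 - real j\<bar>" by (simp add: abs_mult)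
      then show ?thesis by (simp add: mm_def)
    qed
    then show ?thesis unfolding C1_def using sum_exp_dist_le[of "d / 2 * ln 2" "ln t / ln 2" J] d by simp
  qed
  let ?g = "\<lambda>r (J::nat) x::'a. norm x powr (d * (1 / 2 - s)) *
      (\<Sum>j<J. (r * 2 ^ j) powr - (d / 2) * ((norm x / (r * 2 ^ j)) powr b * gauss 1 (x /\<^sub>R (r * 2 ^ j))))"
  have g0: "0 \<le> ?g r J x" for r J x by (auto intro!: mult_nonneg_nonneg sum_nonneg)
  \<comment> \<open>With |x| = t R, half a power of |x|^d cancels the amplitude R^(-d/2). What
    remains is |x|^(-d s) times the profile in t.\<close>
  have gle: "?g r J x \<le> norm x powr - (d * s) * (C0 * (\<Sum>j<J. mm (norm x / r / 2 ^ j)))" if r: "0 < r" and x: "x \<noteq> 0" for r J x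
  proof -
    have "?g r J x \<le> (\<Sum>j<J. norm x powr - (d * s) * (C0 * mm (norm x / r / 2 ^ j)))"
      unfolding sum_distrib_left
    proof (rule sum_mono)
      fix j
      define R where "R = r * 2 ^ j"
      have R: "0 < R" using r by (simp add: R_def)
      define t where "t = norm x / R"
      have t: "0 < t" using x R by (simp add: t_def)
      have nx: "norm x = t * R" using R by (simp add: t_def)
      have ga: "gauss 1 (x /\<^sub>R R) = exp (- pi * t\<^sup>2)" using R by (simp add: gauss_def t_def divide_inverse mult.commute)
      have "norm x powr (d * (1 / 2 - s)) = norm x powr (- (d * s) + d / 2)"
        by (simp add: algebra_simps)
      also have "\<dots> = norm x powr - (d * s) * (t powr (d / 2) * R powr (d / 2))"
        using t R by (simp only: powr_add) (simp add: nx powr_mult)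
      finally have "norm x powr (d * (1 / 2 - s)) * (R powr - (d / 2) * (t powr b * exp (- pi * t\<^sup>2))) =
         norm x powr - (d * s) * (t powr (d / 2) * (t powr b * exp (- pi * t\<^sup>2))) * (R powr (d / 2) * R powr - (d / 2))"
        by (simp add: mult_ac)
      also have "R powr (d / 2) * R powr - (d / 2) = 1" using R by (simp flip: powr_add)
      also have "norm x powr - (d * s) * (t powr (d / 2) * (t powr b * exp (- pi * t\<^sup>2))) * 1 \<le> norm x powr - (d * s) * (C0 * mm t)"
        using kb[OF t] by (simp add: mult_left_mono)
      finally show "norm x powr (d * (1 / 2 - s)) * ((r * 2 ^ j) powr - (d / 2) * ((norm x / (r * 2 ^ j)) powr b * gauss 1 (x /\<^sub>R (r * 2 ^ j))))
          \<le> norm x powr - (d * s) * (C0 * mm (norm x / r / 2 ^ j))"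
        unfolding R_def[symmetric] t_def[symmetric] ga by (simp add: t_def R_def)
    qed
    then show ?thesis by (simp add: sum_distrib_left)
  qed
  have gmeas: "?g r J \<in> borel_measurable borel" for r J by measurable
  show ?thesis
  proof (cases "s = 0")
    case True
    show ?thesis
    proof (rule that[of "C0 * C1"])
      show "0 < C0 * C1" using C0 C1 by simp
      fix r :: real and J :: nat assume r: "0 < r" and J: "0 < J"
      have "AE x in lborel. ?g r J x \<le> C0 * C1"
        using AE_lborel_singleton[of "0::'a"]
      proof eventually_elim
        case (elim x)
        have "?g r J x \<le> C0 * (\<Sum>j<J. mm (norm x / r / 2 ^ j))" using gle[OF r elim, of J] elim True by simp
        also have "\<dots> \<le> C0 * C1" using C0 r elim by (intro mult_left_mono Hle) auto
        finally show ?case .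
      qed
      then have "lnorm 0 (?g r J) \<le> ennreal (C0 * C1)"
        using C0 C1 by (subst lnorm_0_le_iff[OF gmeas _ g0]) auto
      then show "lnorm s (\<lambda>x::'a. norm x powr (DIM('a) * (1 / 2 - s)) *
      (\<Sum>j<J. (r * 2 ^ j) powr - (DIM('a) / 2) * ((norm x / (r * 2 ^ j)) powr b * gauss 1 (x /\<^sub>R (r * 2 ^ j)))))
    \<le> ennreal (C0 * C1 * J powr s)" using True J by (simp add: d_def)
    qed
  next
    case False
    then have s0: "0 < s" using s by simp
    \<comment> \<open>|x|^(-d) mm (|x| / R) is R^(-d) times this function at x / R. The exponents d
      / 2 and 3 d / 2 enclose d, so it is integrable, and by dilation every scale contributes the
      same amount.\<close>
    let ?W = "\<lambda>y::'a. inverse (broken_power (d / 2, 3 * d / 2) y)"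
    have "(\<integral>\<^sup>+ y. ennreal (?W y) \<partial>lborel) < \<infinity>"
      using d by (intro nn_integral_inverse_broken_power) (auto simp: d_def)
    then obtain I where I: "0 \<le> I" "(\<integral>\<^sup>+ y. ennreal (?W y) \<partial>lborel) = ennreal I"
      by (cases "\<integral>\<^sup>+ y. ennreal (?W y) \<partial>lborel") auto
    define p where "p = 1 / s"
    have p: "1 \<le> p" using s s0 by (simp add: p_def)
    define C where "C = (C0 powr p * C1 powr (p - 1) * (I + 1)) powr s"
    have C: "0 < C" using C0 C1 I by (simp add: C_def)
    show ?thesis
    proof (rule that[OF C])
      fix r :: real and J :: nat assume r: "0 < r" and J: "0 < J"
      have "(\<integral>\<^sup>+ x. ennreal (?g r J x powr p) \<partial>lborel) \<le>
         (\<integral>\<^sup>+ x. (\<Sum>j<J. ennreal (C0 powr p * C1 powr (p - 1)) * (ennreal ((r * 2 ^ j) powr - d) * ennreal (?W (x /\<^sub>R (r * 2 ^ j))))) \<partial>lborel)"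
      proof (rule nn_integral_mono_AE)
        show "AE x in lborel. ennreal (?g r J x powr p) \<le>
          (\<Sum>j<J. ennreal (C0 powr p * C1 powr (p - 1)) * (ennreal ((r * 2 ^ j) powr - d) * ennreal (?W (x /\<^sub>R (r * 2 ^ j)))))"
          using AE_lborel_singleton[of "0::'a"]
        proof eventually_elim
          case (elim x)
          define H where "H = (\<Sum>j<J. mm (norm x / r / 2 ^ j))"
          have H: "0 \<le> H" unfolding H_def by (intro sum_nonneg mm0)
          have HC: "H \<le> C1" unfolding H_def using elim r by (intro Hle) auto
          have "?g r J x powr p \<le> (norm x powr - (d * s) * (C0 * H)) powr p"
            using gle[OF r elim, of J] g0[of x r J] p unfolding H_def by (intro powr_mono2) auto
          also have "\<dots> = norm x powr - d * (C0 powr p * H powr p)"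
            using C0 H s0 by (simp add: powr_mult powr_powr p_def)
          \<comment> \<open>Since H is bounded, its power p is at most a multiple of H itself. The
            power of the sum thus becomes a sum of J equal integrals, which gives J^s after the
            root.\<close>
          also have "H powr p \<le> C1 powr (p - 1) * H"
          proof (cases "H = 0")
            case False
            then have "H powr p = H powr (p - 1) * H" using H powr_add[of H "p - 1" 1] by simp
            also have "\<dots> \<le> C1 powr (p - 1) * H" using H HC p by (intro mult_right_mono powr_mono2) auto
            finally show ?thesis .
          qed simp
          then have "norm x powr - d * (C0 powr p * H powr p) \<le> norm x powr - d * (C0 powr p * (C1 powr (p - 1) * H))"
            by (intro mult_left_mono) auto
          also have "\<dots> = (\<Sum>j<J. C0 powr p * C1 powr (p - 1) * (norm x powr - d * mm (norm x / r / 2 ^ j)))"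
            by (simp add: H_def sum_distrib_left mult_ac)
          also have "\<dots> = (\<Sum>j<J. C0 powr p * C1 powr (p - 1) * ((r * 2 ^ j) powr - d * ?W (x /\<^sub>R (r * 2 ^ j))))"
          proof (rule sum.cong[OF refl])
            fix j
            define R where "R = r * 2 ^ j"
            have R: "0 < R" using r by (simp add: R_def)
            define t where "t = norm x / R"
            have t: "0 < t" using elim R by (simp add: t_def)
            have nt: "norm (x /\<^sub>R R) = t" using R by (simp add: t_def divide_inverse mult.commute)
            have nx: "norm x = R * t" using R by (simp add: t_def)
            have "t powr - d * mm t = ?W (x /\<^sub>R R)"
            proof (cases "t < 1")
              case True
              have "t powr - d * t powr (d / 2) = t powr - (d / 2)" by (simp flip: powr_add)
              then show ?thesis using True mlt[OF t True] unfolding broken_power_def nt by (simp add: powr_minus)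
            next
              case False
              have "t powr - d * t powr - (d / 2) = t powr - (3 * d / 2)" by (simp flip: powr_add)
              then show ?thesis using False mge[of t] unfolding broken_power_def nt by (simp add: powr_minus)
            qed
            moreover have "norm x powr - d = R powr - d * t powr - d" unfolding nx using R t by (simp add: powr_mult)
            ultimately have "norm x powr - d * mm t = R powr - d * ?W (x /\<^sub>R R)" by simp
            then show "C0 powr p * C1 powr (p - 1) * (norm x powr - d * mm (norm x / r / 2 ^ j)) =
               C0 powr p * C1 powr (p - 1) * ((r * 2 ^ j) powr - d * ?W (x /\<^sub>R (r * 2 ^ j)))"
              by (simp add: t_def R_def)
          qed
          finally have "ennreal (?g r J x powr p) \<le> ennreal (\<Sum>j<J. C0 powr p * C1 powr (p - 1) * ((r * 2 ^ j) powr - d * ?W (x /\<^sub>R (r * 2 ^ j))))"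
            by (intro ennreal_leI) (auto elim: order_trans)
          also have "\<dots> = (\<Sum>j<J. ennreal (C0 powr p * C1 powr (p - 1) * ((r * 2 ^ j) powr - d * ?W (x /\<^sub>R (r * 2 ^ j)))))"
            by (rule sum_ennreal[symmetric]) auto
          also have "\<dots> = (\<Sum>j<J. ennreal (C0 powr p * C1 powr (p - 1)) * (ennreal ((r * 2 ^ j) powr - d) * ennreal (?W (x /\<^sub>R (r * 2 ^ j)))))"
            by (intro sum.cong refl ennreal_mult_mult[symmetric]) auto
          finally show ?case .
        qed
      qed
      also have "\<dots> = (\<Sum>j<J. ennreal (C0 powr p * C1 powr (p - 1)) * (ennreal ((r * 2 ^ j) powr - d) * (\<integral>\<^sup>+ x. ennreal (?W (x /\<^sub>R (r * 2 ^ j))) \<partial>lborel)))"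
        by (simp add: nn_integral_sum nn_integral_cmult)
      also have "\<dots> = (\<Sum>j<J. ennreal (C0 powr p * C1 powr (p - 1)) * ennreal I)"
      proof (rule sum.cong[OF refl])
        fix j
        define R where "R = r * 2 ^ j"
        have R: "0 < R" using r by (simp add: R_def)
        have "(\<integral>\<^sup>+ x. ennreal (?W (x /\<^sub>R R)) \<partial>lborel) = ennreal (R ^ DIM('a)) * (\<integral>\<^sup>+ x. ennreal (?W ((R *\<^sub>R x) /\<^sub>R R)) \<partial>lborel)"
          by (rule nn_integral_scaleR[OF _ R]) measurable
        also have "\<dots> = ennreal (R powr d) * ennreal I" using R I by (simp add: powr_realpow d_def)
        finally have "ennreal (R powr - d) * (\<integral>\<^sup>+ x. ennreal (?W (x /\<^sub>R R)) \<partial>lborel) = ennreal (R powr - d * R powr d) * ennreal I"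
          by (simp add: ennreal_mult mult.assoc)
        also have "R powr - d * R powr d = 1" using R by (simp flip: powr_add)
        finally show "ennreal (C0 powr p * C1 powr (p - 1)) * (ennreal ((r * 2 ^ j) powr - d) * (\<integral>\<^sup>+ x. ennreal (?W (x /\<^sub>R (r * 2 ^ j))) \<partial>lborel)) = ennreal (C0 powr p * C1 powr (p - 1)) * ennreal I"
          by (simp add: R_def)
      qed
      also have "\<dots> = ennreal (real J * (C0 powr p * C1 powr (p - 1) * I))"
        using I by (simp add: ennreal_of_nat_eq_real_of_nat ennreal_mult)
      also have "\<dots> \<le> ennreal ((C * J powr s) powr p)"
      proof (rule ennreal_leI)
        have "(C * J powr s) powr p = (C0 powr p * C1 powr (p - 1) * (I + 1)) * real J"
          using s0 I C0 C1 by (simp add: C_def p_def powr_mult powr_powr)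
        then show "real J * (C0 powr p * C1 powr (p - 1) * I) \<le> (C * J powr s) powr p"
          using I by (simp add: algebra_simps)
      qed
      finally have "lnorm s (?g r J) \<le> ennreal (C * J powr s)"
        using C s0 by (subst lnorm_le_iff[OF gmeas]) (auto simp: p_def)
      then show "lnorm s (\<lambda>x::'a. norm x powr (DIM('a) * (1 / 2 - s)) *
        (\<Sum>j<J. (r * 2 ^ j) powr - (DIM('a) / 2) * ((norm x / (r * 2 ^ j)) powr b * gauss 1 (x /\<^sub>R (r * 2 ^ j)))))
        \<le> ennreal (C * J powr s)" by (simp add: d_def)
    qed
  qed
qed

lemma chirp_envelope_nonneg [simp]: "0 \<le> chirp_envelope s J S R x"
  by (auto simp: chirp_envelope_def intro!: mult_nonneg_nonneg sum_nonneg)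

lemma chirp_envelope_measurable [measurable]: "chirp_envelope s J S R \<in> borel_measurable borel"
  unfolding chirp_envelope_def[abs_def] by measurable

text \<open>The test in terms of the envelope alone: b0 and b1 bound the chirps in space, while
  their frequency data are already absorbed into M.\<close>

lemma uncertainty_chirp_test:
  fixes s A1 A2 B1 B2 K :: real
  assumes s: "0 \<le> s" "s \<le> 1 / 2" and A: "0 < A1" "0 < A2" and B: "0 < B1" "0 < B2" and K: "0 < K"
    and unc: "\<And>f::'a::euclidean_space \<Rightarrow> complex. integrable lborel f \<Longrightarrow> uncertainty s (A1, A2) (B1, B2) K f"
  obtains M where "1 \<le> M" "\<And>(J::nat) (S::real) R (l::real) (e::real) (b0::real) (b1::real).
      0 < J \<Longrightarrow> 0 < S \<Longrightarrow> (\<And>j. j < J \<Longrightarrow> 0 < R j \<and> J \<le> R j * S) \<Longrightarrow>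
      0 < l \<Longrightarrow> 0 < e \<Longrightarrow> 0 \<le> b0 \<Longrightarrow> 0 \<le> b1 \<Longrightarrow> l \<le> 1 / M \<Longrightarrow> b0 \<le> l / M \<Longrightarrow>
      lnorm s (chirp_envelope s J S R :: 'a \<Rightarrow> real) \<le> ennreal b0 \<Longrightarrow>
      lnorm s (\<lambda>x::'a. broken_power (A1, A2) x * chirp_envelope s J S R x) \<le> ennreal b1 \<Longrightarrow>
      l \<le> M * ((l * broken_power (A1, A2) e + b1) * (l * broken_power (B1, B2) (1 / e) + broken_power (B1, B2) S))"
proof -
  obtain c0 c1 where c: "0 < c0" "0 < c1" and sup: "\<And>(J::nat) (S::real) R. 0 < J \<Longrightarrow> 0 < S \<Longrightarrow> (\<And>j. j < J \<Longrightarrow> 0 < R j \<and> J \<le> R j * S) \<Longrightarrow>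
    \<exists>g::'a \<Rightarrow> complex. integrable lborel g
      \<and> (\<forall>x. norm (g x) \<le> chirp_envelope s J S R x)
      \<and> ennreal c0 \<le> lnorm (1 - s) (\<lambda>\<xi>. norm (fourier g \<xi>))
      \<and> (\<forall>\<xi>. norm (fourier g \<xi>) \<le> c1 * S powr - (DIM('a) * (1 - s)) * gauss (1 / 4) (\<xi> /\<^sub>R S))"
    using chirp_superposition[where 'a='a, OF s] by blast
  have s1: "s \<le> 1" "0 \<le> 1 - s" "1 - s \<le> 1" using s by auto
  obtain N where N: "0 < N" "\<And>R::real. 0 < R \<Longrightarrow>
    lnorm (1 - s) (\<lambda>x::'a. broken_power (B1, B2) x * gauss (1 / 4) (x /\<^sub>R R))
    \<le> ennreal (N * R powr (DIM('a) * (1 - s)) * broken_power (B1, B2) R)"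
    using lnorm_broken_power_gauss[where 'a='a, OF B _ s1(2,3), of "1 / 4"] by auto
  have c1N: "0 < c1 * N" using c N by simp
  obtain M where M: "1 \<le> M" "\<And>(g::'a \<Rightarrow> complex) (l::real) (e::real) (S::real) (b0::real) (b1::real). integrable lborel g \<Longrightarrow>
      0 < l \<Longrightarrow> 0 < e \<Longrightarrow> 0 \<le> b0 \<Longrightarrow> 0 \<le> b1 \<Longrightarrow> l \<le> 1 / M \<Longrightarrow> b0 \<le> l / M \<Longrightarrow>
      lnorm s (\<lambda>x. norm (g x)) \<le> ennreal b0 \<Longrightarrow>
      lnorm s (\<lambda>x. broken_power (A1, A2) x * norm (g x)) \<le> ennreal b1 \<Longrightarrow>
      ennreal c0 \<le> lnorm (1 - s) (\<lambda>\<xi>. norm (fourier g \<xi>)) \<Longrightarrow>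
      lnorm (1 - s) (\<lambda>\<xi>. broken_power (B1, B2) \<xi> * norm (fourier g \<xi>)) \<le> ennreal (c1 * N * broken_power (B1, B2) S) \<Longrightarrow>
      l \<le> M * ((l * broken_power (A1, A2) e + b1) * (l * broken_power (B1, B2) (1 / e) + broken_power (B1, B2) S))"
    using uncertainty_two_scales[where 'a='a, OF s(1) s1(1) A B K c(1) c1N unc] by blast
  show ?thesis
  proof (rule that[OF M(1)])
    fix J :: nat and S :: real and R :: "nat \<Rightarrow> real" and l e b0 b1 :: real
    assume J: "0 < J" and S: "0 < S" and R: "\<And>j. j < J \<Longrightarrow> 0 < R j \<and> J \<le> R j * S"
      and le: "0 < l" "0 < e" "0 \<le> b0" "0 \<le> b1" "l \<le> 1 / M" "b0 \<le> l / M"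
      and b0: "lnorm s (chirp_envelope s J S R :: 'a \<Rightarrow> real) \<le> ennreal b0"
      and b1: "lnorm s (\<lambda>x::'a. broken_power (A1, A2) x * chirp_envelope s J S R x) \<le> ennreal b1"
    obtain g :: "'a \<Rightarrow> complex" where g: "integrable lborel g" "\<And>x. norm (g x) \<le> chirp_envelope s J S R x"
      "ennreal c0 \<le> lnorm (1 - s) (\<lambda>\<xi>. norm (fourier g \<xi>))"
      "\<And>\<xi>. norm (fourier g \<xi>) \<le> c1 * S powr - (DIM('a) * (1 - s)) * gauss (1 / 4) (\<xi> /\<^sub>R S)"
    proof (rule exE[OF sup[of J S R, OF J S]], erule R)
      fix g :: "'a \<Rightarrow> complex"
      assume "integrable lborel g \<and> (\<forall>x. norm (g x) \<le> chirp_envelope s J S R x)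
        \<and> ennreal c0 \<le> lnorm (1 - s) (\<lambda>\<xi>. norm (fourier g \<xi>))
        \<and> (\<forall>\<xi>. norm (fourier g \<xi>) \<le> c1 * S powr - (DIM('a) * (1 - s)) * gauss (1 / 4) (\<xi> /\<^sub>R S))"
      then show thesis by (intro that) auto
    qed
    have [measurable]: "g \<in> borel_measurable borel" using g by auto
    show "l \<le> M * ((l * broken_power (A1, A2) e + b1) * (l * broken_power (B1, B2) (1 / e) + broken_power (B1, B2) S))"
    proof (rule M(2)[OF g(1) le])
      show "lnorm s (\<lambda>x. norm (g x)) \<le> ennreal b0"
        by (rule order_trans[OF lnorm_mono b0]) (use s g(2) in auto)
      show "lnorm s (\<lambda>x. broken_power (A1, A2) x * norm (g x)) \<le> ennreal b1"
        by (rule order_trans[OF lnorm_mono b1]) (use s g(2) in \<open>auto intro: mult_left_mono\<close>)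
      show "ennreal c0 \<le> lnorm (1 - s) (\<lambda>\<xi>. norm (fourier g \<xi>))" by (rule g(3))
      define \<sigma> where "\<sigma> = S powr - (DIM('a) * (1 - s))"
      have \<sigma>: "0 \<le> \<sigma>" by (simp add: \<sigma>_def)
      have "lnorm (1 - s) (\<lambda>\<xi>. broken_power (B1, B2) \<xi> * norm (fourier g \<xi>)) \<le>
          lnorm (1 - s) (\<lambda>\<xi>::'a. c1 * \<sigma> * (broken_power (B1, B2) \<xi> * gauss (1 / 4) (\<xi> /\<^sub>R S)))"
      proof (rule lnorm_mono)
        fix \<xi> :: 'a
        have "broken_power (B1, B2) \<xi> * norm (fourier g \<xi>) \<le> broken_power (B1, B2) \<xi> * (c1 * \<sigma> * gauss (1 / 4) (\<xi> /\<^sub>R S))"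
          unfolding \<sigma>_def by (intro mult_left_mono g(4)) auto
        then show "broken_power (B1, B2) \<xi> * norm (fourier g \<xi>) \<le> c1 * \<sigma> * (broken_power (B1, B2) \<xi> * gauss (1 / 4) (\<xi> /\<^sub>R S))"
          by (simp add: mult_ac)
      qed (use s1 in auto)
      also have "\<dots> = ennreal (c1 * \<sigma>) * lnorm (1 - s) (\<lambda>\<xi>::'a. broken_power (B1, B2) \<xi> * gauss (1 / 4) (\<xi> /\<^sub>R S))"
        using s1 c \<sigma> by (intro lnorm_cmult) auto
      also have "\<dots> \<le> ennreal (c1 * \<sigma>) * ennreal (N * S powr (DIM('a) * (1 - s)) * broken_power (B1, B2) S)"
        by (intro mult_left_mono N(2) S) auto
      also have "\<dots> = ennreal ((c1 * \<sigma>) * (N * S powr (DIM('a) * (1 - s)) * broken_power (B1, B2) S))"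
        using c \<sigma> N by (intro ennreal_mult[symmetric]) auto
      also have "(c1 * \<sigma>) * (N * S powr (DIM('a) * (1 - s)) * broken_power (B1, B2) S) =
          c1 * N * broken_power (B1, B2) S * (\<sigma> * S powr (DIM('a) * (1 - s)))" by (simp only: mult_ac)
      also have "\<sigma> * S powr (DIM('a) * (1 - s)) = 1" using S by (simp add: \<sigma>_def flip: powr_add)
      finally show "lnorm (1 - s) (\<lambda>\<xi>. broken_power (B1, B2) \<xi> * norm (fourier g \<xi>)) \<le> ennreal (c1 * N * broken_power (B1, B2) S)" by simp
    qed
  qed
qed

lemma small_powr:
  fixes a b y :: real
  assumes "0 < a" "0 < b" "0 < y"
  obtains e where "0 < e" "e < 1" "e powr a \<le> y" "e powr b \<le> y"
proof -
  define e where "e = min (1 / 2) (min (y powr (1 / a)) (y powr (1 / b)))"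
  have e: "0 < e" "e < 1" "e \<le> y powr (1 / a)" "e \<le> y powr (1 / b)" using assms by (auto simp: e_def)
  have "e powr a \<le> (y powr (1 / a)) powr a" using e assms by (intro powr_mono2) auto
  moreover have "e powr b \<le> (y powr (1 / b)) powr b" using e assms by (intro powr_mono2) auto
  ultimately show ?thesis using e assms by (intro that[of e]) (auto simp: powr_powr)
qed

lemma eventually_small_powr:
  fixes C a y :: real
  assumes "a < 0" "0 < y"
  shows "eventually (\<lambda>J. C * real J powr a \<le> y) sequentially"
proof -
  have "(\<lambda>J. C * real J powr a) \<longlonglongrightarrow> C * 0"
    using assms by (intro tendsto_mult tendsto_const tendsto_neg_powr filterlim_real_sequentially)
  then have "eventually (\<lambda>J. C * real J powr a < y) sequentially"
    using assms by (intro order_tendstoD(2)) auto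
  then show ?thesis by eventually_elim simp
qed

section \<open>Necessity\<close>

lemma broken_power_below_1: "0 < t \<Longrightarrow> t < 1 \<Longrightarrow> broken_power (C1, C2) (t::real) = t powr C1"
  and broken_power_above_1: "1 \<le> t \<Longrightarrow> broken_power (C1, C2) (t::real) = t powr C2"
  and broken_power_1_divide: "0 < t \<Longrightarrow> t \<le> 1 \<Longrightarrow> broken_power (C1, C2) (1 / t::real) = t powr - C2"
  by (auto simp: broken_power_def powr_divide powr_minus_divide)

lemma ennreal_two_mult_add:
  assumes "0 \<le> q" "0 \<le> a" "0 \<le> b"
  shows "2 * (ennreal q * ennreal a + ennreal q * ennreal b) = ennreal (2 * (q * a + q * b))"
proof -
  have "ennreal (2 * (q * a + q * b)) = ennreal 2 * (ennreal (q * a) + ennreal (q * b))"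
    using assms by (subst ennreal_mult) (auto simp: ennreal_plus)
  then show ?thesis using assms by (simp add: ennreal_mult)
qed

text \<open>For Gaussians of width e and 1 / e with e < 1 the product of the weights is e^(A1 - B2)
  and e^(B1 - A2); it has to stay bounded below as e tends to 0.\<close>

lemma uncertainty_necessary_gauss:
  fixes s A1 A2 B1 B2 K :: real
  assumes s: "0 \<le> s" "s \<le> 1" and A: "0 < A1" "0 < A2" and B: "0 < B1" "0 < B2" and K: "0 < K"
    and unc: "\<And>f::'a::euclidean_space \<Rightarrow> complex. integrable lborel f \<Longrightarrow> uncertainty s (A1, A2) (B1, B2) K f"
  shows "A1 \<le> B2" "B1 \<le> A2"
proof -
  obtain c where c: "0 < c" "\<And>e::real. 0 < e \<Longrightarrow> c \<le> broken_power (A1, A2) e * broken_power (B1, B2) (1 / e)"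
    using uncertainty_gauss[OF s A B K unc] by blast
  show "A1 \<le> B2"
  proof (rule ccontr)
    assume "\<not> A1 \<le> B2"
    then obtain e :: real where e: "0 < e" "e < 1" "e powr (A1 - B2) \<le> c / 2"
      using small_powr[of "A1 - B2" "A1 - B2" "c / 2"] c by auto
    have "c \<le> e powr A1 * e powr - B2"
      using c(2)[OF e(1)] e by (simp add: broken_power_below_1 broken_power_1_divide)
    also have "\<dots> = e powr (A1 - B2)" by (simp flip: powr_add)
    finally show False using e c by simp
  qed
  show "B1 \<le> A2"
  proof (rule ccontr)
    assume "\<not> B1 \<le> A2"
    then obtain e :: real where e: "0 < e" "e < 1" "e powr (B1 - A2) \<le> c / 2"
      using small_powr[of "B1 - A2" "B1 - A2" "c / 2"] c by auto
    have "c \<le> e powr - A2 * e powr B1"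
      using c(2)[of "1 / e"] e by (simp add: broken_power_below_1 broken_power_1_divide)
    also have "\<dots> = e powr (B1 - A2)" by (simp flip: powr_add)
    finally show False using e c by simp
  qed
qed

text \<open>If A2 \<le> \<delta>, both 1 and the weight are at most the indicator of the unit ball
  plus |x|^\<delta>. With S = 1 the plain and the weighted norm of the chirps in space are then
  O(J^(s - 1/2)), which tends to 0 because s < 1/2, while their norm in frequency stays of order 1.
  The order of choices is e, then l, then J.\<close>

lemma uncertainty_necessary_wide_chirps:
  fixes s A1 A2 B1 B2 K :: real
  assumes s: "0 \<le> s" "s \<le> 1 / 2" and A: "0 < A1" "0 < A2" and B: "0 < B1" "0 < B2" and K: "0 < K"
    and unc: "\<And>f::'a::euclidean_space \<Rightarrow> complex. integrable lborel f \<Longrightarrow> uncertainty s (A1, A2) (B1, B2) K f"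
  shows "DIM('a) * (1 / 2 - s) < A2"
proof (rule ccontr)
  define \<delta> where "\<delta> = DIM('a) * (1 / 2 - s)"
  assume "\<not> DIM('a) * (1 / 2 - s) < A2"
  then have \<delta>: "A2 \<le> \<delta>" "0 < \<delta>" using A by (auto simp: \<delta>_def)
  have s2: "s < 1 / 2"
  proof (rule ccontr)
    assume "\<not> s < 1 / 2"
    then have "s = 1 / 2" using s by linarith
    then have "\<delta> = 0" unfolding \<delta>_def by simp
    with \<delta>(2) show False by simp
  qed
  have s1: "s \<le> 1" using s by simp
  obtain M where M: "1 \<le> M" and test: "\<And>(J::nat) (S::real) R (l::real) (e::real) (b0::real) (b1::real).
      0 < J \<Longrightarrow> 0 < S \<Longrightarrow> (\<And>j. j < J \<Longrightarrow> 0 < R j \<and> J \<le> R j * S) \<Longrightarrow>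
      0 < l \<Longrightarrow> 0 < e \<Longrightarrow> 0 \<le> b0 \<Longrightarrow> 0 \<le> b1 \<Longrightarrow> l \<le> 1 / M \<Longrightarrow> b0 \<le> l / M \<Longrightarrow>
      lnorm s (chirp_envelope s J S R :: 'a \<Rightarrow> real) \<le> ennreal b0 \<Longrightarrow>
      lnorm s (\<lambda>x::'a. broken_power (A1, A2) x * chirp_envelope s J S R x) \<le> ennreal b1 \<Longrightarrow>
      l \<le> M * ((l * broken_power (A1, A2) e + b1) * (l * broken_power (B1, B2) (1 / e) + broken_power (B1, B2) S))"
    using uncertainty_chirp_test[OF s A B K unc] by blast
  obtain N where N: "0 < N" "\<And>S. 0 < S \<Longrightarrow>
      lnorm s (indicator (ball (0::'a) S)) \<le> ennreal (N * S powr (DIM('a) * s))"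
    using lnorm_indicator_ball[where 'a='a, OF s(1)] by blast
  obtain C where C: "0 < C" "\<And>(r::real) J::nat. 0 < r \<Longrightarrow> 0 < J \<Longrightarrow>
    lnorm s (\<lambda>x::'a. norm x powr (DIM('a) * (1 / 2 - s)) *
      (\<Sum>j<J. (r * 2 ^ j) powr - (DIM('a) / 2) * ((norm x / (r * 2 ^ j)) powr 0 * gauss 1 (x /\<^sub>R (r * 2 ^ j)))))
    \<le> ennreal (C * J powr s)"
    using lnorm_dyadic_sum[where 'a='a, OF s(1) s1, of 0] by auto
  define C' where "C' = 2 * (N + C)"
  have C': "0 < C'" using N C by (simp add: C'_def)
  \<comment> \<open>The factor J^2 makes each amplitude (R j)^(-d/2) at most 1 / J, so that the J
    chirps together stay below J^(-1/2); it also gives J \<le> R j S.\<close>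
  let ?R = "\<lambda>J j. (real J)\<^sup>2 * 2 ^ j"
  have env: "lnorm s (\<lambda>x::'a. v x * chirp_envelope s J 1 (?R J) x) \<le> ennreal (C' * J powr (s - 1 / 2))"
    if J: "0 < J" and v: "\<And>x. 0 \<le> v x" "\<And>x. v x \<le> indicator (ball 0 1) x + norm x powr \<delta>"
      and [measurable]: "v \<in> borel_measurable borel" for J :: nat and v
  proof -
    define T where "T x = norm x powr (DIM('a) * (1 / 2 - s)) *
      (\<Sum>j<J. (?R J j) powr - (DIM('a) / 2) * ((norm x / ?R J j) powr 0 * gauss 1 (x /\<^sub>R ?R J j)))" for x :: 'a
    have T0: "0 \<le> T x" for x by (auto simp: T_def intro!: mult_nonneg_nonneg sum_nonneg)
    have [measurable]: "T \<in> borel_measurable borel" unfolding T_def[abs_def] by measurable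
    define q where "q = real J powr - (1 / 2)"
    have q: "0 \<le> q" by (simp add: q_def)
    have im [measurable]: "indicat_real (ball (0::'a) 1) \<in> borel_measurable borel" by (intro borel_measurable_indicator) simp
    have qm: "(\<lambda>x::'a. q * indicator (ball 0 1) x) \<in> borel_measurable borel" by measurable
    have Rge: "1 \<le> ?R J j" "real J powr 2 \<le> ?R J j" for j
    proof -
      have "(real J)\<^sup>2 * 1 \<le> ?R J j" by (intro mult_left_mono) auto
      moreover have "1 \<le> (real J)\<^sup>2" using J by simp
      ultimately show "1 \<le> ?R J j" by linarith
      show "real J powr 2 \<le> ?R J j" using \<open>(real J)\<^sup>2 * 1 \<le> ?R J j\<close> J by (simp add: powr_numeral)
    qed
    have small: "chirp_envelope s J 1 (?R J) x \<le> q" for x :: 'a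
    proof -
      have "?R J j powr - (DIM('a) / 2) * gauss 1 (x /\<^sub>R ?R J j) \<le> real J powr - 1 * 1" for j
      proof (rule mult_mono)
        have "?R J j powr - (DIM('a) / 2) \<le> ?R J j powr - (1 / 2)"
          using Rge[of j] by (intro powr_mono) (auto simp: Suc_leI)
        also have "\<dots> \<le> (real J powr 2) powr - (1 / 2)"
          using J Rge[of j] by (intro powr_mono2') auto
        also have "\<dots> = real J powr - 1" by (simp only: powr_powr) simp
        finally show "?R J j powr - (DIM('a) / 2) \<le> real J powr - 1" .
      qed (auto intro: gauss_le_1)
      then have "(\<Sum>j<J. ?R J j powr - (DIM('a) / 2) * gauss 1 (x /\<^sub>R ?R J j)) \<le> (\<Sum>j<J. real J powr - 1 * 1)"
        by (intro sum_mono)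
      also have "\<dots> = 1" using J by (simp add: powr_minus_divide)
      finally have "q * (\<Sum>j<J. ?R J j powr - (DIM('a) / 2) * gauss 1 (x /\<^sub>R ?R J j)) \<le> q * 1"
        using q by (intro mult_left_mono)
      then show ?thesis by (simp add: chirp_envelope_def q_def)
    qed
    have "v x * chirp_envelope s J 1 (?R J) x \<le> q * indicator (ball 0 1) x + q * T x" for x :: 'a
    proof -
      have "v x * chirp_envelope s J 1 (?R J) x \<le> (indicator (ball 0 1) x + norm x powr \<delta>) * chirp_envelope s J 1 (?R J) x"
        by (intro mult_right_mono v) simp
      moreover have "indicator (ball 0 1) x * chirp_envelope s J 1 (?R J) x \<le> indicator (ball 0 1) x * q"
        by (intro mult_left_mono small) simp
      moreover have "norm x powr \<delta> * chirp_envelope s J 1 (?R J) x = q * T x"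
        using J by (cases "x = 0") (simp_all add: chirp_envelope_def q_def T_def \<delta>_def)
      ultimately show ?thesis by (simp add: algebra_simps)
    qed
    then have "lnorm s (\<lambda>x::'a. v x * chirp_envelope s J 1 (?R J) x) \<le> lnorm s (\<lambda>x::'a. q * indicator (ball 0 1) x + q * T x)"
      using s v by (intro lnorm_mono) auto
    also have "\<dots> \<le> 2 * (lnorm s (\<lambda>x::'a. q * indicator (ball 0 1) x) + lnorm s (\<lambda>x::'a. q * T x))"
      using s s1 q T0 qm by (intro lnorm_add) auto
    also have "lnorm s (\<lambda>x::'a. q * indicator (ball 0 1) x) = ennreal q * lnorm s (indicator (ball (0::'a) 1))"
      using s q im by (intro lnorm_cmult) auto
    also have "lnorm s (\<lambda>x::'a. q * T x) = ennreal q * lnorm s T"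
      using s q T0 by (intro lnorm_cmult) auto
    also have "2 * (ennreal q * lnorm s (indicator (ball (0::'a) 1)) + ennreal q * lnorm s T) \<le>
        2 * (ennreal q * ennreal N + ennreal q * ennreal (C * J powr s))"
      using N(2)[of 1] C(2)[of "(real J)\<^sup>2" J] J unfolding T_def
      by (intro mult_left_mono add_mono) auto
    also have "\<dots> = ennreal (2 * (q * N + q * (C * J powr s)))"
      using q N(1) C(1) by (intro ennreal_two_mult_add) auto
    also have "\<dots> \<le> ennreal (C' * J powr (s - 1 / 2))"
    proof (rule ennreal_leI)
      have "J powr s * q = J powr (s - 1 / 2)" by (simp add: q_def flip: powr_add)
      moreover have "1 \<le> J powr s" using J s by (intro ge_one_powr_ge_zero) auto
      then have "q * 1 * N \<le> q * J powr s * N" using q N by (intro mult_right_mono mult_left_mono) auto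
      ultimately show "2 * (q * N + q * (C * J powr s)) \<le> C' * J powr (s - 1 / 2)"
        by (simp add: C'_def algebra_simps)
    qed
    finally show ?thesis .
  qed
  have y: "0 < 1 / (8 * M)" using M by simp
  obtain e :: real where e: "0 < e" "e < 1" "e powr A1 \<le> 1 / (8 * M)" "e powr B2 \<le> 1 / (8 * M)"
    using small_powr[OF A(1) B(2) y] by blast
  \<comment> \<open>Balances the frequency factor: l times the weight at 1 / e equals 1, the weight
    at S = 1.\<close>
  define l where "l = e powr B2"
  have l: "0 < l" using e by (simp add: l_def)
  have "eventually (\<lambda>J. C' * real J powr (s - 1 / 2) \<le> l / (8 * M)) sequentially"
    using s2 l M by (intro eventually_small_powr) auto
  then have "eventually (\<lambda>J. 0 < J \<and> C' * real J powr (s - 1 / 2) \<le> l / (8 * M)) sequentially"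
    using eventually_gt_at_top[of 0] by eventually_elim simp
  then obtain J :: nat where J: "0 < J" "C' * real J powr (s - 1 / 2) \<le> l / (8 * M)"
    by (auto simp: eventually_sequentially)
  define b where "b = C' * real J powr (s - 1 / 2)"
  have b: "0 \<le> b" "b \<le> l / (8 * M)" using C' J by (auto simp: b_def)
  have "l \<le> M * ((l * broken_power (A1, A2) e + b) * (l * broken_power (B1, B2) (1 / e) + broken_power (B1, B2) (1::real)))"
  proof (rule test[where S=1 and R="?R J", OF J(1) _ _ l e(1) b(1) b(1)])
    fix j assume "j < J"
    have "1 * 1 \<le> real J * 2 ^ j" using J by (intro mult_mono) auto
    then have "real J * 1 \<le> real J * (real J * 2 ^ j)" by (intro mult_left_mono) auto
    then show "0 < ?R J j \<and> real J \<le> ?R J j * 1" using J by (simp add: power2_eq_square mult_ac)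
  next
    show "l \<le> 1 / M" using e M unfolding l_def by (intro order_trans[OF e(4)]) (simp add: field_simps)
    show "b \<le> l / M" using M l by (intro order_trans[OF b(2)]) (simp add: field_simps)
    show "lnorm s (chirp_envelope s J 1 (?R J) :: 'a \<Rightarrow> real) \<le> ennreal b"
    proof -
      have "(1::real) \<le> indicator (ball 0 1) x + norm x powr \<delta>" for x :: 'a
        using \<delta> by (cases "norm x < 1") (auto intro: ge_one_powr_ge_zero)
      then show ?thesis using env[of J "\<lambda>_. 1"] J by (simp add: b_def)
    qed
    show "lnorm s (\<lambda>x::'a. broken_power (A1, A2) x * chirp_envelope s J 1 (?R J) x) \<le> ennreal b"
    proof -
      have "broken_power (A1, A2) x \<le> indicator (ball 0 1) x + norm x powr \<delta>" for x :: 'a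
      proof (cases "norm x < 1")
        case True
        then have "norm x powr A1 \<le> 1" using A by (intro powr_le1) auto
        then show ?thesis using True by (simp add: broken_power_def add_increasing2)
      next
        case False
        then show ?thesis using \<delta> by (simp add: broken_power_def powr_mono)
      qed
      then show ?thesis using env[of J "broken_power (A1, A2)"] J by (simp add: b_def)
    qed
  qed simp
  moreover have "l * broken_power (B1, B2) (1 / e) = 1"
    using e by (simp add: broken_power_1_divide l_def flip: powr_add)
  ultimately have le: "l \<le> M * ((l * e powr A1 + b) * 2)"
    using e by (simp add: broken_power_below_1 broken_power_above_1)
  have "l * e powr A1 \<le> l * (1 / (8 * M))" using e l by (intro mult_left_mono) auto
  then have "(l * e powr A1 + b) * 2 \<le> l / (2 * M)" using b by simp
  then have "M * ((l * e powr A1 + b) * 2) \<le> M * (l / (2 * M))" using M by (intro mult_left_mono) auto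
  then show False using le l M by simp
qed

text \<open>One chirp of width 1 in space with S = 1 / z: its norms in space are of order
  z^\<delta>, against the frequency weight z^(-B2).\<close>

lemma uncertainty_necessary_single_chirp:
  fixes s A1 A2 B1 B2 K :: real
  assumes s: "0 \<le> s" "s \<le> 1 / 2" and A: "0 < A1" "0 < A2" and B: "0 < B1" "0 < B2" and K: "0 < K"
    and unc: "\<And>f::'a::euclidean_space \<Rightarrow> complex. integrable lborel f \<Longrightarrow> uncertainty s (A1, A2) (B1, B2) K f"
    and A1: "A1 < DIM('a) * (1 / 2 - s)"
  shows "DIM('a) * (1 / 2 - s) * A1 \<le> B2\<^sup>2"
proof (rule ccontr)
  define \<delta> where "\<delta> = DIM('a) * (1 / 2 - s)"
  assume "\<not> DIM('a) * (1 / 2 - s) * A1 \<le> B2\<^sup>2"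
  then have less: "B2\<^sup>2 < \<delta> * A1" by (simp add: \<delta>_def)
  have A1\<delta>: "A1 < \<delta>" using A1 by (simp add: \<delta>_def)
  have s1: "s \<le> 1" using s by simp
  obtain M where M: "1 \<le> M" and test: "\<And>(J::nat) (S::real) R (l::real) (e::real) (b0::real) (b1::real).
      0 < J \<Longrightarrow> 0 < S \<Longrightarrow> (\<And>j. j < J \<Longrightarrow> 0 < R j \<and> J \<le> R j * S) \<Longrightarrow>
      0 < l \<Longrightarrow> 0 < e \<Longrightarrow> 0 \<le> b0 \<Longrightarrow> 0 \<le> b1 \<Longrightarrow> l \<le> 1 / M \<Longrightarrow> b0 \<le> l / M \<Longrightarrow>
      lnorm s (chirp_envelope s J S R :: 'a \<Rightarrow> real) \<le> ennreal b0 \<Longrightarrow>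
      lnorm s (\<lambda>x::'a. broken_power (A1, A2) x * chirp_envelope s J S R x) \<le> ennreal b1 \<Longrightarrow>
      l \<le> M * ((l * broken_power (A1, A2) e + b1) * (l * broken_power (B1, B2) (1 / e) + broken_power (B1, B2) S))"
    using uncertainty_chirp_test[OF s A B K unc] by blast
  obtain n where n: "0 < n" "\<And>R::real. 0 < R \<Longrightarrow>
      lnorm s (\<lambda>x::'a. gauss 1 (x /\<^sub>R R)) = ennreal (n * R powr (DIM('a) * s))"
    using lnorm_gauss[where 'a='a, OF s(1), of 1] by auto
  obtain N where N: "0 < N" "\<And>R::real. 0 < R \<Longrightarrow>
      lnorm s (\<lambda>x::'a. broken_power (A1, A2) x * gauss 1 (x /\<^sub>R R))
      \<le> ennreal (N * R powr (DIM('a) * s) * broken_power (A1, A2) R)"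
    using lnorm_broken_power_gauss[where 'a='a, OF A _ s(1) s1, of 1] by auto
  \<comment> \<open>With e = z^\<kappa> and l = z^(B2 (\<kappa> - 1)) the Gaussian and the chirp
    balance in both factors: l e^(-B2) = z^(-B2) by the form of l, and l e^A1 = z^\<delta> by the
    choice of \<kappa>. Then A1 < \<delta> means \<kappa> > 1, so that l is small, and B2^2 <
    \<delta> A1 means \<delta> > B2 \<kappa>, so that the right side of the test, a multiple of l
    z^(\<delta> - B2 \<kappa>), drops below l.\<close>
  define \<kappa> where "\<kappa> = (B2 + \<delta>) / (A1 + B2)"
  have \<kappa>1: "1 < \<kappa>" using A B A1\<delta> by (simp add: \<kappa>_def)
  have \<kappa>: "B2 * (\<kappa> - 1) + \<kappa> * A1 = \<delta>"
  proof -
    have "\<kappa> * (A1 + B2) = B2 + \<delta>" using A B by (simp add: \<kappa>_def)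
    then show ?thesis by (simp add: algebra_simps)
  qed
  have B\<kappa>: "0 < \<delta> - B2 * \<kappa>" using less A B by (simp add: \<kappa>_def field_simps power2_eq_square)
  have pos: "0 < B2 * (\<kappa> - 1)" using B \<kappa>1 by simp
  define Y where "Y = max n N"
  have Y: "0 < Y" "n \<le> Y" "N \<le> Y" using n by (auto simp: Y_def)
  have y: "0 < 1 / (4 * M * (1 + Y))" using M Y by simp
  obtain z :: real where z: "0 < z" "z < 1" "z powr (\<delta> - B2 * \<kappa>) \<le> 1 / (4 * M * (1 + Y))"
      "z powr (B2 * (\<kappa> - 1)) \<le> 1 / (4 * M * (1 + Y))"
    using small_powr[OF B\<kappa> pos y] by blast
  define l where "l = z powr (B2 * (\<kappa> - 1))"
  define e where "e = z powr \<kappa>"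
  define b where "b = Y * z powr \<delta>"
  have l: "0 < l" using z by (simp add: l_def)
  have e: "0 < e" "e < 1" using z \<kappa>1 powr_less_mono2[of \<kappa> z 1] by (auto simp: e_def)
  have b: "0 \<le> b" using Y by (simp add: b_def)
  have b1: "b \<le> l / (4 * M)"
  proof -
    have "z powr \<delta> \<le> z powr (\<delta> - B2 * \<kappa> + B2 * (\<kappa> - 1))" using z B by (intro powr_mono') (auto simp: algebra_simps)
    also have "\<dots> = z powr (\<delta> - B2 * \<kappa>) * l" by (simp only: powr_add l_def)
    also have "\<dots> \<le> 1 / (4 * M * (1 + Y)) * l" using z l by (intro mult_right_mono) auto
    finally have "b \<le> Y * (1 / (4 * M * (1 + Y)) * l)" unfolding b_def using Y by (intro mult_left_mono) auto
    also have "\<dots> = Y / (1 + Y) * (l / (4 * M))" using Y M by (simp add: field_simps)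
    also have "\<dots> \<le> 1 * (l / (4 * M))" using Y M l by (intro mult_right_mono) auto
    finally show ?thesis by simp
  qed
  have Sz: "(1 / z) powr - \<delta> = z powr \<delta>" using z by (simp add: powr_divide powr_minus_divide)
  have env: "chirp_envelope s 1 (1 / z) (\<lambda>_. 1) x = z powr \<delta> * gauss 1 (x /\<^sub>R 1)" for x :: 'a
    using Sz by (simp add: chirp_envelope_def \<delta>_def)
  have "l \<le> M * ((l * broken_power (A1, A2) e + b) * (l * broken_power (B1, B2) (1 / e) + broken_power (B1, B2) (1 / z)))"
  proof (rule test[where J=1 and R="\<lambda>_. 1", OF _ _ _ l e(1) b b])
    show "0 < 1 / z" using z by simp
    show "0 < (1::real) \<and> real 1 \<le> 1 * (1 / z)" using z by simp
    have "M * 1 \<le> M * (4 * (1 + Y))" using M Y by (intro mult_left_mono) auto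
    then have "1 / (4 * M * (1 + Y)) \<le> 1 / M" using M Y by (intro frac_le) (auto simp: mult_ac)
    then show "l \<le> 1 / M" using z(4) unfolding l_def by linarith
    show "b \<le> l / M" using b1 M l by (auto simp: field_simps intro: order_trans)
    have "lnorm s (chirp_envelope s 1 (1 / z) (\<lambda>_. 1) :: 'a \<Rightarrow> real) = ennreal (z powr \<delta>) * lnorm s (\<lambda>x::'a. gauss 1 (x /\<^sub>R 1))"
      unfolding env[abs_def] using s by (intro lnorm_cmult) auto
    also have "\<dots> = ennreal (z powr \<delta> * n)" unfolding n(2)[OF zero_less_one] using n by (simp add: ennreal_mult)
    also have "\<dots> \<le> ennreal b" unfolding b_def using Y by (intro ennreal_leI) (simp add: mult.commute[of _ "z powr \<delta>"] mult_left_mono)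
    finally show "lnorm s (chirp_envelope s 1 (1 / z) (\<lambda>_. 1) :: 'a \<Rightarrow> real) \<le> ennreal b" .
    have "lnorm s (\<lambda>x::'a. broken_power (A1, A2) x * chirp_envelope s 1 (1 / z) (\<lambda>_. 1) x) =
        lnorm s (\<lambda>x::'a. z powr \<delta> * (broken_power (A1, A2) x * gauss 1 (x /\<^sub>R 1)))"
      unfolding env by (simp only: mult_ac)
    also have "\<dots> = ennreal (z powr \<delta>) * lnorm s (\<lambda>x::'a. broken_power (A1, A2) x * gauss 1 (x /\<^sub>R 1))"
      using s by (intro lnorm_cmult) auto
    also have "\<dots> \<le> ennreal (z powr \<delta>) * ennreal N"
      using N(2)[OF zero_less_one] by (intro mult_left_mono) (auto simp: broken_power_above_1)
    also have "\<dots> = ennreal (z powr \<delta> * N)" using N by (simp add: ennreal_mult)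
    also have "\<dots> \<le> ennreal b" unfolding b_def using Y by (intro ennreal_leI) (simp add: mult.commute[of _ "z powr \<delta>"] mult_left_mono)
    finally show "lnorm s (\<lambda>x::'a. broken_power (A1, A2) x * chirp_envelope s 1 (1 / z) (\<lambda>_. 1) x) \<le> ennreal b" .
  qed simp
  moreover have "l * broken_power (A1, A2) e = z powr \<delta>"
    using z e by (simp add: broken_power_below_1) (simp add: l_def e_def powr_powr \<kappa> flip: powr_add)
  moreover have "l * broken_power (B1, B2) (1 / e) = z powr - B2"
    using z e by (simp add: broken_power_1_divide) (simp add: l_def e_def powr_powr algebra_simps flip: powr_add)
  moreover have "broken_power (B1, B2) (1 / z) = z powr - B2" using z by (simp add: broken_power_1_divide)
  ultimately have "l \<le> M * ((z powr \<delta> + Y * z powr \<delta>) * (z powr - B2 + z powr - B2))" by (simp add: b_def)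
  also have "\<dots> = 2 * M * (1 + Y) * (z powr \<delta> * z powr - B2)" by (simp add: algebra_simps)
  also have "z powr \<delta> * z powr - B2 = l * z powr (\<delta> - B2 * \<kappa>)"
    by (simp add: l_def algebra_simps flip: powr_add)
  also have "2 * M * (1 + Y) * (l * z powr (\<delta> - B2 * \<kappa>)) \<le> 2 * M * (1 + Y) * (l * (1 / (4 * M * (1 + Y))))"
    using M Y l z(3) by (intro mult_left_mono) auto
  also have "\<dots> = l / 2"
  proof -
    have "2 * w * (l * (1 / (4 * w))) = l / 2" if "0 < w" for w :: real using that by (simp add: field_simps)
    from this[of "M * (1 + Y)"] show ?thesis using M Y by (simp add: mult.assoc)
  qed
  finally show False using l by simp
qed

text \<open>Here a single chirp only balances the exponents (\<kappa> would be 1), and the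
  contradiction has to come from the gain over J dyadic scales. With e = t / S and l = t^\<delta>
  all powers of S cancel, and the test reads l \<le> 2 M (l^2 + C J^(s - 1/2)), which fails for
  small l and then large J.\<close>

lemma uncertainty_necessary_narrow_chirps:
  fixes s A1 A2 B1 B2 K :: real
  assumes s: "0 \<le> s" "s \<le> 1 / 2" and A: "0 < A1" "0 < A2" and B: "0 < B1" "0 < B2" and K: "0 < K"
    and unc: "\<And>f::'a::euclidean_space \<Rightarrow> complex. integrable lborel f \<Longrightarrow> uncertainty s (A1, A2) (B1, B2) K f"
    and A1: "A1 = DIM('a) * (1 / 2 - s)"
  shows "B2 \<noteq> A1"
proof
  define \<delta> where "\<delta> = DIM('a) * (1 / 2 - s)"
  assume "B2 = A1"
  then have \<delta>: "A1 = \<delta>" "B2 = \<delta>" "0 < \<delta>" using A A1 by (auto simp: \<delta>_def)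
  have s2: "s < 1 / 2"
  proof (rule ccontr)
    assume "\<not> s < 1 / 2"
    then have "s = 1 / 2" using s by linarith
    then have "\<delta> = 0" unfolding \<delta>_def by simp
    with \<delta>(3) show False by simp
  qed
  have s1: "s \<le> 1" using s by simp
  obtain M where M: "1 \<le> M" and test: "\<And>(J::nat) (S::real) R (l::real) (e::real) (b0::real) (b1::real).
      0 < J \<Longrightarrow> 0 < S \<Longrightarrow> (\<And>j. j < J \<Longrightarrow> 0 < R j \<and> J \<le> R j * S) \<Longrightarrow>
      0 < l \<Longrightarrow> 0 < e \<Longrightarrow> 0 \<le> b0 \<Longrightarrow> 0 \<le> b1 \<Longrightarrow> l \<le> 1 / M \<Longrightarrow> b0 \<le> l / M \<Longrightarrow>
      lnorm s (chirp_envelope s J S R :: 'a \<Rightarrow> real) \<le> ennreal b0 \<Longrightarrow>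
      lnorm s (\<lambda>x::'a. broken_power (A1, A2) x * chirp_envelope s J S R x) \<le> ennreal b1 \<Longrightarrow>
      l \<le> M * ((l * broken_power (A1, A2) e + b1) * (l * broken_power (B1, B2) (1 / e) + broken_power (B1, B2) S))"
    using uncertainty_chirp_test[OF s A B K unc] by blast
  obtain n where n: "0 < n" "\<And>R::real. 0 < R \<Longrightarrow>
      lnorm s (\<lambda>x::'a. gauss 1 (x /\<^sub>R R)) = ennreal (n * R powr (DIM('a) * s))"
    using lnorm_gauss[where 'a='a, OF s(1), of 1] by auto
  define a where "a = max (A2 - \<delta>) 0"
  have a: "0 \<le> a" "A2 - \<delta> \<le> a" by (auto simp: a_def)
  define T where "T c r J x = norm x powr (DIM('a) * (1 / 2 - s)) *
      (\<Sum>j<J. (r * 2 ^ j) powr - (DIM('a) / 2) * ((norm x / (r * 2 ^ j)) powr c * gauss 1 (x /\<^sub>R (r * 2 ^ j))))"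
    for c r :: real and J :: nat and x :: 'a
  have T0: "0 \<le> T c r J x" for c r J x by (auto simp: T_def intro!: mult_nonneg_nonneg sum_nonneg)
  have Tm [measurable]: "T c r J \<in> borel_measurable borel" for c r J unfolding T_def[abs_def] by measurable
  obtain C0 where C0: "0 < C0" "\<And>(r::real) J::nat. 0 < r \<Longrightarrow> 0 < J \<Longrightarrow> lnorm s (T 0 r J) \<le> ennreal (C0 * J powr s)"
    using lnorm_dyadic_sum[where 'a='a, OF s(1) s1, of 0] unfolding T_def[abs_def] by auto
  obtain Ca where Ca: "0 < Ca" "\<And>(r::real) J::nat. 0 < r \<Longrightarrow> 0 < J \<Longrightarrow> lnorm s (T a r J) \<le> ennreal (Ca * J powr s)"
    using lnorm_dyadic_sum[where 'a='a, OF s(1) s1 a(1)] unfolding T_def[abs_def] by auto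
  define C where "C = 2 * (C0 + Ca)"
  have C: "0 < C" using C0 Ca by (simp add: C_def)
  \<comment> \<open>S = 2^(k J) must beat the amplitude 2^(J d / 2) of the narrowest chirp: k
    \<delta> \<ge> d / 2 + 2 leaves 2^(-2 J) \<le> J^(-2), so J chirps stay below a multiple of 1 /
    J. Moreover k \<ge> 2 gives R j S \<ge> 2^J \<ge> J.\<close>
  obtain k0 :: nat where k0: "(DIM('a) / 2 + 2) / \<delta> \<le> k0" using real_arch_simple by blast
  define k where "k = max k0 2"
  have k: "2 \<le> k" "DIM('a) / 2 + 2 \<le> k * \<delta>"
  proof -
    have "(DIM('a) / 2 + 2) / \<delta> \<le> k" using k0 by (simp add: k_def)
    then show "DIM('a) / 2 + 2 \<le> k * \<delta>" using \<delta> by (simp add: field_simps)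
  qed (simp add: k_def)
  let ?S = "\<lambda>J::nat. (2::real) ^ (k * J)"
  let ?R = "\<lambda>J j. (1 / 2) ^ J * (2::real) ^ j"
  have b0: "lnorm s (chirp_envelope s J (?S J) (?R J) :: 'a \<Rightarrow> real) \<le> ennreal (n * real J powr - 1)" if J: "0 < J" for J :: nat
  proof -
    define q where "q = ?S J powr - \<delta> * real J powr - (1 / 2)"
    have q: "0 \<le> q" by (simp add: q_def)
    have "chirp_envelope s J (?S J) (?R J) x \<le> q * (J * 2 powr (J * (DIM('a) / 2))) * gauss 1 (x /\<^sub>R 1)" for x :: 'a
    proof -
      have "?R J j powr - (DIM('a) / 2) * gauss 1 (x /\<^sub>R ?R J j) \<le> 2 powr (J * (DIM('a) / 2)) * gauss 1 (x /\<^sub>R 1)" if j: "j < J" for j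
      proof (rule mult_mono)
        have "?R J j powr - (DIM('a) / 2) \<le> ((1 / 2) ^ J) powr - (DIM('a) / 2)" by (intro powr_mono2') auto
        also have "((1 / 2) ^ J :: real) powr - (DIM('a) / 2) = 2 powr (J * (DIM('a) / 2))"
          using powr_powr[of 2 "- real J" "- (DIM('a) / 2)"] by (simp add: powr_minus_divide powr_realpow power_one_over)
        finally show "?R J j powr - (DIM('a) / 2) \<le> 2 powr (J * (DIM('a) / 2))" .
        have "?R J j \<le> (1 / 2) ^ J * 2 ^ J" using j by (intro mult_left_mono power_increasing) auto
        then have R: "0 < ?R J j" "?R J j \<le> 1" by (auto simp: power_one_over)
        then have "1 \<le> 1 / (?R J j)\<^sup>2" by (simp add: power_le_one)
        then have "1 * (norm x)\<^sup>2 \<le> 1 / (?R J j)\<^sup>2 * (norm x)\<^sup>2" by (intro mult_right_mono) auto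
        then have "pi * (1 * (norm x)\<^sup>2) \<le> pi * (1 / (?R J j)\<^sup>2 * (norm x)\<^sup>2)" by (intro mult_left_mono) auto
        then show "gauss 1 (x /\<^sub>R ?R J j) \<le> gauss 1 (x /\<^sub>R 1)"
          unfolding gauss_scaleR[OF R(1)] by (simp add: gauss_def mult.assoc)
      qed auto
      then have "(\<Sum>j<J. ?R J j powr - (DIM('a) / 2) * gauss 1 (x /\<^sub>R ?R J j)) \<le> (\<Sum>j<J. 2 powr (J * (DIM('a) / 2)) * gauss 1 (x /\<^sub>R 1))"
        by (intro sum_mono) auto
      then have "q * (\<Sum>j<J. ?R J j powr - (DIM('a) / 2) * gauss 1 (x /\<^sub>R ?R J j)) \<le> q * (\<Sum>j<J. 2 powr (J * (DIM('a) / 2)) * gauss 1 (x /\<^sub>R 1))"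
        using q by (intro mult_left_mono) auto
      then show ?thesis by (simp add: chirp_envelope_def q_def \<delta>_def mult_ac)
    qed
    then have "lnorm s (chirp_envelope s J (?S J) (?R J) :: 'a \<Rightarrow> real) \<le> lnorm s (\<lambda>x::'a. q * (J * 2 powr (J * (DIM('a) / 2))) * gauss 1 (x /\<^sub>R 1))"
      using s by (intro lnorm_mono) auto
    also have "\<dots> = ennreal (q * (J * 2 powr (J * (DIM('a) / 2)))) * lnorm s (\<lambda>x::'a. gauss 1 (x /\<^sub>R 1))"
      using s q by (intro lnorm_cmult) auto
    also have "\<dots> = ennreal (q * (J * 2 powr (J * (DIM('a) / 2))) * n)"
      unfolding n(2)[OF zero_less_one] using n q by (subst ennreal_mult) auto
    also have "\<dots> \<le> ennreal (n * real J powr - 1)"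
    proof (rule ennreal_leI)
      have J2: "real J \<le> 2 powr J" using of_nat_less_two_power[of J, where 'a=real] by (simp add: powr_realpow)
      have "?S J powr - \<delta> = 2 powr - (J * (k * \<delta>))" by (simp add: powr_powr mult_ac flip: powr_realpow)
      also have "\<dots> \<le> 2 powr - (J * (DIM('a) / 2 + 2))"
        using k(2) by (intro powr_mono) (auto intro: mult_left_mono)
      finally have "?S J powr - \<delta> * 2 powr (J * (DIM('a) / 2)) \<le> 2 powr - (J * (DIM('a) / 2 + 2)) * 2 powr (J * (DIM('a) / 2))"
        by (intro mult_right_mono) auto
      also have "\<dots> = (2 powr J) powr - 2" by (simp add: powr_powr algebra_simps flip: powr_add)
      also have "\<dots> \<le> real J powr - 2" using J J2 by (intro powr_mono2') auto
      finally have "?S J powr - \<delta> * 2 powr (J * (DIM('a) / 2)) \<le> real J powr - 2" .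
      moreover have "real J powr - (1 / 2) \<le> 1" using J powr_mono2'[of "- (1 / 2)" 1 "real J"] by simp
      ultimately have "(?S J powr - \<delta> * 2 powr (J * (DIM('a) / 2))) * real J powr - (1 / 2) \<le> real J powr - 2 * 1"
        by (intro mult_mono) auto
      then have "(?S J powr - \<delta> * 2 powr (J * (DIM('a) / 2))) * real J powr - (1 / 2) * (real J powr 1 * n) \<le> (real J powr - 2 * 1) * (real J powr 1 * n)"
        using n by (intro mult_right_mono) auto
      also have "\<dots> = n * (real J powr - 2 * real J powr 1)" by (simp only: mult_ac mult_1_right)
      also have "\<dots> = n * real J powr - 1" by (simp only: powr_add[symmetric]) simp
      finally show "q * (J * 2 powr (J * (DIM('a) / 2))) * n \<le> n * real J powr - 1"
        using J by (simp add: q_def mult_ac)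
    qed
    finally show ?thesis .
  qed
  have b1: "lnorm s (\<lambda>x::'a. broken_power (A1, A2) x * chirp_envelope s J (?S J) (?R J) x)
      \<le> ennreal (C * ?S J powr - \<delta> * real J powr (s - 1 / 2))" if J: "0 < J" for J :: nat
  proof -
    define q where "q = ?S J powr - \<delta> * real J powr - (1 / 2)"
    have q: "0 \<le> q" by (simp add: q_def)
    define r :: real where "r = (1 / 2) ^ J"
    have r: "0 < r" by (simp add: r_def)
    have "broken_power (A1, A2) x * chirp_envelope s J (?S J) (?R J) x \<le> q * (T 0 r J x + T a r J x)" for x :: 'a
    proof (cases "x = 0")
      case False
      have "broken_power (A1, A2) x \<le> norm x powr \<delta> * (1 + (norm x / (r * 2 ^ j)) powr a)" if j: "j < J" for j
      proof (cases "norm x < 1")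
        case True
        then have "norm x powr \<delta> * 1 \<le> norm x powr \<delta> * (1 + (norm x / (r * 2 ^ j)) powr a)" by (intro mult_left_mono) auto
        then show ?thesis using True \<delta> by (simp add: broken_power_def)
      next
        case ge: False
        have "r * 2 ^ j \<le> (1 / 2) ^ J * 2 ^ J" unfolding r_def using j by (intro mult_left_mono power_increasing) auto
        then have R: "0 < r * 2 ^ j" "r * 2 ^ j \<le> 1" using r by (auto simp: power_one_over)
        have "norm x powr A2 \<le> norm x powr (\<delta> + a)" using ge a by (intro powr_mono) auto
        also have "\<dots> = norm x powr \<delta> * norm x powr a" by (rule powr_add)
        also have "\<dots> \<le> norm x powr \<delta> * (norm x / (r * 2 ^ j)) powr a"
        proof (intro mult_left_mono powr_mono2)
          have "norm x * (r * 2 ^ j) \<le> norm x * 1" using R by (intro mult_left_mono) auto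
          then show "norm x \<le> norm x / (r * 2 ^ j)" using R(1) by (subst pos_le_divide_eq) auto
        qed (use a in auto)
        also have "\<dots> \<le> norm x powr \<delta> * (1 + (norm x / (r * 2 ^ j)) powr a)" by (intro mult_left_mono) auto
        finally show ?thesis using ge by (simp add: broken_power_def)
      qed
      then have "broken_power (A1, A2) x * ((r * 2 ^ j) powr - (DIM('a) / 2) * gauss 1 (x /\<^sub>R (r * 2 ^ j))) \<le>
          norm x powr \<delta> * (1 + (norm x / (r * 2 ^ j)) powr a) * ((r * 2 ^ j) powr - (DIM('a) / 2) * gauss 1 (x /\<^sub>R (r * 2 ^ j)))" if "j < J" for j
        using that by (intro mult_right_mono) auto
      then have "(\<Sum>j<J. broken_power (A1, A2) x * ((r * 2 ^ j) powr - (DIM('a) / 2) * gauss 1 (x /\<^sub>R (r * 2 ^ j)))) \<le>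
          (\<Sum>j<J. norm x powr \<delta> * (1 + (norm x / (r * 2 ^ j)) powr a) * ((r * 2 ^ j) powr - (DIM('a) / 2) * gauss 1 (x /\<^sub>R (r * 2 ^ j))))"
        by (intro sum_mono) auto
      also have "\<dots> = T 0 r J x + T a r J x"
        using False r by (simp add: T_def \<delta>_def sum_distrib_left flip: sum.distrib) (simp add: algebra_simps)
      finally have "q * (\<Sum>j<J. broken_power (A1, A2) x * ((r * 2 ^ j) powr - (DIM('a) / 2) * gauss 1 (x /\<^sub>R (r * 2 ^ j)))) \<le>
          q * (T 0 r J x + T a r J x)" using q by (intro mult_left_mono) auto
      moreover have "broken_power (A1, A2) x * chirp_envelope s J (?S J) (?R J) x =
          q * (\<Sum>j<J. broken_power (A1, A2) x * ((r * 2 ^ j) powr - (DIM('a) / 2) * gauss 1 (x /\<^sub>R (r * 2 ^ j))))"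
        by (simp only: chirp_envelope_def q_def r_def \<delta>_def sum_distrib_left[symmetric] mult_ac)
      ultimately show ?thesis by simp
    qed (use q T0 in \<open>auto intro!: mult_nonneg_nonneg add_nonneg_nonneg\<close>)
    then have "lnorm s (\<lambda>x::'a. broken_power (A1, A2) x * chirp_envelope s J (?S J) (?R J) x) \<le> lnorm s (\<lambda>x. q * (T 0 r J x + T a r J x))"
      using s by (intro lnorm_mono) auto
    also have "\<dots> = ennreal q * lnorm s (\<lambda>x. T 0 r J x + T a r J x)"
      using s q T0 by (intro lnorm_cmult) auto
    also have "\<dots> \<le> ennreal q * (2 * (ennreal (C0 * J powr s) + ennreal (Ca * J powr s)))"
    proof (rule mult_left_mono)
      have "lnorm s (\<lambda>x. T 0 r J x + T a r J x) \<le> 2 * (lnorm s (T 0 r J) + lnorm s (T a r J))"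
        using s s1 T0 by (intro lnorm_add) auto
      also have "\<dots> \<le> 2 * (ennreal (C0 * J powr s) + ennreal (Ca * J powr s))"
        by (intro mult_left_mono add_mono C0 Ca r J) auto
      finally show "lnorm s (\<lambda>x. T 0 r J x + T a r J x) \<le> 2 * (ennreal (C0 * J powr s) + ennreal (Ca * J powr s))" .
    qed simp
    also have "\<dots> = ennreal (q * (2 * (C0 * J powr s + Ca * J powr s)))"
      using ennreal_two_mult_add[of 1 "C0 * J powr s" "Ca * J powr s"] q C0(1) Ca(1) by (simp add: ennreal_mult)
    also have "q * (2 * (C0 * J powr s + Ca * J powr s)) = C * ?S J powr - \<delta> * (J powr s * J powr - (1 / 2))"
      by (simp add: q_def C_def algebra_simps)
    also have "J powr s * J powr - (1 / 2) = J powr (s - 1 / 2)" by (simp flip: powr_add)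
    finally show ?thesis .
  qed
  have y: "0 < 1 / (8 * M)" using M by simp
  obtain t :: real where t: "0 < t" "t < 1" "t powr \<delta> \<le> 1 / (8 * M)"
    using small_powr[OF \<delta>(3) \<delta>(3) y] by blast
  define l where "l = t powr \<delta>"
  have l: "0 < l" "l \<le> 1 / (8 * M)" using t by (auto simp: l_def)
  have "eventually (\<lambda>J. C * real J powr (s - 1 / 2) \<le> l / (8 * M)) sequentially"
    "eventually (\<lambda>J. n * real J powr - 1 \<le> l / (8 * M)) sequentially"
    using s2 l M by (intro eventually_small_powr; simp)+
  then have "eventually (\<lambda>J. 0 < J \<and> C * real J powr (s - 1 / 2) \<le> l / (8 * M) \<and> n * real J powr - 1 \<le> l / (8 * M)) sequentially"
    using eventually_gt_at_top[of 0] by eventually_elim simp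
  then obtain J :: nat where J: "0 < J" "C * real J powr (s - 1 / 2) \<le> l / (8 * M)" "n * real J powr - 1 \<le> l / (8 * M)"
    by (auto simp: eventually_sequentially)
  define S where "S = ?S J"
  have S: "1 \<le> S" by (simp add: S_def)
  \<comment> \<open>At this scale l times the space weight is l^2 S^(-\<delta>) and l times the
    frequency weight is S^\<delta>: the powers of S are those of b and of the weight at S.\<close>
  define e where "e = t / S"
  have e: "0 < e" "e < 1" using t S by (auto simp: e_def)
  define b where "b = C * S powr - \<delta> * real J powr (s - 1 / 2)"
  have b: "0 \<le> b" using C by (simp add: b_def)
  have "l \<le> M * ((l * broken_power (A1, A2) e + b) * (l * broken_power (B1, B2) (1 / e) + broken_power (B1, B2) S))"
  proof (rule test[where R="?R J" and ?b0.0="n * real J powr - 1", OF J(1) _ _ l(1) e(1) _ b])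
    show "0 < S" using S by simp
    fix j assume "j < J"
    have "real J * 1 \<le> 2 ^ J * 2 ^ j"
      using of_nat_less_two_power[of J, where 'a=real] by (intro mult_mono) auto
    also have "(2 ^ J * 2 ^ j :: real) = (1 / 2) ^ J * 2 ^ (2 * J) * 2 ^ j" by (simp add: power_one_over mult_2 power_add)
    also have "\<dots> \<le> (1 / 2) ^ J * S * 2 ^ j"
      unfolding S_def using k(1) by (intro mult_right_mono mult_left_mono power_increasing) auto
    finally show "0 < ?R J j \<and> real J \<le> ?R J j * S" by (simp add: mult_ac)
  next
    have "1 / (8 * M) \<le> 1 / M" using M by (simp add: field_simps)
    then show "l \<le> 1 / M" using l by linarith
    have "l / (8 * M) \<le> l / M" using M l by (simp add: field_simps)
    then show "n * real J powr - 1 \<le> l / M" using J(3) by linarith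
    show "lnorm s (chirp_envelope s J S (?R J) :: 'a \<Rightarrow> real) \<le> ennreal (n * real J powr - 1)"
      unfolding S_def by (rule b0[OF J(1)])
    show "lnorm s (\<lambda>x::'a. broken_power (A1, A2) x * chirp_envelope s J S (?R J) x) \<le> ennreal b"
      unfolding S_def b_def by (rule b1[OF J(1)])
  qed (use n in auto)
  moreover have "broken_power (A1, A2) e = l * S powr - \<delta>"
    using e t S \<delta> by (simp add: broken_power_below_1) (simp add: e_def l_def powr_divide powr_minus_divide)
  moreover have "broken_power (B1, B2) (1 / e) = S powr \<delta> / l"
    using e t S \<delta> by (simp add: broken_power_1_divide) (simp add: e_def l_def powr_divide powr_minus_divide)
  moreover have "broken_power (B1, B2) S = S powr \<delta>" using S \<delta> by (simp add: broken_power_above_1)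
  ultimately have "l \<le> M * ((l * (l * S powr - \<delta>) + b) * (l * (S powr \<delta> / l) + S powr \<delta>))" by simp
  also have "l * (S powr \<delta> / l) = S powr \<delta>" using l by simp
  also have "M * ((l * (l * S powr - \<delta>) + b) * (S powr \<delta> + S powr \<delta>)) =
      2 * M * (l * l + C * real J powr (s - 1 / 2)) * (S powr - \<delta> * S powr \<delta>)"
    by (simp add: b_def algebra_simps)
  also have "S powr - \<delta> * S powr \<delta> = 1" using S by (simp flip: powr_add)
  finally have le: "l \<le> 2 * M * (l * l + C * real J powr (s - 1 / 2))" by simp
  have "l * l \<le> l * (1 / (8 * M))" using l by (intro mult_left_mono) auto
  then have "l * l + C * real J powr (s - 1 / 2) \<le> l / (4 * M)" using J(2) by simp
  then have "2 * M * (l * l + C * real J powr (s - 1 / 2)) \<le> 2 * M * (l / (4 * M))" using M by (intro mult_left_mono) auto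
  then show False using le l M by simp
qed

section \<open>From Lebesgue to Borel functions\<close>

lemma uncertainty_necessary:
  fixes s A1 A2 B1 B2 K :: real
  defines "\<delta> \<equiv> DIM('a) * (1 / 2 - s)"
  assumes s: "0 \<le> s" "s \<le> 1 / 2" and A: "0 < A1" "0 < A2" and B: "0 < B1" "0 < B2" and K: "0 < K"
    and unc: "\<And>f::'a::euclidean_space \<Rightarrow> complex. integrable lborel f \<Longrightarrow> uncertainty s (A1, A2) (B1, B2) K f"
  shows "A1 \<le> B2" "B1 \<le> A2" "\<delta> < A2"
    and "A1 < \<delta> \<and> \<delta> * A1 \<le> B2\<^sup>2 \<or> \<delta> < A1 \<or> A1 = \<delta> \<and> \<delta> < B2"
proof -
  have s1: "s \<le> 1" using s by simp
  show le: "A1 \<le> B2" "B1 \<le> A2" by (rule uncertainty_necessary_gauss[OF s(1) s1 A B K unc], assumption)+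
  show "\<delta> < A2" unfolding \<delta>_def by (rule uncertainty_necessary_wide_chirps[OF s A B K unc])
  consider "A1 < \<delta>" | "\<delta> < A1" | "A1 = \<delta>" by linarith
  then show "A1 < \<delta> \<and> \<delta> * A1 \<le> B2\<^sup>2 \<or> \<delta> < A1 \<or> A1 = \<delta> \<and> \<delta> < B2"
  proof cases
    case 1
    have "\<delta> * A1 \<le> B2\<^sup>2"
      using uncertainty_necessary_single_chirp[OF s A B K unc] 1 unfolding \<delta>_def by blast
    with 1 show ?thesis by blast
  next
    case 3
    have "B2 \<noteq> A1"
      by (rule uncertainty_necessary_narrow_chirps[OF s A B K unc]) (use 3 in \<open>auto simp: \<delta>_def\<close>)
    with 3 le show ?thesis by auto
  qed blast
qed

text \<open>Completion does not change the filter of almost everywhere true properties.\<close>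

lemma esssup_lebesgue:
  fixes u :: "'a::euclidean_space \<Rightarrow> ennreal"
  assumes u: "u \<in> borel_measurable borel"
  shows "esssup lebesgue u = esssup lborel u"
proof -
  have "ae_filter (lebesgue :: 'a measure) = ae_filter lborel"
    by (simp add: filter_eq_iff AE_completion_iff)
  moreover have "u \<in> borel_measurable lebesgue" using u by (simp add: measurable_completion)
  ultimately show ?thesis using u by (simp add: esssup_def)
qed

text \<open>Since 1 / \<infinity> = 0, each branch of \<open>Lp_norm\<close> corresponds to the
  matching branch of \<open>lnorm\<close> at \<open>enn2real (1 / p)\<close>.\<close>

lemma Lp_norm_eq_lnorm:
  fixes g :: "'a::euclidean_space \<Rightarrow> complex"
  assumes p: "p \<noteq> 0" and g: "g \<in> borel_measurable lebesgue"
    and u: "u \<in> borel_measurable borel" and eq: "AE x in lborel. norm (g x) = u x"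
  shows "Lp_norm p g = lnorm (enn2real (1 / p)) u"
proof (cases p)
  case top
  have "esssup lebesgue (\<lambda>x. ennreal (norm (g x))) = esssup lebesgue (\<lambda>x. ennreal (u x))"
  proof (rule esssup_AE_cong)
    show "(\<lambda>x. ennreal (norm (g x))) \<in> borel_measurable lebesgue" using g by measurable
    have "(\<lambda>x. ennreal (u x)) \<in> borel_measurable lborel" using u by measurable
    then show "(\<lambda>x. ennreal (u x)) \<in> borel_measurable lebesgue" by (rule measurable_completion)
    show "AE x in lebesgue. ennreal (norm (g x)) = ennreal (u x)"
      unfolding AE_completion_iff using eq by eventually_elim simp
  qed
  also have "\<dots> = esssup lborel (\<lambda>x. ennreal (u x))"
    by (rule esssup_lebesgue) (use u in measurable)
  finally show ?thesis using top by (simp add: Lp_norm_def lnorm_def)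
next
  case (real r)
  then have r: "0 < r" using p by (cases "r = 0") auto
  have s: "enn2real (1 / p) = 1 / r"
    using divide_ennreal[of 1 r] r real by simp
  have "(\<integral>\<^sup>+ x. ennreal (norm (g x) powr r) \<partial>lebesgue) = (\<integral>\<^sup>+ x. ennreal (norm (g x) powr r) \<partial>lborel)"
    by (rule nn_integral_completion)
  also have "\<dots> = (\<integral>\<^sup>+ x. ennreal (u x powr r) \<partial>lborel)"
    by (rule nn_integral_cong_AE) (use eq in \<open>eventually_elim, simp\<close>)
  finally show ?thesis unfolding s using r real by (simp add: Lp_norm_def lnorm_def)
qed

text \<open>The transform depends on f only up to null sets, so a Borel representative yields the
  same four norms.\<close>

lemma Lp_uncertainty_iff:
  fixes f f' :: "'a::euclidean_space \<Rightarrow> complex"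
  assumes p: "p \<noteq> 0" "p' \<noteq> 0" and s: "enn2real (1 / p) = s" "enn2real (1 / p') = 1 - s"
    and f: "f \<in> borel_measurable lebesgue" and f': "f' \<in> borel_measurable borel"
    and eq: "AE x in lborel. f x = f' x"
  shows "Lp_norm p f * Lp_norm p' (fourier f)
        \<le> ennreal K * (Lp_norm p (\<lambda>x. broken_power A x *\<^sub>R f x)
                     * Lp_norm p' (\<lambda>\<xi>. broken_power B \<xi> *\<^sub>R fourier f \<xi>)) \<longleftrightarrow> uncertainty s A B K f'"
proof -
  have [measurable]: "f' \<in> borel_measurable borel" by (rule f')
  have leb: "h \<in> borel_measurable lebesgue" if "h \<in> borel_measurable borel" for h :: "'a \<Rightarrow> 'b::topological_space"
    using that by (intro measurable_completion) simp
  have w: "broken_power C \<in> borel_measurable (lebesgue :: 'a measure)" for C by (intro leb) simp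
  have "fourier f = fourier f'"
  proof
    fix \<xi> :: 'a
    have e: "(\<lambda>x. exp (- 2 * complex_of_real pi * \<i> * complex_of_real (x \<bullet> \<xi>))) \<in> borel_measurable lebesgue"
      by (intro leb) measurable
    show "fourier f \<xi> = fourier f' \<xi>"
      unfolding fourier_def
    proof (rule integral_cong_AE)
      show "AE x in lebesgue. f x * exp (- 2 * complex_of_real pi * \<i> * complex_of_real (x \<bullet> \<xi>)) =
          f' x * exp (- 2 * complex_of_real pi * \<i> * complex_of_real (x \<bullet> \<xi>))"
        unfolding AE_completion_iff using eq by eventually_elim simp
    qed (intro borel_measurable_times f e leb f')+
  qed
  moreover have "Lp_norm p f = lnorm s (\<lambda>x. norm (f' x))"
    unfolding s(1)[symmetric] by (rule Lp_norm_eq_lnorm[OF p(1) f]) (measurable, use eq in \<open>eventually_elim, simp\<close>)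
  moreover have "Lp_norm p (\<lambda>x. broken_power A x *\<^sub>R f x) = lnorm s (\<lambda>x. broken_power A x * norm (f' x))"
    unfolding s(1)[symmetric]
    by (rule Lp_norm_eq_lnorm[OF p(1) borel_measurable_scaleR[OF w f]]) (measurable, use eq in \<open>eventually_elim, simp\<close>)
  moreover have F: "fourier f' \<in> borel_measurable borel" by (rule fourier_measurable[OF f'])
  moreover have "Lp_norm p' (fourier f') = lnorm (1 - s) (\<lambda>\<xi>. norm (fourier f' \<xi>))"
    unfolding s(2)[symmetric]
    by (rule Lp_norm_eq_lnorm[OF p(2) leb[OF F] measurable_compose[OF F borel_measurable_norm]]) simp
  moreover have "Lp_norm p' (\<lambda>\<xi>. broken_power B \<xi> *\<^sub>R fourier f' \<xi>) = lnorm (1 - s) (\<lambda>\<xi>. broken_power B \<xi> * norm (fourier f' \<xi>))"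
    unfolding s(2)[symmetric]
    by (rule Lp_norm_eq_lnorm[OF p(2) leb[OF borel_measurable_scaleR[OF broken_power_measurable F]]
          borel_measurable_times[OF broken_power_measurable measurable_compose[OF F borel_measurable_norm]]]) simp
  ultimately show ?thesis by (simp add: uncertainty_def)
qed

text \<open>Real and imaginary part have Borel representatives separately.\<close>

lemma integrable_lebesgue_representative:
  fixes f :: "'a::euclidean_space \<Rightarrow> complex"
  assumes f: "integrable lebesgue f"
  obtains f' where "integrable lborel f'" "AE x in lborel. f x = f' x"
proof -
  have fm: "f \<in> borel_measurable lebesgue" using f by auto
  then have "(\<lambda>x. Re (f x)) \<in> borel_measurable lebesgue" "(\<lambda>x. Im (f x)) \<in> borel_measurable lebesgue" by measurable
  from this[THEN completion_ex_borel_measurable_real] obtain r i :: "'a \<Rightarrow> real"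
    where [measurable]: "r \<in> borel_measurable borel" "i \<in> borel_measurable borel"
      and ri: "AE x in lborel. Re (f x) = r x" "AE x in lborel. Im (f x) = i x" by auto
  define f' where "f' x = Complex (r x) (i x)" for x
  have f'_eq: "f' = (\<lambda>x. of_real (r x) + \<i> * of_real (i x))" by (auto simp: f'_def complex_eq_iff)
  have m: "f' \<in> borel_measurable lborel" unfolding f'_eq by measurable
  have eq: "AE x in lborel. f x = f' x"
    using ri by eventually_elim (simp add: f'_def complex_eq_iff)
  have "integrable lebesgue f'"
    using f eq by (subst integrable_cong_AE[where g=f]) (auto simp: AE_completion_iff eq_commute fm intro: measurable_completion m)
  then have "integrable lborel f'" using m by (simp add: integrable_completion)
  then show ?thesis using eq by (rule that)
qed

lemma conjugate_exponents:
  fixes p p' :: ennreal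
  assumes p: "2 \<le> p" and conj: "1 / p + 1 / p' = 1"
  shows "enn2real (1 / p) \<le> 1 / 2" "enn2real (1 / p') = 1 - enn2real (1 / p)" "p \<noteq> 0" "p' \<noteq> 0"
proof -
  show "p \<noteq> 0" using p by auto
  show "p' \<noteq> 0"
  proof
    \<comment> \<open>In \<open>ennreal\<close>, 1 / 0 is infinite.\<close>
    assume "p' = 0"
    then have "1 / p' = \<infinity>" by simp
    then show False using conj by simp
  qed
  have "1 / p \<le> ennreal (1 / 2)"
  proof (cases p)
    case (real r)
    then have "2 \<le> r" using p by (cases "2 \<le> r") (auto simp: ennreal_le_iff2 simp flip: ennreal_numeral)
    then show ?thesis using divide_ennreal[of 1 r] real by (simp add: ennreal_leI del: ennreal_half)
  qed simp
  then show "enn2real (1 / p) \<le> 1 / 2" by (intro enn2real_leI) auto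
  have "1 / p \<noteq> top" "1 / p' \<noteq> top" using conj by auto
  then have "enn2real (1 / p + 1 / p') = enn2real (1 / p) + enn2real (1 / p')"
    by (intro enn2real_plus) (auto simp: less_top)
  then show "enn2real (1 / p') = 1 - enn2real (1 / p)" unfolding conj by simp
qed

theorem theorem1p4:
  fixes p p' :: ennreal and A1 A2 B1 B2 :: real
  assumes "2 \<le> p" and "1 / p + 1 / p' = 1"
    and "A1 > 0" and "A2 > 0" and "B1 > 0" and "B2 > 0"
  shows
    "(\<exists>K::real. \<forall>f::'a::euclidean_space \<Rightarrow> complex. integrable lebesgue f \<longrightarrow>
        Lp_norm p f * Lp_norm p' (fourier f)
        \<le> ennreal K * (Lp_norm p (\<lambda>x. broken_power (A1, A2) x *\<^sub>R f x)
                     * Lp_norm p' (\<lambda>\<xi>. broken_power (B1, B2) \<xi> *\<^sub>R fourier f \<xi>)))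
     \<longleftrightarrow>
     (let \<delta> = real DIM('a) * (1 / 2 - enn2real (1 / p)) in
        B2 \<ge> A1 \<and> A2 \<ge> B1 \<and> A2 > \<delta> \<and>
        ((A1 < \<delta> \<and> B2\<^sup>2 \<ge> \<delta> * A1) \<or> A1 > \<delta> \<or> (A1 = \<delta> \<and> \<delta> < B2)))"
proof -
  note A = assms(3,4) and B = assms(5,6)
  note conj = conjugate_exponents[OF assms(1,2)]
  define s where "s = enn2real (1 / p)"
  have s: "0 \<le> s" "s \<le> 1 / 2" using conj(1) by (auto simp: s_def)
  have s': "enn2real (1 / p) = s" "enn2real (1 / p') = 1 - s" using conj(2) by (auto simp: s_def)
  define \<delta> where "\<delta> = DIM('a) * (1 / 2 - s)"
  note iff = Lp_uncertainty_iff[OF conj(3,4) s', where 'a='a]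
  show ?thesis
    unfolding s' Let_def \<delta>_def[symmetric]
  proof (intro iffI; (elim exE)?)
    fix K :: real
    assume K: "\<forall>f::'a \<Rightarrow> complex. integrable lebesgue f \<longrightarrow>
        Lp_norm p f * Lp_norm p' (fourier f)
        \<le> ennreal K * (Lp_norm p (\<lambda>x. broken_power (A1, A2) x *\<^sub>R f x)
                     * Lp_norm p' (\<lambda>\<xi>. broken_power (B1, B2) \<xi> *\<^sub>R fourier f \<xi>))"
    \<comment> \<open>K may be negative, in which case \<open>ennreal K = 0\<close>; enlarging it to
      \<open>max K 1\<close> provides the positive constant that the necessity lemmas take.\<close>
    have unc: "uncertainty s (A1, A2) (B1, B2) (max K 1) f" if f: "integrable lborel f" for f :: "'a \<Rightarrow> complex"
    proof -
      have m: "f \<in> borel_measurable borel" using f by auto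
      have "integrable lebesgue f" using f m by (simp add: integrable_completion)
      with K have "uncertainty s (A1, A2) (B1, B2) K f"
        using iff[of f f K "(A1, A2)" "(B1, B2)"] m by (auto intro: measurable_completion)
      then show ?thesis unfolding uncertainty_def
        by (rule order_trans) (intro mult_right_mono ennreal_leI, auto)
    qed
    have K1: "0 < max K 1" by simp
    show "B2 \<ge> A1 \<and> A2 \<ge> B1 \<and> A2 > \<delta> \<and>
        ((A1 < \<delta> \<and> B2\<^sup>2 \<ge> \<delta> * A1) \<or> A1 > \<delta> \<or> (A1 = \<delta> \<and> \<delta> < B2))"
      using uncertainty_necessary[OF s A B K1 unc] unfolding \<delta>_def by blast
  next
    assume R: "B2 \<ge> A1 \<and> A2 \<ge> B1 \<and> A2 > \<delta> \<and>
        ((A1 < \<delta> \<and> B2\<^sup>2 \<ge> \<delta> * A1) \<or> A1 > \<delta> \<or> (A1 = \<delta> \<and> \<delta> < B2))"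
    \<comment> \<open>The lost power is \<delta> in the first case and A1 in the second, where A1 a
      \<le> B2^2 becomes A1 \<le> B2. In the critical case a must exceed \<delta> = A1; the largest
      admissible value B2^2 / A1 does so because B2 > A1.\<close>
    have "\<exists>a. A1 \<le> a \<and> (\<delta> < a \<or> \<delta> = a \<and> A1 < a) \<and> A1 * a \<le> B2\<^sup>2"
    proof -
      consider "A1 < \<delta>" "\<delta> * A1 \<le> B2\<^sup>2" | "\<delta> < A1" | "A1 = \<delta>" "\<delta> < B2" using R by blast
      then show ?thesis
      proof cases
        case 1
        then show ?thesis by (intro exI[of _ \<delta>]) (auto simp: mult.commute)
      next
        case 2
        then show ?thesis using R A by (intro exI[of _ A1]) (auto simp: power2_eq_square mult_mono)
      next
        case 3
        have "A1 * A1 < B2 * B2" using 3 A by (intro mult_strict_mono) auto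
        then have "A1 < B2\<^sup>2 / A1" using A by (simp add: field_simps power2_eq_square)
        then show ?thesis using 3 A by (intro exI[of _ "B2\<^sup>2 / A1"]) auto
      qed
    qed
    then obtain a where a: "A1 \<le> a" "\<delta> < a \<or> \<delta> = a \<and> A1 < a" "A1 * a \<le> B2\<^sup>2" by blast
    obtain K where K: "0 < K" "\<And>f::'a \<Rightarrow> complex. integrable lborel f \<Longrightarrow> uncertainty s (A1, A2) (B1, B2) K f"
      using uncertainty_sufficient[where 'a='a and ?A1.0=A1 and ?A2.0=A2 and ?B1.0=B1 and ?B2.0=B2, OF s A B _ _ a[unfolded \<delta>_def]] R
      unfolding uncertainty_def \<delta>_def by blast
    show "\<exists>K::real. \<forall>f::'a \<Rightarrow> complex. integrable lebesgue f \<longrightarrow>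
        Lp_norm p f * Lp_norm p' (fourier f)
        \<le> ennreal K * (Lp_norm p (\<lambda>x. broken_power (A1, A2) x *\<^sub>R f x)
                     * Lp_norm p' (\<lambda>\<xi>. broken_power (B1, B2) \<xi> *\<^sub>R fourier f \<xi>))"
    proof (intro exI[of _ K] allI impI)
      fix f :: "'a \<Rightarrow> complex" assume f: "integrable lebesgue f"
      obtain f' where f': "integrable lborel f'" "AE x in lborel. f x = f' x"
        using integrable_lebesgue_representative[OF f] by blast
      show "Lp_norm p f * Lp_norm p' (fourier f)
        \<le> ennreal K * (Lp_norm p (\<lambda>x. broken_power (A1, A2) x *\<^sub>R f x)
                     * Lp_norm p' (\<lambda>\<xi>. broken_power (B1, B2) \<xi> *\<^sub>R fourier f \<xi>))"
        using iff[of f f' K "(A1, A2)" "(B1, B2)"] f f' K(2)[OF f'(1)] by auto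
    qed
  qed
qed

end
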